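(* Let $\kappa$ be an algebraically closed, valued field (the valuation may be trivial). For every finite simple, three-regular, three-edge-connected planar graph $G$, there is a canonical embedding of the graph curve $X_G$ over $\kappa$ whose extended tropicalisation (with respect to the given valuation on $\kappa$), with the topology induced from the Euclidean topology on tropical projective space, is homeomorphic to $G^{\rm top}$.
   Context: **Graphs.** $G^{\rm top}$ is the topological space underlying any geometric realisation of $G$ (one closed interval per edge, glued at the vertices). The genus $g$ of a connected graph is its first Betti number; a connected three-regular graph of genus $g$ has $2g-2$ vertices and $3g-3$ edges. **Graph curves.** For a simple, three-regular, connected graph $G$, the graph curve $X_G$ over $\kappa$ is the totally degenerate nodal curve with dual graph $G$: its irreducible components are copies of $\mathbb{P}^1_\kappa$ in bijection with the vertices of $G$, and two components meet (in one node) exactly when the corresponding vertices are adjacent. (By three-regularity it is independent of the choice of nodes up to isomorphism.) A canonical embedding of $X_G$ is an embedding into $\mathbb{P}^{g-1}_\kappa$ by the complete linear series of the canonical (dualizing) bundle of $X_G$. **Tropical projective space.** $\mathbb{TP}^n$ is the quotient of $(\mathbb{R}\cup\{\infty\})^{n+1}\setminus\{(\infty,\dots,\infty)\}$ by the action of $\mathbb{R}$ given by $\lambda\odot(q_0,\dots,q_n)=(\lambda+q_0,\dots,\lambda+q_n)$, with its natural (Euclidean) topology; it is homeomorphic to an $n$-simplex. **Extended tropicalisation.** Let $I\subset\kappa[x_1,\dots,x_{n+1}]$ be a homogeneous ideal. For each proper subset $\mathcal V\subsetneq\{1,\dots,n+1\}$ (corresponding to the torus orbit of $\mathbb{P}^n$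 where exactly the coordinates $x_j$, $j\in\mathcal V$, vanish), let $\tilde I_{\mathcal V}\subset\kappa[x_j^{\pm1}\mid j\notin\mathcal V]$ be the ideal generated by the polynomials obtained from elements of $I$ by setting $x_j=0$ for $j\in\mathcal V$. For an ideal $J$ of a Laurent polynomial ring over $\kappa$, ${\rm trop}(J)$ is the set of real vectors $w$ such that for every nonzero $f=\sum_a c_a x^a\in J$ the minimum of ${\rm val}(c_a)+w\cdot a$ over $a$ with $c_a\neq0$ is attained at least twice. The extended (Kajiwara–Payne) tropicalisation ${\rm tropproj}(I)\subset\mathbb{TP}^n$ is the union over all $\mathcal V$ of ${\rm trop}(\tilde I_{\mathcal V})$ modulo $\mathbb{R}(1,\dots,1)$, placed in the stratum of $\mathbb{TP}^n$ where exactly the coordinates in $\mathcal V$ are $\infty$. The extended tropicalisation of a projective variety is that of its homogeneous ideal. *)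

theory Defs
  imports
    "HOL-Analysis.Analysis"
    "HOL-Library.Poly_Mapping"
    "HOL-Computational_Algebra.Polynomial"
    "HOL-Computational_Algebra.Fraction_Field"
begin

section \<open>Finite simple graphs\<close>

definition simple_graph :: "'v set \<Rightarrow> 'v set set \<Rightarrow> bool" where
  "simple_graph V E \<longleftrightarrow> finite V \<and> (\<forall>e\<in>E. e \<subseteq> V \<and> card e = 2)"

definition three_regular :: "'v set \<Rightarrow> 'v set set \<Rightarrow> bool" where
  "three_regular V E \<longleftrightarrow> (\<forall>v\<in>V. card {e\<in>E. v \<in> e} = 3)"

definition connected_graph :: "'v set \<Rightarrow> 'v set set \<Rightarrow> bool" where
  "connected_graph V E \<longleftrightarrow> V \<noteq> {} \<and> (\<forall>u\<in>V. \<forall>v\<in>V. (u, v) \<in> {(x, y). {x, y} \<in> E}\<^sup>*)"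

definition three_edge_connected :: "'v set \<Rightarrow> 'v set set \<Rightarrow> bool" where
  "three_edge_connected V E \<longleftrightarrow> (\<forall>F\<subseteq>E. finite F \<and> card F < 3 \<longrightarrow> connected_graph V (E - F))"

text \<open>The first Betti number of a connected graph, by the Euler--Poincare formula.\<close>
definition genus :: "'v set \<Rightarrow> 'v set set \<Rightarrow> nat" where
  "genus V E = card E + 1 - card V"

text \<open>The geometric realisation in barycentric coordinates: the vertex \<open>v\<close> is the unit vector at
  \<open>v\<close>, and the edge \<open>{u, v}\<close> is the closed segment joining the unit vectors at \<open>u\<close> and \<open>v\<close>.\<close>
definition graph_top :: "'v set \<Rightarrow> 'v set set \<Rightarrow> ('v \<Rightarrow> real) topology" where
  "graph_top V E = subtopology (product_topology (\<lambda>_. euclideanreal) V)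
     {t. (\<forall>v\<in>V. 0 \<le> t v) \<and> (\<Sum>v\<in>V. t v) = 1 \<and>
         ((\<exists>v\<in>V. {u\<in>V. t u \<noteq> 0} \<subseteq> {v}) \<or> (\<exists>e\<in>E. {u\<in>V. t u \<noteq> 0} \<subseteq> e))}"

definition planar_graph :: "'v set \<Rightarrow> 'v set set \<Rightarrow> bool" where
  "planar_graph V E \<longleftrightarrow>
     (\<exists>f :: ('v \<Rightarrow> real) \<Rightarrow> real ^ 2. embedding_map (graph_top V E) euclidean f)"


section \<open>Quotient topology\<close>

definition quotient_topology :: "'a topology \<Rightarrow> ('a \<Rightarrow> 'b) \<Rightarrow> 'b topology" where
  "quotient_topology X q =
     topology (\<lambda>U. U \<subseteq> q ` topspace X \<and> openin X {x \<in> topspace X. q x \<in> U})"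

lemma openin_quotient_topology:
  "openin (quotient_topology X q) U \<longleftrightarrow>
     U \<subseteq> q ` topspace X \<and> openin X {x \<in> topspace X. q x \<in> U}"
proof -
  have 1: "{x \<in> topspace X. q x \<in> S \<inter> T} = {x \<in> topspace X. q x \<in> S} \<inter> {x \<in> topspace X. q x \<in> T}" for S T
    by auto
  have 2: "{x \<in> topspace X. q x \<in> \<Union>\<K>} = (\<Union>K\<in>\<K>. {x \<in> topspace X. q x \<in> K})" for \<K>
    by auto
  have "istopology (\<lambda>U. U \<subseteq> q ` topspace X \<and> openin X {x \<in> topspace X. q x \<in> U})"
    unfolding istopology_def 1 2 by blast
  then show ?thesis
    by (simp add: quotient_topology_def)
qed

lemma topspace_quotient_topology [simp]: "topspace (quotient_topology X q) = q ` topspace X"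
proof -
  have "{x \<in> topspace X. q x \<in> q ` topspace X} = topspace X"
    by auto
  then have "openin (quotient_topology X q) (q ` topspace X)"
    by (simp add: openin_quotient_topology)
  then show ?thesis
    by (meson openin_quotient_topology openin_subset openin_topspace subset_antisym)
qed


section \<open>Polynomials and Laurent polynomials in several variables\<close>

text \<open>Polynomials in the variables \<open>x\<^sub>0, x\<^sub>1, \<dots>\<close> are finitely supported coefficient functions on
  exponent vectors \<open>nat \<Rightarrow>\<^sub>0 nat\<close>, and Laurent polynomials are the same on \<open>nat \<Rightarrow>\<^sub>0 int\<close>; the ring
  structure is the convolution product. The set \<open>J\<close> lists the variables that may occur.\<close>

type_synonym 'k mpoly = "(nat \<Rightarrow>\<^sub>0 nat) \<Rightarrow>\<^sub>0 'k"
type_synonym 'k laurent = "(nat \<Rightarrow>\<^sub>0 int) \<Rightarrow>\<^sub>0 'k"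

definition polys_in :: "nat set \<Rightarrow> ((nat \<Rightarrow>\<^sub>0 'e::zero) \<Rightarrow>\<^sub>0 'k::zero) set" where
  "polys_in J = {F. \<forall>m \<in> Poly_Mapping.keys F. Poly_Mapping.keys m \<subseteq> J}"

definition mpoly_eval :: "'k::field mpoly \<Rightarrow> (nat \<Rightarrow> 'k) \<Rightarrow> 'k" where
  "mpoly_eval F x = (\<Sum>m \<in> Poly_Mapping.keys F.
     Poly_Mapping.lookup F m * (\<Prod>i \<in> Poly_Mapping.keys m. x i ^ Poly_Mapping.lookup m i))"

definition homogeneous :: "nat \<Rightarrow> 'k::field mpoly \<Rightarrow> bool" where
  "homogeneous d F \<longleftrightarrow>
     (\<forall>m \<in> Poly_Mapping.keys F. (\<Sum>i \<in> Poly_Mapping.keys m. Poly_Mapping.lookup m i) = d)"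

text \<open>The ideal generated by \<open>S\<close> in the subring with underlying set \<open>R\<close>.\<close>
definition ideal_gen :: "'a::comm_ring_1 set \<Rightarrow> 'a set \<Rightarrow> 'a set" where
  "ideal_gen R S = {(\<Sum>a\<in>T. c a * a) | T c. finite T \<and> T \<subseteq> S \<and> (\<forall>a\<in>T. c a \<in> R)}"


section \<open>Projective space as a classical variety\<close>

text \<open>Points of \<open>P\<^bsup>N-1\<^esup>\<close> are the classes of nonzero vectors \<open>(x\<^sub>0, \<dots>, x\<^bsub>N-1\<^esub>)\<close> (continued by zero)
  up to scaling; \<open>N\<close> is the number of homogeneous coordinates, not the dimension.\<close>

definition proj_class :: "(nat \<Rightarrow> 'k::field) \<Rightarrow> (nat \<Rightarrow> 'k) set" where
  "proj_class x = {(\<lambda>i. c * x i) | c. c \<noteq> 0}"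

definition proj_space :: "nat \<Rightarrow> (nat \<Rightarrow> 'k::field) set set" where
  "proj_space N = proj_class ` {x. (\<forall>i\<ge>N. x i = 0) \<and> (\<exists>i. x i \<noteq> 0)}"

text \<open>The Zariski topology, generated by the principal open sets.\<close>
definition zariski :: "nat \<Rightarrow> (nat \<Rightarrow> 'k::field) set topology" where
  "zariski N = topology_generated_by
     {{p \<in> proj_space N. \<forall>x\<in>p. mpoly_eval F x \<noteq> 0} | F d. F \<in> polys_in {..<N} \<and> homogeneous d F}"

text \<open>\<open>f\<close> is a regular function on the open subset \<open>U\<close> of the closed subvariety \<open>Z\<close>: locally a
  quotient of homogeneous polynomials of the same degree.\<close>
definition regular_on ::
  "nat \<Rightarrow> (nat \<Rightarrow> 'k::field) set set \<Rightarrow> (nat \<Rightarrow> 'k) set set \<Rightarrow> ((nat \<Rightarrow> 'k) set \<Rightarrow> 'k) \<Rightarrow> bool" where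
  "regular_on N Z U f \<longleftrightarrow>
     (\<forall>p\<in>U. \<exists>W F G d. p \<in> W \<and> W \<subseteq> U \<and> openin (subtopology (zariski N) Z) W \<and>
        F \<in> polys_in {..<N} \<and> G \<in> polys_in {..<N} \<and> homogeneous d F \<and> homogeneous d G \<and>
        (\<forall>q\<in>W. \<forall>x\<in>q. mpoly_eval G x \<noteq> 0 \<and> f q = mpoly_eval F x / mpoly_eval G x))"

text \<open>The homogeneous ideal of a closed subvariety \<open>Z\<close>.\<close>
definition homogeneous_ideal :: "nat \<Rightarrow> (nat \<Rightarrow> 'k::field) set set \<Rightarrow> 'k mpoly set" where
  "homogeneous_ideal N Z = ideal_gen (polys_in {..<N})
     {F \<in> polys_in {..<N}. (\<exists>d. homogeneous d F) \<and> (\<forall>p\<in>Z. \<forall>x\<in>p. mpoly_eval F x = 0)}"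


section \<open>The projective line and its rational differentials\<close>

text \<open>The points of \<open>P\<^sup>1\<close> are parametrised by \<open>\<kappa> \<union> {\<infinity>}\<close>, where \<open>Some a\<close> stands for \<open>[1 : a]\<close> and
  \<open>None\<close> for \<open>\<infinity> = [0 : 1]\<close>; so \<open>t = x\<^sub>1 / x\<^sub>0\<close> is the affine coordinate. Topology and regular functions
  are those of the projective space \<open>P\<^sup>1\<close>.\<close>

fun p1_point :: "'k::field option \<Rightarrow> (nat \<Rightarrow> 'k) set" where
  "p1_point (Some a) = proj_class ((\<lambda>_. 0)(0 := 1, 1 := a))"
| "p1_point None = proj_class ((\<lambda>_. 0)(1 := 1))"

definition p1_top :: "'k::field option topology" where
  "p1_top = pullback_topology UNIV p1_point (zariski 2)"

definition p1_regular :: "'k::field option set \<Rightarrow> ('k option \<Rightarrow> 'k) \<Rightarrow> bool" where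
  "p1_regular U f \<longleftrightarrow>
     (\<exists>g. regular_on 2 (proj_space 2) (p1_point ` U) g \<and> (\<forall>p\<in>U. f p = g (p1_point p)))"

text \<open>Rational functions on \<open>P\<^sup>1\<close> are elements of \<open>\<kappa>(t)\<close>. \<open>has_value h p c\<close> says that \<open>h\<close> is regular
  at \<open>p\<close> with value \<open>c\<close>.\<close>

fun has_value :: "'k::field poly fract \<Rightarrow> 'k option \<Rightarrow> 'k \<Rightarrow> bool" where
  "has_value h (Some a) c \<longleftrightarrow>
     (\<exists>P Q. h = Fract P Q \<and> poly Q a \<noteq> 0 \<and> c = poly P a / poly Q a)"
| "has_value h None c \<longleftrightarrow>
     (\<exists>P Q. h = Fract P Q \<and> Q \<noteq> 0 \<and> degree P \<le> degree Q \<and> c = coeff P (degree Q) / lead_coeff Q)"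

text \<open>The local parameter \<open>\<pi>\<^sub>p\<close> at \<open>p\<close> is \<open>t - a\<close> or \<open>1 / t\<close>; \<open>dlocal_param\<close> is its derivative with
  respect to \<open>t\<close>. A rational differential is written \<open>h dt\<close> with \<open>h \<in> \<kappa>(t)\<close>, so that
  \<open>h / dlocal_param p\<close> is its coefficient with respect to \<open>d\<pi>\<^sub>p\<close>.\<close>

fun local_param :: "'k::field option \<Rightarrow> 'k poly fract" where
  "local_param (Some a) = Fract [:-a, 1:] 1"
| "local_param None = Fract 1 [:0, 1:]"

fun dlocal_param :: "'k::field option \<Rightarrow> 'k poly fract" where
  "dlocal_param (Some a) = 1"
| "dlocal_param None = Fract (-1) [:0, 0, 1:]"

text \<open>\<open>h dt\<close> is regular at \<open>p\<close>, and equals \<open>c d\<pi>\<^sub>p\<close> there.\<close>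
definition diff_value :: "'k::field poly fract \<Rightarrow> 'k option \<Rightarrow> 'k \<Rightarrow> bool" where
  "diff_value h p c \<longleftrightarrow> has_value (h / dlocal_param p) p c"

text \<open>\<open>h dt\<close> has at most a simple pole at \<open>p\<close>, with residue \<open>c\<close>.\<close>
definition diff_residue :: "'k::field poly fract \<Rightarrow> 'k option \<Rightarrow> 'k \<Rightarrow> bool" where
  "diff_residue h p c \<longleftrightarrow> has_value (local_param p * h / dlocal_param p) p c"


section \<open>Graph curves\<close>

text \<open>\<open>\<nu> v e\<close> is the point of the component \<open>P\<^sup>1\<close> of the vertex \<open>v\<close> that lies over the node of the
  edge \<open>e\<close>.\<close>
definition node_positions :: "'v set \<Rightarrow> 'v set set \<Rightarrow> ('v \<Rightarrow> 'v set \<Rightarrow> 'k option) \<Rightarrow> bool" where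
  "node_positions V E \<nu> \<longleftrightarrow> (\<forall>v\<in>V. inj_on (\<nu> v) {e\<in>E. v \<in> e})"

text \<open>The graph curve is the disjoint union of the components with \<open>(u, \<nu> u e)\<close> and \<open>(v, \<nu> v e)\<close>
  identified for every edge \<open>e = {u, v}\<close>; \<open>glue\<close> maps a point of the disjoint union to its class.
  Regular functions are those that are regular on every component, that is, pairs of functions
  agreeing at the glued points; this is the scheme structure of an ordinary node.\<close>

definition glue ::
  "'v set set \<Rightarrow> ('v \<Rightarrow> 'v set \<Rightarrow> 'k option) \<Rightarrow> 'v \<times> 'k option \<Rightarrow> ('v \<times> 'k option) set" where
  "glue E \<nu> = (\<lambda>(v, p). insert (v, p) {(u, q). \<exists>e\<in>E. v \<in> e \<and> u \<in> e \<and> p = \<nu> v e \<and> q = \<nu> u e})"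

definition graph_curve ::
  "'v set \<Rightarrow> 'v set set \<Rightarrow> ('v \<Rightarrow> 'v set \<Rightarrow> 'k::field option) \<Rightarrow> ('v \<times> 'k option) set topology" where
  "graph_curve V E \<nu> = quotient_topology (sum_topology (\<lambda>_. p1_top) V) (glue E \<nu>)"

definition curve_regular ::
  "'v set \<Rightarrow> 'v set set \<Rightarrow> ('v \<Rightarrow> 'v set \<Rightarrow> 'k::field option) \<Rightarrow>
   ('v \<times> 'k option) set set \<Rightarrow> (('v \<times> 'k option) set \<Rightarrow> 'k) \<Rightarrow> bool" where
  "curve_regular V E \<nu> U f \<longleftrightarrow>
     (\<forall>v\<in>V. p1_regular {p. glue E \<nu> (v, p) \<in> U} (\<lambda>p. f (glue E \<nu> (v, p))))"

text \<open>An isomorphism of varieties onto a closed subvariety of \<open>P\<^bsup>N-1\<^esup>\<close>.\<close>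
definition closed_embedding ::
  "'v set \<Rightarrow> 'v set set \<Rightarrow> ('v \<Rightarrow> 'v set \<Rightarrow> 'k::field option) \<Rightarrow> nat \<Rightarrow>
   (('v \<times> 'k option) set \<Rightarrow> (nat \<Rightarrow> 'k) set) \<Rightarrow> bool" where
  "closed_embedding V E \<nu> N \<phi> \<longleftrightarrow>
     (let X = topspace (graph_curve V E \<nu>); Z = \<phi> ` X in
        closedin (zariski N) Z \<and>
        homeomorphic_map (graph_curve V E \<nu>) (subtopology (zariski N) Z) \<phi> \<and>
        (\<forall>U f. openin (subtopology (zariski N) Z) U \<longrightarrow>
           (regular_on N Z U f \<longleftrightarrow> curve_regular V E \<nu> {x \<in> X. \<phi> x \<in> U} (f \<circ> \<phi>))))"


section \<open>The dualizing bundle and canonical embeddings\<close>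

text \<open>Global sections of the dualizing sheaf of the nodal curve: rational differentials \<open>h v dt\<close> on
  the components that are regular away from the nodes and have at most simple poles at the two
  points over each node, with opposite residues. (Functions are normalised to vanish off \<open>V\<close>.)\<close>
definition dualizing_sections ::
  "'v set \<Rightarrow> 'v set set \<Rightarrow> ('v \<Rightarrow> 'v set \<Rightarrow> 'k::field option) \<Rightarrow> ('v \<Rightarrow> 'k poly fract) set" where
  "dualizing_sections V E \<nu> =
     {h. (\<forall>v. v \<notin> V \<longrightarrow> h v = 0) \<and>
         (\<forall>v\<in>V. \<forall>p. p \<notin> \<nu> v ` {e\<in>E. v \<in> e} \<longrightarrow> (\<exists>c. diff_value (h v) p c)) \<and>
         (\<forall>u v. {u, v} \<in> E \<longrightarrow>
            (\<exists>r. diff_residue (h u) (\<nu> u {u, v}) r \<and> diff_residue (h v) (\<nu> v {u, v}) (- r)))}"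

definition dualizing_basis ::
  "'v set \<Rightarrow> 'v set set \<Rightarrow> ('v \<Rightarrow> 'v set \<Rightarrow> 'k::field option) \<Rightarrow> nat \<Rightarrow>
   (nat \<Rightarrow> 'v \<Rightarrow> 'k poly fract) \<Rightarrow> bool" where
  "dualizing_basis V E \<nu> N s \<longleftrightarrow>
     (\<forall>i<N. s i \<in> dualizing_sections V E \<nu>) \<and>
     (\<forall>h \<in> dualizing_sections V E \<nu>.
        \<exists>!c. c \<in> extensional {..<N} \<and> (\<forall>v. h v = (\<Sum>i<N. Fract [:c i:] 1 * s i v)))"

text \<open>The value of a section at the point \<open>p\<close> of the component \<open>v\<close>, relative to the local generator
  \<open>d\<pi>\<^sub>p\<close> of the dualizing sheaf at a smooth point, and \<open>d\<pi>\<^sub>p / \<pi>\<^sub>p\<close> on the branch \<open>v\<close> at a node. (On the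
  other branch of a node this generator is \<open>- d\<pi> / \<pi>\<close>, so that the values computed on the two branches
  differ by the sign, which does not change the point of projective space.)\<close>
definition section_value ::
  "'v set set \<Rightarrow> ('v \<Rightarrow> 'v set \<Rightarrow> 'k::field option) \<Rightarrow> 'v \<Rightarrow> 'k option \<Rightarrow> 'k poly fract \<Rightarrow> 'k \<Rightarrow> bool" where
  "section_value E \<nu> v p h c \<longleftrightarrow>
     (if p \<in> \<nu> v ` {e\<in>E. v \<in> e} then diff_residue h p c else diff_value h p c)"

text \<open>\<open>\<phi>\<close> embeds the curve by \<open>x \<mapsto> [s\<^sub>0(x) : \<dots> : s\<^bsub>g-1\<^esub>(x)]\<close> for a basis \<open>s\<^sub>0, \<dots>, s\<^bsub>g-1\<^esub>\<close> of the space of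
  all sections of the dualizing bundle.\<close>
definition canonical_embedding ::
  "'v set \<Rightarrow> 'v set set \<Rightarrow> ('v \<Rightarrow> 'v set \<Rightarrow> 'k::field option) \<Rightarrow>
   (('v \<times> 'k option) set \<Rightarrow> (nat \<Rightarrow> 'k) set) \<Rightarrow> bool" where
  "canonical_embedding V E \<nu> \<phi> \<longleftrightarrow>
     (let g = genus V E in
        (\<exists>s. dualizing_basis V E \<nu> g s \<and>
           (\<forall>v\<in>V. \<forall>p. \<exists>c. (\<forall>i<g. section_value E \<nu> v p (s i v) (c i)) \<and> (\<forall>i\<ge>g. c i = 0) \<and>
              (\<exists>i. c i \<noteq> 0) \<and> \<phi> (glue E \<nu> (v, p)) = proj_class c)) \<and>
        closed_embedding V E \<nu> g \<phi>)"


section \<open>Tropicalisation\<close>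

definition valuation :: "('k::field \<Rightarrow> ereal) \<Rightarrow> bool" where
  "valuation val \<longleftrightarrow>
     (\<forall>x. val x \<noteq> -\<infinity>) \<and> (\<forall>x. val x = \<infinity> \<longleftrightarrow> x = 0) \<and>
     (\<forall>x y. val (x * y) = val x + val y) \<and>
     (\<forall>x y. min (val x) (val y) \<le> val (x + y))"

text \<open>Tropical projective space \<open>TP\<^bsup>N-1\<^esup>\<close>, whose points are the orbits of the translation action.\<close>

definition tp_cone :: "nat \<Rightarrow> (nat \<Rightarrow> ereal) set" where
  "tp_cone N = {q \<in> {..<N} \<rightarrow>\<^sub>E {x. x \<noteq> -\<infinity>}. \<exists>i<N. q i \<noteq> \<infinity>}"

definition tp_class :: "nat \<Rightarrow> (nat \<Rightarrow> ereal) \<Rightarrow> (nat \<Rightarrow> ereal) set" where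
  "tp_class N q = {(\<lambda>i\<in>{..<N}. ereal r + q i) | r. True}"

definition tp_top :: "nat \<Rightarrow> (nat \<Rightarrow> ereal) set topology" where
  "tp_top N =
     quotient_topology (subtopology (product_topology (\<lambda>_. euclidean) {..<N}) (tp_cone N)) (tp_class N)"

text \<open>The Laurent polynomial obtained from \<open>F\<close> by setting \<open>x\<^sub>j = 0\<close> for all \<open>j \<in> A\<close>.\<close>
definition set_zero :: "nat set \<Rightarrow> 'k::field mpoly \<Rightarrow> 'k laurent" where
  "set_zero A F = (\<Sum>m | m \<in> Poly_Mapping.keys F \<and> Poly_Mapping.keys m \<inter> A = {}.
     Poly_Mapping.single (Poly_Mapping.map int m) (Poly_Mapping.lookup F m))"

definition stratum_ideal :: "nat \<Rightarrow> nat set \<Rightarrow> 'k::field mpoly set \<Rightarrow> 'k laurent set" where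
  "stratum_ideal N A I = ideal_gen (polys_in ({..<N} - A)) (set_zero A ` I)"

definition trop_weight :: "('k::field \<Rightarrow> ereal) \<Rightarrow> (nat \<Rightarrow> real) \<Rightarrow> 'k laurent \<Rightarrow> (nat \<Rightarrow>\<^sub>0 int) \<Rightarrow> ereal" where
  "trop_weight val w f a = val (Poly_Mapping.lookup f a) +
     ereal (\<Sum>i \<in> Poly_Mapping.keys a. w i * real_of_int (Poly_Mapping.lookup a i))"

definition trop :: "('k::field \<Rightarrow> ereal) \<Rightarrow> 'k laurent set \<Rightarrow> (nat \<Rightarrow> real) set" where
  "trop val J = {w. \<forall>f\<in>J. f \<noteq> 0 \<longrightarrow>
     (\<exists>a \<in> Poly_Mapping.keys f. \<exists>b \<in> Poly_Mapping.keys f. a \<noteq> b \<and>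
        trop_weight val w f a = trop_weight val w f b \<and>
        (\<forall>c \<in> Poly_Mapping.keys f. trop_weight val w f a \<le> trop_weight val w f c))}"

text \<open>The point of \<open>q\<close> lies in the stratum of \<open>A = {i. q i = \<infinity>}\<close>. The ideal of that stratum only
  involves the variables outside \<open>A\<close>, where \<open>q\<close> is real.\<close>
definition trop_proj :: "('k::field \<Rightarrow> ereal) \<Rightarrow> nat \<Rightarrow> 'k mpoly set \<Rightarrow> (nat \<Rightarrow> ereal) set set" where
  "trop_proj val N I = {tp_class N q | q. q \<in> tp_cone N \<and>
     (\<lambda>i. real_of_ereal (q i)) \<in> trop val (stratum_ideal N {i. i < N \<and> q i = \<infinity>} I)}"

definition trop_proj_top :: "('k::field \<Rightarrow> ereal) \<Rightarrow> nat \<Rightarrow> 'k mpoly set \<Rightarrow> (nat \<Rightarrow> ereal) set topology" where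
  "trop_proj_top val N I = subtopology (tp_top N) (trop_proj val N I)"

end

(* The sections of the dualizing bundle are the flows on G with values in the field: a differential with
   simple poles is determined by its residues, and the residue theorem is Kirchhoff's law. Draw G in the plane.
   The boundary cycles of the g + 1 faces span the flows with the single relation that they sum to zero, so
   all faces but one form a basis; this gives the canonical embedding, written in g + 1 coordinates on the
   hyperplane where they sum to zero. At a vertex v exactly three faces meet, so the component of v is mapped
   onto the line on which only these three coordinates are nonzero. By three-edge-connectedness two vertices
   share two faces only if they are adjacent, so these lines meet exactly at the nodes.

   The tropicalisation is the union of the tropicalisations of these coordinate lines. It lies in that union
   because a product of linear forms, one for each line and each with a unique minimal term at a point outside,
   vanishes on the curve; conversely the points s * u(t) of a line, over the function field with
   Gauss valuations extending the given one, realise every point of its tropicalisation. The tropical line of v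
   is a tripod with its ends at the nodes if the omitted face does not touch v, and otherwise a segment.
   These pieces glue to a copy of G; continuity of an explicit bijection from the compact graph suffices. *)
theory Submission
  imports Defs
begin

section \<open>Walks, paths and cycles\<close>

text \<open>The faces are not components of the complement of the drawing but are built up: some
  cycle encloses the whole drawing, ears are added inside it one at a time, and by the theta-curve
  form of the Jordan curve theorem each ear cuts exactly one bounded face \<open>z\<close> into two
  cycles with sum \<open>z\<close>. Incidences, number, sum and span of the face cycles survive such
  a cut. Flows take values in the field, where signs are lost in characteristic 2, so incidence is
  expressed by nonvanishing and by cardinalities.

  A trivial valuation gives no points over the field itself with prescribed real weights; hence the
  function field. Of its two variables one moves along the line and the other scales all
  coordinates, which shifts the weights by a constant. Forms that vanish on the curve vanish at this
  generic point because an algebraically closed field is infinite.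

  The omitted face breaks the symmetry: at its vertices its coordinate, minus the sum of the others,
  puts no condition on the other weights. So an edge running from a vertex off this face to a vertex
  on it is covered by one cell, all other edges by two halves.\<close>

fun wedges :: "'v list \<Rightarrow> 'v set set" where
  "wedges (x # y # r) = insert {x, y} (wedges (y # r))"
| "wedges _ = {}"

text \<open>A walk as a 1-chain. Antisymmetric functions on ordered pairs of vertices stand for
  chains on the oriented edges, which avoids fixing an orientation of every edge.\<close>

fun wflow :: "'v list \<Rightarrow> 'v \<Rightarrow> 'v \<Rightarrow> 'k::comm_ring_1" where
  "wflow (x # y # r) = (\<lambda>a b. of_bool (a = x \<and> b = y) - of_bool (a = y \<and> b = x) + wflow (y # r) a b)"
| "wflow _ = (\<lambda>a b. 0)"

lemma wedges_append: "wedges (xs @ y # ys) = wedges (xs @ [y]) \<union> wedges (y # ys)"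
  by (induction xs rule: wedges.induct) auto

lemma wflow_append: "(wflow (xs @ y # ys) a b :: 'k::comm_ring_1) = wflow (xs @ [y]) a b + wflow (y # ys) a b"
  by (induction xs rule: wflow.induct) auto

lemma wedges_snoc2: "wedges (xs @ [x, y]) = insert {x, y} (wedges (xs @ [x]))"
  using wedges_append[of xs x "[y]"] by auto

lemma wedges_rev: "wedges (rev xs) = wedges xs"
  by (induction xs rule: wedges.induct) (auto simp: wedges_snoc2 insert_commute)

lemma wflow_rev: "wflow (rev xs) a b = - (wflow xs a b :: 'k::comm_ring_1)"
proof (induction xs rule: wflow.induct)
  case (1 x y r)
  have "wflow (rev (x # y # r)) a b = (wflow (rev (y # r)) a b + wflow [y, x] a b :: 'k)"
    using wflow_append[of "rev r" y "[x]" a b] by simp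
  also have "\<dots> = - wflow (y # r) a b + wflow [y, x] a b" by (simp only: 1)
  also have "\<dots> = - wflow (x # y # r) a b" by simp
  finally show ?case .
qed auto

lemma wflow_swap: "wflow xs b a = - (wflow xs a b :: 'k::comm_ring_1)"
proof -
  have "wflow xs b a + wflow xs a b = (0::'k)"
  proof (induction xs rule: wflow.induct)
    case (1 x y r)
    have "wflow (x # y # r) b a + wflow (x # y # r) a b = (wflow (y # r) b a + wflow (y # r) a b :: 'k)"
      by (simp add: conj_commute[of "b = x"] conj_commute[of "b = y"])
    then show ?case unfolding 1 .
  qed auto
  then show ?thesis by (simp add: eq_neg_iff_add_eq_0)
qed

lemma wedges_subset: "e \<in> wedges xs \<Longrightarrow> e \<subseteq> set xs"
  by (induction xs rule: wedges.induct) auto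

lemma Union_wedges: "2 \<le> length xs \<Longrightarrow> \<Union> (wedges xs) = set xs"
proof (induction xs rule: wedges.induct)
  case (1 x y r) then show ?case by (cases r) auto
qed auto

lemma finite_wedges [simp]: "finite (wedges xs)"
  by (induction xs rule: wedges.induct) auto

lemma wflow_nonzero_edge: "wflow xs a b \<noteq> (0::'k::comm_ring_1) \<Longrightarrow> {a, b} \<in> wedges xs"
proof (induction xs rule: wflow.induct)
  case (1 x y r)
  show ?case
  proof (cases "{a, b} = {x, y}")
    case False
    then have "wflow (x # y # r) a b = (wflow (y # r) a b :: 'k)" by (auto simp: doubleton_eq_iff)
    then show ?thesis using 1 by simp
  qed simp
qed auto

lemma wedges_notin: "x \<notin> set xs \<Longrightarrow> {x, y} \<notin> wedges xs" "x \<notin> set xs \<Longrightarrow> {y, x} \<notin> wedges xs"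
  using wedges_subset[of _ xs] by blast+

text \<open>The first edge of a path cannot recur, because its first vertex is not met again; so the
  contributions of the steps neither cancel nor add up.\<close>

lemma wflow_path:
  assumes "distinct xs"
  shows "(wflow xs a b \<noteq> (0::'k) \<longleftrightarrow> {a, b} \<in> wedges xs) \<and> wflow xs a b \<in> {0, 1, -1::'k::field}"
  using assms
proof (induction xs rule: wflow.induct)
  case (1 x y r)
  have n: "{x, y} \<notin> wedges (y # r)" using 1 wedges_notin(1)[of x "y # r" y] by auto
  have IH: "wflow (y # r) a b \<noteq> (0::'k) \<longleftrightarrow> {a, b} \<in> wedges (y # r)" "wflow (y # r) a b \<in> {0, 1, -1::'k}"
    using 1 by auto
  have v: "wflow (x # y # r) a b = of_bool (a = x \<and> b = y) - of_bool (a = y \<and> b = x) + (wflow (y # r) a b :: 'k)"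
    by simp
  have xy: "x \<noteq> y" using 1 by auto
  show ?case
  proof (cases "{a, b} = {x, y}")
    case True
    then have "wflow (y # r) a b = (0::'k)" using IH(1) n by simp
    then show ?thesis using True xy v by (auto simp: doubleton_eq_iff)
  next
    case False
    then have "wflow (x # y # r) a b = (wflow (y # r) a b :: 'k)" unfolding v by (auto simp: doubleton_eq_iff)
    then show ?thesis using IH False by simp
  qed
qed auto

text \<open>Telescoping sum: each step contributes 1 at its start and -1 at its end. For a closed
  walk the two ends cancel, which is Kirchhoff's law.\<close>

lemma wflow_boundary:
  assumes "finite V" "set xs \<subseteq> V" "xs \<noteq> []"
  shows "(\<Sum>b\<in>V. wflow xs a b) = of_bool (a = hd xs) - (of_bool (a = last xs) :: 'k::comm_ring_1)"
  using assms(2,3)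
proof (induction xs rule: wflow.induct)
  case (1 x y r)
  have s: "(\<Sum>b\<in>V. of_bool (a = x \<and> b = y)) = (of_bool (a = x) :: 'k)" if "y \<in> V" for x y
    using assms(1) that by (cases "a = x") (auto simp: of_bool_def sum.delta)
  have "(\<Sum>b\<in>V. wflow (x # y # r) a b :: 'k) = of_bool (a = x) - of_bool (a = y) + (\<Sum>b\<in>V. wflow (y # r) a b)"
    using 1(2) s[of x y] s[of y x] by (simp add: sum.distrib sum_subtractf)
  then show ?case using 1 by simp
qed auto

definition supp :: "('v \<Rightarrow> 'v \<Rightarrow> 'k::zero) \<Rightarrow> 'v set set" where
  "supp z = {{x, y} | x y. z x y \<noteq> 0}"

text \<open>A cycle is represented by its flow, which forgets the starting vertex but keeps the
  orientation. At least three vertices are demanded, since going along an edge and back has zero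
  flow.\<close>

definition cyc :: "'v set set \<Rightarrow> ('v \<Rightarrow> 'v \<Rightarrow> 'k::field) \<Rightarrow> bool" where
  "cyc F z \<longleftrightarrow> (\<exists>a xs. distinct (a # xs) \<and> 2 \<le> length xs \<and> wedges (a # xs @ [a]) \<subseteq> F \<and>
     z = wflow (a # xs @ [a]))"

text \<open>The closing edge \<open>{b, a}\<close> is not an edge of the path \<open>a # xs\<close>,
  whose ends are not consecutive as it has at least three vertices. So \<open>wflow_path\<close>
  applies to the path and the closing edge adds a flow on a new edge.\<close>

lemma cyc_list:
  fixes z :: "'v \<Rightarrow> 'v \<Rightarrow> 'k::field"
  assumes "distinct (a # xs)" "2 \<le> length xs" "z = wflow (a # xs @ [a])"
  shows "supp z = wedges (a # xs @ [a])" "\<Union> (supp z) = set (a # xs)"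
    "z x y \<noteq> 0 \<longleftrightarrow> {x, y} \<in> wedges (a # xs @ [a])"
proof -
  obtain ys b where xs: "xs = ys @ [b]" using assms(2) by (cases xs rule: rev_cases) auto
  then have xs: "xs = ys @ [b]" "ys \<noteq> []" using assms(2) by auto
  have w: "wedges (a # xs @ [a]) = insert {b, a} (wedges (a # xs))"
    using wedges_snoc2[of "a # ys" b a] xs by simp
  have z: "z x y = wflow (a # xs) x y + wflow [b, a] x y" for x y
    using wflow_append[of "a # ys" b "[a]" x y] xs assms by simp
  have n: "{b, a} \<notin> wedges (a # xs)"
  proof
    assume "{b, a} \<in> wedges (a # xs)"
    moreover have "wedges (a # xs) = insert {a, hd ys} (wedges xs)" using xs by (cases ys) auto
    moreover have "hd ys \<noteq> b" "a \<notin> set xs" using assms xs by (cases ys; auto)+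
    ultimately show False using wedges_notin(2)[of a xs b] assms(1) by (auto simp: doubleton_eq_iff)
  qed
  have ab: "a \<noteq> b" using assms xs by auto
  have *: "z x y \<noteq> 0 \<longleftrightarrow> {x, y} \<in> wedges (a # xs @ [a])" for x y
  proof -
    have v: "wflow [b, a] x y = (of_bool (x = b \<and> y = a) - of_bool (x = a \<and> y = b) :: 'k)" by simp
    note p = wflow_path[OF assms(1), of x y, where 'k='k]
    show ?thesis
    proof (cases "{x, y} = {b, a}")
      case True
      then have "wflow (a # xs) x y = (0::'k)" using p n by simp
      then have "z x y = wflow [b, a] x y" using z[of x y] by simp
      then show ?thesis using True ab w v by (auto simp: doubleton_eq_iff)
    next
      case False
      then have "wflow [b, a] x y = (0::'k)" unfolding v by (auto simp: doubleton_eq_iff)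
      then have "z x y = wflow (a # xs) x y" using z[of x y] by simp
      then show ?thesis using p False unfolding w by simp
    qed
  qed
  show "z x y \<noteq> 0 \<longleftrightarrow> {x, y} \<in> wedges (a # xs @ [a])" by (rule *)
  have "card e = 2 \<or> (\<exists>x. e = {x})" if "e \<in> wedges l" for e and l :: "'v list"
    using that by (induction l rule: wedges.induct) (auto simp: card_insert_if)
  then have "\<exists>x y. e = {x, y}" if "e \<in> wedges l" for e and l :: "'v list"
    using that by (metis card_2_iff insert_absorb2)
  then show s: "supp z = wedges (a # xs @ [a])"
  proof (intro set_eqI iffI)
    fix e assume "e \<in> supp z"
    then obtain x y where "e = {x, y}" "z x y \<noteq> 0" unfolding supp_def by blast
    then show "e \<in> wedges (a # xs @ [a])" using *[of x y] by simp
  next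
    fix e assume e: "e \<in> wedges (a # xs @ [a])"
    then obtain x y where "e = {x, y}" using \<open>\<And>l e. e \<in> wedges l \<Longrightarrow> \<exists>x y. e = {x, y}\<close> by blast
    then show "e \<in> supp z" using e *[of x y] unfolding supp_def by blast
  qed
  show "\<Union> (supp z) = set (a # xs)" unfolding s by (subst Union_wedges) auto
qed

text \<open>Rotating the cyclic list only regroups the same steps, so the flow is unchanged.\<close>

lemma cycE_at:
  fixes z :: "'v \<Rightarrow> 'v \<Rightarrow> 'k::field"
  assumes "cyc F z" "a \<in> \<Union> (supp z)"
  obtains xs where "distinct (a # xs)" "2 \<le> length xs" "wedges (a # xs @ [a]) \<subseteq> F"
    "z = wflow (a # xs @ [a])"
proof -
  obtain c xs where c: "distinct (c # xs)" "2 \<le> length xs" "wedges (c # xs @ [c]) \<subseteq> F"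
    "z = wflow (c # xs @ [c])" using assms(1) unfolding cyc_def by blast
  have a: "a \<in> set (c # xs)" using assms(2) cyc_list(2)[OF c(1,2,4)] by simp
  show ?thesis
  proof (cases "a = c")
    case True then show ?thesis using c that by blast
  next
    case False
    then obtain ps qs where xs: "xs = ps @ a # qs" using a split_list[of a xs] by auto
    have w: "wedges (a # (qs @ c # ps) @ [a]) = wedges (c # xs @ [c])"
      using wedges_append[of "a # qs" c "ps @ [a]"] wedges_append[of "c # ps" a "qs @ [c]"] xs by auto
    have f: "z x y = wflow (a # (qs @ c # ps) @ [a]) x y" for x y
      using wflow_append[of "a # qs" c "ps @ [a]" x y, where 'k='k]
        wflow_append[of "c # ps" a "qs @ [c]" x y, where 'k='k] xs c(4)
      by (simp add: add.commute)
    show ?thesis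
      by (rule that[of "qs @ c # ps"]) (use c w xs in auto, use f in \<open>auto simp: fun_eq_iff c(4)\<close>)
  qed
qed

text \<open>Cutting a cycle at two of its vertices gives the two arcs to which the theta-curve
  statements apply; \<open>cyc_join\<close> is the converse.\<close>

lemma cyc_split:
  fixes z :: "'v \<Rightarrow> 'v \<Rightarrow> 'k::field"
  assumes "cyc F z" "a \<in> \<Union> (supp z)" "b \<in> \<Union> (supp z)" "a \<noteq> b"
  obtains xs ys where "distinct (a # xs @ b # ys)" "xs @ ys \<noteq> []"
    "\<And>x y. z x y = wflow (a # xs @ [b]) x y + wflow (b # ys @ [a]) x y"
    "supp z = wedges (a # xs @ [b]) \<union> wedges (b # ys @ [a])"
proof -
  obtain zs where zs: "distinct (a # zs)" "2 \<le> length zs" "z = wflow (a # zs @ [a])"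
    using cycE_at[OF assms(1,2)] by metis
  then have "b \<in> set zs" using assms cyc_list(2)[OF zs] by auto
  then obtain xs ys where "zs = xs @ b # ys" by (meson split_list)
  then show ?thesis
    using that[of xs ys] zs cyc_list(1)[OF zs] wedges_append[of "a # xs" b "ys @ [a]"]
      wflow_append[of "a # xs" b "ys @ [a]", where 'k='k] by force
qed

lemma cyc_join:
  fixes z :: "'v \<Rightarrow> 'v \<Rightarrow> 'k::field"
  assumes "distinct (a # xs @ b # ys)" "xs @ ys \<noteq> []"
    "\<And>x y. z x y = wflow (a # xs @ [b]) x y + wflow (b # ys @ [a]) x y"
    "wedges (a # xs @ [b]) \<union> wedges (b # ys @ [a]) \<subseteq> F"
  shows "cyc F z" "supp z = wedges (a # xs @ [b]) \<union> wedges (b # ys @ [a])"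
proof -
  have w: "wedges (a # (xs @ b # ys) @ [a]) = wedges (a # xs @ [b]) \<union> wedges (b # ys @ [a])"
    using wedges_append[of "a # xs" b "ys @ [a]"] by auto
  have f: "z = wflow (a # (xs @ b # ys) @ [a])"
    using wflow_append[of "a # xs" b "ys @ [a]", where 'k='k] assms(3) by (auto simp: fun_eq_iff)
  have l: "2 \<le> length (xs @ b # ys)" using assms(2) by (cases xs; cases ys) auto
  show "cyc F z" unfolding cyc_def using assms w f l by blast
  show "supp z = wedges (a # xs @ [b]) \<union> wedges (b # ys @ [a])"
    using cyc_list(1)[OF assms(1) l f] w by simp
qed

lemma cyc_mono: "cyc F z \<Longrightarrow> F \<subseteq> F' \<Longrightarrow> cyc F' z"
  unfolding cyc_def by blast

text \<open>The last item, as many edges as vertices, starts the Euler count of the ear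
  decomposition.\<close>

lemma cyc_facts:
  fixes z :: "'v \<Rightarrow> 'v \<Rightarrow> 'k::field"
  assumes "cyc F z"
  shows "z y x = - z x y" "supp z \<subseteq> F" "z x y \<noteq> 0 \<longleftrightarrow> {x, y} \<in> supp z"
    "supp z \<noteq> {}" "finite (supp z)"
    "finite W \<Longrightarrow> \<Union> (supp z) \<subseteq> W \<Longrightarrow> (\<Sum>y\<in>W. z x y) = 0" "card (supp z) = card (\<Union> (supp z))"
proof -
  obtain a xs where c: "distinct (a # xs)" "2 \<le> length xs" "wedges (a # xs @ [a]) \<subseteq> F"
    "z = wflow (a # xs @ [a])" using assms(1) unfolding cyc_def by blast
  note l = cyc_list[OF c(1,2,4)]
  show "z y x = - z x y" unfolding c(4) by (rule wflow_swap)
  show "supp z \<subseteq> F" "finite (supp z)" unfolding l(1) by (simp_all add: c)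
  show "z x y \<noteq> 0 \<longleftrightarrow> {x, y} \<in> supp z" using l(3) l(1) by auto
  show "supp z \<noteq> {}" unfolding l(1) by (cases xs) auto
  show "(\<Sum>y\<in>W. z x y) = 0" if "finite W" "\<Union> (supp z) \<subseteq> W"
    unfolding c(4) using that l(2) by (subst wflow_boundary) auto
  have "card (wedges p) + 1 = length p" if "distinct p" "p \<noteq> []" for p :: "'v list"
    using that
  proof (induction p rule: wedges.induct)
    case (1 x y r)
    then show ?case using wedges_notin(1)[of x "y # r" y] by auto
  qed auto
  then have 1: "card (wedges (a # xs)) + 1 = length (a # xs)" using c by blast
  obtain ys b where xs: "xs = ys @ [b]" using c(2) by (cases xs rule: rev_cases) auto
  then have xs: "xs = ys @ [b]" "ys \<noteq> []" using c(2) by auto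
  have w: "wedges (a # xs @ [a]) = insert {b, a} (wedges (a # xs))"
    using wedges_snoc2[of "a # ys" b a] xs by simp
  have n: "{b, a} \<notin> wedges (a # xs)"
  proof
    assume "{b, a} \<in> wedges (a # xs)"
    moreover have "wedges (a # xs) = insert {a, hd ys} (wedges xs)" using xs by (cases ys) auto
    moreover have "hd ys \<noteq> b" "a \<notin> set xs" using c xs by (cases ys; auto)+
    ultimately show False using wedges_notin(2)[of a xs b] c(1) by (auto simp: doubleton_eq_iff)
  qed
  show "card (supp z) = card (\<Union> (supp z))"
    unfolding l(2) unfolding l(1) w using n 1 distinct_card[OF c(1)] by simp
qed

lemma cyc_degree:
  fixes z :: "'v \<Rightarrow> 'v \<Rightarrow> 'k::field"
  assumes "cyc F z" "v \<in> \<Union> (supp z)"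
  shows "card {w. z v w \<noteq> 0} = 2" "2 \<le> card {e \<in> supp z. v \<in> e}"
proof -
  obtain xs where c: "distinct (v # xs)" "2 \<le> length xs" "z = wflow (v # xs @ [v])"
    using cycE_at[OF assms] by metis
  obtain p q ms where xs: "xs = p # ms @ [q]"
    using c(2) by (cases xs; cases "tl xs" rule: rev_cases) auto
  have w: "wedges (v # xs @ [v]) = insert {v, p} (insert {q, v} (wedges xs))"
    using wedges_snoc2[of "v # p # ms" q v] xs by auto
  have *: "{w. z v w \<noteq> 0} = {p, q}"
    using cyc_list(3)[OF c, of v] c(1) wedges_notin[of v xs] unfolding w by (auto simp: doubleton_eq_iff)
  moreover have pq: "p \<noteq> q" using c xs by auto
  ultimately show "card {w. z v w \<noteq> 0} = 2" by simp
  have "{{v, p}, {v, q}} \<subseteq> {e \<in> supp z. v \<in> e}"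
    using cyc_list(1)[OF c] w by (auto simp: insert_commute)
  moreover have "finite {e \<in> supp z. v \<in> e}" using cyc_facts(5)[OF assms(1)] by simp
  moreover have "card {{v, p}, {v, q}} = 2" using pq by (auto simp: doubleton_eq_iff)
  ultimately show "2 \<le> card {e \<in> supp z. v \<in> e}" by (metis card_mono)
qed

text \<open>Loop erasure: when the new first vertex already lies on the path, the path is shortened
  to the part starting there.\<close>

lemma rtrancl_path:
  assumes "(u, w) \<in> {(x, y). {x, y} \<in> F}\<^sup>*"
  shows "\<exists>xs. distinct xs \<and> xs \<noteq> [] \<and> hd xs = u \<and> last xs = w \<and> wedges xs \<subseteq> F"
  using assms
proof (induction rule: converse_rtrancl_induct)
  case base show ?case by (rule exI[of _ "[w]"]) auto
next
  case (step y z)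
  then obtain xs where xs: "distinct xs" "xs \<noteq> []" "hd xs = z" "last xs = w" "wedges xs \<subseteq> F" by blast
  show ?case
  proof (cases "y \<in> set xs")
    case True
    then obtain ps qs where p: "xs = ps @ y # qs" by (meson split_list)
    then show ?thesis using xs wedges_append[of ps y qs]
      by (intro exI[of _ "y # qs"]) auto
  next
    case False
    then show ?thesis using xs step(1) by (intro exI[of _ "y # xs"]) (cases xs; auto)
  qed
qed

text \<open>The form in which connectedness is used below: a property cannot change between two
  vertices without changing across some edge.\<close>

lemma cut_edge:
  assumes "connected_graph V E" "x \<in> V" "y \<in> V" "P x" "\<not> P y"
  shows "\<exists>p q. {p, q} \<in> E \<and> P p \<and> \<not> P q"
proof (rule ccontr)
  assume *: "\<not> ?thesis"
  have "(x, y) \<in> {(x, y). {x, y} \<in> E}\<^sup>*" using assms unfolding connected_graph_def by blast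
  then have "P y" using assms(4) by induction (use * in auto)
  then show False using assms by simp
qed

section \<open>Theta curves\<close>

text \<open>Of three arcs with common ends, one always runs inside the curve formed by the other
  two. Otherwise a point \<open>z\<close> inside \<open>A \<union> B\<close> is outside both curves
  through \<open>C\<close>, since two insides that meet but avoid each other's boundary coincide.
  These two curves have the connected intersection \<open>C\<close>, so by Janiszewski's theorem
  \<open>z\<close> can escape to infinity off all three arcs, against its choice.\<close>

lemma theta_inside:
  fixes a b :: complex
  assumes g: "arc g1" "arc g2" "arc g3"
    and s: "pathstart g1 = a" "pathstart g2 = a" "pathstart g3 = a"
    and f: "pathfinish g1 = b" "pathfinish g2 = b" "pathfinish g3 = b"
    and i: "path_image g1 \<inter> path_image g2 = {a, b}" "path_image g1 \<inter> path_image g3 = {a, b}"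
      "path_image g2 \<inter> path_image g3 = {a, b}"
    and out: "path_image g3 \<inter> inside (path_image g1 \<union> path_image g2) = {}"
  shows "path_image g1 \<inter> inside (path_image g2 \<union> path_image g3) \<noteq> {} \<or>
    path_image g2 \<inter> inside (path_image g1 \<union> path_image g3) \<noteq> {}"
proof (rule ccontr)
  assume neg: "\<not> ?thesis"
  define A where "A = path_image g1"
  define B where "B = path_image g2"
  define C where "C = path_image g3"
  have loop: "inside (path_image p \<union> path_image q) \<noteq> {} \<and> connected (inside (path_image p \<union> path_image q))
      \<and> frontier (inside (path_image p \<union> path_image q)) = path_image p \<union> path_image q"
    if pq: "arc p" "arc q" "pathstart p = a" "pathstart q = a" "pathfinish p = b" "pathfinish q = b"
      "path_image p \<inter> path_image q = {a, b}" for p q :: "real \<Rightarrow> complex"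
  proof -
    let ?c = "p +++ reversepath q"
    have "path_image ?c = path_image p \<union> path_image q" using pq by (simp add: path_image_join)
    moreover have "simple_path ?c"
      using pq by (simp add: simple_path_join_loop_eq arc_reversepath)
    moreover have "pathfinish ?c = pathstart ?c" using pq by simp
    ultimately show ?thesis using Jordan_inside_outside[of ?c] by metis
  qed
  note J1 = loop[OF g(1,2) s(1,2) f(1,2) i(1), folded A_def B_def, THEN conjunct1]
  note J2 = loop[OF g(1,2) s(1,2) f(1,2) i(1), folded A_def B_def, THEN conjunct2, THEN conjunct1]
    loop[OF g(2,3) s(2,3) f(2,3) i(3), folded B_def C_def, THEN conjunct2, THEN conjunct1]
    loop[OF g(1,3) s(1,3) f(1,3) i(2), folded A_def C_def, THEN conjunct2, THEN conjunct1]
  note J3 = loop[OF g(1,2) s(1,2) f(1,2) i(1), folded A_def B_def, THEN conjunct2, THEN conjunct2]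
    loop[OF g(2,3) s(2,3) f(2,3) i(3), folded B_def C_def, THEN conjunct2, THEN conjunct2]
    loop[OF g(1,3) s(1,3) f(1,3) i(2), folded A_def C_def, THEN conjunct2, THEN conjunct2]
  have comp: "compact A" "compact B" "compact C" and con: "connected A" "connected B" "connected C"
    using g unfolding A_def B_def C_def by (auto simp: arc_imp_path compact_path_image connected_path_image)
  have ne: "A - {a, b} \<noteq> {}" "B - {a, b} \<noteq> {}" "C - {a, b} \<noteq> {}"
    using nonempty_simple_path_endless[OF arc_imp_simple_path[OF g(1)]]
      nonempty_simple_path_endless[OF arc_imp_simple_path[OF g(2)]]
      nonempty_simple_path_endless[OF arc_imp_simple_path[OF g(3)]] s f unfolding A_def B_def C_def by simp_all
  have i': "A \<inter> B = {a, b}" "A \<inter> C = {a, b}" "B \<inter> C = {a, b}" using i unfolding A_def B_def C_def by auto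
  \<comment> \<open>Used to show that two of the insides are disjoint from each other at
    \<open>z\<close>: if they met, they would be equal and so would their frontiers, although each
    arc has points off the other two.\<close>
  have eqI: "S = T"
    if "connected S" "connected T" "S \<inter> frontier T = {}" "T \<inter> frontier S = {}" "S \<inter> T \<noteq> {}" for S T :: "complex set"
  proof
    show "S \<subseteq> T" using connected_Int_frontier[of S T] that by blast
    show "T \<subseteq> S" using connected_Int_frontier[of T S] that by blast
  qed
  have o: "A \<inter> inside (B \<union> C) = {}" "B \<inter> inside (A \<union> C) = {}" "C \<inter> inside (A \<union> B) = {}"
    using neg out unfolding A_def B_def C_def by auto
  have dj: "inside (S \<union> T) \<inter> S = {}" "inside (S \<union> T) \<inter> T = {}" for S T :: "complex set"
    using inside_no_overlap[of "S \<union> T"] by (simp_all add: Int_Un_distrib)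
  have n: "x \<notin> S" "x \<notin> T" if "x \<in> inside (S \<union> T)" for x and S T :: "complex set"
    using that dj[of S T] by (simp_all add: disjoint_iff)
  have n1: "x \<notin> A \<and> x \<notin> B \<and> x \<notin> C" if "x \<in> inside (A \<union> B)" for x
    using n[OF that] that o(3) by (simp add: disjoint_iff) metis
  have n2: "x \<notin> A \<and> x \<notin> B \<and> x \<notin> C" if "x \<in> inside (B \<union> C)" for x
    using n[OF that] that o(1) by (simp add: disjoint_iff) metis
  have n3: "x \<notin> A \<and> x \<notin> B \<and> x \<notin> C" if "x \<in> inside (A \<union> C)" for x
    using n[OF that] that o(2) by (simp add: disjoint_iff) metis
  have d: "inside (A \<union> B) \<inter> (B \<union> C) = {}" "inside (B \<union> C) \<inter> (A \<union> B) = {}"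
     "inside (A \<union> B) \<inter> (A \<union> C) = {}" "inside (A \<union> C) \<inter> (A \<union> B) = {}"
    unfolding disjoint_iff using n1 n2 n3 by (metis Un_iff)+
  obtain z where z: "z \<in> inside (A \<union> B)" using J1 by (metis ex_in_conv)
  have "z \<notin> inside (B \<union> C)"
  proof
    assume zi: "z \<in> inside (B \<union> C)"
    have "inside (A \<union> B) = inside (B \<union> C)"
    proof (rule eqI)
      show "connected (inside (A \<union> B))" "connected (inside (B \<union> C))" by (rule J2)+
      show "inside (A \<union> B) \<inter> frontier (inside (B \<union> C)) = {}" unfolding J3 by (rule d(1))
      show "inside (B \<union> C) \<inter> frontier (inside (A \<union> B)) = {}" unfolding J3 by (rule d(2))
      show "inside (A \<union> B) \<inter> inside (B \<union> C) \<noteq> {}" using IntI[OF z zi] by (metis empty_iff)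
    qed
    then have "A \<union> B = B \<union> C" using J3 by metis
    then have "A \<subseteq> {a, b}" using i' by blast
    then show False using ne(1) by blast
  qed
  moreover have "z \<notin> inside (A \<union> C)"
  proof
    assume zi: "z \<in> inside (A \<union> C)"
    have "inside (A \<union> B) = inside (A \<union> C)"
    proof (rule eqI)
      show "connected (inside (A \<union> B))" "connected (inside (A \<union> C))" by (rule J2)+
      show "inside (A \<union> B) \<inter> frontier (inside (A \<union> C)) = {}" unfolding J3 by (rule d(3))
      show "inside (A \<union> C) \<inter> frontier (inside (A \<union> B)) = {}" unfolding J3 by (rule d(4))
      show "inside (A \<union> B) \<inter> inside (A \<union> C) \<noteq> {}" using IntI[OF z zi] by (metis empty_iff)
    qed
    then have "A \<union> B = A \<union> C" using J3 by metis
    then have "B \<subseteq> {a, b}" using i' by blast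
    then show False using ne(2) by blast
  qed
  ultimately have zo: "z \<in> outside (B \<union> C)" "z \<in> outside (A \<union> C)"
    using n1[OF z] inside_outside[of "B \<union> C"] inside_outside[of "A \<union> C"] by auto
  have bd: "bounded (A \<union> B \<union> C)" using comp by (simp add: compact_imp_bounded)
  have "outside (A \<union> B \<union> C) \<noteq> {}" using bd by (simp add: outside_bounded_nonempty)
  then obtain w where w: "w \<in> outside (A \<union> B \<union> C)" by blast
  have wo: "w \<in> outside (B \<union> C)" "w \<in> outside (A \<union> C)" "w \<in> outside (A \<union> B)"
    using w outside_mono[of "B \<union> C" "A \<union> B \<union> C"] outside_mono[of "A \<union> C" "A \<union> B \<union> C"]
      outside_mono[of "A \<union> B" "A \<union> B \<union> C"] by blast+
  have cc: "connected_component (- S) z w" if "z \<in> outside S" "w \<in> outside S" "compact S" for S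
  proof -
    have "connected (outside S)" using that by (simp add: connected_outside compact_imp_bounded)
    moreover have "outside S \<subseteq> - S" by (auto simp: outside_def)
    ultimately show ?thesis using that unfolding connected_component_def by blast
  qed
  have c1: "connected_component (- (B \<union> C)) z w" "connected_component (- (A \<union> C)) z w"
    by (rule cc[OF zo(1) wo(1) compact_Un[OF comp(2,3)]] cc[OF zo(2) wo(2) compact_Un[OF comp(1,3)]])+
  \<comment> \<open>\<open>A \<inter> B\<close> consists of the common ends, which lie on
    \<open>C\<close>; hence the intersection is just \<open>C\<close> and is connected.\<close>
  have "(B \<union> C) \<inter> (A \<union> C) = (A \<inter> B) \<union> C" by (metis Un_Int_distrib2 Int_commute)
  also have "A \<inter> B \<subseteq> C" using i' by (metis Int_lower2)
  then have "(A \<inter> B) \<union> C = C" by (rule Un_absorb1)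
  finally have conC: "connected ((B \<union> C) \<inter> (A \<union> C))" using con(3) by (simp only:)
  have "connected_component (- ((B \<union> C) \<union> (A \<union> C))) z w"
    by (rule Janiszewski[OF compact_Un[OF comp(2,3)] compact_imp_closed[OF compact_Un[OF comp(1,3)]] conC c1])
  then have "connected_component (- (A \<union> B)) z w"
    by (rule connected_component_of_subset) auto
  then have "w \<in> inside (A \<union> B)" using inside_same_component[OF _ z] by (metis)
  then show False using wo(3) inside_Int_outside by (metis IntI empty_iff)
qed

section \<open>Plane graphs\<close>

text \<open>\<open>im\<close> assigns point sets to edges because \<open>{u, v}\<close> is
  unordered; \<open>arcE\<close> yields a parametrisation in either direction. The last three
  assumptions say that the drawing meets itself at vertices only.\<close>

locale plane_graph =
  fixes V :: "'v set" and E :: "'v set set" and im :: "'v set \<Rightarrow> complex set" and pt :: "'v \<Rightarrow> complex"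
  assumes sg: "simple_graph V E" and tr: "three_regular V E" and tec: "three_edge_connected V E"
    and arcE: "{u, v} \<in> E \<Longrightarrow>
      \<exists>\<gamma>. arc \<gamma> \<and> path_image \<gamma> = im {u, v} \<and> pathstart \<gamma> = pt u \<and> pathfinish \<gamma> = pt v"
    and meet: "e \<in> E \<Longrightarrow> e' \<in> E \<Longrightarrow> e \<noteq> e' \<Longrightarrow> im e \<inter> im e' = pt ` (e \<inter> e')"
    and pt_inj: "inj_on pt V"
    and pt_im: "e \<in> E \<Longrightarrow> v \<in> V \<Longrightarrow> pt v \<in> im e \<longleftrightarrow> v \<in> e"
begin

lemma finV: "finite V" and finE: "finite E"
proof -
  show "finite V" using sg unfolding simple_graph_def by blast
  then show "finite E" using sg unfolding simple_graph_def by (meson PowI finite_Pow_iff finite_subset subsetI)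
qed

lemma edge_V: "{u, v} \<in> E \<Longrightarrow> u \<in> V \<and> v \<in> V \<and> u \<noteq> v"
  using sg unfolding simple_graph_def by (metis card_2_iff insert_absorb2 insert_subset card_1_singleton_iff is_singletonI is_singleton_altdef numeral_eq_one_iff semiring_norm(85))

lemma edge_ex: "e \<in> E \<Longrightarrow> \<exists>u v. e = {u, v} \<and> u \<noteq> v \<and> u \<in> V \<and> v \<in> V"
  using sg unfolding simple_graph_def by (metis card_2_iff insert_subset)

lemma Union_V: "S \<subseteq> E \<Longrightarrow> \<Union> S \<subseteq> V"
  using sg unfolding simple_graph_def by blast

definition IM :: "'v set set \<Rightarrow> complex set" where "IM S = \<Union> (im ` S)"

lemma IM_Un: "IM (S \<union> T) = IM S \<union> IM T" unfolding IM_def by blast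

lemma IM_mono: "S \<subseteq> T \<Longrightarrow> IM S \<subseteq> IM T" unfolding IM_def by blast

lemma IM_Int:
  assumes "S \<subseteq> E" "T \<subseteq> E" "S \<inter> T = {}"
  shows "IM S \<inter> IM T = pt ` (\<Union> S \<inter> \<Union> T)"
proof
  show "IM S \<inter> IM T \<subseteq> pt ` (\<Union> S \<inter> \<Union> T)"
  proof
    fix x assume "x \<in> IM S \<inter> IM T"
    then obtain e e' where e: "e \<in> S" "e' \<in> T" "x \<in> im e \<inter> im e'" unfolding IM_def by blast
    then have "x \<in> pt ` (e \<inter> e')" using meet[of e e'] assms by blast
    then show "x \<in> pt ` (\<Union> S \<inter> \<Union> T)" using e by blast
  qed
  show "pt ` (\<Union> S \<inter> \<Union> T) \<subseteq> IM S \<inter> IM T"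
  proof
    fix x assume "x \<in> pt ` (\<Union> S \<inter> \<Union> T)"
    then obtain v e e' where v: "x = pt v" "v \<in> e" "e \<in> S" "v \<in> e'" "e' \<in> T" by blast
    then have "v \<in> V" using Union_V assms by blast
    then show "x \<in> IM S \<inter> IM T" unfolding IM_def using v pt_im assms by blast
  qed
qed

lemma pt_IM: "S \<subseteq> E \<Longrightarrow> v \<in> V \<Longrightarrow> pt v \<in> IM S \<longleftrightarrow> v \<in> \<Union> S"
  unfolding IM_def using pt_im by blast

lemma path_arc:
  assumes "distinct xs" "2 \<le> length xs" "wedges xs \<subseteq> E"
  shows "\<exists>\<gamma>. arc \<gamma> \<and> path_image \<gamma> = IM (wedges xs) \<and> pathstart \<gamma> = pt (hd xs) \<and> pathfinish \<gamma> = pt (last xs)"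
  using assms
proof (induction xs rule: wedges.induct)
  case (1 x y r)
  obtain g where g: "arc g" "path_image g = im {x, y}" "pathstart g = pt x" "pathfinish g = pt y"
    using arcE[of x y] 1 by auto
  show ?case
  proof (cases "r = []")
    case True then show ?thesis using g by (intro exI[of _ g]) (auto simp: IM_def)
  next
    case False
    then have "2 \<le> length (y # r)" by (cases r) auto
    then obtain h where h: "arc h" "path_image h = IM (wedges (y # r))" "pathstart h = pt y"
      "pathfinish h = pt (last (y # r))" using 1 by auto
    have n: "{x, y} \<notin> wedges (y # r)" using wedges_notin(1)[of x "y # r"] 1 by auto
    have "path_image g \<inter> path_image h = IM {{x, y}} \<inter> IM (wedges (y # r))"
      using g h by (simp add: IM_def)
    also have "\<dots> = pt ` (\<Union> {{x, y}} \<inter> \<Union> (wedges (y # r)))"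
      using 1 n by (intro IM_Int) auto
    also have "\<dots> = {pt y}" using Union_wedges[OF \<open>2 \<le> length (y # r)\<close>] 1 by auto
    finally have "arc (g +++ h)" using g h by (intro arc_join) auto
    moreover have "path_image (g +++ h) = IM (wedges (x # y # r))"
      using g h by (simp add: path_image_join IM_def)
    ultimately show ?thesis using g h by (intro exI[of _ "g +++ h"]) auto
  qed
qed auto

text \<open>Two paths with \<open>thet\<close> bound a cycle, three pairwise ones form a theta
  graph. Disjointness of the edges is required separately: it excludes taking the single edge
  \<open>{u, b}\<close> twice.\<close>

definition thet :: "'v \<Rightarrow> 'v \<Rightarrow> 'v list \<Rightarrow> 'v list \<Rightarrow> bool" where
  "thet u b xs ys \<longleftrightarrow> distinct (u # xs @ [b]) \<and> distinct (u # ys @ [b]) \<and> set xs \<inter> set ys = {} \<and>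
    wedges (u # xs @ [b]) \<subseteq> E \<and> wedges (u # ys @ [b]) \<subseteq> E \<and> wedges (u # xs @ [b]) \<inter> wedges (u # ys @ [b]) = {}"

lemma thet_sym: "thet u b xs ys \<longleftrightarrow> thet u b ys xs"
  unfolding thet_def by blast

lemma thet_arcs:
  assumes "thet u b xs ys" shows "IM (wedges (u # xs @ [b])) \<inter> IM (wedges (u # ys @ [b])) = {pt u, pt b}"
proof -
  have "IM (wedges (u # xs @ [b])) \<inter> IM (wedges (u # ys @ [b])) =
    pt ` (\<Union> (wedges (u # xs @ [b])) \<inter> \<Union> (wedges (u # ys @ [b])))"
    using assms unfolding thet_def by (intro IM_Int) auto
  also have "\<Union> (wedges (u # xs @ [b])) = set (u # xs @ [b])" by (intro Union_wedges) auto
  also have "\<Union> (wedges (u # ys @ [b])) = set (u # ys @ [b])" by (intro Union_wedges) auto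
  also have "set (u # xs @ [b]) \<inter> set (u # ys @ [b]) = {u, b}" using assms unfolding thet_def by auto
  finally show ?thesis by simp
qed

lemma thet_pt: assumes "thet u b xs ys" shows "u \<in> V" "b \<in> V" "u \<noteq> b" "pt u \<noteq> pt b"
proof -
  have "\<Union> (wedges (u # xs @ [b])) = set (u # xs @ [b])" by (intro Union_wedges) auto
  then show *: "u \<in> V" "b \<in> V" using Union_V[of "wedges (u # xs @ [b])"] assms unfolding thet_def by auto
  show "u \<noteq> b" using assms unfolding thet_def by auto
  then show "pt u \<noteq> pt b" using * pt_inj by (auto dest: inj_onD)
qed

lemma thet_arc:
  assumes "thet u b xs ys"
  obtains \<gamma> where "arc \<gamma>" "path_image \<gamma> = IM (wedges (u # xs @ [b]))" "pathstart \<gamma> = pt u" "pathfinish \<gamma> = pt b"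
  using path_arc[of "u # xs @ [b]"] assms unfolding thet_def by auto

text \<open>The splitting of the inside of a closed curve by a crosscut, in combinatorial terms; it
  drives the cutting of faces in \<open>ear_step\<close>.\<close>

lemma theta_split:
  assumes "thet u b xs ys" "thet u b xs ps" "thet u b ys ps"
    "IM (wedges (u # ps @ [b])) \<inter> inside (IM (wedges (u # xs @ [b])) \<union> IM (wedges (u # ys @ [b]))) \<noteq> {}"
  shows "inside (IM (wedges (u # xs @ [b])) \<union> IM (wedges (u # ps @ [b]))) \<inter>
      inside (IM (wedges (u # ys @ [b])) \<union> IM (wedges (u # ps @ [b]))) = {}"
    "inside (IM (wedges (u # xs @ [b])) \<union> IM (wedges (u # ps @ [b]))) \<union>
      inside (IM (wedges (u # ys @ [b])) \<union> IM (wedges (u # ps @ [b]))) \<union>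
      (IM (wedges (u # ps @ [b])) - {pt u, pt b}) =
      inside (IM (wedges (u # xs @ [b])) \<union> IM (wedges (u # ys @ [b])))"
proof -
  obtain g1 where g1: "arc g1" "path_image g1 = IM (wedges (u # xs @ [b]))" "pathstart g1 = pt u" "pathfinish g1 = pt b"
    using thet_arc[OF assms(1)] by metis
  obtain g2 where g2: "arc g2" "path_image g2 = IM (wedges (u # ys @ [b]))" "pathstart g2 = pt u" "pathfinish g2 = pt b"
    using thet_arc[OF assms(3)] by metis
  obtain g3 where g3: "arc g3" "path_image g3 = IM (wedges (u # ps @ [b]))" "pathstart g3 = pt u" "pathfinish g3 = pt b"
    using thet_arc[OF thet_sym[THEN iffD1, OF assms(3)]] by metis
  note t = thet_arcs[OF assms(1)] thet_arcs[OF assms(2)] thet_arcs[OF assms(3)]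
  have t': "path_image g1 \<inter> path_image g2 = {pt u, pt b}" "path_image g1 \<inter> path_image g3 = {pt u, pt b}"
     "path_image g2 \<inter> path_image g3 = {pt u, pt b}" using t g1 g2 g3 by auto
  have "path_image g3 \<inter> inside (path_image g1 \<union> path_image g2) \<noteq> {}" using assms(4) g1 g2 g3 by simp
  note split_inside_simple_closed_curve[OF arc_imp_simple_path[OF g1(1)] g1(3,4) arc_imp_simple_path[OF g2(1)] g2(3,4)
      arc_imp_simple_path[OF g3(1)] g3(3,4) thet_pt(4)[OF assms(1)] t' this]
  then show "inside (IM (wedges (u # xs @ [b])) \<union> IM (wedges (u # ps @ [b]))) \<inter>
      inside (IM (wedges (u # ys @ [b])) \<union> IM (wedges (u # ps @ [b]))) = {}"
    "inside (IM (wedges (u # xs @ [b])) \<union> IM (wedges (u # ps @ [b]))) \<union>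
      inside (IM (wedges (u # ys @ [b])) \<union> IM (wedges (u # ps @ [b]))) \<union>
      (IM (wedges (u # ps @ [b])) - {pt u, pt b}) =
      inside (IM (wedges (u # xs @ [b])) \<union> IM (wedges (u # ys @ [b])))"
    unfolding g1 g2 g3 by blast+
qed

text \<open>The opposite case, in which the third path stays out: then one of the other two is
  swallowed, which lets the enclosing cycle grow in \<open>outer_cycle\<close>.\<close>

lemma theta_out:
  assumes "thet u b xs ys" "thet u b xs ps" "thet u b ys ps"
    "IM (wedges (u # ps @ [b])) \<inter> inside (IM (wedges (u # xs @ [b])) \<union> IM (wedges (u # ys @ [b]))) = {}"
  shows "IM (wedges (u # xs @ [b])) \<inter> inside (IM (wedges (u # ys @ [b])) \<union> IM (wedges (u # ps @ [b]))) \<noteq> {} \<or>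
     IM (wedges (u # ys @ [b])) \<inter> inside (IM (wedges (u # xs @ [b])) \<union> IM (wedges (u # ps @ [b]))) \<noteq> {}"
proof -
  obtain g1 where g1: "arc g1" "path_image g1 = IM (wedges (u # xs @ [b]))" "pathstart g1 = pt u" "pathfinish g1 = pt b"
    using thet_arc[OF assms(1)] by metis
  obtain g2 where g2: "arc g2" "path_image g2 = IM (wedges (u # ys @ [b]))" "pathstart g2 = pt u" "pathfinish g2 = pt b"
    using thet_arc[OF assms(3)] by metis
  obtain g3 where g3: "arc g3" "path_image g3 = IM (wedges (u # ps @ [b]))" "pathstart g3 = pt u" "pathfinish g3 = pt b"
    using thet_arc[OF thet_sym[THEN iffD1, OF assms(3)]] by metis
  note t = thet_arcs[OF assms(1)] thet_arcs[OF assms(2)] thet_arcs[OF assms(3)]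
  have t': "path_image g1 \<inter> path_image g2 = {pt u, pt b}" "path_image g1 \<inter> path_image g3 = {pt u, pt b}"
     "path_image g2 \<inter> path_image g3 = {pt u, pt b}" using t g1 g2 g3 by auto
  have "path_image g3 \<inter> inside (path_image g1 \<union> path_image g2) = {}" using assms(4) g1 g2 g3 by simp
  from theta_inside[OF g1(1) g2(1) g3(1) g1(3) g2(3) g3(3) g1(4) g2(4) g3(4) t' this]
  show ?thesis unfolding g1 g2 g3 .
qed

definition I :: "('v \<Rightarrow> 'v \<Rightarrow> 'k::field) \<Rightarrow> complex set" where
  "I z = inside (IM (supp z))"

lemma wedge_ends: "distinct (u # xs @ [b]) \<Longrightarrow> xs \<noteq> [] \<Longrightarrow> {u, b} \<notin> wedges (u # xs @ [b])"
  using wedges_notin(1)[of u "xs @ [b]" b] by (cases xs) (auto simp: doubleton_eq_iff)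

lemma thetI:
  assumes "distinct (u # xs @ [b])" "distinct (u # ys @ [b])" "set xs \<inter> set ys = {}"
    "wedges (u # xs @ [b]) \<subseteq> E" "wedges (u # ys @ [b]) \<subseteq> E" "xs \<noteq> [] \<or> ys \<noteq> []"
  shows "thet u b xs ys"
proof -
  have False if e12: "e \<in> wedges (u # xs @ [b])" "e \<in> wedges (u # ys @ [b])" for e
  proof -
    have "e \<in> E" using e12 assms by blast
    then obtain p q where e: "e = {p, q}" "p \<noteq> q" using edge_ex by blast
    have "set (u # xs @ [b]) \<inter> set (u # ys @ [b]) \<subseteq> {u, b}" using assms(3) by auto
    then have "e \<subseteq> {u, b}" using wedges_subset[OF e12(1)] wedges_subset[OF e12(2)] by blast
    then have "e = {u, b}" using e(2) unfolding e(1) by (simp add: doubleton_eq_iff) blast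
    then have "{u, b} \<in> wedges (u # xs @ [b])" "{u, b} \<in> wedges (u # ys @ [b])" using e12 by simp_all
    then show False using assms(6) wedge_ends[OF assms(1)] wedge_ends[OF assms(2)] by metis
  qed
  then show ?thesis using assms unfolding thet_def by blast
qed

text \<open>The second arc is reversed so that both arcs run from \<open>a\<close> to
  \<open>b\<close>; thereby the sum of their flows becomes a difference.\<close>

lemma cyc_thet:
  fixes z :: "'v \<Rightarrow> 'v \<Rightarrow> 'k::field"
  assumes "cyc E z" "a \<in> \<Union> (supp z)" "b \<in> \<Union> (supp z)" "a \<noteq> b"
  obtains xs ys where "thet a b xs ys" "supp z = wedges (a # xs @ [b]) \<union> wedges (a # ys @ [b])"
    "\<And>x y. z x y = wflow (a # xs @ [b]) x y - wflow (a # ys @ [b]) x y"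
proof -
  obtain xs ys where s: "distinct (a # xs @ b # ys)" "xs @ ys \<noteq> []"
    "\<And>x y. z x y = wflow (a # xs @ [b]) x y + wflow (b # ys @ [a]) x y"
    "supp z = wedges (a # xs @ [b]) \<union> wedges (b # ys @ [a])"
    using cyc_split[OF assms] by metis
  have r: "b # ys @ [a] = rev (a # rev ys @ [b])" by simp
  have w: "wedges (b # ys @ [a]) = wedges (a # rev ys @ [b])" unfolding r by (rule wedges_rev)
  have f: "wflow (b # ys @ [a]) x y = - (wflow (a # rev ys @ [b]) x y :: 'k)" for x y unfolding r by (rule wflow_rev)
  have "thet a b xs (rev ys)" using s cyc_facts(2)[OF assms(1)] w by (intro thetI) auto
  then show ?thesis using that[of xs "rev ys"] s w f by auto
qed

lemma thet_cyc:
  fixes z :: "'v \<Rightarrow> 'v \<Rightarrow> 'k::field"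
  assumes "thet a b xs ys" "wedges (a # xs @ [b]) \<subseteq> F" "wedges (a # ys @ [b]) \<subseteq> F"
    "\<And>x y. z x y = wflow (a # xs @ [b]) x y - wflow (a # ys @ [b]) x y"
  shows "cyc F z" "supp z = wedges (a # xs @ [b]) \<union> wedges (a # ys @ [b])"
proof -
  have r: "b # rev ys @ [a] = rev (a # ys @ [b])" by simp
  have w: "wedges (b # rev ys @ [a]) = wedges (a # ys @ [b])" unfolding r by (rule wedges_rev)
  have f: "wflow (b # rev ys @ [a]) x y = - (wflow (a # ys @ [b]) x y :: 'k)" for x y unfolding r by (rule wflow_rev)
  have d: "distinct (a # xs @ b # rev ys)" "xs @ rev ys \<noteq> []" using assms(1) unfolding thet_def by auto
  note cyc_join[OF d, of z F]
  then show "cyc F z" "supp z = wedges (a # xs @ [b]) \<union> wedges (a # ys @ [b])"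
    using assms w f by auto
qed

text \<open>The Jordan curve theorem for the loop made of the two arcs between the ends of some edge
  of the cycle.\<close>

lemma I_facts:
  fixes z :: "'v \<Rightarrow> 'v \<Rightarrow> 'k::field"
  assumes "cyc E z"
  shows "open (I z)" "connected (I z)" "frontier (I z) = IM (supp z)" "I z \<inter> IM (supp z) = {}"
    "closure (I z) = I z \<union> IM (supp z)"
proof -
  obtain e where e: "e \<in> supp z" using cyc_facts(4)[OF assms] by blast
  then obtain a b where "e = {a, b}" "a \<noteq> b" using cyc_facts(2)[OF assms] edge_ex by blast
  then have ab: "a \<in> \<Union> (supp z)" "b \<in> \<Union> (supp z)" "a \<noteq> b" using e by auto
  obtain xs ys where s: "thet a b xs ys" "supp z = wedges (a # xs @ [b]) \<union> wedges (a # ys @ [b])"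
    using cyc_thet[OF assms ab] by metis
  obtain g1 where g1: "arc g1" "path_image g1 = IM (wedges (a # xs @ [b]))" "pathstart g1 = pt a" "pathfinish g1 = pt b"
    using thet_arc[OF s(1)] by metis
  obtain g2 where g2: "arc g2" "path_image g2 = IM (wedges (a # ys @ [b]))" "pathstart g2 = pt a" "pathfinish g2 = pt b"
    using thet_arc[OF thet_sym[THEN iffD1, OF s(1)]] by metis
  have "path_image (g1 +++ reversepath g2) = path_image g1 \<union> path_image g2"
    using g1 g2 by (simp add: path_image_join)
  then have pi1: "path_image (g1 +++ reversepath g2) = IM (supp z)"
    unfolding s(2) IM_Un g1 g2 .
  have "path_image g1 \<inter> path_image g2 = {pt a, pt b}" using thet_arcs[OF s(1)] g1 g2 by simp
  then have "simple_path (g1 +++ reversepath g2)"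
    using g1(1,3,4) g2(1,3,4) by (simp add: simple_path_join_loop_eq arc_reversepath)
  note pi = pi1 this
  have "pathfinish (g1 +++ reversepath g2) = pathstart (g1 +++ reversepath g2)" using g1 g2 by simp
  note J = Jordan_inside_outside[OF pi(2) this, unfolded pi(1)]
  show "open (I z)" "connected (I z)" "frontier (I z) = IM (supp z)" using J unfolding I_def by simp_all
  show "I z \<inter> IM (supp z) = {}" unfolding I_def by simp
  show "closure (I z) = I z \<union> IM (supp z)"
    using \<open>frontier (I z) = IM (supp z)\<close> closure_Un_frontier by metis
qed

text \<open>The open arc is the image of the open interval, and a continuous map takes the closure
  of the interval into the closure of the image.\<close>

lemma arc_interior:
  assumes "thet u b xs ys" defines "P \<equiv> IM (wedges (u # xs @ [b])) - {pt u, pt b}"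
  shows "connected P" "P \<noteq> {}" "pt u \<in> closure P" "pt b \<in> closure P"
proof -
  obtain g where g: "arc g" "path_image g = IM (wedges (u # xs @ [b]))" "pathstart g = pt u" "pathfinish g = pt b"
    using thet_arc[OF assms(1)] by metis
  have sp: "simple_path g" using g(1) by (rule arc_imp_simple_path)
  have P: "P = path_image g - {pathstart g, pathfinish g}" using g unfolding P_def by simp
  show "connected P" "P \<noteq> {}" unfolding P using connected_simple_path_endless[OF sp] nonempty_simple_path_endless[OF sp] by auto
  have P2: "P = g ` {0<..<1}" using P simple_path_endless[OF sp] by simp
  have "continuous_on (closure {0<..<1}) g" using arc_imp_path[OF g(1)] unfolding path_def by simp
  then have "g ` closure {0<..<1} \<subseteq> closure (g ` {0<..<1})"
    by (metis closed_closure closure_subset continuous_on_closure image_closure_subset)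
  then have "g ` {0..1} \<subseteq> closure P" unfolding P2 by simp
  then have "g 0 \<in> closure P" "g 1 \<in> closure P" by auto
  then show "pt u \<in> closure P" "pt b \<in> closure P" using g(3,4) unfolding pathstart_def pathfinish_def by auto
qed

lemma degree3: "v \<in> V \<Longrightarrow> card {e \<in> E. v \<in> e} = 3"
  using tr unfolding three_regular_def by blast

lemma connected_minus: "F \<subseteq> E \<Longrightarrow> card F < 3 \<Longrightarrow> connected_graph V (E - F)"
  using tec finE finite_subset unfolding three_edge_connected_def by blast

text \<open>Deleting the edge \<open>{u, w}\<close> keeps the graph connected, so \<open>w\<close>
  is joined to \<open>H\<close> without it; the path is cut at its first vertex of \<open>H\<close>.
  It cannot close up at \<open>u\<close>, where \<open>H\<close> has two edges already and the
  degree is three.\<close>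

lemma ear:
  assumes H: "H \<subseteq> E" "\<forall>v\<in>\<Union> H. 2 \<le> card {e \<in> H. v \<in> e}"
    and e: "{u, w} \<in> E" "{u, w} \<notin> H" and u: "u \<in> \<Union> H"
  obtains xs b where "b \<in> \<Union> H" "distinct (u # xs @ [b])" "set xs \<inter> \<Union> H = {}"
    "wedges (u # xs @ [b]) \<subseteq> E - H" "{u, w} \<in> wedges (u # xs @ [b])"
proof (cases "w \<in> \<Union> H")
  case True
  then show ?thesis using that[of w "[]"] edge_V[OF e(1)] e by auto
next
  case False
  have "connected_graph V (E - {{u, w}})" using connected_minus[of "{{u, w}}"] e by simp
  then have "(w, u) \<in> {(x, y). {x, y} \<in> E - {{u, w}}}\<^sup>*"
    using edge_V[OF e(1)] unfolding connected_graph_def by blast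
  then obtain p where p: "distinct p" "p \<noteq> []" "hd p = w" "last p = u" "wedges p \<subseteq> E - {{u, w}}"
    using rtrancl_path by metis
  have "\<exists>x\<in>set p. x \<in> \<Union> H" using p u last_in_set by blast
  then obtain ys b zs where ys: "p = ys @ b # zs" "b \<in> \<Union> H" "\<forall>y\<in>set ys. y \<notin> \<Union> H"
    using split_list_first_prop[of p "\<lambda>x. x \<in> \<Union> H"] by blast
  have yne: "ys \<noteq> []" using False p ys by (cases ys) auto
  then obtain ys' where ys': "ys = w # ys'" using p ys by (cases ys) auto
  have wy: "wedges (ys @ [b]) \<subseteq> E - {{u, w}}" using p ys wedges_append[of ys b zs] by blast
  have m: "e \<inter> set l \<noteq> {}" if "e \<in> wedges (l @ [b])" for e and l :: "'v list"
    using that by (induction l rule: wedges.induct) auto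
  have bu: "b \<noteq> u"
  proof
    assume bu: "b = u"
    obtain qs q where q: "ys = qs @ [q]" using yne by (cases ys rule: rev_cases) auto
    have "{q, u} \<in> wedges (ys @ [b])" using q bu wedges_snoc2[of qs q u] by simp
    then have qE: "{q, u} \<in> E - {{u, w}}" using wy by blast
    have qH: "{q, u} \<notin> H" using q ys(3) by auto
    have f: "finite {e \<in> H. u \<in> e}" using H finE finite_subset by fastforce
    have c2: "card {{u, w}, {q, u}} = 2" using qE by (simp only: card_2_iff) blast
    have "{e \<in> H. u \<in> e} \<inter> {{u, w}, {q, u}} = {}" using e qH by blast
    then have "card ({e \<in> H. u \<in> e} \<union> {{u, w}, {q, u}}) = card {e \<in> H. u \<in> e} + 2"
      using card_Un_disjoint[OF f _, of "{{u, w}, {q, u}}"] c2 by simp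
    moreover have "{e \<in> H. u \<in> e} \<union> {{u, w}, {q, u}} \<subseteq> {e \<in> E. u \<in> e}" using e qE H by auto
    then have "card ({e \<in> H. u \<in> e} \<union> {{u, w}, {q, u}}) \<le> 3"
      using card_mono[of "{e \<in> E. u \<in> e}"] degree3[of u] edge_V[OF e(1)] finE by auto
    moreover have "2 \<le> card {e \<in> H. u \<in> e}" using H u by blast
    ultimately show False by simp
  qed
  have uy: "u \<notin> set ys" using ys u by blast
  have wu: "wedges (u # ys @ [b]) = insert {u, w} (wedges (ys @ [b]))" using ys' by simp
  have nH: "e \<notin> H" if "e \<in> wedges (ys @ [b])" for e using m[OF that] ys(3) by blast
  show ?thesis
  proof (rule that[of b ys])
    show "distinct (u # ys @ [b])" using p ys uy bu by auto
    show "wedges (u # ys @ [b]) \<subseteq> E - H" unfolding wu using wy nH e by blast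
  qed (use ys wu in auto)
qed

end

section \<open>The face cycles of a plane graph\<close>

text \<open>The cycle space of the graph with coefficients in the field, that is, its first
  homology.\<close>

definition is_flow :: "'v set \<Rightarrow> 'v set set \<Rightarrow> ('v \<Rightarrow> 'v \<Rightarrow> 'k::field) \<Rightarrow> bool" where
  "is_flow V E r \<longleftrightarrow> (\<forall>x y. r y x = - r x y) \<and> (\<forall>x y. {x, y} \<notin> E \<longrightarrow> r x y = 0) \<and> (\<forall>x\<in>V. (\<Sum>y\<in>V. r x y) = 0)"

lemma is_flow_diff: "is_flow V E r \<Longrightarrow> is_flow V E s \<Longrightarrow> is_flow V E (\<lambda>x y. r x y - c * s x y)"
proof -
  assume r: "is_flow V E r" and s: "is_flow V E s"
  have sums: "(\<Sum>y\<in>V. r x y - c * s x y) = (\<Sum>y\<in>V. r x y) - c * (\<Sum>y\<in>V. s x y)" for x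
    by (simp only: sum_subtractf sum_distrib_left)
  show ?thesis unfolding is_flow_def
  proof (intro conjI allI ballI impI)
    fix x y
    have 1: "r y x = - r x y" using r unfolding is_flow_def by blast
    have 2: "s y x = - s x y" using s unfolding is_flow_def by blast
    show "r y x - c * s y x = - (r x y - c * s x y)"
      unfolding 1 2 by (simp only: minus_diff_eq mult_minus_right diff_minus_eq_add) simp
  next
    fix x y assume "{x, y} \<notin> E"
    then have "r x y = 0" "s x y = 0" using r s unfolding is_flow_def by blast+
    then show "r x y - c * s x y = 0" by simp
  next
    fix x assume "x \<in> V"
    then have "(\<Sum>y\<in>V. r x y) = 0" "(\<Sum>y\<in>V. s x y) = 0" using r s unfolding is_flow_def by blast+
    then show "(\<Sum>y\<in>V. r x y - c * s x y) = 0" unfolding sums by simp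
  qed
qed

text \<open>Kirchhoff's law carries the value of a flow through a vertex at which it uses two edges
  only. The inner vertices of the path, listed by \<open>butlast (y # l)\<close>, are assumed to be
  of this kind, so a zero on the first edge spreads along the whole path.\<close>

lemma flow_path_zero:
  fixes r :: "'v \<Rightarrow> 'v \<Rightarrow> 'k::field"
  assumes "is_flow V E r" "finite V" "distinct (x # y # l)" "set (x # y # l) \<subseteq> V" "r x y = 0"
    "\<And>p q. p \<in> set (butlast (y # l)) \<Longrightarrow> r p q \<noteq> 0 \<Longrightarrow> {p, q} \<in> wedges (x # y # l)"
    "{p, q} \<in> wedges (x # y # l)"
  shows "r p q = 0"
  using assms(3-)
proof (induction l arbitrary: x y)
  case Nil
  then have "(p = x \<and> q = y) \<or> (p = y \<and> q = x)" by (simp add: doubleton_eq_iff)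
  then show ?case using Nil(3) assms(1) unfolding is_flow_def by (metis neg_equal_0_iff_equal)
next
  case (Cons z zs)
  have anti: "r b a = - r a b" for a b using assms(1) unfolding is_flow_def by blast
  have y0: "r y x = 0" using anti[of y x] Cons(4) by simp
  have "r y w = 0" if "w \<in> V - {z}" for w
  proof (rule ccontr)
    assume w: "r y w \<noteq> 0"
    then have "{y, w} \<in> wedges (x # y # z # zs)" using Cons(5)[of y w] by simp
    moreover have "{y, w} \<notin> wedges (z # zs)" using Cons(2) by (intro wedges_notin) simp
    ultimately have "{y, w} = {x, y} \<or> {y, w} = {y, z}" by simp
    then have "w = x" using that Cons(2) by (auto simp: doubleton_eq_iff)
    then show False using w y0 by simp
  qed
  then have s0: "(\<Sum>w\<in>V - {z}. r y w) = 0" by (intro sum.neutral) blast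
  have "y \<in> V" "z \<in> V" using Cons(3) by auto
  then have "(\<Sum>w\<in>V. r y w) = 0" using assms(1) unfolding is_flow_def by blast
  then have yz: "r y z = 0" using s0 sum.remove[OF assms(2) \<open>z \<in> V\<close>, of "r y"] by simp
  have xy0: "r a b = 0" if "{a, b} = {x, y}" for a b using that Cons(4) y0 by (auto simp: doubleton_eq_iff)
  show ?case
  proof (cases "{p, q} = {x, y}")
    case True then show ?thesis by (rule xy0)
  next
    case False
    show ?thesis
    proof (rule Cons(1)[of y z])
      show "distinct (y # z # zs)" "set (y # z # zs) \<subseteq> V" using Cons by auto
      show "r y z = 0" by (rule yz)
      show "{p, q} \<in> wedges (y # z # zs)" using Cons(6) False by simp
      fix a b assume a: "a \<in> set (butlast (z # zs))" "r a b \<noteq> 0"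
      then have "a \<in> set (butlast (y # z # zs))" by simp
      then have "{a, b} \<in> wedges (x # y # z # zs)" using Cons(5) a by blast
      moreover have "{a, b} \<noteq> {x, y}" using xy0 a by blast
      ultimately show "{a, b} \<in> wedges (y # z # zs)" by simp
    qed
  qed
qed

lemma card_wedges_path: "distinct p \<Longrightarrow> p \<noteq> [] \<Longrightarrow> card (wedges p) + 1 = length p"
proof (induction p rule: wedges.induct)
  case (1 x y r)
  then show ?case using wedges_notin(1)[of x "y # r" y] by auto
qed auto

section \<open>The outer cycle of the drawing\<close>

context plane_graph
begin

lemma cyc_flow: "cyc E z \<Longrightarrow> is_flow V E z"
  unfolding is_flow_def using cyc_facts(1,2,3)[of E z] cyc_facts(6)[of E z V] finV Union_V by blast

lemma conn: "connected_graph V E"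
  using connected_minus[of "{}"] by simp

lemma ex_edge: assumes "v \<in> V" shows "\<exists>w. {v, w} \<in> E"
proof -
  have "{e \<in> E. v \<in> e} \<noteq> {}" using degree3[OF assms] by (metis card.empty zero_neq_numeral)
  then obtain e where "e \<in> E" "v \<in> e" by blast
  then show ?thesis using edge_ex[of e] by (auto simp: insert_commute)
qed

lemma Union_E: "\<Union> E = V"
  using ex_edge Union_V[of E] by blast

text \<open>Without the edge \<open>{v, w}\<close> its ends are still joined by a path, and the edge
  closes this path up.\<close>

lemma ex_cycle: "\<exists>z :: 'v \<Rightarrow> 'v \<Rightarrow> 'k::field. cyc E z"
proof -
  obtain v where v: "v \<in> V" using conn unfolding connected_graph_def by blast
  obtain w where w: "{v, w} \<in> E" using ex_edge[OF v] by blast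
  have vw: "v \<noteq> w" "w \<in> V" using edge_V[OF w] by auto
  have "connected_graph V (E - {{v, w}})" using connected_minus[of "{{v, w}}"] w by simp
  then have "(v, w) \<in> {(x, y). {x, y} \<in> E - {{v, w}}}\<^sup>*" using v vw unfolding connected_graph_def by blast
  then obtain p where p: "distinct p" "p \<noteq> []" "hd p = v" "last p = w" "wedges p \<subseteq> E - {{v, w}}"
    using rtrancl_path by metis
  obtain xs where xs: "p = v # xs @ [w]"
    using p vw by (cases p; cases "tl p" rule: rev_cases) auto
  have "xs \<noteq> []" using p xs by auto
  then have t: "thet v w xs []" using p xs w vw by (intro thetI) auto
  show ?thesis
    using thet_cyc(1)[OF t _ _ refl, of E] p xs w by auto
qed

lemma im_connected: "e \<in> E \<Longrightarrow> connected (im e)"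
  using edge_ex[of e] arcE by (metis arc_imp_path connected_path_image)

text \<open>By \<open>theta_split\<close> the inside of the new cycle is composed of the old inside,
  the region between \<open>xs\<close> and \<open>ps\<close>, and the open arc \<open>xs\<close>.
  This is the growth step for \<open>outer_cycle\<close>.\<close>

lemma bigger:
  fixes z0 :: "'v \<Rightarrow> 'v \<Rightarrow> 'k::field"
  assumes t: "thet u b xs ys" "thet u b xs ps" "thet u b ys ps"
    and s: "supp z0 = wedges (u # xs @ [b]) \<union> wedges (u # ys @ [b])"
    and i: "IM (wedges (u # xs @ [b])) \<inter> inside (IM (wedges (u # ys @ [b])) \<union> IM (wedges (u # ps @ [b]))) \<noteq> {}"
  shows "\<exists>z1 :: 'v \<Rightarrow> 'v \<Rightarrow> 'k. cyc E z1 \<and> IM (supp z0) \<union> I z0 \<union> IM (wedges (u # ps @ [b])) \<subseteq> IM (supp z1) \<union> I z1"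
proof -
  let ?z1 = "\<lambda>x y. wflow (u # ys @ [b]) x y - wflow (u # ps @ [b]) x y :: 'k"
  have c: "cyc E ?z1" "supp ?z1 = wedges (u # ys @ [b]) \<union> wedges (u # ps @ [b])"
    using thet_cyc[OF t(3), of E ?z1] t unfolding thet_def by auto
  let ?A = "IM (wedges (u # xs @ [b]))" let ?B = "IM (wedges (u # ys @ [b]))" let ?P = "IM (wedges (u # ps @ [b]))"
  have sp: "inside (?B \<union> ?A) \<union> inside (?P \<union> ?A) \<union> (?A - {pt u, pt b}) = inside (?B \<union> ?P)"
    using theta_split(2)[of u b ys ps xs] t i thet_sym by metis
  have I1: "I ?z1 = inside (?B \<union> ?P)" "I z0 = inside (?B \<union> ?A)"
    unfolding I_def c s by (simp_all add: IM_Un Un_commute)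
  have "{pt u, pt b} \<subseteq> ?B" using thet_arcs[OF t(1)] by (metis Int_lower2)
  then have "?A \<union> ?B \<union> inside (?B \<union> ?A) \<union> ?P \<subseteq> ?B \<union> ?P \<union> inside (?B \<union> ?P)"
    unfolding sp[symmetric] by blast
  then show ?thesis
    using c by (intro exI[of _ ?z1]) (simp add: I1 s IM_Un)
qed

text \<open>If a missing edge is away from \<open>H\<close>, connectedness gives an edge with just
  one end on \<open>H\<close>, and such an edge is missing as well.\<close>

lemma next_edge:
  assumes "H \<subseteq> E" "H \<noteq> E" "H \<noteq> {}"
  obtains u w where "{u, w} \<in> E" "{u, w} \<notin> H" "u \<in> \<Union> H"
proof -
  obtain e where e: "e \<in> E" "e \<notin> H" using assms by blast
  obtain x y where xy: "e = {x, y}" "x \<in> V" using edge_ex[OF e(1)] by blast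
  obtain h where h: "h \<in> \<Union> H" using assms edge_ex by blast
  show ?thesis
  proof (cases "x \<in> \<Union> H")
    case True then show ?thesis using that[of x y] e xy by blast
  next
    case False
    obtain p q where "{p, q} \<in> E" "p \<notin> \<Union> H" "\<not> q \<notin> \<Union> H"
      using cut_edge[OF conn, of x h "\<lambda>v. v \<notin> \<Union> H"] xy False h Union_V[OF assms(1)] by blast
    then show ?thesis using that[of q p] by (auto simp: insert_commute)
  qed
qed

lemma ear_thet:
  assumes "thet u b as bs" "wedges (u # as @ [b]) \<subseteq> H" "distinct (u # xs @ [b])" "set xs \<inter> \<Union> H = {}"
    "wedges (u # xs @ [b]) \<subseteq> E - H"
  shows "thet u b as xs"
proof -
  have "\<Union> (wedges (u # as @ [b])) = set (u # as @ [b])" by (intro Union_wedges) simp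
  then have "set as \<subseteq> \<Union> H" using assms(2) by auto
  then have "set as \<inter> set xs = {}" using assms(4) by blast
  moreover have "wedges (u # as @ [b]) \<inter> wedges (u # xs @ [b]) = {}" using assms(2,5) by blast
  moreover have "wedges (u # xs @ [b]) \<subseteq> E" using assms(5) by blast
  ultimately show ?thesis using assms(1,3) unfolding thet_def by simp
qed

lemma ear_image:
  assumes "H \<subseteq> E" "u \<in> \<Union> H" "b \<in> \<Union> H" "set xs \<inter> \<Union> H = {}" "wedges (u # xs @ [b]) \<subseteq> E - H"
  shows "IM (wedges (u # xs @ [b])) \<inter> IM H = {pt u, pt b}"
proof -
  have "IM (wedges (u # xs @ [b])) \<inter> IM H = pt ` (\<Union> (wedges (u # xs @ [b])) \<inter> \<Union> H)"
    using assms by (intro IM_Int) auto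
  also have "\<Union> (wedges (u # xs @ [b])) = set (u # xs @ [b])" by (intro Union_wedges) simp
  also have "set (u # xs @ [b]) = {u, b} \<union> set xs" by auto
  also have "({u, b} \<union> set xs) \<inter> \<Union> H = {u, b}" using assms(2,3,4) by (simp only: Int_Un_distrib2) blast
  finally show ?thesis by simp
qed

text \<open>A cycle that encloses the greatest number of edges encloses all of them. Otherwise some
  edge at a vertex of the cycle sticks out; extended to an ear it runs outside, and
  \<open>theta_out\<close> with \<open>bigger\<close> gives a cycle that encloses it in
  addition.\<close>

lemma outer_cycle:
  "\<exists>z0 :: 'v \<Rightarrow> 'v \<Rightarrow> 'k::field. cyc E z0 \<and> (\<forall>e\<in>E. im e \<subseteq> IM (supp z0) \<union> I z0)"
proof -
  define m where "m z = card {e \<in> E. im e \<subseteq> IM (supp z) \<union> I z}" for z :: "'v \<Rightarrow> 'v \<Rightarrow> 'k"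
  obtain zz :: "'v \<Rightarrow> 'v \<Rightarrow> 'k" where zz: "cyc E zz" using ex_cycle by blast
  have "\<forall>z. cyc E z \<longrightarrow> m z < Suc (card E)" unfolding m_def using finE by (simp add: card_mono less_Suc_eq_le)
  then obtain z0 :: "'v \<Rightarrow> 'v \<Rightarrow> 'k" where z0: "cyc E z0" "\<And>z. cyc E z \<Longrightarrow> m z \<le> m z0"
    using ex_has_greatest_nat[of "cyc E", OF zz, of m "Suc (card E)"] by metis
  define H where "H = supp z0"
  have HE: "H \<subseteq> E" and Hne: "H \<noteq> {}" unfolding H_def using cyc_facts(2,4)[OF z0(1)] by auto
  note If = I_facts[OF z0(1), folded H_def]
  have Hdeg: "\<forall>v\<in>\<Union> H. 2 \<le> card {e \<in> H. v \<in> e}" using cyc_degree(2)[OF z0(1)] unfolding H_def by blast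
  have side: "S \<subseteq> I z0 \<or> S \<inter> I z0 = {}" if "connected S" "S \<inter> IM H = {}" for S
    using connected_Int_frontier[OF that(1), of "I z0"] that(2) If(3) by auto
  have "\<forall>e\<in>E. im e \<subseteq> IM H \<union> I z0"
  proof (rule ccontr)
    assume "\<not> ?thesis"
    then obtain e where e: "e \<in> E" "\<not> im e \<subseteq> IM H \<union> I z0" by blast
    obtain x y where xy: "e = {x, y}" "x \<in> V" "y \<in> V" using edge_ex[OF e(1)] by blast
    \<comment> \<open>An edge that sticks out can be chosen at a vertex of the cycle: an edge away
      from the cycle lies entirely on one side of it, and connectedness leads from the outside to
      the cycle.\<close>
    have "\<exists>u w. {u, w} \<in> E \<and> u \<in> \<Union> H \<and> \<not> im {u, w} \<subseteq> IM H \<union> I z0"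
    proof (cases "x \<in> \<Union> H \<or> y \<in> \<Union> H")
      case True
      then show ?thesis using e xy by (metis insert_commute)
    next
      case False
      have away: "im {p, q} \<inter> IM H = {}" if "{p, q} \<in> E" "p \<notin> \<Union> H" "q \<notin> \<Union> H" for p q
      proof -
        have "{p, q} \<notin> H" using that by blast
        then have "IM {{p, q}} \<inter> IM H = pt ` (\<Union> {{p, q}} \<inter> \<Union> H)" using that HE by (intro IM_Int) auto
        also have "\<Union> {{p, q}} \<inter> \<Union> H = {}" using that by blast
        finally show ?thesis by (simp add: IM_def)
      qed
      define P where "P v \<longleftrightarrow> pt v \<notin> IM H \<union> I z0" for v
      have "im e \<inter> I z0 = {}" using side[OF im_connected[OF e(1)]] away[of x y] e xy False by blast
      moreover have "pt x \<in> im e" using pt_im[OF e(1) xy(2)] xy by simp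
      ultimately have "pt x \<notin> I z0" by (metis IntI empty_iff)
      moreover have "pt x \<notin> IM H" using pt_IM[OF HE xy(2)] False by simp
      ultimately have "P x" unfolding P_def by simp
      obtain h where h: "h \<in> \<Union> H" using Hne HE edge_ex by blast
      have hV: "h \<in> V" using h Union_V[OF HE] by blast
      have "\<not> P h" unfolding P_def using pt_IM[OF HE hV] h by blast
      then obtain p q where pq: "{p, q} \<in> E" "P p" "\<not> P q"
        using cut_edge[OF conn xy(2) hV, of P] \<open>P x\<close> by blast
      have pqV: "p \<in> V" "q \<in> V" using edge_V[OF pq(1)] by auto
      have ptp: "pt p \<in> im {p, q}" "pt q \<in> im {p, q}" using pt_im[OF pq(1)] pqV by auto
      have "q \<in> \<Union> H"
      proof (rule ccontr)
        assume qH: "q \<notin> \<Union> H"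
        have pH: "p \<notin> \<Union> H" using pq(2) pt_IM[OF HE pqV(1)] unfolding P_def by blast
        have "pt q \<in> I z0" using pq(3) qH pt_IM[OF HE pqV(2)] unfolding P_def by simp
        then have "im {p, q} \<inter> I z0 \<noteq> {}" using ptp(2) by (metis IntI empty_iff)
        then have "im {p, q} \<subseteq> I z0" using side[OF im_connected[OF pq(1)] away[OF pq(1) pH qH]] by simp
        then show False using pq(2) ptp(1) unfolding P_def by (metis UnCI subsetD)
      qed
      moreover have "\<not> im {q, p} \<subseteq> IM H \<union> I z0"
        using ptp(1) pq(2) unfolding P_def insert_commute[of q p] by (metis subsetD)
      moreover have "{q, p} \<in> E" using pq(1) by (simp add: insert_commute)
      ultimately show ?thesis by (intro exI conjI)
    qed
    then obtain u w where uw: "{u, w} \<in> E" "u \<in> \<Union> H" "\<not> im {u, w} \<subseteq> IM H \<union> I z0" by blast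
    then have nH: "{u, w} \<notin> H" unfolding IM_def by blast
    obtain xs b where xs: "b \<in> \<Union> H" "distinct (u # xs @ [b])" "set xs \<inter> \<Union> H = {}"
      "wedges (u # xs @ [b]) \<subseteq> E - H" "{u, w} \<in> wedges (u # xs @ [b])"
      using ear[OF HE Hdeg uw(1) nH uw(2)] by metis
    have ub: "u \<noteq> b" using xs(2) by auto
    obtain as bs where ab: "thet u b as bs" "H = wedges (u # as @ [b]) \<union> wedges (u # bs @ [b])"
      using cyc_thet[OF z0(1) uw(2)[unfolded H_def] xs(1)[unfolded H_def] ub] unfolding H_def by metis
    have t: "thet u b as xs" "thet u b bs xs"
      using ear_thet[OF ab(1) _ xs(2-4)] ear_thet[OF ab(1)[unfolded thet_sym[of u b as]] _ xs(2-4)] ab(2) by blast+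
    note ei = ear_image[OF HE uw(2) xs(1,3,4)]
    let ?P = "IM (wedges (u # xs @ [b]))"
    have "connected (?P - {pt u, pt b})" using arc_interior(1)[OF t(1)[unfolded thet_sym[of u b as]]] .
    moreover have PH: "(?P - {pt u, pt b}) \<inter> IM H = {}" using ei by blast
    moreover have "\<not> ?P - {pt u, pt b} \<subseteq> I z0"
    proof -
      obtain x where x: "x \<in> im {u, w}" "x \<notin> IM H" "x \<notin> I z0" using uw(3) by blast
      then have "x \<in> ?P" unfolding IM_def using xs(5) by blast
      moreover have "x \<notin> {pt u, pt b}" using ei x(2) by blast
      ultimately show ?thesis using x(3) by blast
    qed
    ultimately have "(?P - {pt u, pt b}) \<inter> I z0 = {}" using side by blast
    moreover have "{pt u, pt b} \<inter> I z0 = {}"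
    proof -
      have "{pt u, pt b} \<subseteq> IM H" using ei by blast
      then show ?thesis using If(4) by blast
    qed
    ultimately have "?P \<inter> I z0 = {}" by blast
    then have out: "?P \<inter> inside (IM (wedges (u # as @ [b])) \<union> IM (wedges (u # bs @ [b]))) = {}"
      unfolding I_def H_def[symmetric] ab(2) IM_Un .
    have "\<exists>z1 :: 'v \<Rightarrow> 'v \<Rightarrow> 'k. cyc E z1 \<and> IM (supp z0) \<union> I z0 \<union> ?P \<subseteq> IM (supp z1) \<union> I z1"
      using theta_out[OF ab(1) t out]
    proof
      assume "IM (wedges (u # as @ [b])) \<inter> inside (IM (wedges (u # bs @ [b])) \<union> ?P) \<noteq> {}"
      then show ?thesis using bigger[OF ab(1) t, of z0] ab(2) unfolding H_def by blast
    next
      assume "IM (wedges (u # bs @ [b])) \<inter> inside (IM (wedges (u # as @ [b])) \<union> ?P) \<noteq> {}"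
      then show ?thesis using bigger[OF ab(1)[unfolded thet_sym[of u b as]] t(2,1), of z0] ab(2)
        unfolding H_def by (metis Un_commute)
    qed
    then obtain z1 :: "'v \<Rightarrow> 'v \<Rightarrow> 'k" where z1: "cyc E z1" "IM (supp z0) \<union> I z0 \<union> ?P \<subseteq> IM (supp z1) \<union> I z1"
      by blast
    have "im {u, w} \<subseteq> ?P" unfolding IM_def using xs(5) by blast
    then have "insert {u, w} {e \<in> E. im e \<subseteq> IM (supp z0) \<union> I z0} \<subseteq> {e \<in> E. im e \<subseteq> IM (supp z1) \<union> I z1}"
      using z1(2) uw(1) by blast
    then have "card (insert {u, w} {e \<in> E. im e \<subseteq> IM (supp z0) \<union> I z0}) \<le> m z1"
      unfolding m_def using finE by (intro card_mono) auto
    moreover have "card (insert {u, w} {e \<in> E. im e \<subseteq> IM (supp z0) \<union> I z0}) = Suc (m z0)"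
      unfolding m_def using finE uw(3) unfolding H_def by (subst card_insert_disjoint) auto
    ultimately show False using z0(2)[OF z1(1)] by simp
  qed
  then show ?thesis using z0(1) unfolding H_def by blast
qed

end

section \<open>Ear decomposition: the bounded faces\<close>

context plane_graph
begin

text \<open>Invariant of the ear decomposition inside the outer cycle \<open>z0\<close>: \<open>B\<close> are the bounded faces of the subgraph \<open>H\<close>,
  oriented so that they sum to \<open>z0\<close>.\<close>

definition ear_inv :: "('v \<Rightarrow> 'v \<Rightarrow> 'k::field) \<Rightarrow> 'v set set \<Rightarrow> ('v \<Rightarrow> 'v \<Rightarrow> 'k) set \<Rightarrow> bool" where
  "ear_inv z0 H B \<longleftrightarrow> H \<subseteq> E \<and> supp z0 \<subseteq> H \<and> finite B \<and> (\<forall>z\<in>B. cyc H z) \<and>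
     (\<forall>z\<in>B. I z \<inter> IM H = {}) \<and> (\<forall>z\<in>B. \<forall>z'\<in>B. z \<noteq> z' \<longrightarrow> I z \<inter> I z' = {}) \<and>
     (\<forall>x y. {x, y} \<in> H \<longrightarrow> (\<Sum>z\<in>B. of_bool (z x y \<noteq> 0)) = (if z0 x y \<noteq> 0 then 1 else 2 :: nat)) \<and>
     I z0 \<subseteq> IM H \<union> \<Union> (I ` B) \<and> card B + card (\<Union> H) = card H + 1 \<and>
     (\<forall>x y. (\<Sum>z\<in>B. z x y) = z0 x y) \<and>
     (\<forall>r. is_flow V E r \<longrightarrow> (\<forall>x y. {x, y} \<notin> H \<longrightarrow> r x y = 0) \<longrightarrow>
        (\<exists>a. \<forall>x y. r x y = (\<Sum>z\<in>B. a z * z x y))) \<and>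
     (\<forall>v\<in>\<Union> H. 2 \<le> card {e \<in> H. v \<in> e})"

text \<open>Subtracting a multiple of \<open>z0\<close> kills the flow on one edge, and
  \<open>flow_path_zero\<close> then kills it along the path \<open>a # xs\<close>; the closing edge
  is left to Kirchhoff's law at \<open>a\<close>.\<close>

lemma flow_on_cycle:
  fixes r z0 :: "'v \<Rightarrow> 'v \<Rightarrow> 'k::field"
  assumes z0: "cyc E z0" and r: "is_flow V E r" "\<And>x y. {x, y} \<notin> supp z0 \<Longrightarrow> r x y = 0"
  shows "\<exists>c. \<forall>x y. r x y = c * z0 x y"
proof -
  obtain a xs where c: "distinct (a # xs)" "2 \<le> length xs" "wedges (a # xs @ [a]) \<subseteq> E" "z0 = wflow (a # xs @ [a])"
    using z0 unfolding cyc_def by blast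
  note l = cyc_list[OF c(1,2,4)]
  obtain y ys where xs: "xs = y # ys" using c(2) by (cases xs) auto
  then have ysne: "ys \<noteq> []" using c(2) by auto
  obtain cs b where cs: "ys = cs @ [b]" using ysne by (cases ys rule: rev_cases) auto
  define q where "q = r a y / z0 a y"
  let ?r = "\<lambda>u v. r u v - q * z0 u v"
  have fl: "is_flow V E ?r" using is_flow_diff[OF r(1) cyc_flow[OF z0]] .
  have ay: "z0 a y \<noteq> 0" using l(3)[of a y] xs by simp
  then have r0: "?r a y = 0" unfolding q_def by simp
  have out: "?r u v = 0" if "{u, v} \<notin> supp z0" for u v
    using r(2)[OF that] cyc_facts(3)[OF z0, of u v] that by simp
  have w: "wedges (a # xs @ [a]) = insert {b, a} (wedges (a # xs))"
    using wedges_snoc2[of "a # y # cs" b a] xs cs by simp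
  have sV: "set (a # xs) \<subseteq> V" using l(2) cyc_facts(2)[OF z0] Union_V by metis
  have inner: "?r u v = 0" if "{u, v} \<in> wedges (a # xs)" for u v
  proof (rule flow_path_zero[OF fl finV, of a y ys])
    show "distinct (a # y # ys)" "set (a # y # ys) \<subseteq> V" using c(1) sV xs by auto
    show "?r a y = 0" by (rule r0)
    show "{u, v} \<in> wedges (a # y # ys)" using that xs by simp
    fix p s assume p: "p \<in> set (butlast (y # ys))" and ps: "?r p s \<noteq> 0"
    have "{p, s} \<in> supp z0" using out ps by blast
    then have "{p, s} \<in> insert {b, a} (wedges (a # xs))" using l(1) w by simp
    moreover have "p \<noteq> a" using c(1) xs p in_set_butlastD by fastforce
    moreover have "p \<noteq> b"
    proof -
      have "p \<in> set (y # cs)" using p unfolding cs by (simp add: butlast_append)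
      then show ?thesis using c(1) unfolding xs cs by auto
    qed
    ultimately show "{p, s} \<in> wedges (a # y # ys)" using xs by (auto simp: doubleton_eq_iff)
  qed
  have aV: "a \<in> V" "b \<in> V" using sV unfolding xs cs by auto
  have "?r a v = 0" if "v \<in> V - {b}" for v
  proof (cases "{a, v} \<in> wedges (a # xs)")
    case True then show ?thesis by (rule inner)
  next
    case False
    have "{a, v} \<noteq> {b, a}" using that by (auto simp: doubleton_eq_iff)
    then have "{a, v} \<notin> supp z0" using False l(1) w by simp
    then show ?thesis by (rule out)
  qed
  then have "(\<Sum>v\<in>V - {b}. ?r a v) = 0" by (intro sum.neutral) blast
  moreover have "(\<Sum>v\<in>V. ?r a v) = 0" using fl aV unfolding is_flow_def by blast
  ultimately have rab: "?r a b = 0" using sum.remove[OF finV aV(2), of "?r a"] by simp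
  have anti: "?r u v = - ?r v u" for u v using fl unfolding is_flow_def by blast
  have rba: "?r b a = 0" using anti[of b a] rab by simp
  have "?r u v = 0" for u v
  proof (cases "{u, v} \<in> wedges (a # xs)")
    case True then show ?thesis by (rule inner)
  next
    case False
    show ?thesis
    proof (cases "{u, v} = {b, a}")
      case True
      then have "(u = b \<and> v = a) \<or> (u = a \<and> v = b)" by (simp add: doubleton_eq_iff)
      then show ?thesis using rab rba by blast
    next
      case F: False
      then have "{u, v} \<notin> supp z0" using False l(1) w by simp
      then show ?thesis by (rule out)
    qed
  qed
  then show ?thesis by (intro exI[of _ q]) simp
qed

lemma ear_inv_init:
  assumes "cyc E z0"
  shows "ear_inv z0 (supp z0) {z0}"
proof -
  have 1: "cyc (supp z0) z0"
  proof -
    obtain a xs where c: "distinct (a # xs)" "2 \<le> length xs" "z0 = wflow (a # xs @ [a])"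
      using assms unfolding cyc_def by blast
    then show ?thesis using cyc_list(1)[OF c] unfolding cyc_def by blast
  qed
  have 2: "\<exists>a. \<forall>x y. r x y = (\<Sum>z\<in>{z0}. a z * z x y)"
    if r: "is_flow V E r" "\<forall>x y. {x, y} \<notin> supp z0 \<longrightarrow> r x y = 0" for r
  proof -
    obtain c where "\<forall>x y. r x y = c * z0 x y" using flow_on_cycle[OF assms r(1)] r(2) by blast
    then show ?thesis by (intro exI[of _ "\<lambda>_. c"]) simp
  qed
  have 3: "(\<Sum>z\<in>{z0}. of_bool (z x y \<noteq> 0)) = (if z0 x y \<noteq> 0 then 1 else 2 :: nat)" if "{x, y} \<in> supp z0" for x y
    using cyc_facts(3)[OF assms, of x y] that by simp
  show ?thesis unfolding ear_inv_def
    using 1 2 3 cyc_facts(2,7)[OF assms] I_facts(4)[OF assms] cyc_degree(2)[OF assms] by simp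
qed

lemma ear_invD:
  assumes inv: "ear_inv z0 H B"
  shows "H \<subseteq> E"
    "supp z0 \<subseteq> H"
    "finite B"
    "\<And>z. z \<in> B \<Longrightarrow> cyc H z"
    "\<And>z. z \<in> B \<Longrightarrow> I z \<inter> IM H = {}"
    "\<And>z z'. z \<in> B \<Longrightarrow> z' \<in> B \<Longrightarrow> z \<noteq> z' \<Longrightarrow> I z \<inter> I z' = {}"
    "\<And>x y. {x, y} \<in> H \<Longrightarrow> (\<Sum>z\<in>B. of_bool (z x y \<noteq> 0)) = (if z0 x y \<noteq> 0 then 1 else 2 :: nat)"
    "I z0 \<subseteq> IM H \<union> \<Union> (I ` B)"
    "card B + card (\<Union> H) = card H + 1"
    "\<And>x y. (\<Sum>z\<in>B. z x y) = z0 x y"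
    "\<And>r. is_flow V E r \<Longrightarrow> (\<And>x y. {x, y} \<notin> H \<Longrightarrow> r x y = 0) \<Longrightarrow> \<exists>a. \<forall>x y. r x y = (\<Sum>z\<in>B. a z * z x y)"
    "\<forall>v\<in>\<Union> H. 2 \<le> card {e \<in> H. v \<in> e}"
proof -
  note i1 = inv[unfolded ear_inv_def]
  show "H \<subseteq> E" by (rule i1[THEN conjunct1])
  note i2 = i1[THEN conjunct2]
  show "supp z0 \<subseteq> H" by (rule i2[THEN conjunct1])
  note i3 = i2[THEN conjunct2]
  show "finite B" by (rule i3[THEN conjunct1])
  note i4 = i3[THEN conjunct2]
  show "\<And>z. z \<in> B \<Longrightarrow> cyc H z" by (rule i4[THEN conjunct1, rule_format])
  note i5 = i4[THEN conjunct2]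
  show "\<And>z. z \<in> B \<Longrightarrow> I z \<inter> IM H = {}" by (rule i5[THEN conjunct1, rule_format])
  note i6 = i5[THEN conjunct2]
  show "\<And>z z'. z \<in> B \<Longrightarrow> z' \<in> B \<Longrightarrow> z \<noteq> z' \<Longrightarrow> I z \<inter> I z' = {}" by (rule i6[THEN conjunct1, rule_format])
  note i7 = i6[THEN conjunct2]
  show "\<And>x y. {x, y} \<in> H \<Longrightarrow> (\<Sum>z\<in>B. of_bool (z x y \<noteq> 0)) = (if z0 x y \<noteq> 0 then 1 else 2 :: nat)" by (rule i7[THEN conjunct1, rule_format])
  note i8 = i7[THEN conjunct2]
  show "I z0 \<subseteq> IM H \<union> \<Union> (I ` B)" by (rule i8[THEN conjunct1])
  note i9 = i8[THEN conjunct2]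
  show "card B + card (\<Union> H) = card H + 1" by (rule i9[THEN conjunct1])
  note i10 = i9[THEN conjunct2]
  show "\<And>x y. (\<Sum>z\<in>B. z x y) = z0 x y" by (rule i10[THEN conjunct1, rule_format])
  note i11 = i10[THEN conjunct2]
  show "\<exists>a. \<forall>x y. r x y = (\<Sum>z\<in>B. a z * z x y)"
    if "is_flow V E r" "\<And>x y. {x, y} \<notin> H \<Longrightarrow> r x y = 0" for r
  proof -
    have "\<forall>x y. {x, y} \<notin> H \<longrightarrow> r x y = 0" using that(2) by simp
    then show ?thesis by (rule i11[THEN conjunct1, THEN spec, THEN mp, THEN mp, OF that(1)])
  qed
  note i12 = i11[THEN conjunct2]
  show "\<forall>v\<in>\<Union> H. 2 \<le> card {e \<in> H. v \<in> e}" by (rule i12)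
qed

text \<open>The open ear is connected and avoids the drawing of \<open>H\<close>, so it lies in the
  inside of one face \<open>z\<close>, and its ends lie on the boundary of \<open>z\<close>. It cuts
  \<open>z\<close> into \<open>z1\<close> and \<open>z2\<close> with sum \<open>z\<close>, and every
  clause of the invariant is checked against this replacement.\<close>

lemma ear_step:
  fixes z0 :: "'v \<Rightarrow> 'v \<Rightarrow> 'k::field"
  assumes z0: "cyc E z0" "\<forall>e\<in>E. im e \<subseteq> IM (supp z0) \<union> I z0"
    and inv: "ear_inv z0 H B" and ne: "H \<noteq> E"
  shows "\<exists>H' B'. ear_inv z0 H' B' \<and> H \<subset> H'"
proof -
  note HE = ear_invD(1)[OF inv] and sH = ear_invD(2)[OF inv] and fB = ear_invD(3)[OF inv]
    and Bc = ear_invD(4)[OF inv] and BH = ear_invD(5)[OF inv] and BB = ear_invD(6)[OF inv]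
    and cnt = ear_invD(7)[OF inv] and cov = ear_invD(8)[OF inv] and eul = ear_invD(9)[OF inv]
    and tot = ear_invD(10)[OF inv] and spn = ear_invD(11)[OF inv] and deg = ear_invD(12)[OF inv]
  have "H \<noteq> {}" using sH cyc_facts(4)[OF z0(1)] by blast
  then obtain u w where uw: "{u, w} \<in> E" "{u, w} \<notin> H" "u \<in> \<Union> H" using next_edge[OF HE ne] by metis
  obtain xs b where xs: "b \<in> \<Union> H" "distinct (u # xs @ [b])" "set xs \<inter> \<Union> H = {}"
    "wedges (u # xs @ [b]) \<subseteq> E - H" "{u, w} \<in> wedges (u # xs @ [b])"
    using ear[OF HE deg uw] by metis
  let ?W = "wedges (u # xs @ [b])"
  define P where "P = IM ?W - {pt u, pt b}"
  have uV: "u \<in> V" "b \<in> V" using uw(3) xs(1) Union_V[OF HE] by blast+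
  have ub: "u \<noteq> b" using xs(2) by auto
  have WH: "?W \<inter> H = {}" "?W \<subseteq> E" using xs(4) by blast+
  note ei = ear_image[OF HE uw(3) xs(1,3,4)]
  obtain \<gamma> where \<gamma>: "arc \<gamma>" "path_image \<gamma> = IM ?W" "pathstart \<gamma> = pt u" "pathfinish \<gamma> = pt b"
    using path_arc[OF xs(2) _ WH(2)] by auto
  have PH: "P \<inter> IM H = {}" using ei unfolding P_def by blast
  have Pcon: "connected P" "P \<noteq> {}"
    using connected_simple_path_endless[OF arc_imp_simple_path[OF \<gamma>(1)]]
      nonempty_simple_path_endless[OF arc_imp_simple_path[OF \<gamma>(1)]] \<gamma> unfolding P_def by simp_all
  \<comment> \<open>Here the choice of the outer cycle enters: the whole drawing is enclosed, so the
    ear runs through bounded faces.\<close>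
  have "IM ?W \<subseteq> IM (supp z0) \<union> I z0" using z0(2) WH(2) unfolding IM_def[of ?W] by blast
  then have Pin: "P \<subseteq> \<Union> (I ` B)" using PH cov IM_mono[OF sH] unfolding P_def by blast
  then obtain z where z: "z \<in> B" "P \<inter> I z \<noteq> {}" using Pcon(2) by blast
  have zE: "cyc E z" using cyc_mono[OF Bc[OF z(1)] HE] .
  have szH: "supp z \<subseteq> H" using cyc_facts(2)[OF Bc[OF z(1)]] .
  have "P \<inter> frontier (I z) = {}" unfolding I_facts(3)[OF zE] using PH IM_mono[OF szH] by blast
  then have PI: "P \<subseteq> I z" using connected_Int_frontier[OF Pcon(1) z(2)] by blast
  \<comment> \<open>An end of the ear is a limit of points of the face but lies on the drawing of
    \<open>H\<close>, hence on the boundary of the face.\<close>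
  have end_in: "v \<in> \<Union> (supp z)" if v: "v \<in> V" "v \<in> \<Union> H" "pt v \<in> closure P" for v
  proof -
    have "pt v \<in> closure (I z)" using closure_mono[OF PI] v(3) by blast
    moreover have "pt v \<in> IM H" using pt_IM[OF HE v(1)] v(2) by simp
    then have "pt v \<notin> I z" using BH[OF z(1)] by (metis IntI empty_iff)
    ultimately have "pt v \<in> IM (supp z)" using I_facts(5)[OF zE] by simp
    then show ?thesis using pt_IM[OF _ v(1), of "supp z"] szH HE by blast
  qed
  have "pt u \<in> closure P" "pt b \<in> closure P"
  proof -
    have P2: "P = \<gamma> ` {0<..<1}" using simple_path_endless[OF arc_imp_simple_path[OF \<gamma>(1)]] \<gamma> unfolding P_def by simp
    have "continuous_on (closure {0<..<1}) \<gamma>" using arc_imp_path[OF \<gamma>(1)] unfolding path_def by simp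
    then have "\<gamma> ` closure {0<..<1} \<subseteq> closure (\<gamma> ` {0<..<1})"
      by (metis closed_closure closure_subset continuous_on_closure image_closure_subset)
    then have "\<gamma> 0 \<in> closure P" "\<gamma> 1 \<in> closure P" unfolding P2 by auto
    then show "pt u \<in> closure P" "pt b \<in> closure P" using \<gamma>(3,4) unfolding pathstart_def pathfinish_def by auto
  qed
  then have ubz: "u \<in> \<Union> (supp z)" "b \<in> \<Union> (supp z)" using end_in uV uw(3) xs(1) by blast+
  obtain as bs where ab: "thet u b as bs" "supp z = wedges (u # as @ [b]) \<union> wedges (u # bs @ [b])"
    "\<And>x y. z x y = wflow (u # as @ [b]) x y - wflow (u # bs @ [b]) x y"
    using cyc_thet[OF zE ubz ub] by metis
  let ?A = "wedges (u # as @ [b])" let ?B = "wedges (u # bs @ [b])"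
  have AH: "?A \<subseteq> H" "?B \<subseteq> H" using ab(2) szH by blast+
  have t: "thet u b as xs" "thet u b bs xs"
    using ear_thet[OF ab(1) AH(1) xs(2-4)] ear_thet[OF ab(1)[unfolded thet_sym[of u b as]] AH(2) xs(2-4)] by blast+
  have PIz: "I z = inside (IM ?A \<union> IM ?B)" unfolding I_def ab(2) IM_Un ..
  have "P \<subseteq> IM ?W" unfolding P_def by blast
  then have "IM ?W \<inter> inside (IM ?A \<union> IM ?B) \<noteq> {}" using z(2) unfolding PIz[symmetric] by blast
  note sp = theta_split[OF ab(1) t this]
  \<comment> \<open>\<open>z1\<close> and \<open>z2\<close> traverse the ear in opposite directions,
    so that it drops out of their sum.\<close>
  define z1 where "z1 = (\<lambda>x y. wflow (u # as @ [b]) x y - wflow (u # xs @ [b]) x y :: 'k)"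
  define z2 where "z2 = (\<lambda>x y. wflow (u # xs @ [b]) x y - wflow (u # bs @ [b]) x y :: 'k)"
  define H' where "H' = H \<union> ?W"
  define C where "C = B - {z}"
  define B' where "B' = insert z1 (insert z2 C)"
  have H'E: "H' \<subseteq> E" unfolding H'_def using HE WH by blast
  have c1: "cyc H' z1" "supp z1 = ?A \<union> ?W"
    using thet_cyc[OF t(1), of H' z1] AH unfolding z1_def H'_def by auto
  have c2: "cyc H' z2" "supp z2 = ?W \<union> ?B"
    using thet_cyc[OF t(2)[unfolded thet_sym[of u b bs]], of H' z2] AH unfolding z2_def H'_def by auto
  have c1E: "cyc E z1" and c2E: "cyc E z2" using cyc_mono[OF c1(1) H'E] cyc_mono[OF c2(1) H'E] .
  have zz: "z1 x y + z2 x y = z x y" for x y unfolding z1_def z2_def ab(3) by simp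
  have I1: "I z1 = inside (IM ?A \<union> IM ?W)" and I2: "I z2 = inside (IM ?B \<union> IM ?W)"
    unfolding I_def c1 c2 IM_Un by (simp_all add: Un_commute)
  have I12: "I z1 \<inter> I z2 = {}" and Isum: "I z1 \<union> I z2 \<union> P = I z"
    unfolding I1 I2 P_def PIz using sp by simp_all
  have AB: "?A \<inter> ?B = {}" using ab(1) unfolding thet_def by blast
  have Ane: "?A \<noteq> {}" "?B \<noteq> {}" "?W \<noteq> {}" by (cases as; cases bs; cases xs; simp)+
  have z1B: "z1 \<notin> C" and z2B: "z2 \<notin> C"
  proof -
    have "\<not> supp z1 \<subseteq> H" "\<not> supp z2 \<subseteq> H" using c1 c2 WH(1) xs(5) uw(2) by blast+
    then show "z1 \<notin> C" "z2 \<notin> C" using cyc_facts(2)[OF Bc] unfolding C_def by blast+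
  qed
  have z12: "z1 \<noteq> z2"
  proof
    assume "z1 = z2"
    then have "?A \<union> ?W = ?W \<union> ?B" using c1(2) c2(2) by simp
    moreover have "?A \<inter> ?W = {}" using WH(1) AH by blast
    ultimately show False using AB Ane by blast
  qed
  have fC: "finite C" unfolding C_def using fB by simp
  have sumB: "(\<Sum>t\<in>B. f t) = f z + (\<Sum>t\<in>C. f t)" for f :: "_ \<Rightarrow> 'm::comm_monoid_add"
    unfolding C_def by (rule sum.remove[OF fB z(1)])
  have sumB': "(\<Sum>t\<in>B'. f t) = f z1 + (f z2 + (\<Sum>t\<in>C. f t))" for f :: "_ \<Rightarrow> 'm::comm_monoid_add"
    unfolding B'_def using z1B z2B z12 fC by simp
  have n1: "z1 x y \<noteq> 0 \<longleftrightarrow> {x, y} \<in> ?A \<union> ?W" and n2: "z2 x y \<noteq> 0 \<longleftrightarrow> {x, y} \<in> ?W \<union> ?B"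
    and n: "z x y \<noteq> 0 \<longleftrightarrow> {x, y} \<in> ?A \<union> ?B" for x y
    using cyc_facts(3)[OF c1(1), of x y] cyc_facts(3)[OF c2(1), of x y] cyc_facts(3)[OF zE, of x y]
    unfolding c1(2) c2(2) ab(2) by blast+
  have Coff: "t x y = 0" if "t \<in> B" "{x, y} \<notin> H" for t x y
    using cyc_facts(2)[OF Bc[OF that(1)]] cyc_facts(3)[OF Bc[OF that(1)], of x y] that(2) by blast
  have B'D: "t = z1 \<or> t = z2 \<or> (t \<in> C \<and> t \<in> B \<and> t \<noteq> z)" if "t \<in> B'" for t
    using that unfolding B'_def C_def by simp
  have "ear_inv z0 H' B'"
    unfolding ear_inv_def
  proof (intro conjI ballI allI impI)
    show "H' \<subseteq> E" by (rule H'E)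
    show "supp z0 \<subseteq> H'" using sH unfolding H'_def by blast
    show "finite B'" unfolding B'_def using fC by simp
    show "cyc H' t" if tB: "t \<in> B'" for t
    proof -
      consider "t = z1" | "t = z2" | "t \<in> B" using B'D[OF tB] by (elim disjE conjE)
      then show ?thesis
      proof cases
        case 1 show ?thesis unfolding 1 by (rule c1(1))
      next
        case 2 show ?thesis unfolding 2 by (rule c2(1))
      next
        case 3
        have "H \<subseteq> H'" unfolding H'_def by blast
        with Bc[OF 3] show ?thesis by (rule cyc_mono)
      qed
    qed
    show "I t \<inter> IM H' = {}" if tB: "t \<in> B'" for t
    proof -
      have ends: "IM ?W \<subseteq> P \<union> IM H" using ei unfolding P_def by blast
      consider "t = z1" | "t = z2" | "t \<in> B" "t \<noteq> z" using B'D[OF tB] by (elim disjE conjE)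
      then have "I t \<inter> IM H = {} \<and> I t \<inter> P = {}"
      proof cases
        case 1
        have "I t \<subseteq> I z" using Isum 1 by blast
        moreover have "IM ?W \<subseteq> IM (supp z1)" unfolding c1(2) IM_Un by blast
        then have "P \<subseteq> IM (supp z1)" unfolding P_def by blast
        ultimately show ?thesis using BH[OF z(1)] I_facts(4)[OF c1E] 1 by (simp only:) blast
      next
        case 2
        have "I t \<subseteq> I z" using Isum 2 by blast
        moreover have "IM ?W \<subseteq> IM (supp z2)" unfolding c2(2) IM_Un by blast
        then have "P \<subseteq> IM (supp z2)" unfolding P_def by blast
        ultimately show ?thesis using BH[OF z(1)] I_facts(4)[OF c2E] 2 by (simp only:) blast
      next
        case 3
        then show ?thesis using BB[OF 3(1) z(1) 3(2)] PI BH[OF 3(1)] by blast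
      qed
      then show ?thesis unfolding H'_def IM_Un using ends by blast
    qed
    show "I t \<inter> I t' = {}" if tt: "t \<in> B'" "t' \<in> B'" "t \<noteq> t'" for t t'
    proof -
      have *: "I s \<inter> I s' = {}" if "s \<in> {z1, z2}" "s' \<in> C" for s s'
      proof -
        have "I s \<subseteq> I z" using that(1) Isum by blast
        moreover have "I z \<inter> I s' = {}" using that(2) BB[OF z(1)] unfolding C_def by blast
        ultimately show ?thesis by blast
      qed
      consider "t \<in> C" "t' \<in> C" | "t \<in> {z1, z2}" "t' \<in> C" | "t \<in> C" "t' \<in> {z1, z2}" | "t \<in> {z1, z2}" "t' \<in> {z1, z2}"
        using B'D[OF tt(1)] B'D[OF tt(2)] by (elim disjE conjE) simp_all
      then show ?thesis
      proof cases
        case 1 then show ?thesis using BB tt(3) unfolding C_def by blast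
      next
        case 2 then show ?thesis by (rule *)
      next
        case 3 then show ?thesis using *[OF 3(2,1)] by (simp only: Int_commute)
      next
        case 4
        then have "(t = z1 \<and> t' = z2) \<or> (t = z2 \<and> t' = z1)" using tt(3) by blast
        then show ?thesis using I12 by (metis Int_commute)
      qed
    qed
    \<comment> \<open>An edge of \<open>z\<close> lies on exactly one of \<open>z1\<close> and
      \<open>z2\<close>, so its count is unchanged; an edge of the ear lies on these two and on no
      older face.\<close>
    show "(\<Sum>t\<in>B'. of_bool (t x y \<noteq> 0)) = (if z0 x y \<noteq> 0 then 1 else 2 :: nat)" if xy: "{x, y} \<in> H'" for x y
    proof (cases "{x, y} \<in> H")
      case True
      then have "{x, y} \<notin> ?W" using WH by blast
      then have "of_bool (z1 x y \<noteq> 0) + of_bool (z2 x y \<noteq> 0) = (of_bool (z x y \<noteq> 0) :: nat)"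
        unfolding n1 n2 n using AB by auto
      then show ?thesis using cnt[OF True] unfolding sumB' sumB by simp
    next
      case False
      then have W: "{x, y} \<in> ?W" using xy unfolding H'_def by blast
      have "z0 x y = 0" using False sH cyc_facts(3)[OF z0(1), of x y] by blast
      moreover have "z1 x y \<noteq> 0" "z2 x y \<noteq> 0" unfolding n1 n2 using W by simp_all
      moreover have "(\<Sum>t\<in>C. of_bool (t x y \<noteq> 0)) = (0::nat)"
        using Coff False unfolding C_def by (intro sum.neutral) simp
      ultimately show ?thesis unfolding sumB' by simp
    qed
    show "I z0 \<subseteq> IM H' \<union> \<Union> (I ` B')"
    proof
      fix x assume "x \<in> I z0"
      then consider "x \<in> IM H" | "x \<in> I z" | t where "t \<in> C" "x \<in> I t" using cov unfolding C_def by blast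
      then show "x \<in> IM H' \<union> \<Union> (I ` B')"
      proof cases
        case 1 then show ?thesis unfolding H'_def IM_Un by blast
      next
        case 2
        then have "x \<in> I z1 \<or> x \<in> I z2 \<or> x \<in> P" using Isum by blast
        then show ?thesis unfolding H'_def IM_Un B'_def P_def by blast
      next
        case 3 then show ?thesis unfolding B'_def by blast
      qed
    qed
    \<comment> \<open>There is one more face, and the ear has one more edge than it has new
      vertices.\<close>
    show "card B' + card (\<Union> H') = card H' + 1"
    proof -
      have "card B' = card B + 1"
        unfolding B'_def using z1B z2B z12 fC card_Suc_Diff1[OF fB z(1)] unfolding C_def by simp
      moreover have "card H' = card H + (length xs + 1)"
        unfolding H'_def using card_wedges_path[OF xs(2)] WH(1) finite_subset[OF HE finE]
        by (subst card_Un_disjoint) auto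
      moreover have "\<Union> H' = \<Union> H \<union> set xs"
      proof -
        have "\<Union> ?W = set (u # xs @ [b])" by (intro Union_wedges) simp
        then show ?thesis unfolding H'_def using uw(3) xs(1) by auto
      qed
      moreover have "card (\<Union> H \<union> set xs) = card (\<Union> H) + length xs"
        using finite_subset[OF Union_V[OF HE] finV] xs(2,3)
        by (subst card_Un_disjoint) (auto simp: distinct_card)
      ultimately show ?thesis using eul by simp
    qed
    show "(\<Sum>t\<in>B'. t x y) = z0 x y" for x y
      unfolding sumB' using tot[of x y] zz[of x y] unfolding sumB by (simp add: add.assoc[symmetric])
    show "\<exists>a. \<forall>x y. r x y = (\<Sum>t\<in>B'. a t * t x y)"
      if r: "is_flow V E r" "\<forall>x y. {x, y} \<notin> H' \<longrightarrow> r x y = 0" for r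
    proof -
      obtain y l where yl: "xs @ [b] = y # l" by (cases xs) auto
      \<comment> \<open>\<open>q\<close> makes the difference vanish on the first edge of the ear,
        hence on all of it; what is left is a flow on \<open>H\<close>.\<close>
      define q where "q = r u y / z1 u y"
      let ?r = "\<lambda>x y. r x y - q * z1 x y"
      have fl: "is_flow V E ?r" using is_flow_diff[OF r(1) cyc_flow[OF c1E]] .
      have uy: "{u, y} \<in> ?W" using yl by simp
      then have "z1 u y \<noteq> 0" unfolding n1 by simp
      then have r0: "?r u y = 0" unfolding q_def by simp
      have out: "?r x y = 0" if "{x, y} \<notin> H'" for x y
        using r(2) that cyc_facts(2)[OF c1(1)] cyc_facts(3)[OF c1(1), of x y] by auto
      have sW: "set (u # xs @ [b]) \<subseteq> V"
        using Union_wedges[of "u # xs @ [b]"] Union_V[OF WH(2)] by auto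
      have W0: "?r p s = 0" if "{p, s} \<in> ?W" for p s
      proof (rule flow_path_zero[OF fl finV, of u y l])
        show "distinct (u # y # l)" using xs(2) yl by simp
        show "set (u # y # l) \<subseteq> V" using sW yl by simp
        show "?r u y = 0" by (rule r0)
        show "{p, s} \<in> wedges (u # y # l)" using that yl by simp
        fix g h assume g: "g \<in> set (butlast (y # l))" "?r g h \<noteq> 0"
        have "g \<in> set xs" using g(1) unfolding yl[symmetric] by simp
        then have "g \<notin> \<Union> H" using xs(3) by blast
        then have "{g, h} \<notin> H" by blast
        moreover have "{g, h} \<in> H'" using out g(2) by blast
        ultimately show "{g, h} \<in> wedges (u # y # l)" unfolding H'_def yl by simp
      qed
      have "?r x y = 0" if "{x, y} \<notin> H" for x y
        using W0 out that unfolding H'_def by blast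
      then obtain a where a: "\<And>x y. ?r x y = (\<Sum>t\<in>B. a t * t x y)" using spn[OF fl] by blast
      \<comment> \<open>The coefficient of \<open>z\<close> passes to both \<open>z1\<close> and
        \<open>z2\<close>, whose sum is \<open>z\<close>; the subtracted multiple \<open>q\<close>
        of \<open>z1\<close> is put back.\<close>
      define a' where "a' = (\<lambda>t. if t = z1 then q + a z else if t = z2 then a z else a t)"
      have aC: "(\<Sum>t\<in>C. a' t * t x y) = (\<Sum>t\<in>C. a t * t x y)" for x y
        using z1B z2B by (intro sum.cong) (auto simp: a'_def)
      have "r x y = (\<Sum>t\<in>B'. a' t * t x y)" for x y
      proof -
        have "r x y = q * z1 x y + (a z * z x y + (\<Sum>t\<in>C. a t * t x y))"
          using a[of x y] unfolding sumB by (simp add: algebra_simps)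
        also have "\<dots> = (q + a z) * z1 x y + (a z * z2 x y + (\<Sum>t\<in>C. a t * t x y))"
          unfolding zz[of x y, symmetric] by (simp add: algebra_simps)
        also have "\<dots> = (\<Sum>t\<in>B'. a' t * t x y)"
          unfolding sumB' aC using z12 by (simp add: a'_def)
        finally show ?thesis .
      qed
      then show ?thesis by blast
    qed
    show "2 \<le> card {e \<in> H'. v \<in> e}" if v: "v \<in> \<Union> H'" for v
    proof -
      have f: "finite {e \<in> H'. v \<in> e}" using finite_subset[OF H'E finE] by simp
      consider "v \<in> \<Union> H" | "v \<in> \<Union> (supp z1)" using v unfolding H'_def c1(2) by blast
      then show ?thesis
      proof cases
        case 1
        have "{e \<in> H. v \<in> e} \<subseteq> {e \<in> H'. v \<in> e}" unfolding H'_def by blast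
        then show ?thesis using card_mono[OF f] deg 1 le_trans by blast
      next
        case 2
        have "{e \<in> supp z1. v \<in> e} \<subseteq> {e \<in> H'. v \<in> e}" using cyc_facts(2)[OF c1(1)] by blast
        then show ?thesis using card_mono[OF f] cyc_degree(2)[OF c1(1) 2] le_trans by blast
      qed
    qed
  qed
  moreover have "H \<subset> H'" unfolding H'_def using WH(1) Ane(3) by blast
  ultimately show ?thesis by blast
qed

lemma ear_decomposition:
  fixes z0 :: "'v \<Rightarrow> 'v \<Rightarrow> 'k::field"
  assumes "cyc E z0" "\<forall>e\<in>E. im e \<subseteq> IM (supp z0) \<union> I z0"
  shows "\<exists>B. ear_inv z0 E B"
proof -
  have "\<exists>B. ear_inv z0 E B" if "ear_inv z0 H B" for H B
    using that
  proof (induction "card (E - H)" arbitrary: H B rule: less_induct)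
    case less
    show ?case
    proof (cases "H = E")
      case True then show ?thesis using less by blast
    next
      case False
      then obtain H' B' where *: "ear_inv z0 H' B'" "H \<subset> H'" using ear_step[OF assms less(2)] by blast
      have "H' \<subseteq> E" by (rule ear_invD(1)[OF *(1)])
      then have "E - H' \<subset> E - H" using *(2) by blast
      then have "card (E - H') < card (E - H)" using finE by (intro psubset_card_mono) auto
      then show ?thesis using less(1) *(1) by blast
    qed
  qed
  then show ?thesis using ear_inv_init[OF assms(1)] by blast
qed

lemma card_nbrs: assumes "v \<in> V" shows "card {y. {v, y} \<in> E} = 3"
proof -
  have bij: "bij_betw (\<lambda>y. {v, y}) {y. {v, y} \<in> E} {e \<in> E. v \<in> e}"
    unfolding bij_betw_def
  proof
    show "inj_on (\<lambda>y. {v, y}) {y. {v, y} \<in> E}" by (auto simp: inj_on_def doubleton_eq_iff)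
    show "(\<lambda>y. {v, y}) ` {y. {v, y} \<in> E} = {e \<in> E. v \<in> e}"
    proof
      show "{e \<in> E. v \<in> e} \<subseteq> (\<lambda>y. {v, y}) ` {y. {v, y} \<in> E}"
      proof
        fix e assume e: "e \<in> {e \<in> E. v \<in> e}"
        then obtain a b where "e = {a, b}" using edge_ex by blast
        then have "e = {v, b} \<or> e = {v, a}" using e by auto
        then show "e \<in> (\<lambda>y. {v, y}) ` {y. {v, y} \<in> E}" using e by blast
      qed
    qed auto
  qed
  show ?thesis using bij_betw_same_card[OF bij] degree3[OF assms] by simp
qed

text \<open>The outer face is added as \<open>- z0\<close>. This makes the sum zero and gives the
  edges of the outer cycle their second face; the bounded faces already span.\<close>

lemma face_flows:
  obtains FF :: "('v \<Rightarrow> 'v \<Rightarrow> 'k::field) set" where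
    "finite FF" "card FF = genus V E + 1" "\<And>z. z \<in> FF \<Longrightarrow> is_flow V E z"
    "\<And>z v. z \<in> FF \<Longrightarrow> card {w. z v w \<noteq> 0} \<in> {0, 2}"
    "\<And>z. z \<in> FF \<Longrightarrow> \<exists>x y. z x y \<noteq> 0"
    "\<And>x y. {x, y} \<in> E \<Longrightarrow> card {z \<in> FF. z x y \<noteq> 0} = 2"
    "\<And>x y. (\<Sum>z\<in>FF. z x y) = 0"
    "\<And>r. is_flow V E r \<Longrightarrow> \<exists>a. \<forall>x y. r x y = (\<Sum>z\<in>FF. a z * z x y)"
proof -
  obtain z0 :: "'v \<Rightarrow> 'v \<Rightarrow> 'k" where z0: "cyc E z0" "\<forall>e\<in>E. im e \<subseteq> IM (supp z0) \<union> I z0"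
    using outer_cycle by blast
  obtain B where inv: "ear_inv z0 E B" using ear_decomposition[OF z0] by blast
  note fB = ear_invD(3)[OF inv] and Bc = ear_invD(4)[OF inv] and cnt = ear_invD(7)[OF inv]
    and eul = ear_invD(9)[OF inv] and tot = ear_invD(10)[OF inv] and spn = ear_invD(11)[OF inv]
  define n0 where "n0 = (\<lambda>x y. - z0 x y)"
  have cnt': "card {z \<in> B. z x y \<noteq> 0} = (if z0 x y \<noteq> 0 then 1 else 2)" if "{x, y} \<in> E" for x y
  proof -
    have "(\<Sum>z\<in>B. of_bool (z x y \<noteq> 0)) = card {z \<in> B. z x y \<noteq> 0}"
      using fB by (simp add: of_bool_def sum.If_cases Int_def)
    then show ?thesis using cnt[OF that] by simp
  qed
  \<comment> \<open>The number of faces depends on this. At a vertex \<open>v\<close> of the outer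
    cycle, the face \<open>t\<close> along the third edge also uses an outer edge, and this edge
    lies on one bounded face only; \<open>n0\<close> would be a second one.\<close>
  have n0B: "n0 \<notin> B"
  proof
    assume nB: "n0 \<in> B"
    obtain v where v: "v \<in> \<Union> (supp z0)" using cyc_facts(2,4)[OF z0(1)] edge_ex by blast
    then have vV: "v \<in> V" using Union_V[OF cyc_facts(2)[OF z0(1)]] by blast
    have d0: "card {w. z0 v w \<noteq> 0} = 2" by (rule cyc_degree(1)[OF z0(1) v])
    have sub: "{w. t v w \<noteq> 0} \<subseteq> {y. {v, y} \<in> E}" if "cyc E t" for t :: "'v \<Rightarrow> 'v \<Rightarrow> 'k"
      using cyc_facts(2,3)[OF that] by blast
    have fN: "finite {y. {v, y} \<in> E}" using card_nbrs[OF vV] by (metis card.infinite zero_neq_numeral)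
    have "card ({y. {v, y} \<in> E} - {w. z0 v w \<noteq> 0}) = 1"
      using card_Diff_subset[OF finite_subset[OF sub[OF z0(1)] fN] sub[OF z0(1)]] d0 card_nbrs[OF vV] by simp
    then obtain y3 where y3: "{y. {v, y} \<in> E} - {w. z0 v w \<noteq> 0} = {y3}" by (auto simp: card_1_singleton_iff)
    then have e3: "{v, y3} \<in> E" "z0 v y3 = 0" by blast+
    then have "card {z \<in> B. z v y3 \<noteq> 0} = 2" using cnt' by simp
    then have "{z \<in> B. z v y3 \<noteq> 0} \<noteq> {}" by (metis card.empty zero_neq_numeral)
    then obtain t where t: "t \<in> B" "t v y3 \<noteq> 0" by blast
    have tn: "t \<noteq> n0" using t e3 unfolding n0_def by auto
    have "v \<in> \<Union> (supp t)" using t cyc_facts(3)[OF Bc[OF t(1)], of v y3] by blast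
    then have dt: "card {w. t v w \<noteq> 0} = 2" by (rule cyc_degree(1)[OF Bc[OF t(1)]])
    have "\<not> {w. t v w \<noteq> 0} \<subseteq> {y3}"
    proof
      assume "{w. t v w \<noteq> 0} \<subseteq> {y3}"
      then have "card {w. t v w \<noteq> 0} \<le> card {y3}" by (intro card_mono) auto
      then show False using dt by simp
    qed
    then obtain y where y: "t v y \<noteq> 0" "y \<noteq> y3" by blast
    have yE: "{v, y} \<in> E" using sub[OF Bc[OF t(1)]] y(1) by blast
    then have "z0 v y \<noteq> 0" using y3 y(2) by blast
    then have c1: "card {z \<in> B. z v y \<noteq> 0} = 1" using cnt'[OF yE] by simp
    moreover have "{t, n0} \<subseteq> {z \<in> B. z v y \<noteq> 0}" using t(1) y(1) nB \<open>z0 v y \<noteq> 0\<close> unfolding n0_def by auto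
    then have "card {t, n0} \<le> card {z \<in> B. z v y \<noteq> 0}" using fB by (intro card_mono) auto
    ultimately show False using tn by simp
  qed
  \<comment> \<open>\<open>- z0\<close> is obtained as \<open>z0 - 2 * z0\<close>.\<close>
  have fl0: "is_flow V E n0"
    using is_flow_diff[OF cyc_flow[OF z0(1)] cyc_flow[OF z0(1)], of 2] unfolding n0_def by simp
  have sz: "card {w. z v w \<noteq> 0} \<in> {0, 2}" if "cyc E z" for z :: "'v \<Rightarrow> 'v \<Rightarrow> 'k" and v
  proof (cases "v \<in> \<Union> (supp z)")
    case True then show ?thesis using cyc_degree(1)[OF that] by simp
  next
    case False
    then have "{w. z v w \<noteq> 0} = {}" using cyc_facts(3)[OF that] by blast
    then show ?thesis by simp
  qed
  have nz: "\<exists>x y. z x y \<noteq> 0" if "cyc E z" for z :: "'v \<Rightarrow> 'v \<Rightarrow> 'k"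
    using cyc_facts(4)[OF that] unfolding supp_def by blast
  show ?thesis
  proof (rule that[of "insert n0 B"])
    show "finite (insert n0 B)" using fB by simp
    have "card (\<Union> E) = card V" using Union_E by simp
    then show "card (insert n0 B) = genus V E + 1" using eul n0B fB unfolding genus_def by simp
    show "is_flow V E z" if "z \<in> insert n0 B" for z using that fl0 cyc_flow[OF Bc] by blast
    show "card {w. z v w \<noteq> 0} \<in> {0, 2}" if "z \<in> insert n0 B" for z v
      using that sz[OF Bc, of z v] sz[OF z0(1), of v] unfolding n0_def by auto
    show "\<exists>x y. z x y \<noteq> 0" if "z \<in> insert n0 B" for z
    proof (cases "z = n0")
      case True
      obtain x y where "z0 x y \<noteq> 0" using nz[OF z0(1)] by blast
      then show ?thesis unfolding True n0_def by (intro exI[of _ x] exI[of _ y]) simp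
    next
      case False then show ?thesis using that nz[OF Bc] by blast
    qed
    show "card {z \<in> insert n0 B. z x y \<noteq> 0} = 2" if "{x, y} \<in> E" for x y
    proof (cases "z0 x y = 0")
      case True
      then have "{z \<in> insert n0 B. z x y \<noteq> 0} = {z \<in> B. z x y \<noteq> 0}" unfolding n0_def by auto
      then show ?thesis using cnt'[OF that] True by simp
    next
      case False
      then have "{z \<in> insert n0 B. z x y \<noteq> 0} = insert n0 {z \<in> B. z x y \<noteq> 0}" unfolding n0_def by auto
      then show ?thesis using cnt'[OF that] False n0B fB by simp
    qed
    show "(\<Sum>z\<in>insert n0 B. z x y) = 0" for x y using tot[of x y] n0B fB by (simp add: n0_def)
    show "\<exists>a. \<forall>x y. r x y = (\<Sum>z\<in>insert n0 B. a z * z x y)" if r: "is_flow V E r" for r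
    proof -
      have "\<And>x y. {x, y} \<notin> E \<Longrightarrow> r x y = 0" using r unfolding is_flow_def by blast
      then obtain a where a: "\<And>x y. r x y = (\<Sum>z\<in>B. a z * z x y)" using spn[OF r] by blast
      have *: "(\<Sum>z\<in>insert n0 B. (a(n0 := 0)) z * z x y) = (\<Sum>z\<in>B. a z * z x y)" for x y
      proof -
        have "(\<Sum>z\<in>B. (a(n0 := 0)) z * z x y) = (\<Sum>z\<in>B. a z * z x y)"
        proof (rule sum.cong[OF refl])
          fix z assume "z \<in> B"
          then have "z \<noteq> n0" using n0B by blast
          then show "(a(n0 := 0)) z * z x y = a z * z x y" by simp
        qed
        then show ?thesis unfolding sum.insert[OF fB n0B] by simp
      qed
      have "\<forall>x y. r x y = (\<Sum>z\<in>insert n0 B. (a(n0 := 0)) z * z x y)" unfolding * using a by (intro allI)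
      then show ?thesis by (rule exI[of _ "a(n0 := 0)"])
    qed
  qed
qed

end

section \<open>From the topological to the combinatorial notion of planarity\<close>

definition unit_at :: "'v set \<Rightarrow> 'v \<Rightarrow> 'v \<Rightarrow> real" where
  "unit_at V v = (\<lambda>w\<in>V. of_bool (w = v))"

definition edge_seg :: "'v set \<Rightarrow> 'v \<Rightarrow> 'v \<Rightarrow> real \<Rightarrow> 'v \<Rightarrow> real" where
  "edge_seg V u v s = (\<lambda>w\<in>V. if w = u then 1 - s else if w = v then s else 0)"

lemma topspace_graph_top:
  "t \<in> topspace (graph_top V E) \<longleftrightarrow> t \<in> extensional V \<and> (\<forall>v\<in>V. 0 \<le> t v) \<and> (\<Sum>v\<in>V. t v) = 1 \<and>
     ((\<exists>v\<in>V. {u\<in>V. t u \<noteq> 0} \<subseteq> {v}) \<or> (\<exists>e\<in>E. {u\<in>V. t u \<noteq> 0} \<subseteq> e))"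
  unfolding graph_top_def by (auto simp: PiE_def)

lemma support_singleton:
  assumes "finite V" "t \<in> extensional V" "(\<Sum>v\<in>V. t v) = (1::real)" "{u\<in>V. t u \<noteq> 0} \<subseteq> {v}"
  shows "v \<in> V \<and> t = unit_at V v"
proof -
  have 0: "t u = 0" if "u \<in> V - {v}" for u using that assms(4) by blast
  have vV: "v \<in> V"
  proof (rule ccontr)
    assume "v \<notin> V"
    then have "(\<Sum>v\<in>V. t v) = 0" using 0 by (intro sum.neutral) blast
    then show False using assms(3) by simp
  qed
  have "(\<Sum>v\<in>V - {v}. t v) = 0" using 0 by (intro sum.neutral) blast
  then have "t v = 1" using sum.remove[OF assms(1) vV, of t] assms(3) by simp
  then have "t = unit_at V v" using 0 assms(2) vV
    unfolding unit_at_def by (intro extensionalityI[OF assms(2)]) auto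
  then show ?thesis using vV by simp
qed

lemma support_edge:
  assumes "finite V" "t \<in> extensional V" "(\<Sum>v\<in>V. t v) = (1::real)" "{w\<in>V. t w \<noteq> 0} \<subseteq> {u, v}"
    "u \<in> V" "v \<in> V" "u \<noteq> v"
  shows "t = edge_seg V u v (t v)"
proof -
  have 0: "t w = 0" if "w \<in> V - {u} - {v}" for w using that assms(4) by blast
  have "(\<Sum>w\<in>V - {u} - {v}. t w) = 0" using 0 by (intro sum.neutral) blast
  moreover have "(\<Sum>w\<in>V. t w) = t u + (t v + (\<Sum>w\<in>V - {u} - {v}. t w))"
    using sum.remove[of V u t] sum.remove[of "V - {u}" v t] assms by simp
  ultimately have "t u = 1 - t v" using assms(3) by simp
  then show ?thesis using 0 assms(2)
    unfolding edge_seg_def by (intro extensionalityI[OF assms(2)]) auto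
qed

lemma edge_seg_in:
  assumes "finite V" "{u, v} \<in> E" "u \<in> V" "v \<in> V" "u \<noteq> v" "0 \<le> s" "s \<le> 1"
  shows "edge_seg V u v s \<in> topspace (graph_top V E)" "{w\<in>V. edge_seg V u v s w \<noteq> 0} \<subseteq> {u, v}"
proof -
  show sub: "{w\<in>V. edge_seg V u v s w \<noteq> 0} \<subseteq> {u, v}" unfolding edge_seg_def by auto
  have "(\<Sum>w\<in>V - {u} - {v}. edge_seg V u v s w) = 0" by (intro sum.neutral) (auto simp: edge_seg_def)
  moreover have "(\<Sum>w\<in>V. edge_seg V u v s w) = edge_seg V u v s u + (edge_seg V u v s v + (\<Sum>w\<in>V - {u} - {v}. edge_seg V u v s w))"
    using sum.remove[of V u "edge_seg V u v s"] sum.remove[of "V - {u}" v "edge_seg V u v s"] assms by simp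
  moreover have "edge_seg V u v s u = 1 - s" "edge_seg V u v s v = s" using assms unfolding edge_seg_def by auto
  ultimately have "(\<Sum>w\<in>V. edge_seg V u v s w) = 1" by simp
  moreover have "\<forall>w\<in>V. 0 \<le> edge_seg V u v s w" using assms unfolding edge_seg_def by simp
  moreover have "edge_seg V u v s \<in> extensional V" unfolding edge_seg_def by simp
  ultimately show "edge_seg V u v s \<in> topspace (graph_top V E)"
    unfolding topspace_graph_top using sub assms(2) by blast
qed

lemma edge_seg_continuous:
  assumes "finite V" "{u, v} \<in> E" "u \<in> V" "v \<in> V" "u \<noteq> v"
  shows "continuous_map (top_of_set {0..1}) (graph_top V E) (edge_seg V u v)"
proof -
  have "continuous_map (top_of_set {0..1}) (product_topology (\<lambda>_. euclideanreal) V) (edge_seg V u v)"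
    unfolding continuous_map_componentwise
  proof (intro conjI ballI)
    show "edge_seg V u v ` topspace (top_of_set {0..1}) \<subseteq> extensional V" by (auto simp: edge_seg_def)
    fix k assume k: "k \<in> V"
    have "continuous_on {0..1} (\<lambda>s. edge_seg V u v s k)"
      using k unfolding edge_seg_def by (cases "k = u"; cases "k = v") (auto intro!: continuous_intros)
    then show "continuous_map (top_of_set {0..1}) euclideanreal (\<lambda>s. edge_seg V u v s k)" by simp
  qed
  moreover have "edge_seg V u v s \<in> {t. (\<forall>v\<in>V. 0 \<le> t v) \<and> (\<Sum>v\<in>V. t v) = 1 \<and>
         ((\<exists>v\<in>V. {u\<in>V. t u \<noteq> 0} \<subseteq> {v}) \<or> (\<exists>e\<in>E. {u\<in>V. t u \<noteq> 0} \<subseteq> e))}" if "s \<in> {0..1}" for s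
    using edge_seg_in(1)[OF assms, of s] that unfolding topspace_graph_top by simp
  ultimately show ?thesis
    unfolding graph_top_def by (simp add: continuous_map_in_subtopology Pi_iff image_subset_iff)
qed

text \<open>The drawing of an edge is the image of the points of the geometric realisation supported
  on it. The plane is identified with the complex numbers, for which the Jordan curve theorem is
  formulated.\<close>

lemma planar_plane_graph:
  fixes V :: "'v set"
  assumes sg: "simple_graph V E" and tr: "three_regular V E" and tec: "three_edge_connected V E"
    and pl: "planar_graph V E"
  shows "\<exists>im pt. plane_graph V E im pt"
proof -
  obtain f :: "('v \<Rightarrow> real) \<Rightarrow> real ^ 2" where f: "embedding_map (graph_top V E) euclidean f"
    using pl unfolding planar_graph_def by blast
  have fV: "finite V" using sg unfolding simple_graph_def by blast
  have fc: "continuous_map (graph_top V E) euclidean f"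
    using f by (metis embedding_map_def homeomorphic_imp_continuous_map continuous_map_in_subtopology)
  have fi: "inj_on f (topspace (graph_top V E))"
    using f unfolding embedding_map_def by (metis homeomorphic_imp_injective_map)
  define h :: "real ^ 2 \<Rightarrow> complex" where "h = (\<lambda>x. Complex (x $ 1) (x $ 2))"
  have hi: "inj h" unfolding h_def inj_def by (simp add: vec_eq_iff forall_2)
  have hc: "continuous_on UNIV h"
    unfolding h_def Complex_eq by (intro continuous_intros)
  define F where "F = h \<circ> f"
  have Fc: "continuous_map (graph_top V E) euclidean F"
    unfolding F_def using fc hc by (intro continuous_map_compose) auto
  have Fi: "inj_on F (topspace (graph_top V E))"
    unfolding F_def using fi hi by (intro comp_inj_on) (auto intro: inj_on_subset)
  define X where "X = topspace (graph_top V E)"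
  define S where "S e = {t \<in> X. {w\<in>V. t w \<noteq> 0} \<subseteq> e}" for e
  have eV: "u \<in> V" "v \<in> V" "u \<noteq> v" if "{u, v} \<in> E" for u v
    using that sg unfolding simple_graph_def by (auto simp: card_2_iff doubleton_eq_iff)
  have ex: "\<exists>u v. e = {u, v} \<and> u \<noteq> v" if "e \<in> E" for e
    using that sg unfolding simple_graph_def by (metis card_2_iff)
  have unitX: "unit_at V v \<in> X" if "v \<in> V" for v
    unfolding X_def topspace_graph_top using that fV by (auto simp: unit_at_def of_bool_def)
  have unit_inj: "v = w" if "unit_at V v = unit_at V w" "v \<in> V" "w \<in> V" for v w
    using fun_cong[OF that(1), of v] that(2,3) by (auto simp: unit_at_def split: if_splits)
  have unitS: "unit_at V v \<in> S e \<longleftrightarrow> v \<in> e" if "v \<in> V" for v e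
    unfolding S_def using unitX[OF that] that by (auto simp: unit_at_def)
  have "plane_graph V E (\<lambda>e. F ` S e) (\<lambda>v. F (unit_at V v))"
  proof
    show "simple_graph V E" "three_regular V E" "three_edge_connected V E" by fact+
  next
    fix u v assume e: "{u, v} \<in> E"
    note uv = eV[OF e]
    let ?g = "F \<circ> edge_seg V u v"
    have "continuous_map (top_of_set {0..1}) euclidean ?g"
      using edge_seg_continuous[OF fV e uv] Fc by (rule continuous_map_compose)
    then have "path ?g" unfolding path_def by simp
    moreover have "inj_on ?g {0..1}"
    proof (rule comp_inj_on)
      show "inj_on (edge_seg V u v) {0..1}"
      proof (rule inj_onI)
        fix s s' assume "edge_seg V u v s = edge_seg V u v s'"
        from fun_cong[OF this, of v] show "s = s'" using uv by (simp add: edge_seg_def)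
      qed
      show "inj_on F (edge_seg V u v ` {0..1})"
        using edge_seg_in(1)[OF fV e uv] by (intro inj_on_subset[OF Fi]) auto
    qed
    ultimately have "arc ?g" unfolding arc_def by simp
    moreover have "edge_seg V u v ` {0..1} = S {u, v}"
    proof
      show "edge_seg V u v ` {0..1} \<subseteq> S {u, v}"
      proof (rule image_subsetI)
        fix s :: real assume "s \<in> {0..1}"
        then have "0 \<le> s" "s \<le> 1" by auto
        then show "edge_seg V u v s \<in> S {u, v}" using edge_seg_in[OF fV e uv] unfolding S_def X_def by blast
      qed
      show "S {u, v} \<subseteq> edge_seg V u v ` {0..1}"
      proof
        fix t assume t: "t \<in> S {u, v}"
        then have t': "t \<in> extensional V" "\<forall>v\<in>V. 0 \<le> t v" "(\<Sum>v\<in>V. t v) = 1" "{w\<in>V. t w \<noteq> 0} \<subseteq> {u, v}"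
          unfolding S_def X_def topspace_graph_top by blast+
        have "t = edge_seg V u v (t v)" by (rule support_edge[OF fV t'(1,3,4) uv])
        moreover have "t v \<le> (\<Sum>v\<in>V. t v)" using t'(2) uv fV by (intro member_le_sum) auto
        ultimately show "t \<in> edge_seg V u v ` {0..1}" using t'(2,3) uv by (intro image_eqI[of _ _ "t v"]) auto
      qed
    qed
    then have "path_image ?g = F ` S {u, v}" unfolding path_image_def by (metis image_comp)
    moreover have "edge_seg V u v 0 = unit_at V u" "edge_seg V u v 1 = unit_at V v"
      using uv by (auto simp: edge_seg_def unit_at_def fun_eq_iff)
    then have "pathstart ?g = F (unit_at V u)" "pathfinish ?g = F (unit_at V v)"
      unfolding pathstart_def pathfinish_def by simp_all
    ultimately show "\<exists>\<gamma>. arc \<gamma> \<and> path_image \<gamma> = F ` S {u, v} \<and> pathstart \<gamma> = F (unit_at V u) \<and>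
        pathfinish \<gamma> = F (unit_at V v)" by blast
  next
    fix e e' assume e: "e \<in> E" "e' \<in> E" "e \<noteq> e'"
    have "F ` S e \<inter> F ` S e' = F ` (S e \<inter> S e')"
      using Fi unfolding S_def X_def by (intro inj_on_image_Int[symmetric]) auto
    also have "S e \<inter> S e' = unit_at V ` (e \<inter> e')"
    proof
      show "unit_at V ` (e \<inter> e') \<subseteq> S e \<inter> S e'"
      proof
        fix t assume "t \<in> unit_at V ` (e \<inter> e')"
        then obtain v where v: "v \<in> e" "v \<in> e'" "t = unit_at V v" by blast
        have "v \<in> V" using v(1) e(1) sg unfolding simple_graph_def by blast
        then show "t \<in> S e \<inter> S e'" using v unitS by blast
      qed
      show "S e \<inter> S e' \<subseteq> unit_at V ` (e \<inter> e')"
      proof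
        fix t assume t: "t \<in> S e \<inter> S e'"
        then have t': "t \<in> extensional V" "(\<Sum>v\<in>V. t v) = 1" "{w\<in>V. t w \<noteq> 0} \<subseteq> e \<inter> e'"
          unfolding S_def X_def topspace_graph_top by blast+
        obtain v where v: "e \<inter> e' \<subseteq> {v}"
        proof -
          obtain a b c d where ab: "e = {a, b}" "a \<noteq> b" "e' = {c, d}" "c \<noteq> d" using ex e by metis
          have "\<exists>v. e \<inter> e' \<subseteq> {v}" using ab e(3) by (auto simp: doubleton_eq_iff)
          then show ?thesis using that by blast
        qed
        have "v \<in> V \<and> t = unit_at V v" using support_singleton[OF fV t'(1,2)] t'(3) v by blast
        moreover then have "t v \<noteq> 0" by (simp add: unit_at_def)
        ultimately show "t \<in> unit_at V ` (e \<inter> e')" using t'(3) by blast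
      qed
    qed
    finally show "F ` S e \<inter> F ` S e' = (\<lambda>v. F (unit_at V v)) ` (e \<inter> e')" by (simp add: image_image)
  next
    show "inj_on (\<lambda>v. F (unit_at V v)) V"
    proof (rule inj_onI)
      fix v w assume "v \<in> V" "w \<in> V" "F (unit_at V v) = F (unit_at V w)"
      then show "v = w" using unit_inj inj_onD[OF Fi] unitX unfolding X_def by blast
    qed
  next
    fix e v assume "e \<in> E" "v \<in> V"
    have "F (unit_at V v) \<in> F ` S e \<longleftrightarrow> unit_at V v \<in> S e"
      using Fi unitX[OF \<open>v \<in> V\<close>] unfolding X_def S_def by (intro inj_on_image_mem_iff) auto
    then show "F (unit_at V v) \<in> F ` S e \<longleftrightarrow> v \<in> e" using unitS[OF \<open>v \<in> V\<close>] by simp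
  qed
  then show ?thesis by blast
qed

section \<open>Face structure\<close>

text \<open>\<open>F i x y\<close> is the flow of the boundary cycle of the \<open>i\<close>-th face along the directed edge \<open>(x, y)\<close>; the face \<open>g\<close>
  will be the one whose coordinate is left out.\<close>

locale face_system =
  fixes V :: "'v set" and E :: "'v set set" and g :: nat and F :: "nat \<Rightarrow> 'v \<Rightarrow> 'v \<Rightarrow> 'k::field"
  assumes sg: "simple_graph V E" and tr: "three_regular V E" and tec: "three_edge_connected V E"
    and gen: "g = genus V E"
    and F_flow: "i \<le> g \<Longrightarrow> is_flow V E (F i)"
    and F_deg: "i \<le> g \<Longrightarrow> card {w. F i v w \<noteq> 0} \<in> {0, 2}"
    and F_ne: "i \<le> g \<Longrightarrow> \<exists>x y. F i x y \<noteq> 0"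
    and F_edge: "{x, y} \<in> E \<Longrightarrow> card {i. i \<le> g \<and> F i x y \<noteq> 0} = 2"
    and F_sum: "(\<Sum>i\<le>g. F i x y) = 0"
    and F_span: "is_flow V E r \<Longrightarrow> \<exists>a. \<forall>x y. r x y = (\<Sum>i\<le>g. a i * F i x y)"

text \<open>The faces are numbered because they serve as coordinate indices. The numbering is
  arbitrary; it decides which face becomes the omitted one.\<close>

lemma planar_face_system:
  fixes V :: "'v set"
  assumes "simple_graph V E" "three_regular V E" "three_edge_connected V E" "planar_graph V E"
  shows "\<exists>F :: nat \<Rightarrow> 'v \<Rightarrow> 'v \<Rightarrow> 'k::field. face_system V E (genus V E) F"
proof -
  obtain im pt where "plane_graph V E im pt" using planar_plane_graph[OF assms] by blast
  then interpret plane_graph V E im pt .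
  obtain FF :: "('v \<Rightarrow> 'v \<Rightarrow> 'k::field) set" where FF:
    "finite FF" "card FF = genus V E + 1" "\<And>z. z \<in> FF \<Longrightarrow> is_flow V E z"
    "\<And>z v. z \<in> FF \<Longrightarrow> card {w. z v w \<noteq> 0} \<in> {0, 2}"
    "\<And>z. z \<in> FF \<Longrightarrow> \<exists>x y. z x y \<noteq> 0"
    "\<And>x y. {x, y} \<in> E \<Longrightarrow> card {z \<in> FF. z x y \<noteq> 0} = 2"
    "\<And>x y. (\<Sum>z\<in>FF. z x y) = 0"
    "\<And>r. is_flow V E r \<Longrightarrow> \<exists>a. \<forall>x y. r x y = (\<Sum>z\<in>FF. a z * z x y)"
  proof (rule face_flows[where 'k='k], goal_cases)
    case (1 FF)
    show ?case by (rule 1(1)[of FF]) (fact 1)+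
  qed
  obtain h where h0: "bij_betw h {0..<card FF} FF" using ex_bij_betw_nat_finite[OF FF(1)] by blast
  have "{0..<card FF} = {..genus V E}" using FF(2) by auto
  with h0 have h: "bij_betw h {..genus V E} FF" by simp
  have hF: "h i \<in> FF" if "i \<le> genus V E" for i using h that by (auto simp: bij_betw_def)
  have reidx: "(\<Sum>i\<le>genus V E. f (h i)) = (\<Sum>z\<in>FF. f z)" for f :: "_ \<Rightarrow> 'k" by (rule sum.reindex_bij_betw[OF h])
  have "face_system V E (genus V E) h"
  proof
    show "simple_graph V E" "three_regular V E" "three_edge_connected V E" by fact+
    show "genus V E = genus V E" ..
    fix i assume i: "i \<le> genus V E"
    show "is_flow V E (h i)" "\<exists>x y. h i x y \<noteq> 0" using FF hF[OF i] by blast+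
    show "card {w. h i v w \<noteq> 0} \<in> {0, 2}" for v by (rule FF(4)[OF hF[OF i]])
  next
    fix x y assume e: "{x, y} \<in> E"
    have hs: "h ` {..genus V E} = FF" by (rule bij_betw_imp_surj_on[OF h])
    have img: "{z \<in> FF. z x y \<noteq> 0} = h ` {i. i \<le> genus V E \<and> h i x y \<noteq> 0}"
    proof (rule set_eqI)
      fix z
      have "z \<in> FF \<longleftrightarrow> (\<exists>i\<le>genus V E. z = h i)" unfolding hs[symmetric] by (simp only: image_iff Bex_def atMost_iff)
      then show "z \<in> {z \<in> FF. z x y \<noteq> 0} \<longleftrightarrow> z \<in> h ` {i. i \<le> genus V E \<and> h i x y \<noteq> 0}"
        by (simp only: image_iff Bex_def mem_Collect_eq) metis
    qed
    have "inj_on h {i. i \<le> genus V E \<and> h i x y \<noteq> 0}"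
      by (rule inj_on_subset[OF bij_betw_imp_inj_on[OF h]]) auto
    then show "card {i. i \<le> genus V E \<and> h i x y \<noteq> 0} = 2" using FF(6)[OF e] unfolding img by (simp only: card_image)
  next
    show "(\<Sum>i\<le>genus V E. h i x y) = 0" for x y using FF(7)[of x y] reidx[of "\<lambda>z. z x y"] by simp
    fix r :: "'v \<Rightarrow> 'v \<Rightarrow> 'k" assume "is_flow V E r"
    then obtain a where a: "\<forall>x y. r x y = (\<Sum>z\<in>FF. a z * z x y)" using FF(8) by blast
    have "r x y = (\<Sum>i\<le>genus V E. a (h i) * h i x y)" for x y
      using a reidx[of "\<lambda>z. a z * z x y"] by simp
    then show "\<exists>a. \<forall>x y. r x y = (\<Sum>i\<le>genus V E. a i * h i x y)" by (intro exI[of _ "\<lambda>i. a (h i)"] allI)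
  qed
  then show ?thesis by blast
qed

lemma card_eq_3_iff: "card A = 3 \<longleftrightarrow> (\<exists>a b c. A = {a, b, c} \<and> a \<noteq> b \<and> a \<noteq> c \<and> b \<noteq> c)"
  by (simp add: card_3_iff) metis

section \<open>Incidences of faces, edges and vertices\<close>

context face_system
begin

lemma finV: "finite V" and finE: "finite E"
proof -
  show "finite V" using sg unfolding simple_graph_def by blast
  then show "finite E" using sg unfolding simple_graph_def by (meson PowI finite_Pow_iff finite_subset subsetI)
qed

lemma edge_V: assumes "{u, v} \<in> E" shows "u \<in> V" "v \<in> V" "u \<noteq> v"
  using assms sg unfolding simple_graph_def by (auto simp: card_2_iff doubleton_eq_iff)

lemma edge_ex: "e \<in> E \<Longrightarrow> \<exists>u v. e = {u, v} \<and> u \<noteq> v \<and> u \<in> V \<and> v \<in> V"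
  using sg unfolding simple_graph_def by (metis card_2_iff insert_subset)

lemma conn: "connected_graph V E"
  using tec[unfolded three_edge_connected_def, rule_format, of "{}"] by simp

lemma F_off: "i \<le> g \<Longrightarrow> {x, y} \<notin> E \<Longrightarrow> F i x y = 0"
  using F_flow unfolding is_flow_def by blast

lemma F_anti: "i \<le> g \<Longrightarrow> F i y x = - F i x y"
  using F_flow unfolding is_flow_def by blast

definition nbrs :: "'v \<Rightarrow> 'v set" where "nbrs v = {w. {v, w} \<in> E}"

lemma card_nbrs: assumes "v \<in> V" shows "card (nbrs v) = 3"
proof -
  have bij: "bij_betw (\<lambda>y. {v, y}) (nbrs v) {e \<in> E. v \<in> e}"
    unfolding bij_betw_def
  proof
    show "inj_on (\<lambda>y. {v, y}) (nbrs v)" by (auto simp: inj_on_def doubleton_eq_iff)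
    show "(\<lambda>y. {v, y}) ` nbrs v = {e \<in> E. v \<in> e}"
    proof
      show "{e \<in> E. v \<in> e} \<subseteq> (\<lambda>y. {v, y}) ` nbrs v"
      proof
        fix e assume e: "e \<in> {e \<in> E. v \<in> e}"
        then obtain a b where "e = {a, b}" using edge_ex by blast
        then have "e = {v, b} \<or> e = {v, a}" using e by auto
        then show "e \<in> (\<lambda>y. {v, y}) ` nbrs v" using e unfolding nbrs_def by blast
      qed
    qed (auto simp: nbrs_def)
  qed
  show ?thesis using bij_betw_same_card[OF bij] assms tr unfolding three_regular_def by simp
qed

text \<open>The faces around a vertex and, for an edge, the faces on its two sides. The omitted face
  \<open>g\<close> counts in both.\<close>

definition fc :: "'v \<Rightarrow> nat set" where "fc v = {i. i \<le> g \<and> (\<exists>w. F i v w \<noteq> 0)}"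
definition fe :: "'v \<Rightarrow> 'v \<Rightarrow> nat set" where "fe v w = {i. i \<le> g \<and> F i v w \<noteq> 0}"

lemma fc_le: "i \<in> fc v \<Longrightarrow> i \<le> g" and fe_le: "i \<in> fe v w \<Longrightarrow> i \<le> g"
  unfolding fc_def fe_def by auto

lemma finite_fc [simp]: "finite (fc v)" and finite_fe [simp]: "finite (fe v w)"
  unfolding fc_def fe_def by auto

lemma card_fe: "{v, w} \<in> E \<Longrightarrow> card (fe v w) = 2"
  unfolding fe_def by (rule F_edge)

lemma fe_sub: "fe v w \<subseteq> fc v" "fe v w = fe w v"
  unfolding fe_def fc_def using F_anti[of _ v w] by (auto simp: neg_equal_0_iff_equal)

lemma F_sum_zero: assumes "i \<le> g" "v \<in> V" shows "(\<Sum>w\<in>nbrs v. F i v w) = 0"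
proof -
  have "(\<Sum>w\<in>V. F i v w) = 0" using F_flow[OF assms(1)] assms(2) unfolding is_flow_def by blast
  moreover have "nbrs v \<subseteq> V" using edge_V unfolding nbrs_def by blast
  then have "(\<Sum>w\<in>nbrs v. F i v w) = (\<Sum>w\<in>V. F i v w)"
    using finV F_off[OF assms(1)] by (intro sum.mono_neutral_left) (auto simp: nbrs_def)
  ultimately show ?thesis by simp
qed

text \<open>A face cycle passes a vertex along two of its three edges.\<close>

lemma fc_missing:
  assumes v: "v \<in> V" and i: "i \<in> fc v"
  obtains w where "w \<in> nbrs v" "F i v w = 0" "\<And>u. u \<in> nbrs v \<Longrightarrow> u \<noteq> w \<Longrightarrow> F i v u \<noteq> 0"
proof -
  have ig: "i \<le> g" using i fc_le by blast
  let ?S = "{w. F i v w \<noteq> 0}"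
  have S: "?S \<subseteq> nbrs v" using F_off[OF ig] unfolding nbrs_def by blast
  have fN: "finite (nbrs v)" using card_nbrs[OF v] by (metis card.infinite zero_neq_numeral)
  have "?S \<noteq> {}" using i unfolding fc_def by blast
  then have "card ?S \<noteq> 0" using finite_subset[OF S fN] by simp
  then have "card ?S = 2" using F_deg[OF ig, of v] by simp
  then have "card (nbrs v - ?S) = 1" using card_Diff_subset[OF finite_subset[OF S fN] S] card_nbrs[OF v] by simp
  then obtain w where "nbrs v - ?S = {w}" by (auto simp: card_1_singleton_iff)
  then show ?thesis using that[of w] by blast
qed

lemma sum_fe: "(\<Sum>k\<le>g. f k * F k x y) = (\<Sum>k\<in>fe x y. f k * F k x y)"
  by (intro sum.mono_neutral_right) (auto simp: fe_def)

lemma F_pair: assumes "fe x y = {i, j}" "i \<noteq> j" shows "F j x y = - F i x y"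
proof -
  have "F i x y + F j x y = 0"
    using F_sum[of x y] sum_fe[of "\<lambda>_. 1" x y] assms(2) unfolding assms(1) by simp
  then show ?thesis by (simp add: eq_neg_iff_add_eq_0 add.commute)
qed

text \<open>A combination of faces is a potential on the faces, and its flow through an edge is the
  difference of the potentials on the two sides.\<close>

lemma comb_pair: assumes "fe x y = {i, j}" "i \<noteq> j"
  shows "(\<Sum>k\<le>g. a k * F k x y) = (a i - a j) * F i x y"
  unfolding sum_fe assms(1) using F_pair[OF assms] assms(2) by (simp add: algebra_simps)

text \<open>Each face at \<open>v\<close> misses exactly one edge and each edge lies on two faces,
  so faces against edges form a 3 by 3 matrix with one zero in each row and column. Its row and
  column sums vanish, which fixes it up to the factor \<open>s\<close>. The faces are numbered so
  that \<open>a1\<close>, \<open>a2\<close>, \<open>a3\<close> miss the edges to \<open>w1\<close>,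
  \<open>w2\<close>, \<open>w3\<close>.\<close>

lemma vertex_structure:
  assumes v: "v \<in> V"
  obtains a1 a2 a3 w1 w2 w3 s where
    "fc v = {a1, a2, a3}" "nbrs v = {w1, w2, w3}" "distinct [a1, a2, a3]" "distinct [w1, w2, w3]" "s \<noteq> 0"
    "F a1 v w1 = 0" "F a1 v w2 = s" "F a1 v w3 = - s"
    "F a2 v w1 = - s" "F a2 v w2 = 0" "F a2 v w3 = s"
    "F a3 v w1 = s" "F a3 v w2 = - s" "F a3 v w3 = 0"
    "fe v w1 = {a2, a3}" "fe v w2 = {a1, a3}" "fe v w3 = {a1, a2}"
proof -
  obtain w1 w2 w3 where N: "nbrs v = {w1, w2, w3}" "w1 \<noteq> w2" "w1 \<noteq> w3" "w2 \<noteq> w3"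
    using card_nbrs[OF v] card_eq_3_iff by metis
  have E: "{v, w1} \<in> E" "{v, w2} \<in> E" "{v, w3} \<in> E" using N(1) unfolding nbrs_def by auto
  have miss: "\<exists>!w. w \<in> nbrs v \<and> i \<notin> fe v w" if i: "i \<in> fc v" for i
  proof -
    have ig: "i \<le> g" using i fc_le by blast
    obtain w where w: "w \<in> nbrs v" "F i v w = 0" "\<And>u. u \<in> nbrs v \<Longrightarrow> u \<noteq> w \<Longrightarrow> F i v u \<noteq> 0"
      using fc_missing[OF v i] by metis
    then show ?thesis using ig unfolding fe_def by (intro ex1I[of _ w]) auto
  qed
  have un: "fc v = fe v w1 \<union> fe v w2"
  proof
    show "fe v w1 \<union> fe v w2 \<subseteq> fc v" using fe_sub(1) by blast
    show "fc v \<subseteq> fe v w1 \<union> fe v w2"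
    proof
      fix i assume "i \<in> fc v"
      from miss[OF this] show "i \<in> fe v w1 \<union> fe v w2" using N by auto
    qed
  qed
  obtain p q where pq: "fe v w1 = {p, q}" "p \<noteq> q" using card_fe[OF E(1)] card_2_iff by metis
  have pqc: "p \<in> fc v" "q \<in> fc v" using pq fe_sub(1)[of v w1] by blast+
  have pm: "(p \<in> fe v w2) \<noteq> (p \<in> fe v w3)" using miss[OF pqc(1)] N pq by auto
  have qm: "(q \<in> fe v w2) \<noteq> (q \<in> fe v w3)" using miss[OF pqc(2)] N pq by auto
  have rm: "i \<in> fe v w3 \<and> i \<in> fe v w2" if "i \<in> fc v" "i \<noteq> p" "i \<noteq> q" for i
    using miss[OF that(1)] that N pq by auto
  \<comment> \<open>With two faces only, all three edges would have both of them, although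
    \<open>p\<close> misses one edge.\<close>
  obtain r where r: "r \<in> fc v" "r \<noteq> p" "r \<noteq> q"
  proof (rule ccontr)
    assume "\<not> thesis"
    then have "fc v \<subseteq> {p, q}" using that by blast
    then have "fe v w2 \<subseteq> {p, q}" "fe v w3 \<subseteq> {p, q}" using fe_sub(1) by blast+
    then have "fe v w2 = {p, q}" "fe v w3 = {p, q}"
      using card_fe E pq(2) by (metis card_2_iff card_subset_eq finite.emptyI finite.insertI)+
    then show False using pm by simp
  qed
  have r23: "r \<in> fe v w2" "r \<in> fe v w3" using rm[OF r] by auto
  have only: "i = p \<or> i = q \<or> i = r" if "i \<in> fc v" for i
  proof (rule ccontr)
    assume n: "\<not> ?thesis"
    then have i: "i \<in> fe v w2" "i \<in> fe v w3" using rm that by auto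
    have "fe v w2 = {i, r}" "fe v w3 = {i, r}"
      using card_fe[OF E(2)] card_fe[OF E(3)] i r23 n
      by (metis card_2_iff card_subset_eq empty_subsetI finite_fe insert_subset)+
    then show False using pm n r by auto
  qed
  have fc: "fc v = {p, q, r}" using only pqc r(1) by blast
  obtain a2 a3 where a: "{a2, a3} = {p, q}" "a2 \<noteq> a3" "a2 \<in> fe v w3" "a3 \<in> fe v w2" "a2 \<notin> fe v w2" "a3 \<notin> fe v w3"
  proof -
    have np: "\<not> (p \<in> fe v w2 \<and> q \<in> fe v w2)"
    proof
      assume "p \<in> fe v w2 \<and> q \<in> fe v w2"
      then have "{p, q, r} \<subseteq> fe v w2" using r23 by blast
      then have "card {p, q, r} \<le> 2" using card_fe[OF E(2)] card_mono[of "fe v w2"] by fastforce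
      then show False using pq r by simp
    qed
    have nq: "\<not> (p \<in> fe v w3 \<and> q \<in> fe v w3)"
    proof
      assume "p \<in> fe v w3 \<and> q \<in> fe v w3"
      then have "{p, q, r} \<subseteq> fe v w3" using r23 by blast
      then have "card {p, q, r} \<le> 2" using card_fe[OF E(3)] card_mono[of "fe v w3"] by fastforce
      then show False using pq r by simp
    qed
    show ?thesis
    proof (cases "p \<in> fe v w2")
      case True then show ?thesis using that[of q p] pm qm np pq by blast
    next
      case False then show ?thesis using that[of p q] pm qm nq pq by blast
    qed
  qed
  have fc': "fc v = {r, a2, a3}" using fc a(1) by blast
  have d: "r \<noteq> a2" "r \<noteq> a3" using r a(1) by auto
  have r1: "r \<notin> fe v w1" using pq r by simp
  have fes: "fe v w1 = {a2, a3}" "fe v w2 = {r, a3}" "fe v w3 = {r, a2}"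
    using pq a fe_sub(1)[of v w2] fe_sub(1)[of v w3] r23 unfolding fc' by auto
  have g: "r \<le> g" "a2 \<le> g" "a3 \<le> g" using fc' fc_le by blast+
  have z: "F r v w1 = 0" "F a2 v w2 = 0" "F a3 v w3 = 0"
    using r1 a(5,6) g unfolding fe_def by auto
  have sums: "F i v w1 + F i v w2 + F i v w3 = 0" if "i \<le> g" for i
    using F_sum_zero[OF that v] N by (simp add: add.assoc)
  have cols: "F i v w + F j v w = 0" if "fe v w = {i, j}" "i \<noteq> j" for i j w
    using F_pair[OF that] by simp
  define s where "s = F r v w2"
  have s: "s \<noteq> 0" using r23 unfolding s_def fe_def by simp
  have e1: "F r v w3 = - s" using sums[OF g(1)] z unfolding s_def by (simp add: eq_neg_iff_add_eq_0 add.commute)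
  have e2: "F a3 v w2 = - s" using cols[OF fes(2) d(2)] unfolding s_def by (simp add: eq_neg_iff_add_eq_0 add.commute)
  have e3: "F a2 v w3 = s" using cols[OF fes(3) d(1)] e1 by simp
  have e4: "F a3 v w1 = s" using sums[OF g(3)] z e2 by simp
  have e5: "F a2 v w1 = - s" using sums[OF g(2)] z e3 by (simp add: eq_neg_iff_add_eq_0)
  show ?thesis
    by (rule that[of r a2 a3 w1 w2 w3 s]) (use fc' N d a(2) s z e1 e2 e3 e4 e5 fes in \<open>auto simp: s_def\<close>)
qed

lemma card_fc: assumes "v \<in> V" shows "card (fc v) = 3"
proof -
  obtain a1 a2 a3 where "fc v = {a1, a2, a3}" "distinct [a1, a2, a3]" using vertex_structure[OF assms] by metis
  then show ?thesis by simp
qed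

lemma pair_edge:
  assumes "v \<in> V" "P \<subseteq> fc v" "card P = 2"
  shows "\<exists>w. {v, w} \<in> E \<and> fe v w = P"
proof -
  obtain a1 a2 a3 w1 w2 w3 where *: "fc v = {a1, a2, a3}" "nbrs v = {w1, w2, w3}" "distinct [a1, a2, a3]"
    "fe v w1 = {a2, a3}" "fe v w2 = {a1, a3}" "fe v w3 = {a1, a2}"
    using vertex_structure[OF assms(1)] by metis
  obtain p q where "P = {p, q}" "p \<noteq> q" using assms(3) card_2_iff by metis
  then have "P = {a2, a3} \<or> P = {a1, a3} \<or> P = {a1, a2}" using assms(2) * by auto
  then show ?thesis using * unfolding nbrs_def by blast
qed

text \<open>If two edges lay on the same two faces \<open>i\<close>, \<open>j\<close>, then by three-edge-connectedness some cycle would use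
  only one of them. But a combination of the faces takes up to sign the same value \<open>a i - a j\<close> on both edges.\<close>

lemma fe_inj:
  assumes e: "{x, y} \<in> E" and e': "{x', y'} \<in> E" and f: "fe x y = fe x' y'"
  shows "{x, y} = {x', y'}"
proof (rule ccontr)
  assume ne: "{x, y} \<noteq> {x', y'}"
  let ?D = "{{x, y}, {x', y'}}"
  have "card ?D < 3" by (simp add: card_insert_if)
  then have "connected_graph V (E - ?D)" using tec e e' unfolding three_edge_connected_def by simp
  then have "(x, y) \<in> {(x, y). {x, y} \<in> E - ?D}\<^sup>*"
    using edge_V[OF e] unfolding connected_graph_def by blast
  then obtain p where p: "distinct p" "p \<noteq> []" "hd p = x" "last p = y" "wedges p \<subseteq> E - ?D"
    using rtrancl_path by metis
  have pV: "set p \<subseteq> V"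
  proof (cases "2 \<le> length p")
    case True
    then show ?thesis using Union_wedges[of p] p(5) sg unfolding simple_graph_def by blast
  next
    case False
    then have "p = [x]" using p by (cases p; cases "tl p") auto
    then show ?thesis using edge_V[OF e] by simp
  qed
  \<comment> \<open>The path followed by the edge from \<open>y\<close> back to \<open>x\<close>: a
    closed walk that uses \<open>{x, y}\<close> but not \<open>{x', y'}\<close>.\<close>
  define r where "r = (\<lambda>u w. wflow p u w - 1 * (wflow [x, y] u w :: 'k))"
  have "is_flow V E r"
    unfolding is_flow_def
  proof (intro conjI allI impI ballI)
    show "r w u = - r u w" for u w
      unfolding r_def using wflow_swap[of p w u, where 'k='k] wflow_swap[of "[x, y]" w u, where 'k='k] by simp
    show "r u w = 0" if "{u, w} \<notin> E" for u w
    proof -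
      have "{u, w} \<notin> wedges p" "{u, w} \<notin> wedges [x, y]" using that p(5) e by auto
      then have "wflow p u w = (0::'k)" "wflow [x, y] u w = (0::'k)"
        using wflow_nonzero_edge[of p u w, where 'k='k] wflow_nonzero_edge[of "[x, y]" u w, where 'k='k] by blast+
      then show ?thesis unfolding r_def by simp
    qed
    show "(\<Sum>w\<in>V. r u w) = 0" for u
      unfolding r_def using wflow_boundary[OF finV pV p(2), of u, where 'k='k] p(3,4)
        wflow_boundary[OF finV, of "[x, y]" u, where 'k='k] edge_V[OF e]
      by (simp add: sum_subtractf)
  qed
  then obtain a where a: "\<And>u w. r u w = (\<Sum>k\<le>g. a k * F k u w)" using F_span by blast
  obtain i j where ij: "fe x y = {i, j}" "i \<noteq> j" using card_fe[OF e] card_2_iff by metis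
  have n1: "wflow p x y = (0::'k)" "wflow p x' y' = (0::'k)"
    using p(5) wflow_nonzero_edge[of p x y, where 'k='k] wflow_nonzero_edge[of p x' y', where 'k='k] by blast+
  have n2: "wflow [x, y] x' y' = (0::'k)"
    using ne wflow_nonzero_edge[of "[x, y]" x' y', where 'k='k] by auto
  have n3: "wflow [x, y] x y = (1::'k)" using edge_V[OF e] by simp
  have "(a i - a j) * F i x' y' = 0"
    using comb_pair[of x' y' i j a] ij f a[of x' y'] n1 n2 unfolding r_def by simp
  moreover have "F i x' y' \<noteq> 0" using ij f unfolding fe_def by auto
  ultimately have "a i - a j = 0" by simp
  then have "r x y = 0" using comb_pair[OF ij, of a] a[of x y] by simp
  then show False unfolding r_def n1 n3 by simp
qed

text \<open>\<open>P\<close> is the pair of sides of an edge at \<open>v\<close> and of an edge at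
  \<open>w\<close>; by \<open>fe_inj\<close> these are one edge, which therefore joins
  \<open>v\<close> and \<open>w\<close>.\<close>

lemma fc_share:
  assumes "v \<in> V" "w \<in> V" "v \<noteq> w" "P \<subseteq> fc v \<inter> fc w" "card P = 2"
  shows "{v, w} \<in> E" "fe v w = P"
proof -
  obtain p where p: "{v, p} \<in> E" "fe v p = P" using pair_edge[of v P] assms by blast
  obtain q where q: "{w, q} \<in> E" "fe w q = P" using pair_edge[of w P] assms by blast
  have "{v, p} = {w, q}" using fe_inj[OF p(1) q(1)] p q by simp
  then have "p = w" using assms(3) by (auto simp: doubleton_eq_iff)
  then show "{v, w} \<in> E" "fe v w = P" using p by simp_all
qed

text \<open>A third common face would form, with one side of the edge, another pair shared by both
  ends, and by \<open>fc_share\<close> that pair would have to be the pair of sides too.\<close>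

lemma fc_Int_edge:
  assumes e: "{v, w} \<in> E"
  shows "fc v \<inter> fc w = fe v w"
proof
  show s: "fe v w \<subseteq> fc v \<inter> fc w" using fe_sub[of v w] fe_sub(1)[of w v] by blast
  show "fc v \<inter> fc w \<subseteq> fe v w"
  proof
    fix i assume i: "i \<in> fc v \<inter> fc w"
    obtain p q where pq: "fe v w = {p, q}" "p \<noteq> q" using card_fe[OF e] card_2_iff by metis
    show "i \<in> fe v w"
    proof (cases "i = p")
      case False
      then have "card {i, p} = 2" "{i, p} \<subseteq> fc v \<inter> fc w" using i s pq by auto
      then have "fe v w = {i, p}" using fc_share(2)[of v w "{i, p}"] edge_V[OF e] by blast
      then show ?thesis by simp
    qed (use pq in simp)
  qed
qed

lemma card_Int_fc:
  assumes "v \<in> V" "w \<in> V" "v \<noteq> w" "{v, w} \<notin> E"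
  shows "\<exists>i. fc v \<inter> fc w \<subseteq> {i}"
proof (rule ccontr)
  assume *: "\<not> ?thesis"
  then obtain i where i: "i \<in> fc v \<inter> fc w" by blast
  then obtain j where "j \<in> fc v \<inter> fc w" "j \<noteq> i" using * by blast
  then have "{i, j} \<subseteq> fc v \<inter> fc w" "card {i, j} = 2" using i by auto
  then show False using fc_share(1)[OF assms(1-3)] assms(4) by blast
qed

text \<open>A potential with zero flow agrees on the two sides of every edge, hence on the faces
  around every vertex, hence everywhere by connectedness. So the vanishing of the sum is, up to a
  factor, the only linear relation between the faces.\<close>

lemma kernel_const:
  assumes "\<And>x y. (\<Sum>k\<le>g. a k * F k x y) = 0" "i \<le> g" "j \<le> g"
  shows "a i = a j"
proof -
  have pair: "a i = a j" if vij: "v \<in> V" "i \<in> fc v" "j \<in> fc v" for v i j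
  proof (cases "i = j")
    case False
    then have "card {i, j} = 2" "{i, j} \<subseteq> fc v" using vij by auto
    then obtain w where w: "fe v w = {i, j}" using pair_edge[OF vij(1)] by blast
    then have "(a i - a j) * F i v w = 0" using comb_pair[OF w False, of a] assms(1) by simp
    moreover have "F i v w \<noteq> 0" using w unfolding fe_def by auto
    ultimately show ?thesis by simp
  qed simp
  have ex: "\<exists>v\<in>V. i \<in> fc v" if i: "i \<le> g" for i
  proof -
    obtain x y where "F i x y \<noteq> 0" using F_ne[OF i] by blast
    then have "{x, y} \<in> E" "i \<in> fc x" using F_off[OF i] i unfolding fc_def by blast+
    then show ?thesis using edge_V by blast
  qed
  obtain v where v: "v \<in> V" "i \<in> fc v" using ex[OF assms(2)] by blast
  obtain w where w: "w \<in> V" "j \<in> fc w" using ex[OF assms(3)] by blast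
  show ?thesis
  proof (rule ccontr)
    assume ne: "a i \<noteq> a j"
    let ?P = "\<lambda>u. \<forall>k\<in>fc u. a k = a i"
    have "?P v" using pair[OF v(1)] v(2) by blast
    moreover have "\<not> ?P w" using w(2) ne by metis
    ultimately obtain p q where pq: "{p, q} \<in> E" "?P p" "\<not> ?P q"
      using cut_edge[OF conn v(1) w(1), of ?P] by blast
    obtain k l where kl: "fe p q = {k, l}" using card_fe[OF pq(1)] card_2_iff by metis
    then have "k \<in> fc p" "k \<in> fc q" using fc_Int_edge[OF pq(1)] by blast+
    then have "?P q" using pq(2) pair[OF edge_V(2)[OF pq(1)], of k] by metis
    then show False using pq(3) by blast
  qed
qed

end

section \<open>Values and residues of rational differentials\<close>

lemma coeff_mult_le_degree:
  fixes P Q :: "'a::comm_semiring_0 poly"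
  assumes "degree P \<le> n" "degree Q \<le> m"
  shows "coeff (P * Q) (n + m) = coeff P n * coeff Q m"
proof -
  have "coeff (P * Q) (n + m) = (\<Sum>i\<le>n + m. coeff P i * coeff Q (n + m - i))" by (rule coeff_mult)
  also have "\<dots> = (\<Sum>i\<in>{n}. coeff P i * coeff Q (n + m - i))"
  proof (rule sum.mono_neutral_right)
    show "\<forall>i\<in>{..n + m} - {n}. coeff P i * coeff Q (n + m - i) = 0"
    proof
      fix i assume "i \<in> {..n + m} - {n}"
      then have "i > n \<or> n + m - i > m" by auto
      then have "coeff P i = 0 \<or> coeff Q (n + m - i) = 0" using assms by (auto intro: coeff_eq_0)
      then show "coeff P i * coeff Q (n + m - i) = 0" by auto
    qed
  qed auto
  finally show ?thesis by simp
qed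

text \<open>Two representing fractions are multiplied crosswise. Then both sides are evaluated or,
  at infinity, compared in the coefficient at the sum of the degrees of the denominators.\<close>

lemma has_value_unique:
  fixes h :: "'k::field poly fract"
  assumes "has_value h p c" "has_value h p d"
  shows "c = d"
proof (cases p)
  case (Some a)
  obtain P Q where P: "h = Fract P Q" "poly Q a \<noteq> 0" "c = poly P a / poly Q a" using assms(1) Some by auto
  obtain P' Q' where P': "h = Fract P' Q'" "poly Q' a \<noteq> 0" "d = poly P' a / poly Q' a" using assms(2) Some by auto
  have "Q \<noteq> 0" "Q' \<noteq> 0" using P P' by auto
  then have "P * Q' = P' * Q" using P(1) P'(1) eq_fract(1)[of Q Q' P P'] by simp
  then have "poly P a * poly Q' a = poly P' a * poly Q a" by (metis poly_mult)
  then show ?thesis using P P' by (simp add: frac_eq_eq)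
next
  case None
  obtain P Q where P: "h = Fract P Q" "Q \<noteq> 0" "degree P \<le> degree Q" "c = coeff P (degree Q) / lead_coeff Q"
    using assms(1) None by auto
  obtain P' Q' where P': "h = Fract P' Q'" "Q' \<noteq> 0" "degree P' \<le> degree Q'" "d = coeff P' (degree Q') / lead_coeff Q'"
    using assms(2) None by auto
  have "P * Q' = P' * Q" using P P' eq_fract(1)[of Q Q' P P'] by simp
  then have "coeff (P * Q') (degree Q + degree Q') = coeff (P' * Q) (degree Q' + degree Q)"
    by (simp add: add.commute)
  then have "coeff P (degree Q) * lead_coeff Q' = coeff P' (degree Q') * lead_coeff Q"
    using coeff_mult_le_degree[OF P(3) order_refl] coeff_mult_le_degree[OF P'(3) order_refl] by simp
  then show ?thesis using P P' by (simp add: frac_eq_eq)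
qed

lemma has_value_add:
  fixes h :: "'k::field poly fract"
  assumes "has_value h p c" "has_value k p d"
  shows "has_value (h + k) p (c + d)"
proof (cases p)
  case (Some a)
  obtain P Q where P: "h = Fract P Q" "poly Q a \<noteq> 0" "c = poly P a / poly Q a" using assms(1) Some by auto
  obtain P' Q' where P': "k = Fract P' Q'" "poly Q' a \<noteq> 0" "d = poly P' a / poly Q' a" using assms(2) Some by auto
  have nz: "Q \<noteq> 0" "Q' \<noteq> 0" using P P' by auto
  have "h + k = Fract (P * Q' + P' * Q) (Q * Q')" using P(1) P'(1) nz by simp
  moreover have "poly (Q * Q') a \<noteq> 0" using P P' by simp
  moreover have "c + d = poly (P * Q' + P' * Q) a / poly (Q * Q') a"
    unfolding P(3) P'(3) poly_add poly_mult by (rule add_frac_eq[OF P(2) P'(2)])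
  ultimately show ?thesis unfolding Some has_value.simps by blast
next
  case None
  obtain P Q where P: "h = Fract P Q" "Q \<noteq> 0" "degree P \<le> degree Q" "c = coeff P (degree Q) / lead_coeff Q"
    using assms(1) None by auto
  obtain P' Q' where P': "k = Fract P' Q'" "Q' \<noteq> 0" "degree P' \<le> degree Q'" "d = coeff P' (degree Q') / lead_coeff Q'"
    using assms(2) None by auto
  have "h + k = Fract (P * Q' + P' * Q) (Q * Q')" using P P' by simp
  moreover have dq: "degree (Q * Q') = degree Q + degree Q'" using P P' by (simp add: degree_mult_eq)
  moreover have "degree (P * Q' + P' * Q) \<le> degree (Q * Q')"
    unfolding dq by (rule degree_add_le; rule order_trans[OF degree_mult_le]) (use P P' in auto)
  moreover have "coeff (P * Q' + P' * Q) (degree (Q * Q')) = coeff P (degree Q) * lead_coeff Q' + coeff P' (degree Q') * lead_coeff Q"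
    unfolding dq using coeff_mult_le_degree[OF P(3) order_refl[of "degree Q'"]]
      coeff_mult_le_degree[OF P'(3) order_refl[of "degree Q"]] by (simp add: add.commute)
  moreover have "lead_coeff (Q * Q') = lead_coeff Q * lead_coeff Q'" by (rule lead_coeff_mult)
  moreover have "Q * Q' \<noteq> 0" using P P' by simp
  moreover have "lead_coeff Q \<noteq> 0" "lead_coeff Q' \<noteq> 0" using P P' by simp_all
  then have "c + d = (coeff P (degree Q) * lead_coeff Q' + coeff P' (degree Q') * lead_coeff Q) / (lead_coeff Q * lead_coeff Q')"
    unfolding P(4) P'(4) by (rule add_frac_eq)
  ultimately show ?thesis unfolding None has_value.simps
    by (intro exI[of _ "P * Q' + P' * Q"] exI[of _ "Q * Q'"]) simp
qed

lemma has_value_mult: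
  fixes h :: "'k::field poly fract"
  assumes "has_value h p c" "has_value k p d"
  shows "has_value (h * k) p (c * d)"
proof (cases p)
  case (Some a)
  obtain P Q where P: "h = Fract P Q" "poly Q a \<noteq> 0" "c = poly P a / poly Q a" using assms(1) Some by auto
  obtain P' Q' where P': "k = Fract P' Q'" "poly Q' a \<noteq> 0" "d = poly P' a / poly Q' a" using assms(2) Some by auto
  have "h * k = Fract (P * P') (Q * Q')" "poly (Q * Q') a \<noteq> 0" "c * d = poly (P * P') a / poly (Q * Q') a"
    using P P' by simp_all
  then show ?thesis unfolding Some has_value.simps by blast
next
  case None
  obtain P Q where P: "h = Fract P Q" "Q \<noteq> 0" "degree P \<le> degree Q" "c = coeff P (degree Q) / lead_coeff Q"
    using assms(1) None by auto
  obtain P' Q' where P': "k = Fract P' Q'" "Q' \<noteq> 0" "degree P' \<le> degree Q'" "d = coeff P' (degree Q') / lead_coeff Q'"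
    using assms(2) None by auto
  have dq: "degree (Q * Q') = degree Q + degree Q'" using P P' by (simp add: degree_mult_eq)
  have "h * k = Fract (P * P') (Q * Q')" "Q * Q' \<noteq> 0" using P P' by simp_all
  moreover have "degree (P * P') \<le> degree (Q * Q')" unfolding dq by (rule order_trans[OF degree_mult_le]) (use P P' in auto)
  moreover have "c * d = coeff (P * P') (degree (Q * Q')) / lead_coeff (Q * Q')"
    unfolding lead_coeff_mult unfolding dq coeff_mult_le_degree[OF P(3) P'(3)] using P P' by simp
  ultimately show ?thesis unfolding None has_value.simps by blast
qed

definition kfract :: "'k::field \<Rightarrow> 'k poly fract" where "kfract k = Fract [:k:] 1"

lemma has_valueI_Some: "poly Q a \<noteq> 0 \<Longrightarrow> has_value (Fract P Q) (Some a) (poly P a / poly Q a)"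
  unfolding has_value.simps by blast

lemma has_valueI_None:
  "Q \<noteq> 0 \<Longrightarrow> degree P \<le> degree Q \<Longrightarrow> has_value (Fract P Q) None (coeff P (degree Q) / lead_coeff Q)"
  unfolding has_value.simps by blast

lemma has_value_const: "has_value (kfract k) p k"
  unfolding kfract_def using has_valueI_Some[of 1 _ "[:k:]"] has_valueI_None[of 1 "[:k:]"]
  by (cases p) (simp_all del: has_value.simps)

lemma has_value_zero: "has_value 0 p (0::'k::field)"
  using has_value_const[of "0::'k" p] by (simp add: kfract_def Zero_fract_def)

lemma kfract_simps: "kfract 0 = 0" "kfract 1 = 1" "kfract (a + b) = kfract a + kfract b" "kfract (a * b) = kfract a * kfract b"
   "kfract (- a) = - kfract a" "kfract (a - b) = kfract a - kfract b"
  by (simp_all add: kfract_def Zero_fract_def One_fract_def one_pCons mult.commute)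

lemma diff_value_add: "diff_value h p c \<Longrightarrow> diff_value k p d \<Longrightarrow> diff_value (h + k) p (c + d)"
  unfolding diff_value_def add_divide_distrib by (rule has_value_add)

lemma diff_value_scale: "diff_value h p c \<Longrightarrow> diff_value (kfract a * h) p (a * c)"
  unfolding diff_value_def times_divide_eq_right[symmetric] by (rule has_value_mult[OF has_value_const])

lemma diff_residue_add: "diff_residue h p c \<Longrightarrow> diff_residue k p d \<Longrightarrow> diff_residue (h + k) p (c + d)"
  unfolding diff_residue_def distrib_left add_divide_distrib by (rule has_value_add)

lemma diff_residue_scale: "diff_residue h p c \<Longrightarrow> diff_residue (kfract a * h) p (a * c)"
proof -
  assume "diff_residue h p c"
  then have "has_value (kfract a * (local_param p * h / dlocal_param p)) p (a * c)"
    unfolding diff_residue_def by (rule has_value_mult[OF has_value_const])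
  also have "kfract a * (local_param p * h / dlocal_param p) = local_param p * (kfract a * h) / dlocal_param p"
    by (simp only: times_divide_eq_right mult.left_commute)
  finally show ?thesis unfolding diff_residue_def .
qed

lemma diff_residue_unique: "diff_residue h p c \<Longrightarrow> diff_residue h p d \<Longrightarrow> c = d"
  unfolding diff_residue_def by (rule has_value_unique)

lemma diff_residue_zero: "diff_residue 0 p 0"
  unfolding diff_residue_def by (simp add: has_value_zero)

lemma diff_residue_sum:
  assumes "finite S" "\<And>s. s \<in> S \<Longrightarrow> diff_residue (h s) p (c s)"
  shows "diff_residue (\<Sum>s\<in>S. h s) p (\<Sum>s\<in>S. c s)"
  using assms by (induction S rule: finite_induct) (auto simp: diff_residue_zero intro: diff_residue_add)

lemma has_value_local_param: "has_value (local_param p) p 0"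
proof (cases p)
  case (Some a)
  then show ?thesis using has_valueI_Some[of 1 a "[:-a, 1:]"] by (simp del: has_value.simps)
next
  case None
  then show ?thesis using has_valueI_None[of "[:0, 1:]" 1] by (simp del: has_value.simps)
qed

lemma diff_value_residue: "diff_value h p c \<Longrightarrow> diff_residue h p 0"
  unfolding diff_residue_def diff_value_def times_divide_eq_right[symmetric]
  using has_value_mult[OF has_value_local_param[of p]] by (simp only: mult_zero_left)

text \<open>The differential \<open>dt / (t - a)\<close>, with residue 1 at \<open>a\<close> and -1
  at infinity. The value 0 at \<open>None\<close> makes the difference of \<open>polar p\<close> and
  \<open>polar q\<close> have residues 1 at \<open>p\<close> and -1 at \<open>q\<close> also when
  one of the points is infinity.\<close>

fun polar :: "'k::field option \<Rightarrow> 'k poly fract" where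
  "polar (Some a) = Fract 1 [:-a, 1:]"
| "polar None = 0"

lemma fract_dlocal_None: "Fract P Q / dlocal_param None = Fract (- [:0, 0, 1:] * P) (Q :: 'k::field poly)" if "Q \<noteq> 0"
proof -
  have "Fract P Q / dlocal_param None = Fract (P * [:0, 0, 1:]) (Q * (-1))" by simp
  also have "\<dots> = Fract (- [:0, 0, 1:] * P) Q"
    using that by (subst eq_fract(1)) (auto simp: algebra_simps)
  finally show ?thesis .
qed

lemma polar_value:
  assumes "c \<noteq> a" shows "diff_value (polar (Some a)) (Some c) (1 / (c - a))"
  unfolding diff_value_def using assms has_valueI_Some[of "[:-a, 1:]" c 1] by (simp del: has_value.simps)

lemma polar_residue_self: "diff_residue (polar (Some a)) (Some a) (1::'k::field)"
proof -
  have "local_param (Some a) * polar (Some a) / dlocal_param (Some a) = Fract [:-a, 1:] [:-a, 1:]" by simp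
  also have "\<dots> = kfract 1" unfolding kfract_def by (subst eq_fract(1)) auto
  finally have e: "local_param (Some a) * polar (Some a) / dlocal_param (Some a) = kfract 1" .
  show ?thesis unfolding diff_residue_def e by (rule has_value_const)
qed

lemma polar_residue_None: "diff_residue (polar (Some a)) None (-1::'k::field)"
proof -
  have "local_param None * polar (Some a) / dlocal_param None = Fract 1 ([:0, 1:] * [:-a, 1:]) / dlocal_param None"
    by simp
  also have "\<dots> = Fract (- [:0, 0, 1:] * 1) ([:0, 1:] * [:-a, 1:])" by (rule fract_dlocal_None) simp
  also have "\<dots> = Fract [:0, -1:] [:-a, 1:]" by (subst eq_fract(1)) auto
  finally have e: "local_param None * polar (Some a) / dlocal_param None = Fract [:0, -1:] [:-a, 1:]" .
  show ?thesis unfolding diff_residue_def e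
    using has_valueI_None[of "[:-a, 1:]" "[:0, -1:]"] by (simp del: has_value.simps)
qed

definition dpq :: "'k::field option \<Rightarrow> 'k option \<Rightarrow> 'k poly fract" where "dpq p q = polar p - polar q"

lemma polar_residue:
  "diff_residue (polar p) z (if p = None then 0 else if z = None then -1 else of_bool (z = p))"
proof (cases p)
  case None then show ?thesis by (simp add: diff_residue_zero)
next
  case (Some a)
  show ?thesis
  proof (cases z)
    case None then show ?thesis using Some polar_residue_None by simp
  next
    case (Some c)
    then show ?thesis using \<open>p = Some a\<close> polar_residue_self[of a] diff_value_residue[OF polar_value[of c a]]
      by (cases "c = a") auto
  qed
qed

lemma dpq_alt: "dpq p q = polar p + kfract (-1) * polar q"
  unfolding dpq_def by (simp add: kfract_simps)

lemma dpq_residue: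
  fixes p q z :: "'k::field option"
  shows "diff_residue (dpq p q) z (of_bool (z = p) - of_bool (z = q))"
proof -
  let ?r = "\<lambda>p. if p = None then 0 else if z = None then -1 else (of_bool (z = p) :: 'k)"
  have "diff_residue (dpq p q) z (?r p + (-1) * ?r q)"
    unfolding dpq_alt by (intro diff_residue_add diff_residue_scale polar_residue)
  moreover have "?r p + (-1) * ?r q = (of_bool (z = p) - of_bool (z = q))"
    by (cases p; cases q; cases z) auto
  ultimately show ?thesis by simp
qed

text \<open>\<open>rep0 p, rep1 p\<close> are the homogeneous coordinates used by \<open>p1_point\<close>, and \<open>br\<close> is their determinant.\<close>

fun rep0 :: "'k::field option \<Rightarrow> 'k" where "rep0 (Some a) = 1" | "rep0 None = 0"
fun rep1 :: "'k::field option \<Rightarrow> 'k" where "rep1 (Some a) = a" | "rep1 None = 1"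

definition br :: "'k::field option \<Rightarrow> 'k option \<Rightarrow> 'k" where
  "br p q = rep0 p * rep1 q - rep1 p * rep0 q"

lemma br_eq_0_iff: "br p q = 0 \<longleftrightarrow> p = q"
  unfolding br_def by (cases p; cases q) auto

text \<open>The homogeneous form of \<open>1 / (t - a) - 1 / (t - b)\<close>. The extra sign at
  infinity stems from the derivative of the local parameter \<open>1 / t\<close>, which is
  \<open>- 1 / t^2\<close>.\<close>

lemma dpq_value:
  assumes "z \<noteq> p" "z \<noteq> q"
  shows "diff_value (dpq p q) z (- (if z = None then -1 else 1) * br p q / (br p z * br q z))"
proof (cases z)
  case z: (Some c)
  have pv: "diff_value (polar p) z (if p = None then 0 else 1 / br p z)" if "z \<noteq> p" for p
    using that polar_value[of c] z by (cases p) (auto simp: br_def diff_value_def has_value_zero simp del: has_value.simps)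
  have "diff_value (dpq p q) z ((if p = None then 0 else 1 / br p z) + (-1) * (if q = None then 0 else 1 / br q z))"
    unfolding dpq_alt by (intro diff_value_add diff_value_scale pv assms)
  moreover have "(if p = None then 0 else 1 / br p z) + (-1) * (if q = None then 0 else 1 / br q z)
     = - (if z = None then -1 else 1) * br p q / (br p z * br q z)"
    using assms z by (cases p; cases q) (auto simp: br_def field_simps)
  ultimately show ?thesis by simp
next
  case z: None
  then obtain a b where ab: "p = Some a" "q = Some b" using assms by (cases p; cases q) auto
  have "dpq p q = Fract [:a - b:] ([:-a, 1:] * [:-b, 1:])"
    unfolding dpq_def ab by (simp add: eq_fract)
  then have "dpq p q / dlocal_param None = Fract (- [:0, 0, 1:] * [:a - b:]) ([:-a, 1:] * [:-b, 1:])"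
    using fract_dlocal_None[of "[:-a, 1:] * [:-b, 1:]" "[:a - b:]"] by simp
  moreover have "has_value (Fract (- [:0, 0, 1:] * [:a - b:]) ([:-a, 1:] * [:-b, 1:])) None (b - a)"
    unfolding has_value.simps
    by (rule exI[of _ "- [:0, 0, 1:] * [:a - b:]"], rule exI[of _ "[:-a, 1:] * [:-b, 1:]"]) auto
  ultimately show ?thesis unfolding diff_value_def z ab by (simp add: br_def)
qed

text \<open>A differential without finite poles has a polynomial coefficient \<open>h\<close>,
  because over an algebraically closed field a nonconstant denominator has a root. As
  \<open>dt\<close> has a double pole at infinity, a nonzero polynomial would leave a pole of order
  at least two there.\<close>

lemma regular_everywhere:
  fixes h :: "'k::alg_closed_field poly fract"
  assumes fin: "\<And>a. diff_residue h (Some a) 0" and inf: "diff_residue h None c"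
  shows "h = 0"
proof -
  \<comment> \<open>A denominator of least degree replaces the reduced form of the fraction: it has
    no root in common with the numerator.\<close>
  let ?n = "\<lambda>n. \<exists>A B. h = Fract A B \<and> B \<noteq> 0 \<and> degree B = n"
  have "\<exists>n. ?n n" by (cases h) blast
  then have "?n (LEAST n. ?n n)" by (rule LeastI_ex)
  then obtain A B where AB: "h = Fract A B" "B \<noteq> 0" "degree B = (LEAST n. ?n n)" by blast
  have least: "degree B \<le> degree B'" if "h = Fract A' B'" "B' \<noteq> 0" for A' B'
    unfolding AB(3) using that by (intro Least_le) blast
  have nr: "poly B a \<noteq> 0" for a
  proof
    assume B0: "poly B a = 0"
    obtain P Q where P: "local_param (Some a) * h / dlocal_param (Some a) = Fract P Q" "poly Q a \<noteq> 0" "0 = poly P a / poly Q a"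
      using fin[of a] unfolding diff_residue_def by auto
    have "Fract ([:-a, 1:] * A) B = Fract P Q" using P(1) AB by simp
    moreover have "Q \<noteq> 0" using P(2) by auto
    ultimately have e: "[:-a, 1:] * A * Q = P * B" using eq_fract(1)[of B Q "[:-a, 1:] * A" P] AB by simp
    have "poly P a = 0" using P by simp
    then obtain M where M: "P = [:-a, 1:] * M" using poly_eq_0_iff_dvd by blast
    then have "[:-a, 1:] * (A * Q) = [:-a, 1:] * (M * B)" using e by (simp only: mult.assoc)
    then have "A * Q = M * B" by (simp only: mult_cancel_left) simp
    then have "poly A a * poly Q a = 0" using B0 by (metis mult_zero_right poly_mult)
    then have "poly A a = 0" using P by simp
    then have "[:-a, 1:] dvd A" "[:-a, 1:] dvd B" using B0 poly_eq_0_iff_dvd by blast+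
    then obtain A' B' where A': "A = [:-a, 1:] * A'" "B = [:-a, 1:] * B'" by (elim dvdE)
    have B'0: "B' \<noteq> 0" using AB(2) A'(2) by auto
    have "A * B' = A' * B" unfolding A' by (simp only: ac_simps)
    then have "h = Fract A' B'" unfolding AB(1) by (subst eq_fract(1)[OF AB(2) B'0])
    then have "degree B \<le> degree B'" using B'0 by (rule least)
    moreover have "degree B = 1 + degree B'" unfolding A'(2) using B'0 by (subst degree_mult_eq) auto
    ultimately show False by simp
  qed
  have "degree B = 0"
  proof (rule ccontr)
    assume "degree B \<noteq> 0"
    then have "\<exists>x. poly B x = 0" using alg_closed_imp_poly_has_root[of B] by simp
    then show False using nr by blast
  qed
  then obtain b where b: "B = [:b:]" by (metis degree_eq_zeroE)
  then have bnz: "b \<noteq> 0" using AB(2) by auto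
  obtain P Q where P: "local_param None * h / dlocal_param None = Fract P Q" "Q \<noteq> 0" "degree P \<le> degree Q"
    using inf unfolding diff_residue_def by auto
  have "local_param None * h / dlocal_param None = Fract A ([:0, 1:] * B) / dlocal_param None"
    using AB by simp
  also have "\<dots> = Fract (- [:0, 0, 1:] * A) ([:0, 1:] * B)" using AB by (intro fract_dlocal_None) auto
  finally have "Fract (- [:0, 0, 1:] * A) ([:0, 1:] * B) = Fract P Q" using P(1) by simp
  moreover have "[:0, 1:] * B \<noteq> 0" using AB by auto
  ultimately have e: "- [:0, 0, 1:] * A * Q = P * ([:0, 1:] * B)"
    using eq_fract(1)[of "[:0, 1:] * B" Q "- [:0, 0, 1:] * A" P] P(2) by blast
  show ?thesis
  proof (rule ccontr)
    assume "h \<noteq> 0"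
    then have A: "A \<noteq> 0" using AB by (auto simp: fract_collapse)
    have d1: "degree (- [:0, 0, 1:] * A * Q) = 2 + degree A + degree Q" using A P(2) by (simp add: degree_mult_eq)
    have d2: "degree (P * ([:0, 1:] * B)) \<le> degree P + 1"
      by (rule order_trans[OF degree_mult_le]) (use b bnz in simp)
    have "2 + degree A + degree Q \<le> degree P + 1" using d2 unfolding d1[symmetric] e .
    then show False using P(3) by linarith
  qed
qed

text \<open>The difference of \<open>h\<close> and its polar parts has no finite poles and at most a
  simple one at infinity, so \<open>regular_everywhere\<close> makes it zero. Comparing the residues
  at infinity then gives the vanishing of their sum.\<close>

lemma residue_theorem:
  fixes h :: "'k::alg_closed_field poly fract"
  assumes S: "finite S" and res: "\<And>z. z \<in> S \<Longrightarrow> diff_residue h z (r z)" and reg: "\<And>z. z \<notin> S \<Longrightarrow> \<exists>c. diff_value h z c"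
  shows "h = (\<Sum>z\<in>S. kfract (r z) * polar z)" "(\<Sum>z\<in>S. r z) = 0"
proof -
  define R where "R z = (if z \<in> S then r z else 0)" for z
  have resR: "diff_residue h z (R z)" for z
    using res[of z] reg[of z] diff_value_residue unfolding R_def by auto
  let ?k = "\<lambda>z p. if p = None then 0 else if z = None then -1 else (of_bool (z = p) :: 'k)"
  let ?s = "\<Sum>p\<in>S. kfract (r p) * polar p"
  have sres: "diff_residue ?s z (\<Sum>p\<in>S. r p * ?k z p)" for z
    using S by (intro diff_residue_sum diff_residue_scale polar_residue)
  have d: "diff_residue (h + kfract (-1) * ?s) z (R z + (-1) * (\<Sum>p\<in>S. r p * ?k z p))" for z
    by (intro diff_residue_add diff_residue_scale resR sres)
  have k: "(\<Sum>p\<in>S. r p * ?k (Some a) p) = R (Some a)" for a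
  proof -
    have "(\<Sum>p\<in>S. r p * ?k (Some a) p) = (\<Sum>p\<in>S. if p = Some a then r p else 0)"
      by (intro sum.cong) auto
    then show ?thesis using S unfolding R_def by (simp add: sum.delta)
  qed
  have "h + kfract (-1) * ?s = 0"
    using d[of "Some _"] d[of None] unfolding k by (intro regular_everywhere) auto
  then show h: "h = ?s" by (simp add: kfract_simps)
  have "R None = (\<Sum>p\<in>S. r p * ?k None p)"
    using resR[of None] sres[of None] unfolding h[symmetric] by (rule diff_residue_unique)
  also have "\<dots> = (\<Sum>p\<in>S. if p = None then 0 else - r p)" by (intro sum.cong) auto
  also have "\<dots> = - (\<Sum>p\<in>S - {None}. r p)"
    using S by (simp add: sum_negf[symmetric]) (intro sum.mono_neutral_cong_right; auto)
  finally have *: "R None = - (\<Sum>p\<in>S - {None}. r p)" .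
  show "(\<Sum>z\<in>S. r z) = 0"
  proof (cases "None \<in> S")
    case True
    then show ?thesis using * sum.remove[OF S True, of r] unfolding R_def by simp
  next
    case False
    then show ?thesis using * unfolding R_def by simp
  qed
qed

section \<open>Sections of the dualizing bundle and flows\<close>

locale curve_system = face_system V E g F
  for V :: "'v set" and E g and F :: "nat \<Rightarrow> 'v \<Rightarrow> 'v \<Rightarrow> 'k::alg_closed_field" +
  fixes \<nu> :: "'v \<Rightarrow> 'v set \<Rightarrow> 'k option"
  assumes nodes: "node_positions V E \<nu>"
begin

definition nod :: "'v \<Rightarrow> 'v \<Rightarrow> 'k option" where "nod v w = \<nu> v {v, w}"

text \<open>The differential on each component whose residues at the nodes are given by the flow \<open>r\<close>; Kirchhoff's law at
  \<open>v\<close> makes it regular at infinity. It identifies the flows with the sections of the dualizing bundle.\<close>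

definition sect :: "('v \<Rightarrow> 'v \<Rightarrow> 'k) \<Rightarrow> 'v \<Rightarrow> 'k poly fract" where
  "sect r v = (if v \<in> V then \<Sum>w\<in>nbrs v. kfract (r v w) * polar (nod v w) else 0)"

lemma nod_inj: "v \<in> V \<Longrightarrow> inj_on (nod v) (nbrs v)"
proof (rule inj_onI)
  fix x y assume v: "v \<in> V" and xy: "x \<in> nbrs v" "y \<in> nbrs v" "nod v x = nod v y"
  have i: "inj_on (\<nu> v) {e \<in> E. v \<in> e}" using nodes v unfolding node_positions_def by blast
  have "{v, x} = {v, y}"
    by (rule inj_onD[OF i]) (use xy in \<open>auto simp: nod_def nbrs_def\<close>)
  then show "x = y" by (auto simp: doubleton_eq_iff)
qed

lemma node_set: "\<nu> v ` {e \<in> E. v \<in> e} = nod v ` nbrs v"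
proof
  show "\<nu> v ` {e \<in> E. v \<in> e} \<subseteq> nod v ` nbrs v"
  proof (rule image_subsetI)
    fix e assume e: "e \<in> {e \<in> E. v \<in> e}"
    then obtain a b where "e = {a, b}" using edge_ex by blast
    then have "e = {v, b} \<or> e = {v, a}" using e by auto
    then show "\<nu> v e \<in> nod v ` nbrs v" using e unfolding nod_def nbrs_def by blast
  qed
qed (auto simp: nod_def nbrs_def)

lemma finite_nbrs: "v \<in> V \<Longrightarrow> finite (nbrs v)"
  using card_nbrs by (metis card.infinite zero_neq_numeral)

text \<open>Kirchhoff's law eliminates the third residue. The remaining differentials have two poles
  each and are regular elsewhere, infinity included.\<close>

lemma sect_three:
  assumes v: "v \<in> V" and N: "nbrs v = {w1, w2, w3}" "distinct [w1, w2, w3]" and r: "r v w1 + r v w2 + r v w3 = 0"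
  shows "sect r v = kfract (r v w1) * dpq (nod v w1) (nod v w3) + kfract (r v w2) * dpq (nod v w2) (nod v w3)"
proof -
  have r3: "r v w3 = - r v w1 - r v w2" using r by (simp add: eq_neg_iff_add_eq_0 algebra_simps)
  show ?thesis unfolding sect_def N(1) using v N(2) by (simp add: r3 kfract_simps dpq_def algebra_simps)
qed

text \<open>Over the common denominator of the three poles, the coefficient of a section is a linear
  form in the homogeneous coordinates of \<open>z\<close>. The factor \<kappa> is the same for all
  flows \<open>r\<close>, so it does not affect the point of projective space.\<close>

lemma sect_value:
  assumes v: "v \<in> V" and N: "nbrs v = {w1, w2, w3}" "distinct [w1, w2, w3]"
  shows "\<exists>\<kappa>. \<kappa> \<noteq> 0 \<and> (\<forall>r. r v w1 + r v w2 + r v w3 = 0 \<longrightarrow>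
    section_value E \<nu> v z (sect r v) (\<kappa> * (r v w1 * br (nod v w1) (nod v w3) * br (nod v w2) z
      + r v w2 * br (nod v w2) (nod v w3) * br (nod v w1) z)))"
proof -
  define q1 q2 q3 where q: "q1 = nod v w1" "q2 = nod v w2" "q3 = nod v w3"
  have "inj_on (nod v) {w1, w2, w3}" using nod_inj[OF v] N(1) by simp
  then have d: "q1 \<noteq> q2" "q1 \<noteq> q3" "q2 \<noteq> q3" using N(2) unfolding q by (auto simp: inj_on_def)
  have ns: "\<nu> v ` {e \<in> E. v \<in> e} = {q1, q2, q3}" unfolding node_set N(1) q by simp
  have b: "br q1 q2 \<noteq> 0" "br q1 q3 \<noteq> 0" "br q2 q3 \<noteq> 0" "br q2 q1 \<noteq> 0" using d by (auto simp: br_eq_0_iff)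
  have b0: "br p p = 0" for p :: "'k option" by (simp add: br_eq_0_iff)
  have bs: "br q2 q1 = - br q1 q2" unfolding br_def by simp
  let ?n = "\<lambda>r. r v w1 * br q1 q3 * br q2 z + r v w2 * br q2 q3 * br q1 z"
  have sv: "section_value E \<nu> v z (sect r v) c"
    if "r v w1 + r v w2 + r v w3 = 0"
      "c = r v w1 * c13 + r v w2 * c23"
      "if z \<in> {q1, q2, q3} then diff_residue (dpq q1 q3) z c13 \<and> diff_residue (dpq q2 q3) z c23
       else diff_value (dpq q1 q3) z c13 \<and> diff_value (dpq q2 q3) z c23" for r c c13 c23
    unfolding section_value_def ns sect_three[of v w1 w2 w3 r, OF v N that(1), folded q] that(2)
    using that(3) by (auto intro!: diff_residue_add diff_residue_scale diff_value_add diff_value_scale split: if_splits)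
  have "\<exists>\<kappa>. \<kappa> \<noteq> 0 \<and> (\<forall>r. r v w1 + r v w2 + r v w3 = 0 \<longrightarrow> section_value E \<nu> v z (sect r v) (\<kappa> * ?n r))"
  proof (cases "z \<in> {q1, q2, q3}")
    case True
    have key: ?thesis
      if \<kappa>: "\<kappa> \<noteq> 0" "\<And>r. \<kappa> * ?n r = r v w1 * (of_bool (z = q1) - of_bool (z = q3)) + r v w2 * (of_bool (z = q2) - of_bool (z = q3))" for \<kappa>
    proof (intro exI conjI allI impI)
      show "\<kappa> \<noteq> 0" by (rule \<kappa>(1))
      fix r :: "'v \<Rightarrow> 'v \<Rightarrow> 'k" assume r: "r v w1 + r v w2 + r v w3 = 0"
      have "if z \<in> {q1, q2, q3} then diff_residue (dpq q1 q3) z (of_bool (z = q1) - of_bool (z = q3)) \<and>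
            diff_residue (dpq q2 q3) z (of_bool (z = q2) - of_bool (z = q3))
          else diff_value (dpq q1 q3) z (of_bool (z = q1) - of_bool (z = q3)) \<and>
            diff_value (dpq q2 q3) z (of_bool (z = q2) - of_bool (z = q3))"
        unfolding if_P[OF True] by (intro conjI dpq_residue)
      then show "section_value E \<nu> v z (sect r v) (\<kappa> * ?n r)" by (rule sv[of r, OF r \<kappa>(2)[of r]])
    qed
    \<comment> \<open>At a node the value is a residue, and the linear form reduces to the flow
      through this node times a constant; \<kappa> is the inverse of that constant. At
      \<open>q3\<close> this flow is minus the sum of the other two, whence the sign.\<close>
    consider "z = q1" | "z = q2" | "z = q3" using True by blast
    then show ?thesis
    proof cases
      case 1
      show ?thesis by (rule key[of "1 / (br q1 q3 * br q2 q1)"]) (use 1 d b in \<open>simp_all add: b0\<close>)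
    next
      case 2
      show ?thesis by (rule key[of "1 / (br q2 q3 * br q1 q2)"]) (use 2 d b in \<open>simp_all add: b0\<close>)
    next
      case 3
      show ?thesis
      proof (rule key[of "- 1 / (br q1 q3 * br q2 q3)"])
        show "- 1 / (br q1 q3 * br q2 q3) \<noteq> 0" using b by simp
        have z: "of_bool (z = q1) = (0::'k)" "of_bool (z = q2) = (0::'k)" "of_bool (z = q3) = (1::'k)" using 3 d by auto
        show "- 1 / (br q1 q3 * br q2 q3) * ?n r = r v w1 * (of_bool (z = q1) - of_bool (z = q3)) + r v w2 * (of_bool (z = q2) - of_bool (z = q3))" for r
          unfolding z unfolding 3 using b by (simp add: field_simps)
      qed
    qed
  next
    case False
    then have z: "z \<noteq> q1" "z \<noteq> q2" "z \<noteq> q3" by auto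
    then have bz: "br q1 z \<noteq> 0" "br q2 z \<noteq> 0" "br q3 z \<noteq> 0" by (auto simp: br_eq_0_iff)
    \<comment> \<open>The sign at infinity from \<open>dpq_value\<close>.\<close>
    define \<epsilon> where "\<epsilon> = (if z = None then -1 else (1::'k))"
    have \<epsilon>: "\<epsilon> \<noteq> 0" unfolding \<epsilon>_def by simp
    let ?k = "- \<epsilon> / (br q1 z * br q2 z * br q3 z)"
    show ?thesis
    proof (intro exI conjI allI impI)
      show "?k \<noteq> 0" using \<epsilon> bz by simp
      fix r :: "'v \<Rightarrow> 'v \<Rightarrow> 'k" assume r: "r v w1 + r v w2 + r v w3 = 0"
      show "section_value E \<nu> v z (sect r v) (?k * ?n r)"
      proof (rule sv[of r, OF r])
        show "?k * ?n r = r v w1 * (- \<epsilon> * br q1 q3 / (br q1 z * br q3 z)) + r v w2 * (- \<epsilon> * br q2 q3 / (br q2 z * br q3 z))"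
          using bz by (simp add: field_simps)
        show "if z \<in> {q1, q2, q3} then diff_residue (dpq q1 q3) z (- \<epsilon> * br q1 q3 / (br q1 z * br q3 z)) \<and>
              diff_residue (dpq q2 q3) z (- \<epsilon> * br q2 q3 / (br q2 z * br q3 z))
            else diff_value (dpq q1 q3) z (- \<epsilon> * br q1 q3 / (br q1 z * br q3 z)) \<and>
              diff_value (dpq q2 q3) z (- \<epsilon> * br q2 q3 / (br q2 z * br q3 z))"
          unfolding \<epsilon>_def using False dpq_value[OF z(1,3)] dpq_value[OF z(2,3)] by simp
      qed
    qed
  qed
  then show ?thesis unfolding q .
qed

text \<open>The coordinates along the component of \<open>v\<close> are linear forms. Faces off
  \<open>v\<close> give zero, and each of the three faces at \<open>v\<close> vanishes at the node
  of the edge which it misses; these nodes are distinct, so the three forms are pairwise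
  independent.\<close>

lemma vertex_param:
  assumes v: "v \<in> V"
  shows "\<exists>A B. (\<forall>i. i \<notin> fc v \<longrightarrow> A i = 0 \<and> B i = 0) \<and> (\<Sum>i\<in>fc v. A i) = 0 \<and> (\<Sum>i\<in>fc v. B i) = 0 \<and>
    (\<forall>i\<in>fc v. \<forall>j\<in>fc v. i \<noteq> j \<longrightarrow> A i * B j - A j * B i \<noteq> 0) \<and>
    (\<forall>w i. {v, w} \<in> E \<longrightarrow> i \<notin> fe v w \<longrightarrow> A i * rep0 (nod v w) + B i * rep1 (nod v w) = 0) \<and>
    (\<forall>z. \<exists>\<kappa>. \<kappa> \<noteq> 0 \<and> (\<forall>i\<le>g. section_value E \<nu> v z (sect (F i) v) (\<kappa> * (A i * rep0 z + B i * rep1 z))))"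
proof -
  obtain a1 a2 a3 w1 w2 w3 s where vs: "fc v = {a1, a2, a3}" "nbrs v = {w1, w2, w3}" "distinct [a1, a2, a3]"
    "distinct [w1, w2, w3]" "s \<noteq> 0"
    "F a1 v w1 = 0" "F a1 v w2 = s" "F a1 v w3 = - s"
    "F a2 v w1 = - s" "F a2 v w2 = 0" "F a2 v w3 = s"
    "F a3 v w1 = s" "F a3 v w2 = - s" "F a3 v w3 = 0"
    "fe v w1 = {a2, a3}" "fe v w2 = {a1, a3}" "fe v w3 = {a1, a2}"
    by (rule vertex_structure[OF v])
  define q1 q2 q3 where q: "q1 = nod v w1" "q2 = nod v w2" "q3 = nod v w3"
  have "inj_on (nod v) {w1, w2, w3}" using nod_inj[OF v] vs(2) by simp
  then have d: "q1 \<noteq> q2" "q1 \<noteq> q3" "q2 \<noteq> q3" using vs(4) unfolding q by (auto simp: inj_on_def)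
  have b: "br q1 q2 \<noteq> 0" "br q1 q3 \<noteq> 0" "br q2 q3 \<noteq> 0" using d by (auto simp: br_eq_0_iff)
  define A where "A i = - (F i v w1 * br q1 q3 * rep1 q2 + F i v w2 * br q2 q3 * rep1 q1)" for i
  define B where "B i = F i v w1 * br q1 q3 * rep0 q2 + F i v w2 * br q2 q3 * rep0 q1" for i
  have n: "A i * rep0 z + B i * rep1 z = F i v w1 * br q1 q3 * br q2 z + F i v w2 * br q2 q3 * br q1 z" for i z
    unfolding A_def B_def br_def[of q2 z] br_def[of q1 z] by (simp add: algebra_simps)
  \<comment> \<open>Pluecker relations between \<open>q1\<close>, \<open>q2\<close> and
    \<open>q3\<close>; they put the third form into the shape of the first two, a multiple of
    \<open>br q3 z\<close>.\<close>
  have pl1: "br q1 q3 * rep1 q2 - br q2 q3 * rep1 q1 = br q1 q2 * rep1 q3" unfolding br_def by (simp add: algebra_simps)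
  have pl0: "br q1 q3 * rep0 q2 - br q2 q3 * rep0 q1 = br q1 q2 * rep0 q3" unfolding br_def by (simp add: algebra_simps)
  have AB1: "A a1 = - (s * br q2 q3 * rep1 q1)" "B a1 = s * br q2 q3 * rep0 q1" unfolding A_def B_def vs by simp_all
  have AB2: "A a2 = s * br q1 q3 * rep1 q2" "B a2 = - (s * br q1 q3 * rep0 q2)" unfolding A_def B_def vs by simp_all
  have AB3: "A a3 = - (s * br q1 q2 * rep1 q3)" "B a3 = s * br q1 q2 * rep0 q3"
    unfolding A_def B_def vs mult.assoc pl1[symmetric] pl0[symmetric] by (simp_all add: algebra_simps)
  have off: "F i v w = 0" if "i \<notin> fc v" "i \<le> g" for i w using that unfolding fc_def by blast
  let ?A = "\<lambda>i. if i \<le> g then A i else 0" let ?B = "\<lambda>i. if i \<le> g then B i else 0"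
  have le: "a1 \<le> g" "a2 \<le> g" "a3 \<le> g" using vs(1) fc_le by blast+
  have dt: "A a1 * B a2 - A a2 * B a1 \<noteq> 0" "A a1 * B a3 - A a3 * B a1 \<noteq> 0" "A a2 * B a3 - A a3 * B a2 \<noteq> 0"
  proof -
    have "A a1 * B a2 - A a2 * B a1 = - (s * s * br q2 q3 * br q1 q3 * br q1 q2)"
      unfolding AB1 AB2 br_def[of q1 q2] by (simp add: algebra_simps)
    then show "A a1 * B a2 - A a2 * B a1 \<noteq> 0" using b vs(5) by simp
    have "A a1 * B a3 - A a3 * B a1 = s * s * br q2 q3 * br q1 q2 * br q1 q3"
      unfolding AB1 AB3 br_def[of q1 q3] by (simp add: algebra_simps)
    then show "A a1 * B a3 - A a3 * B a1 \<noteq> 0" using b vs(5) by simp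
    have "A a2 * B a3 - A a3 * B a2 = - (s * s * br q1 q3 * br q1 q2 * br q2 q3)"
      unfolding AB2 AB3 br_def[of q2 q3] by (simp add: algebra_simps)
    then show "A a2 * B a3 - A a3 * B a2 \<noteq> 0" using b vs(5) by simp
  qed
  have dsym: "A i * B j - A j * B i \<noteq> 0 \<Longrightarrow> A j * B i - A i * B j \<noteq> 0" for i j by auto
  show ?thesis
  proof (rule exI[of _ ?A], rule exI[of _ ?B], intro conjI allI impI ballI)
    show "?A i = 0" "?B i = 0" if "i \<notin> fc v" for i using off[OF that] unfolding A_def B_def by auto
    have "A a1 + A a2 + A a3 = 0" "B a1 + B a2 + B a3 = 0"
      unfolding A_def B_def vs by (simp_all add: algebra_simps)
    then show "(\<Sum>i\<in>fc v. ?A i) = 0" "(\<Sum>i\<in>fc v. ?B i) = 0"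
      unfolding vs(1) using vs(3) le by (simp_all add: add.assoc)
    show "?A i * ?B j - ?A j * ?B i \<noteq> 0" if ij: "i \<in> fc v" "j \<in> fc v" "i \<noteq> j" for i j
    proof -
      have "A i * B j - A j * B i \<noteq> 0" using ij dt dsym unfolding vs(1) by blast
      then show ?thesis using fc_le[OF ij(1)] fc_le[OF ij(2)] by simp
    qed
    show "?A i * rep0 (nod v w) + ?B i * rep1 (nod v w) = 0" if w: "{v, w} \<in> E" "i \<notin> fe v w" for w i
    proof (cases "i \<le> g")
      case True
      have z: "br p p = 0" for p :: "'k option" by (simp add: br_eq_0_iff)
      have F0: "F i v w = 0" using w(2) True unfolding fe_def by blast
      consider "w = w1" | "w = w2" | "w = w3" using w(1) vs(2) unfolding nbrs_def by blast
      then have "A i * rep0 (nod v w) + B i * rep1 (nod v w) = 0"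
      proof cases
        case 1 then show ?thesis unfolding n using F0 z by (simp add: q)
      next
        case 2 then show ?thesis unfolding n using F0 z by (simp add: q)
      next
        case 3
        have "F i v w1 + F i v w2 = 0" using F_sum_zero[OF True v] vs(2,4) F0 3 by (simp add: add.assoc)
        then have "F i v w2 = - F i v w1" by (simp add: eq_neg_iff_add_eq_0 add.commute)
        then show ?thesis unfolding n 3 q[symmetric] by (simp add: algebra_simps)
      qed
      then show ?thesis using True by simp
    qed simp
    show "\<exists>\<kappa>. \<kappa> \<noteq> 0 \<and> (\<forall>i\<le>g. section_value E \<nu> v z (sect (F i) v) (\<kappa> * (?A i * rep0 z + ?B i * rep1 z)))" for z
    proof -
      obtain \<kappa> where \<kappa>: "\<kappa> \<noteq> 0" "\<And>r. r v w1 + r v w2 + r v w3 = 0 \<Longrightarrow>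
        section_value E \<nu> v z (sect r v) (\<kappa> * (r v w1 * br q1 q3 * br q2 z + r v w2 * br q2 q3 * br q1 z))"
        using sect_value[OF v vs(2,4), of z, folded q] by blast
      have "section_value E \<nu> v z (sect (F i) v) (\<kappa> * (?A i * rep0 z + ?B i * rep1 z))" if i: "i \<le> g" for i
      proof -
        have "F i v w1 + F i v w2 + F i v w3 = 0" using F_sum_zero[OF i v] vs(2,4) by (simp add: add.assoc)
        from \<kappa>(2)[of "F i", OF this] show ?thesis using i by (simp add: n)
      qed
      then show ?thesis using \<kappa>(1) by blast
    qed
  qed
qed

lemma sect_residue:
  assumes v: "v \<in> V" and r: "(\<Sum>w\<in>nbrs v. r v w) = 0"
  shows "w \<in> nbrs v \<Longrightarrow> diff_residue (sect r v) (nod v w) (r v w)"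
    "z \<notin> nod v ` nbrs v \<Longrightarrow> \<exists>c. diff_value (sect r v) z c"
proof -
  obtain w1 w2 w3 where N: "nbrs v = {w1, w2, w3}" "distinct [w1, w2, w3]"
    using vertex_structure[OF v] by metis
  have r3: "r v w1 + r v w2 + r v w3 = 0" using r N by (simp add: add.assoc)
  note sq = sect_three[OF v N, of r, OF r3]
  define q1 q2 q3 where q: "q1 = nod v w1" "q2 = nod v w2" "q3 = nod v w3"
  have "inj_on (nod v) {w1, w2, w3}" using nod_inj[OF v] N(1) by simp
  then have d: "q1 \<noteq> q2" "q1 \<noteq> q3" "q2 \<noteq> q3" using N(2) unfolding q by (auto simp: inj_on_def)
  have e: "r v w3 = - r v w1 - r v w2" using r3 by (simp add: eq_neg_iff_add_eq_0 algebra_simps)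
  have "diff_residue (sect r v) z (r v w1 * (of_bool (z = q1) - of_bool (z = q3)) + r v w2 * (of_bool (z = q2) - of_bool (z = q3)))" for z
    unfolding sq q[symmetric] by (intro diff_residue_add diff_residue_scale dpq_residue)
  from this[of q1] this[of q2] this[of q3]
  show "diff_residue (sect r v) (nod v w) (r v w)" if "w \<in> nbrs v"
    using that d e unfolding N(1) q[symmetric] by (auto simp: q[symmetric])
  show "\<exists>c. diff_value (sect r v) z c" if "z \<notin> nod v ` nbrs v"
  proof -
    have z: "z \<noteq> q1" "z \<noteq> q2" "z \<noteq> q3" using that unfolding N(1) q by auto
    show ?thesis unfolding sq q[symmetric]
      using diff_value_add[OF diff_value_scale[OF dpq_value[OF z(1,3)]] diff_value_scale[OF dpq_value[OF z(2,3)]]] by blast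
  qed
qed

lemma flow_nbrs_sum:
  assumes "is_flow V E r" "v \<in> V" shows "(\<Sum>w\<in>nbrs v. r v w) = 0"
proof -
  have "(\<Sum>w\<in>V. r v w) = 0" using assms unfolding is_flow_def by blast
  moreover have "nbrs v \<subseteq> V" using edge_V unfolding nbrs_def by blast
  moreover have "\<forall>w\<in>V - nbrs v. r v w = 0" using assms(1) unfolding is_flow_def nbrs_def by blast
  ultimately show ?thesis using sum.mono_neutral_left[OF finV, of "nbrs v" "r v"] by simp
qed

lemma sect_dualizing: assumes r: "is_flow V E r" shows "sect r \<in> dualizing_sections V E \<nu>"
  unfolding dualizing_sections_def
proof (intro CollectI conjI allI impI ballI)
  show "sect r v = 0" if "v \<notin> V" for v using that unfolding sect_def by simp
  show "\<exists>c. diff_value (sect r v) p c" if "v \<in> V" "p \<notin> \<nu> v ` {e \<in> E. v \<in> e}" for v p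
    using sect_residue(2)[of _ r, OF that(1) flow_nbrs_sum[OF r that(1)]] that(2) unfolding node_set by blast
  fix u v assume e: "{u, v} \<in> E"
  have uv: "u \<in> V" "v \<in> V" "v \<in> nbrs u" "u \<in> nbrs v" using edge_V[OF e] e unfolding nbrs_def by (auto simp: insert_commute)
  have "r v u = - r u v" using r unfolding is_flow_def by blast
  then show "\<exists>ra. diff_residue (sect r u) (\<nu> u {u, v}) ra \<and> diff_residue (sect r v) (\<nu> v {u, v}) (- ra)"
    using sect_residue(1)[of u r, OF uv(1) flow_nbrs_sum[OF r uv(1)] uv(3)]
      sect_residue(1)[of v r, OF uv(2) flow_nbrs_sum[OF r uv(2)] uv(4)]
    unfolding nod_def by (intro exI[of _ "r u v"]) (simp add: insert_commute)
qed

text \<open>The residues at the nodes are antisymmetric by the condition on the two branches. On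
  each component the residue theorem supplies both Kirchhoff's law and the equality with
  \<open>sect r\<close>.\<close>

lemma dualizing_sect:
  assumes h: "h \<in> dualizing_sections V E \<nu>"
  obtains r where "is_flow V E r" "h = sect r"
proof -
  define r where "r u v = (if {u, v} \<in> E then (THE c. diff_residue (h u) (nod u v) c) else 0)" for u v
  have rr: "diff_residue (h u) (nod u v) (r u v)" and anti: "r v u = - r u v" if e: "{u, v} \<in> E" for u v
  proof -
    obtain c where c: "diff_residue (h u) (nod u v) c" "diff_residue (h v) (nod v u) (- c)"
    proof -
      have "\<forall>u v. {u, v} \<in> E \<longrightarrow> (\<exists>r. diff_residue (h u) (\<nu> u {u, v}) r \<and> diff_residue (h v) (\<nu> v {u, v}) (- r))"
        using h unfolding dualizing_sections_def by blast
      then show ?thesis using e that unfolding nod_def insert_commute[of v u] by blast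
    qed
    have 1: "r u v = c" unfolding r_def using e c(1) diff_residue_unique by (auto intro!: the_equality)
    have 2: "r v u = - c" unfolding r_def using e c(2) diff_residue_unique by (auto intro!: the_equality simp: insert_commute)
    show "diff_residue (h u) (nod u v) (r u v)" "r v u = - r u v" using 1 2 c(1) by simp_all
  qed
  have *: "(\<Sum>w\<in>nbrs v. r v w) = 0 \<and> h v = sect r v" if v: "v \<in> V" for v
  proof -
    let ?i = "the_inv_into (nbrs v) (nod v)"
    have i: "?i (nod v w) = w" if "w \<in> nbrs v" for w using the_inv_into_f_f[OF nod_inj[OF v] that] .
    have 1: "diff_residue (h v) z (r v (?i z))" if "z \<in> nod v ` nbrs v" for z
    proof -
      obtain w where w: "w \<in> nbrs v" "z = nod v w" using \<open>z \<in> nod v ` nbrs v\<close> by blast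
      then show ?thesis using rr[of v w] i[OF w(1)] unfolding nbrs_def by simp
    qed
    have 2: "\<exists>c. diff_value (h v) z c" if "z \<notin> nod v ` nbrs v" for z
      using h v that unfolding dualizing_sections_def node_set by blast
    have "h v = (\<Sum>z\<in>nod v ` nbrs v. kfract (r v (?i z)) * polar z)" "(\<Sum>z\<in>nod v ` nbrs v. r v (?i z)) = 0"
      by (rule residue_theorem; use finite_nbrs[OF v] 1 2 in blast)+
    then show ?thesis unfolding sect_def sum.reindex[OF nod_inj[OF v]] using v i by simp
  qed
  have "is_flow V E r"
    unfolding is_flow_def
  proof (intro conjI allI impI ballI)
    show "r y x = - r x y" for x y
    proof (cases "{x, y} \<in> E")
      case True then show ?thesis by (rule anti)
    qed (auto simp: r_def insert_commute)
    show "r x y = 0" if "{x, y} \<notin> E" for x y using that unfolding r_def by simp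
    fix x assume x: "x \<in> V"
    have "nbrs x \<subseteq> V" using edge_V unfolding nbrs_def by blast
    moreover have "\<forall>w\<in>V - nbrs x. r x w = 0" unfolding r_def nbrs_def by simp
    ultimately show "(\<Sum>y\<in>V. r x y) = 0" using sum.mono_neutral_left[OF finV, of "nbrs x" "r x"] *[OF x] by simp
  qed
  moreover have "h = sect r"
  proof
    fix v show "h v = sect r v"
    proof (cases "v \<in> V")
      case False
      then have "h v = 0" using h unfolding dualizing_sections_def by blast
      then show ?thesis using False unfolding sect_def by simp
    qed (use * in blast)
  qed
  ultimately show ?thesis by (rule that)
qed

lemma kfract_sum: "kfract (\<Sum>i\<in>S. f i) = (\<Sum>i\<in>S. kfract (f i))"
  by (induction S rule: infinite_finite_induct) (simp_all add: kfract_simps)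

lemma sect_comb:
  assumes "\<And>x y. r x y = (\<Sum>i\<in>S. c i * F i x y)"
  shows "sect r v = (\<Sum>i\<in>S. kfract (c i) * sect (F i) v)"
proof (cases "v \<in> V")
  case True
  have "sect r v = (\<Sum>w\<in>nbrs v. \<Sum>i\<in>S. kfract (c i) * (kfract (F i v w) * polar (nod v w)))"
    unfolding sect_def using True by (simp add: assms kfract_sum kfract_simps sum_distrib_right mult.assoc)
  also have "\<dots> = (\<Sum>i\<in>S. \<Sum>w\<in>nbrs v. kfract (c i) * (kfract (F i v w) * polar (nod v w)))" by (rule sum.swap)
  also have "\<dots> = (\<Sum>i\<in>S. kfract (c i) * sect (F i) v)"
    unfolding sect_def using True by (simp add: sum_distrib_left)
  finally show ?thesis .
qed (simp add: sect_def)

text \<open>The relation between the faces eliminates face \<open>g\<close>: coefficients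
  \<open>a i\<close> become \<open>a i - a g\<close> on the other faces. Uniqueness follows from
  \<open>kernel_const\<close>, with the coefficient 0 placed at \<open>g\<close>.\<close>

lemma dualizing_basis_sect: "dualizing_basis V E \<nu> g (\<lambda>i. sect (F i))"
  unfolding dualizing_basis_def
proof (intro conjI allI impI ballI)
  show "sect (F i) \<in> dualizing_sections V E \<nu>" if "i < g" for i
    using sect_dualizing[OF F_flow] that by simp
  fix h assume "h \<in> dualizing_sections V E \<nu>"
  then obtain r where r: "is_flow V E r" "h = sect r" using dualizing_sect by metis
  obtain a where a: "\<And>x y. r x y = (\<Sum>i\<le>g. a i * F i x y)" using F_span[OF r(1)] by blast
  have le: "{..g} = insert g {..<g}" by auto
  have a2: "r x y = (\<Sum>i<g. (a i - a g) * F i x y)" for x y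
  proof -
    have "F g x y = - (\<Sum>i<g. F i x y)" using F_sum[of x y] unfolding le by (simp add: eq_neg_iff_add_eq_0)
    moreover have "r x y = a g * F g x y + (\<Sum>i<g. a i * F i x y)" unfolding a le by simp
    ultimately show ?thesis by (simp add: algebra_simps sum_distrib_left sum_subtractf)
  qed
  let ?c = "restrict (\<lambda>i. a i - a g) {..<g}"
  have main: "(\<forall>v. h v = (\<Sum>i<g. kfract (c i) * sect (F i) v)) \<longleftrightarrow> (\<forall>i<g. c i = a i - a g)" for c
  proof
    assume H: "\<forall>i<g. c i = a i - a g"
    show "\<forall>v. h v = (\<Sum>i<g. kfract (c i) * sect (F i) v)"
      unfolding r(2) using sect_comb[of r "\<lambda>i. a i - a g" "{..<g}", OF a2] H by simp
  next
    assume H: "\<forall>v. h v = (\<Sum>i<g. kfract (c i) * sect (F i) v)"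
    define r' where "r' x y = (\<Sum>i<g. c i * F i x y)" for x y
    have h': "h v = sect r' v" for v using H sect_comb[of r' c "{..<g}" v] unfolding r'_def by simp
    have fl: "is_flow V E r'"
      unfolding is_flow_def
    proof (intro conjI allI impI ballI)
      show "r' y x = - r' x y" for x y unfolding r'_def using F_anti[of _ x y] by (simp add: sum_negf[symmetric])
      show "r' x y = 0" if "{x, y} \<notin> E" for x y unfolding r'_def using F_off[OF _ that] by (intro sum.neutral) simp
      fix x assume x: "x \<in> V"
      have "(\<Sum>y\<in>V. F i x y) = 0" if "i \<le> g" for i using F_flow[OF that] x unfolding is_flow_def by blast
      then show "(\<Sum>y\<in>V. r' x y) = 0"
        unfolding r'_def by (subst sum.swap) (simp add: sum_distrib_left[symmetric])
    qed
    \<comment> \<open>A section remembers its flow as its residues, so equal sections come from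
      equal flows.\<close>
    have eq: "r x y = r' x y" for x y
    proof (cases "{x, y} \<in> E")
      case True
      then have xy: "x \<in> V" "y \<in> nbrs x" using edge_V unfolding nbrs_def by auto
      show ?thesis
        using sect_residue(1)[of x r, OF xy(1) flow_nbrs_sum[OF r(1) xy(1)] xy(2)]
          sect_residue(1)[of x r', OF xy(1) flow_nbrs_sum[OF fl xy(1)] xy(2)] h'[of x] unfolding r(2)
        by (metis diff_residue_unique)
    next
      case False then show ?thesis using r(1) fl unfolding is_flow_def by metis
    qed
    define b where "b i = (if i < g then c i - (a i - a g) else 0)" for i
    have "(\<Sum>i\<le>g. b i * F i x y) = 0" for x y
    proof -
      have "(\<Sum>i\<le>g. b i * F i x y) = (\<Sum>i<g. (c i - (a i - a g)) * F i x y)" unfolding le b_def by simp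
      also have "\<dots> = r' x y - r x y" unfolding r'_def a2 by (simp add: left_diff_distrib sum_subtractf)
      finally show ?thesis using eq by simp
    qed
    then have "b i = b g" if "i \<le> g" for i using kernel_const[of b i g] that by simp
    then show "\<forall>i<g. c i = a i - a g" unfolding b_def by (metis less_imp_le less_irrefl right_minus_eq)
  qed
  show "\<exists>!c. c \<in> extensional {..<g} \<and> (\<forall>v. h v = (\<Sum>i<g. Fract [:c i:] 1 * sect (F i) v))"
    unfolding kfract_def[symmetric] main
  proof (rule ex1I[of _ ?c])
    show "?c \<in> extensional {..<g} \<and> (\<forall>i<g. ?c i = a i - a g)" by simp
    fix c assume c: "c \<in> extensional {..<g} \<and> (\<forall>i<g. c i = a i - a g)"
    show "c = ?c" by (rule extensionalityI[of c "{..<g}"]) (use c in auto)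
  qed
qed

end

section \<open>Homogeneous polynomial functions\<close>

definition mdeg :: "(nat \<Rightarrow>\<^sub>0 nat) \<Rightarrow> nat" where "mdeg m = (\<Sum>i \<in> Poly_Mapping.keys m. Poly_Mapping.lookup m i)"

definition mono_eval :: "(nat \<Rightarrow>\<^sub>0 nat) \<Rightarrow> (nat \<Rightarrow> 'k::comm_ring_1) \<Rightarrow> 'k" where
  "mono_eval m x = (\<Prod>i \<in> Poly_Mapping.keys m. x i ^ Poly_Mapping.lookup m i)"

lemma mdeg_super: "finite S \<Longrightarrow> Poly_Mapping.keys m \<subseteq> S \<Longrightarrow> mdeg m = (\<Sum>i\<in>S. Poly_Mapping.lookup m i)"
  unfolding mdeg_def by (intro sum.mono_neutral_left) (auto simp: in_keys_iff)

lemma mono_eval_super: "finite S \<Longrightarrow> Poly_Mapping.keys m \<subseteq> S \<Longrightarrow> mono_eval m x = (\<Prod>i\<in>S. x i ^ Poly_Mapping.lookup m i)"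
  unfolding mono_eval_def by (intro prod.mono_neutral_left) (auto simp: in_keys_iff)

lemma mdeg_add: "mdeg (a + b) = mdeg a + mdeg b"
proof -
  let ?S = "Poly_Mapping.keys a \<union> Poly_Mapping.keys b"
  have "Poly_Mapping.keys (a + b) \<subseteq> ?S" by (rule Poly_Mapping.keys_add)
  then have "mdeg (a + b) = (\<Sum>i\<in>?S. Poly_Mapping.lookup (a + b) i)" by (intro mdeg_super) auto
  also have "\<dots> = mdeg a + mdeg b"
    by (simp add: lookup_add sum.distrib mdeg_super[of ?S a] mdeg_super[of ?S b])
  finally show ?thesis .
qed

lemma mono_eval_add: "mono_eval (a + b) x = mono_eval a x * mono_eval b x"
proof -
  let ?S = "Poly_Mapping.keys a \<union> Poly_Mapping.keys b"
  have "Poly_Mapping.keys (a + b) \<subseteq> ?S" by (rule Poly_Mapping.keys_add)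
  then have "mono_eval (a + b) x = (\<Prod>i\<in>?S. x i ^ Poly_Mapping.lookup (a + b) i)" by (intro mono_eval_super) auto
  also have "\<dots> = mono_eval a x * mono_eval b x"
    by (simp add: lookup_add power_add prod.distrib mono_eval_super[of ?S a] mono_eval_super[of ?S b])
  finally show ?thesis .
qed

lemma mono_eval_scale: "mono_eval m (\<lambda>i. c * x i) = c ^ mdeg m * mono_eval m x"
  unfolding mono_eval_def mdeg_def by (simp add: power_mult_distrib prod.distrib power_sum)

lemma mpoly_eval_alt: "mpoly_eval F x = (\<Sum>m \<in> Poly_Mapping.keys F. Poly_Mapping.lookup F m * mono_eval m x)"
  unfolding mpoly_eval_def mono_eval_def ..

lemma mpoly_eval_super:
  "finite S \<Longrightarrow> Poly_Mapping.keys F \<subseteq> S \<Longrightarrow> mpoly_eval F x = (\<Sum>m\<in>S. Poly_Mapping.lookup F m * mono_eval m x)"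
  unfolding mpoly_eval_alt by (intro sum.mono_neutral_left) (auto simp: in_keys_iff)

lemma mpoly_eval_add: "mpoly_eval (F + G) x = mpoly_eval F x + mpoly_eval G x"
proof -
  let ?S = "Poly_Mapping.keys F \<union> Poly_Mapping.keys G"
  have "Poly_Mapping.keys (F + G) \<subseteq> ?S" by (rule Poly_Mapping.keys_add)
  then have "mpoly_eval (F + G) x = (\<Sum>m\<in>?S. Poly_Mapping.lookup (F + G) m * mono_eval m x)"
    by (intro mpoly_eval_super) auto
  also have "\<dots> = mpoly_eval F x + mpoly_eval G x"
    by (simp add: lookup_add distrib_right sum.distrib mpoly_eval_super[of ?S F] mpoly_eval_super[of ?S G])
  finally show ?thesis .
qed

lemma mpoly_eval_single: "mpoly_eval (Poly_Mapping.single m c) x = c * mono_eval m x"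
  by (cases "c = 0") (simp_all add: mpoly_eval_alt)

lemma mpoly_eval_zero [simp]: "mpoly_eval 0 x = 0"
  by (simp add: mpoly_eval_alt)

lemma mpoly_eval_sum: "mpoly_eval (\<Sum>a\<in>S. f a) x = (\<Sum>a\<in>S. mpoly_eval (f a) x)"
  by (induction S rule: infinite_finite_induct) (simp_all add: mpoly_eval_add)

lemma poly_mapping_expand: "F = (\<Sum>m\<in>Poly_Mapping.keys F. Poly_Mapping.single m (Poly_Mapping.lookup F m))"
proof (rule poly_mapping_eqI)
  fix k
  have "Poly_Mapping.lookup (\<Sum>m\<in>Poly_Mapping.keys F. Poly_Mapping.single m (Poly_Mapping.lookup F m)) k =
    (\<Sum>m\<in>Poly_Mapping.keys F. if m = k then Poly_Mapping.lookup F m else 0)"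
    by (simp add: lookup_sum lookup_single when_def)
  also have "\<dots> = Poly_Mapping.lookup F k" by (simp add: sum.delta in_keys_iff)
  finally show "Poly_Mapping.lookup F k = Poly_Mapping.lookup (\<Sum>m\<in>Poly_Mapping.keys F. Poly_Mapping.single m (Poly_Mapping.lookup F m)) k" ..
qed

lemma mpoly_eval_mult: "mpoly_eval (F * G) x = mpoly_eval F x * mpoly_eval G x"
proof -
  have "F * G = (\<Sum>m\<in>Poly_Mapping.keys F. \<Sum>n\<in>Poly_Mapping.keys G.
      Poly_Mapping.single (m + n) (Poly_Mapping.lookup F m * Poly_Mapping.lookup G n))"
    by (subst poly_mapping_expand[of F], subst poly_mapping_expand[of G])
       (simp add: sum_product mult_single)
  then have "mpoly_eval (F * G) x = (\<Sum>m\<in>Poly_Mapping.keys F. \<Sum>n\<in>Poly_Mapping.keys G.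
      Poly_Mapping.lookup F m * Poly_Mapping.lookup G n * (mono_eval m x * mono_eval n x))"
    by (simp add: mpoly_eval_sum mpoly_eval_single mono_eval_add)
  also have "\<dots> = mpoly_eval F x * mpoly_eval G x"
    unfolding mpoly_eval_alt by (simp add: sum_product algebra_simps)
  finally show ?thesis .
qed

lemma homogeneous_mdeg: "homogeneous d F \<longleftrightarrow> (\<forall>m\<in>Poly_Mapping.keys F. mdeg m = d)"
  unfolding homogeneous_def mdeg_def ..

definition hpoly :: "nat \<Rightarrow> nat \<Rightarrow> 'k::field mpoly \<Rightarrow> bool" where
  "hpoly N d F \<longleftrightarrow> F \<in> polys_in {..<N} \<and> homogeneous d F"

lemma hpoly_alt: "hpoly N d F \<longleftrightarrow> (\<forall>m\<in>Poly_Mapping.keys F. Poly_Mapping.keys m \<subseteq> {..<N} \<and> mdeg m = d)"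
  unfolding hpoly_def polys_in_def homogeneous_mdeg by auto

lemma hpoly_zero: "hpoly N d 0" unfolding hpoly_alt by simp

lemma hpoly_add: "hpoly N d F \<Longrightarrow> hpoly N d G \<Longrightarrow> hpoly N d (F + G)"
  unfolding hpoly_alt using Poly_Mapping.keys_add[of F G] by blast

lemma hpoly_sum: "(\<And>a. a \<in> S \<Longrightarrow> hpoly N d (f a)) \<Longrightarrow> hpoly N d (\<Sum>a\<in>S. f a)"
  by (induction S rule: infinite_finite_induct) (simp_all add: hpoly_zero hpoly_add)

lemma hpoly_mult: assumes F: "hpoly N d F" and G: "hpoly N e G" shows "hpoly N (d + e) (F * G)"
  unfolding hpoly_alt
proof
  fix m assume "m \<in> Poly_Mapping.keys (F * G)"
  then obtain a b where ab: "m = a + b" "a \<in> Poly_Mapping.keys F" "b \<in> Poly_Mapping.keys G"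
    using Poly_Mapping.keys_mult[of F G] by blast
  then show "Poly_Mapping.keys m \<subseteq> {..<N} \<and> mdeg m = d + e"
    using F G Poly_Mapping.keys_add[of a b] unfolding hpoly_alt by (simp add: mdeg_add) blast
qed

lemma hpoly_single: "Poly_Mapping.keys m \<subseteq> {..<N} \<Longrightarrow> hpoly N (mdeg m) (Poly_Mapping.single m c)"
  unfolding hpoly_alt by (cases "c = 0") auto

lemma hpoly_const: "hpoly N 0 (Poly_Mapping.single 0 c)"
  using hpoly_single[of 0 N c] by (simp add: mdeg_def)

lemma hpoly_power: "hpoly N d F \<Longrightarrow> hpoly N (n * d) (F ^ n)"
proof (induction n)
  case 0
  show ?case using hpoly_const[of N 1] by simp
next
  case (Suc n) then show ?case using hpoly_mult[of N d F "n * d" "F ^ n"] by simp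
qed

lemma hpoly_prod: "(\<And>a. a \<in> S \<Longrightarrow> hpoly N (d a) (f a)) \<Longrightarrow> finite S \<Longrightarrow> hpoly N (\<Sum>a\<in>S. d a) (\<Prod>a\<in>S. f a)"
proof (induction S rule: infinite_finite_induct)
  case empty show ?case using hpoly_const[of N 1] by simp
next
  case (insert a S) then show ?case by (simp add: hpoly_mult)
qed simp

lemma mpoly_eval_one [simp]: "mpoly_eval 1 x = 1"
  using mpoly_eval_single[of 0 1 x] by (simp add: mono_eval_def)

lemma mpoly_eval_power: "mpoly_eval (F ^ n) x = mpoly_eval F x ^ n"
  by (induction n) (simp_all add: mpoly_eval_mult)

lemma mpoly_eval_prod: "mpoly_eval (\<Prod>a\<in>S. f a) x = (\<Prod>a\<in>S. mpoly_eval (f a) x)"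
  by (induction S rule: infinite_finite_induct) (simp_all add: mpoly_eval_mult)

definition mvar :: "nat \<Rightarrow> 'k::field mpoly" where "mvar i = Poly_Mapping.single (Poly_Mapping.single i 1) 1"

lemma mpoly_eval_mvar: "mpoly_eval (mvar i) x = x i"
  unfolding mvar_def mpoly_eval_single by (simp add: mono_eval_def)

lemma hpoly_mvar: "i < N \<Longrightarrow> hpoly N 1 (mvar i)"
  unfolding mvar_def using hpoly_single[of "Poly_Mapping.single i (1::nat)" N 1] by (simp add: mdeg_def)

text \<open>The Zariski topology and regular functions depend on forms only through their values,
  and closure under products and linear substitution is easier to see for functions than for
  coefficient maps.\<close>

definition polyfun :: "nat \<Rightarrow> nat \<Rightarrow> ((nat \<Rightarrow> 'k::field) \<Rightarrow> 'k) \<Rightarrow> bool" where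
  "polyfun N d f \<longleftrightarrow> (\<exists>F. hpoly N d F \<and> (\<forall>x. mpoly_eval F x = f x))"

lemma polyfun_eval: "hpoly N d F \<Longrightarrow> polyfun N d (mpoly_eval F)"
  unfolding polyfun_def by blast

lemma polyfunE:
  assumes "polyfun N d f" obtains F where "hpoly N d F" "f = mpoly_eval F"
  using assms unfolding polyfun_def by (metis ext)

lemma polyfun_add: "polyfun N d f \<Longrightarrow> polyfun N d h \<Longrightarrow> polyfun N d (\<lambda>x. f x + h x)"
  unfolding polyfun_def by (metis hpoly_add mpoly_eval_add)

lemma polyfun_mult: "polyfun N d f \<Longrightarrow> polyfun N e h \<Longrightarrow> polyfun N (d + e) (\<lambda>x. f x * h x)"
  unfolding polyfun_def by (metis hpoly_mult mpoly_eval_mult)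

lemma polyfun_const: "polyfun N 0 (\<lambda>x. c)"
proof -
  have "mpoly_eval (Poly_Mapping.single 0 c) x = c" for x by (simp add: mpoly_eval_single mono_eval_def)
  then show ?thesis unfolding polyfun_def using hpoly_const by blast
qed

lemma polyfun_scale: "polyfun N d f \<Longrightarrow> polyfun N d (\<lambda>x. c * f x)"
  using polyfun_mult[OF polyfun_const[of N c]] by simp

lemma polyfun_var: "i < N \<Longrightarrow> polyfun N 1 (\<lambda>x. x i)"
  unfolding polyfun_def using hpoly_mvar mpoly_eval_mvar by blast

lemma polyfun_zero: "polyfun N d (\<lambda>x. 0)"
  unfolding polyfun_def using hpoly_zero mpoly_eval_zero by blast

lemma polyfun_diff: "polyfun N d f \<Longrightarrow> polyfun N d h \<Longrightarrow> polyfun N d (\<lambda>x. f x - h x)"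
  using polyfun_add[OF _ polyfun_scale[of N d h "-1"]] by simp

lemma polyfun_sum: "(\<And>a. a \<in> S \<Longrightarrow> polyfun N d (f a)) \<Longrightarrow> polyfun N d (\<lambda>x. \<Sum>a\<in>S. f a x)"
  by (induction S rule: infinite_finite_induct) (simp_all add: polyfun_zero polyfun_add)

lemma polyfun_power: "polyfun N d f \<Longrightarrow> polyfun N (n * d) (\<lambda>x. f x ^ n)"
  unfolding polyfun_def by (metis hpoly_power mpoly_eval_power)

lemma polyfun_prod: "finite S \<Longrightarrow> (\<And>a. a \<in> S \<Longrightarrow> polyfun N (d a) (f a)) \<Longrightarrow> polyfun N (\<Sum>a\<in>S. d a) (\<lambda>x. \<Prod>a\<in>S. f a x)"
proof (induction S rule: finite_induct)
  case empty show ?case using polyfun_const[of N 1] by simp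
next
  case (insert a S) then show ?case by (simp add: polyfun_mult)
qed

lemma polyfun_compose:
  assumes "polyfun N d f" "\<And>i. i < N \<Longrightarrow> polyfun M 1 (\<lambda>x. L x i)"
  shows "polyfun M d (\<lambda>x. f (L x))"
proof -
  obtain F where F: "hpoly N d F" "f = mpoly_eval F" using assms(1) by (rule polyfunE)
  have "polyfun M d (\<lambda>x. \<Sum>m\<in>Poly_Mapping.keys F. Poly_Mapping.lookup F m * mono_eval m (L x))"
  proof (intro polyfun_sum polyfun_scale)
    fix m assume "m \<in> Poly_Mapping.keys F"
    then have m: "Poly_Mapping.keys m \<subseteq> {..<N}" "mdeg m = d" using F(1) unfolding hpoly_alt by blast+
    have "polyfun M (\<Sum>i\<in>Poly_Mapping.keys m. Poly_Mapping.lookup m i * 1) (\<lambda>x. \<Prod>i\<in>Poly_Mapping.keys m. L x i ^ Poly_Mapping.lookup m i)"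
      by (intro polyfun_prod polyfun_power assms(2)) (use m in auto)
    then show "polyfun M d (\<lambda>x. mono_eval m (L x))" using m(2) unfolding mono_eval_def mdeg_def by simp
  qed
  then show ?thesis unfolding F(2) mpoly_eval_alt .
qed

lemma polyfun_homog: assumes "polyfun N d f" shows "f (\<lambda>i. c * x i) = c ^ d * f x"
proof -
  obtain F where F: "hpoly N d F" "f = mpoly_eval F" using assms by (rule polyfunE)
  have "f (\<lambda>i. c * x i) = (\<Sum>m\<in>Poly_Mapping.keys F. Poly_Mapping.lookup F m * (c ^ d * mono_eval m x))"
    unfolding F(2) mpoly_eval_alt mono_eval_scale using F(1) unfolding hpoly_alt by (intro sum.cong) auto
  also have "\<dots> = c ^ d * f x" unfolding F(2) mpoly_eval_alt by (simp add: sum_distrib_left algebra_simps)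
  finally show ?thesis .
qed

section \<open>The Zariski topology\<close>

lemma proj_class_self: "x \<in> proj_class x" unfolding proj_class_def by (auto intro: exI[of _ 1])

lemma proj_class_iff: "y \<in> proj_class x \<longleftrightarrow> (\<exists>c. c \<noteq> 0 \<and> y = (\<lambda>i. c * x i))"
  unfolding proj_class_def by auto

lemma proj_class_scale: assumes "c \<noteq> 0" shows "proj_class (\<lambda>i. c * x i) = proj_class x"
proof
  show "proj_class (\<lambda>i. c * x i) \<subseteq> proj_class x"
  proof
    fix y assume "y \<in> proj_class (\<lambda>i. c * x i)"
    then obtain a where "a \<noteq> 0" "y = (\<lambda>i. a * (c * x i))" unfolding proj_class_iff by blast
    then show "y \<in> proj_class x" unfolding proj_class_iff using assms by (intro exI[of _ "a * c"]) (auto simp: mult.assoc)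
  qed
  show "proj_class x \<subseteq> proj_class (\<lambda>i. c * x i)"
  proof
    fix y assume "y \<in> proj_class x"
    then obtain a where "a \<noteq> 0" "y = (\<lambda>i. a * x i)" unfolding proj_class_iff by blast
    then show "y \<in> proj_class (\<lambda>i. c * x i)" unfolding proj_class_iff using assms by (intro exI[of _ "a / c"]) auto
  qed
qed

lemma proj_class_eq: "proj_class x = proj_class y \<longleftrightarrow> (\<exists>c. c \<noteq> 0 \<and> y = (\<lambda>i. c * x i))"
  using proj_class_scale proj_class_self proj_class_iff by metis

definition hvec :: "nat \<Rightarrow> (nat \<Rightarrow> 'k::field) \<Rightarrow> bool" where
  "hvec N x \<longleftrightarrow> (\<forall>i\<ge>N. x i = 0) \<and> (\<exists>i. x i \<noteq> 0)"

lemma proj_space_iff: "p \<in> proj_space N \<longleftrightarrow> (\<exists>x. hvec N x \<and> p = proj_class x)"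
  unfolding proj_space_def hvec_def by auto

lemma proj_space_member: "p \<in> proj_space N \<Longrightarrow> x \<in> p \<Longrightarrow> hvec N x \<and> p = proj_class x"
proof -
  assume "p \<in> proj_space N" "x \<in> p"
  then obtain y where y: "hvec N y" "p = proj_class y" unfolding proj_space_iff by blast
  then obtain c where c: "c \<noteq> 0" "x = (\<lambda>i. c * y i)" using \<open>x \<in> p\<close> unfolding proj_class_iff y(2) by blast
  have "hvec N x" using y(1) c(1) unfolding hvec_def c(2) by auto
  then show ?thesis unfolding y(2) c(2) proj_class_scale[OF c(1)] by blast
qed

lemma polyfun_zero_class:
  assumes "polyfun N d f" "y \<in> proj_class x" shows "f y = 0 \<longleftrightarrow> f x = 0"
  using assms(2) polyfun_homog[OF assms(1)] unfolding proj_class_iff by auto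

definition popen :: "nat \<Rightarrow> ((nat \<Rightarrow> 'k::field) \<Rightarrow> 'k) \<Rightarrow> (nat \<Rightarrow> 'k) set set" where
  "popen N f = {p \<in> proj_space N. \<forall>x\<in>p. f x \<noteq> 0}"

lemma zariski_alt:
  "(zariski N :: (nat \<Rightarrow> 'k::field) set topology) = topology_generated_by {popen N f | f d. polyfun N d f}"
proof -
  have "{{p \<in> proj_space N. \<forall>x\<in>p. mpoly_eval F x \<noteq> (0::'k)} | F d. F \<in> polys_in {..<N} \<and> homogeneous d F} =
    {popen N f | f d. polyfun N d f}"
    unfolding popen_def hpoly_def[symmetric] by (auto elim!: polyfunE intro: polyfun_eval; metis polyfun_eval)
  then show ?thesis unfolding zariski_def by (simp only:)
qed

lemma openin_popen: "polyfun N d f \<Longrightarrow> openin (zariski N) (popen N f)"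
  unfolding zariski_alt by (rule topology_generated_by_Basis) blast

lemma topspace_zariski [simp]: "topspace (zariski N) = proj_space N"
proof -
  have "\<Union>{popen N f | f d. polyfun N d f} \<subseteq> proj_space N" unfolding popen_def by blast
  moreover have "popen N (\<lambda>x. 1) = proj_space N" unfolding popen_def by simp
  then have "proj_space N \<subseteq> \<Union>{popen N f | f d. polyfun N d f}" using polyfun_const[of N 1] by blast
  ultimately show ?thesis unfolding zariski_alt topology_generated_by_topspace by blast
qed

lemma closedin_zero_set:
  assumes "polyfun N d f" shows "closedin (zariski N) {p \<in> proj_space N. \<forall>x\<in>p. f x = 0}"
proof -
  have "{p \<in> proj_space N. \<forall>x\<in>p. f x = 0} = proj_space N - popen N f"
  proof (rule set_eqI)
    fix p
    show "p \<in> {p \<in> proj_space N. \<forall>x\<in>p. f x = 0} \<longleftrightarrow> p \<in> proj_space N - popen N f"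
    proof (cases "p \<in> proj_space N")
      case True
      then obtain x where x: "p = proj_class x" unfolding proj_space_iff by blast
      have "(\<forall>y\<in>p. f y = 0) \<longleftrightarrow> f x = 0" "(\<forall>y\<in>p. f y \<noteq> 0) \<longleftrightarrow> f x \<noteq> 0"
        unfolding x using polyfun_zero_class[OF assms, of _ x] proj_class_self[of x] by blast+
      then show ?thesis using True unfolding popen_def by simp
    qed simp
  qed
  then show ?thesis using openin_popen[OF assms] by (simp add: closedin_def popen_def double_diff)
qed

lemma continuous_to_zariski:
  fixes h :: "'b \<Rightarrow> (nat \<Rightarrow> 'k::field) set"
  assumes "\<And>f d. polyfun N d f \<Longrightarrow> openin T {x \<in> topspace T. h x \<in> popen N f}" "h ` topspace T \<subseteq> proj_space N"
  shows "continuous_map T (zariski N) h"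
  unfolding zariski_alt
proof (rule continuous_on_generated_topo)
  fix U :: "(nat \<Rightarrow> 'k) set set" assume "U \<in> {popen N f | f d. polyfun N d f}"
  then obtain f d where f: "U = popen N f" "polyfun N d f" by blast
  have "h -` U \<inter> topspace T = {x \<in> topspace T. h x \<in> popen N f}" using f by auto
  then show "openin T (h -` U \<inter> topspace T)" using assms(1)[OF f(2)] by simp
next
  have "\<Union>{popen N f | (f :: (nat \<Rightarrow> 'k) \<Rightarrow> 'k) d. polyfun N d f} = proj_space N"
    using topspace_zariski[of N] unfolding zariski_alt topology_generated_by_topspace by simp
  then show "h ` topspace T \<subseteq> \<Union>{popen N f | f d. polyfun N d f}" using assms(2) by (simp only:)
qed

section \<open>The projective line\<close>

definition vec2 :: "'k \<Rightarrow> 'k \<Rightarrow> nat \<Rightarrow> 'k::field" where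
  "vec2 a b = (\<lambda>i. if i = 0 then a else if i = 1 then b else 0)"

lemma hvec2_iff: "hvec 2 x \<longleftrightarrow> (\<exists>a b. x = vec2 a b \<and> (a \<noteq> 0 \<or> b \<noteq> 0))"
proof
  assume x: "hvec 2 x"
  have "x = vec2 (x 0) (x 1)" unfolding vec2_def
  proof
    fix i show "x i = (if i = 0 then x 0 else if i = 1 then x 1 else 0)"
      using x unfolding hvec_def by (cases "i = 0"; cases "i = 1") auto
  qed
  moreover then have "x 0 \<noteq> 0 \<or> x 1 \<noteq> 0" using x unfolding hvec_def vec2_def by metis
  ultimately show "\<exists>a b. x = vec2 a b \<and> (a \<noteq> 0 \<or> b \<noteq> 0)" by blast
next
  assume "\<exists>a b. x = vec2 a b \<and> (a \<noteq> 0 \<or> b \<noteq> 0)"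
  then show "hvec 2 x" unfolding hvec_def vec2_def by auto
qed

fun unrep :: "'k::field \<Rightarrow> 'k \<Rightarrow> 'k option" where "unrep a b = (if a = 0 then None else Some (b / a))"

lemma p1_point_unrep: "a \<noteq> 0 \<or> b \<noteq> 0 \<Longrightarrow> p1_point (unrep a b) = proj_class (vec2 a b)"
proof -
  assume ab: "a \<noteq> 0 \<or> b \<noteq> 0"
  show ?thesis
  proof (cases "a = 0")
    case True
    have "(\<lambda>i. b * ((\<lambda>_. 0)(1 := 1)) i) = vec2 a b" using True by (auto simp: vec2_def)
    then show ?thesis using proj_class_scale[of b "(\<lambda>_. 0)(1 := 1)"] ab True by simp
  next
    case False
    have "(\<lambda>i. a * ((\<lambda>_. 0)(0 := 1, 1 := b / a)) i) = vec2 a b" using False by (auto simp: vec2_def)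
    then show ?thesis using proj_class_scale[of a "(\<lambda>_. 0)(0 := 1, 1 := b / a)"] False by simp
  qed
qed

lemma p1_point_inj: "p1_point p = p1_point q \<Longrightarrow> p = q"
proof -
  assume e: "p1_point p = p1_point q"
  show ?thesis
  proof (cases p)
    case p: None
    show ?thesis
    proof (cases q)
      case (Some b)
      obtain c where c: "c \<noteq> 0" "((\<lambda>_. 0)(0 := 1, 1 := b)) = (\<lambda>i. c * ((\<lambda>_. 0)(1 := 1)) (i::nat))"
        using e[unfolded p Some p1_point.simps proj_class_eq] by (elim exE conjE) (rule that)
      from fun_cong[OF c(2), of 0] show ?thesis by simp
    qed (use p in simp)
  next
    case p: (Some a)
    show ?thesis
    proof (cases q)
      case None
      obtain c where c: "c \<noteq> 0" "((\<lambda>_. 0)(1 := 1)) = (\<lambda>i. c * ((\<lambda>_. 0)(0 := 1, 1 := a)) (i::nat))"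
        using e[unfolded p None p1_point.simps proj_class_eq] by (elim exE conjE) (rule that)
      from fun_cong[OF this(2), of 0] c(1) show ?thesis by simp
    next
      case (Some b)
      obtain c where c: "c \<noteq> 0" "((\<lambda>_. 0)(0 := 1, 1 := b)) = (\<lambda>i. c * ((\<lambda>_. 0)(0 := 1, 1 := a)) (i::nat))"
        using e[unfolded p Some p1_point.simps proj_class_eq] by (elim exE conjE) (rule that)
      show ?thesis using fun_cong[OF c(2), of 0] fun_cong[OF c(2), of 1] p Some by simp
    qed
  qed
qed

lemma p1_point_range: "range (p1_point :: 'k::field option \<Rightarrow> _) = proj_space 2"
proof
  show "range (p1_point :: 'k option \<Rightarrow> _) \<subseteq> proj_space 2"
  proof
    fix P :: "(nat \<Rightarrow> 'k) set" assume "P \<in> range p1_point"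
    then obtain p :: "'k option" where p: "P = p1_point p" by blast
    have h: "hvec 2 ((\<lambda>_. 0)(1 := 1) :: nat \<Rightarrow> 'k)" "hvec 2 ((\<lambda>_. 0)(0 := 1, 1 := a) :: nat \<Rightarrow> 'k)" for a
      unfolding hvec_def by (auto intro: exI[of _ 1] exI[of _ 0])
    show "P \<in> proj_space 2"
      unfolding p proj_space_iff by (cases p) (use h in \<open>auto simp del: fun_upd_apply\<close>)
  qed
  show "proj_space 2 \<subseteq> range (p1_point :: 'k option \<Rightarrow> _)"
    unfolding proj_space_iff hvec2_iff subset_iff using p1_point_unrep by (metis rangeI)
qed

lemma openin_p1:
  fixes U :: "'k::field option set"
  shows "openin p1_top U \<longleftrightarrow> openin (zariski 2) (p1_point ` U)"
proof
  assume "openin p1_top U"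
  then obtain W where W: "openin (zariski 2) W" "U = p1_point -` W \<inter> UNIV"
    unfolding p1_top_def openin_pullback_topology by blast
  have "W \<subseteq> proj_space 2" using openin_subset[OF W(1)] by simp
  then have "W \<subseteq> range p1_point" unfolding p1_point_range .
  then have "p1_point ` U = W" unfolding W(2) by (simp add: image_vimage_eq Int_absorb2)
  then show "openin (zariski 2) (p1_point ` U)" using W by simp
next
  assume o: "openin (zariski 2) (p1_point ` U)"
  have "inj (p1_point :: 'k option \<Rightarrow> _)" using p1_point_inj by (rule injI)
  then have "U = p1_point -` (p1_point ` U) \<inter> UNIV" by (simp add: inj_vimage_image_eq)
  then show "openin p1_top U" unfolding p1_top_def openin_pullback_topology using o by blast
qed

lemma topspace_p1 [simp]: "topspace p1_top = UNIV"
proof -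
  have "openin p1_top UNIV" unfolding openin_p1 p1_point_range by (metis openin_topspace topspace_zariski)
  then show ?thesis using openin_subset by blast
qed

lemma continuous_to_p1:
  fixes h :: "'b \<Rightarrow> 'k::field option"
  assumes "continuous_map T (zariski 2) (\<lambda>x. p1_point (h x))" shows "continuous_map T p1_top h"
  unfolding continuous_map_def
proof (intro conjI allI impI)
  show "h \<in> topspace T \<rightarrow> topspace p1_top" by simp
  fix U :: "'k option set" assume "openin p1_top U"
  then have "openin (zariski 2) (p1_point ` U)" by (simp add: openin_p1)
  then have "openin T {x \<in> topspace T. p1_point (h x) \<in> p1_point ` U}"
    using assms unfolding continuous_map_def by blast
  moreover have "p1_point (h x) \<in> p1_point ` U \<longleftrightarrow> h x \<in> U" for x using p1_point_inj by auto
  ultimately show "openin T {x \<in> topspace T. h x \<in> U}" by simp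
qed

lemma regular_on_alt:
  "regular_on N Z U f \<longleftrightarrow> (\<forall>p\<in>U. \<exists>W a b d. p \<in> W \<and> W \<subseteq> U \<and> openin (subtopology (zariski N) Z) W \<and>
     polyfun N d a \<and> polyfun N d b \<and> (\<forall>q\<in>W. \<forall>x\<in>q. b x \<noteq> 0 \<and> f q = a x / b x))" (is "?L \<longleftrightarrow> ?R")
proof -
  have "(\<exists>W F G d. p \<in> W \<and> W \<subseteq> U \<and> openin (subtopology (zariski N) Z) W \<and>
        F \<in> polys_in {..<N} \<and> G \<in> polys_in {..<N} \<and> homogeneous d F \<and> homogeneous d G \<and>
        (\<forall>q\<in>W. \<forall>x\<in>q. mpoly_eval G x \<noteq> 0 \<and> f q = mpoly_eval F x / mpoly_eval G x)) \<longleftrightarrow>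
    (\<exists>W a b d. p \<in> W \<and> W \<subseteq> U \<and> openin (subtopology (zariski N) Z) W \<and>
     polyfun N d a \<and> polyfun N d b \<and> (\<forall>q\<in>W. \<forall>x\<in>q. b x \<noteq> 0 \<and> f q = a x / b x))" (is "?A \<longleftrightarrow> ?B") for p
  proof
    assume ?A
    then obtain W F G d where W: "p \<in> W" "W \<subseteq> U" "openin (subtopology (zariski N) Z) W"
        "F \<in> polys_in {..<N}" "G \<in> polys_in {..<N}" "homogeneous d F" "homogeneous d G"
        "\<forall>q\<in>W. \<forall>x\<in>q. mpoly_eval G x \<noteq> 0 \<and> f q = mpoly_eval F x / mpoly_eval G x"
      by (elim exE conjE)
    have "polyfun N d (mpoly_eval F)" "polyfun N d (mpoly_eval G)"
      using W(4-7) by (simp_all add: polyfun_eval hpoly_def)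
    then show ?B using W(1-3,8) by (intro exI conjI)
  next
    assume ?B
    then obtain W a b d where W: "p \<in> W" "W \<subseteq> U" "openin (subtopology (zariski N) Z) W"
        "polyfun N d a" "polyfun N d b" "\<forall>q\<in>W. \<forall>x\<in>q. b x \<noteq> 0 \<and> f q = a x / b x"
      by (elim exE conjE)
    obtain F where F: "hpoly N d F" "a = mpoly_eval F" using W(4) by (rule polyfunE)
    obtain G where G: "hpoly N d G" "b = mpoly_eval G" using W(5) by (rule polyfunE)
    show ?A using W(1-3,6) F G unfolding hpoly_def F(2) G(2) by (elim conjE, intro exI conjI)
  qed
  then show ?thesis unfolding regular_on_def by (simp only:)
qed

lemma p1_point_rv:
  fixes p :: "'k::field option"
  shows "p1_point p = proj_class (vec2 (rep0 p) (rep1 p))"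
proof (cases p)
  case None
  have "vec2 0 (1::'k) = ((\<lambda>_. 0)(1 := 1))" by (auto simp: vec2_def)
  then show ?thesis unfolding None p1_point.simps rep0.simps rep1.simps by (simp only:)
next
  case (Some a)
  have "vec2 1 a = ((\<lambda>_. 0)(0 := 1, 1 := a))" by (auto simp: vec2_def)
  then show ?thesis unfolding Some p1_point.simps rep0.simps rep1.simps by (simp only:)
qed

lemma rep_nonzero: "rep0 p \<noteq> 0 \<or> rep1 p \<noteq> (0::'k::field)" by (cases p) auto

lemma hvec_rep: "hvec 2 (vec2 (rep0 p) (rep1 p))" unfolding hvec2_iff using rep_nonzero by blast

lemma p1_point_member: "x \<in> p1_point p \<Longrightarrow> hvec 2 x \<and> p1_point p = proj_class x"
  using proj_space_member p1_point_range by blast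

text \<open>Fixes for every vertex the linear forms obtained in \<open>vertex_param\<close>, which
  turns the geometry of the components into linear algebra with \<open>A\<close> and
  \<open>B\<close>.\<close>

locale param_system = curve_system V E g F \<nu>
  for V :: "'v set" and E g and F :: "nat \<Rightarrow> 'v \<Rightarrow> 'v \<Rightarrow> 'k::alg_closed_field" and \<nu> +
  fixes A B :: "'v \<Rightarrow> nat \<Rightarrow> 'k"
  assumes par_off: "v \<in> V \<Longrightarrow> i \<notin> fc v \<Longrightarrow> A v i = 0 \<and> B v i = 0"
    and par_sum: "v \<in> V \<Longrightarrow> (\<Sum>i\<in>fc v. A v i) = 0 \<and> (\<Sum>i\<in>fc v. B v i) = 0"
    and par_det: "v \<in> V \<Longrightarrow> i \<in> fc v \<Longrightarrow> j \<in> fc v \<Longrightarrow> i \<noteq> j \<Longrightarrow> A v i * B v j - A v j * B v i \<noteq> 0"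
    and par_node: "v \<in> V \<Longrightarrow> {v, w} \<in> E \<Longrightarrow> i \<notin> fe v w \<Longrightarrow> A v i * rep0 (nod v w) + B v i * rep1 (nod v w) = 0"
    and par_val: "v \<in> V \<Longrightarrow> \<exists>\<kappa>. \<kappa> \<noteq> 0 \<and> (\<forall>i\<le>g. section_value E \<nu> v z (sect (F i) v) (\<kappa> * (A v i * rep0 z + B v i * rep1 z)))"
begin

section \<open>The components as lines in projective space\<close>

definition pc :: "'v \<Rightarrow> (nat \<Rightarrow> 'k) \<Rightarrow> nat \<Rightarrow> 'k" where "pc v x = (\<lambda>i. A v i * x 0 + B v i * x 1)"

definition psi :: "'v \<Rightarrow> (nat \<Rightarrow> 'k) \<Rightarrow> nat \<Rightarrow> 'k" where "psi v x = (\<lambda>i. if i < g then pc v x i else 0)"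

text \<open>The coordinate of the outer face \<open>g\<close> is recovered from the relation that all coordinates sum to zero.\<close>

definition ext :: "(nat \<Rightarrow> 'k) \<Rightarrow> nat \<Rightarrow> 'k" where
  "ext X = (\<lambda>i. if i < g then X i else if i = g then - (\<Sum>k<g. X k) else 0)"

definition Psi :: "'v \<Rightarrow> 'k option \<Rightarrow> (nat \<Rightarrow> 'k) set" where
  "Psi v p = proj_class (psi v (vec2 (rep0 p) (rep1 p)))"

text \<open>The line of \<open>v\<close>, given by equations so that it is visibly closed; the
  coordinate of face \<open>g\<close> takes part through \<open>ext\<close>.\<close>

definition Lin :: "'v \<Rightarrow> (nat \<Rightarrow> 'k) set set" where
  "Lin v = {P \<in> proj_space g. \<forall>X\<in>P. \<forall>i\<le>g. i \<notin> fc v \<longrightarrow> ext X i = 0}"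

text \<open>The inverse of \<open>psi v\<close> up to scaling, by Cramer's rule from the coordinates \<open>i\<close> and \<open>j\<close>.\<close>

definition lam :: "'v \<Rightarrow> nat \<Rightarrow> nat \<Rightarrow> (nat \<Rightarrow> 'k) \<Rightarrow> nat \<Rightarrow> 'k" where
  "lam v i j X = vec2 (ext X i * B v j - ext X j * B v i) (A v i * ext X j - A v j * ext X i)"

lemma fc_three: assumes "v \<in> V" "i \<in> fc v" "j \<in> fc v" "i \<noteq> j"
  obtains l where "fc v = {i, j, l}" "l \<noteq> i" "l \<noteq> j"
proof -
  have "card (fc v - {i, j}) = 1"
    using card_Diff_subset[of "{i, j}" "fc v"] card_fc[OF assms(1)] assms(2-4) by simp
  then obtain l where l: "fc v - {i, j} = {l}" by (auto simp: card_1_singleton_iff)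
  then have "fc v = {i, j, l}" "l \<noteq> i" "l \<noteq> j" using assms(2,3) by blast+
  then show ?thesis by (rule that)
qed

lemma fc_two: assumes "v \<in> V" obtains i j where "i \<in> fc v" "j \<in> fc v" "i \<noteq> j" "i < g" "j < g"
proof -
  obtain a b c where abc: "fc v = {a, b, c}" "a \<noteq> b" "a \<noteq> c" "b \<noteq> c" using card_fc[OF assms(1)] card_eq_3_iff by metis
  have m: "a \<in> fc v" "b \<in> fc v" "c \<in> fc v" using abc(1) by simp_all
  have lt: "x < g" if "x \<in> fc v" "x \<noteq> g" for x using fc_le[OF that(1)] that(2) by simp
  show ?thesis
  proof (cases "a = g")
    case True
    have "b \<noteq> g" "c \<noteq> g" using True abc by simp_all
    then show ?thesis by (rule that[OF m(2,3) abc(4) lt[OF m(2)] lt[OF m(3)]])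
  next
    case a: False
    show ?thesis
    proof (cases "b = g")
      case True
      have "c \<noteq> g" using True abc by simp
      then show ?thesis by (rule that[OF m(1,3) abc(3) lt[OF m(1) a] lt[OF m(3)]])
    next
      case False
      show ?thesis by (rule that[OF m(1,2) abc(2) lt[OF m(1) a] lt[OF m(2) False]])
    qed
  qed
qed

lemma atMost_g: "{..g} = insert g {..<g}" by auto

lemma ext_sum: "(\<Sum>i\<le>g. ext X i) = 0"
  unfolding atMost_g by (simp add: ext_def)

lemma ext_scale: "ext (\<lambda>i. c * X i) k = c * ext X k"
  unfolding ext_def by (simp add: sum_distrib_left)

lemma sum_fc: assumes "\<And>i. i \<le> g \<Longrightarrow> i \<notin> S \<Longrightarrow> f i = (0::'k)" "S \<subseteq> {..g}" shows "(\<Sum>i\<le>g. f i) = (\<Sum>i\<in>S. f i)"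
  using assms by (intro sum.mono_neutral_right) auto

lemma fc_atMost: "fc v \<subseteq> {..g}" using fc_le by blast

lemma pc_off: "v \<in> V \<Longrightarrow> i \<notin> fc v \<Longrightarrow> pc v x i = 0"
  unfolding pc_def using par_off by simp

lemma pc_sum: assumes "v \<in> V" shows "(\<Sum>i\<in>fc v. pc v x i) = 0"
  unfolding pc_def using par_sum[OF assms] by (simp add: sum.distrib sum_distrib_right[symmetric])

text \<open>The forms of the faces at \<open>v\<close> sum to zero, so the recovered coordinate is
  the form of face \<open>g\<close>, whether \<open>g\<close> is a face at \<open>v\<close> or
  not.\<close>

lemma ext_psi: assumes "v \<in> V" "i \<le> g" shows "ext (psi v x) i = pc v x i"
proof (cases "i < g")
  case True then show ?thesis unfolding ext_def psi_def by simp
next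
  case False
  then have i: "i = g" using assms by simp
  have "(\<Sum>i\<le>g. pc v x i) = 0"
    using sum_fc[of "fc v" "pc v x"] pc_off[OF assms(1)] fc_atMost pc_sum[OF assms(1)] by simp
  then have "pc v x g + (\<Sum>k<g. pc v x k) = 0" unfolding atMost_g by simp
  then have "pc v x g = - (\<Sum>k<g. pc v x k)" by (simp add: eq_neg_iff_add_eq_0)
  then show ?thesis unfolding i ext_def psi_def by simp
qed

lemma pc_nonzero:
  assumes v: "v \<in> V" "i \<in> fc v" "j \<in> fc v" "i \<noteq> j" and x: "x 0 \<noteq> 0 \<or> x 1 \<noteq> 0"
  shows "pc v x i \<noteq> 0 \<or> pc v x j \<noteq> 0"
proof (rule ccontr)
  assume "\<not> ?thesis"
  then have z: "A v i * x 0 + B v i * x 1 = 0" "A v j * x 0 + B v j * x 1 = 0" unfolding pc_def by simp_all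
  have "(A v i * B v j - A v j * B v i) * x 0 = B v j * (A v i * x 0 + B v i * x 1) - B v i * (A v j * x 0 + B v j * x 1)"
    "(A v i * B v j - A v j * B v i) * x 1 = A v i * (A v j * x 0 + B v j * x 1) - A v j * (A v i * x 0 + B v i * x 1)"
    by (simp_all add: algebra_simps)
  then have "(A v i * B v j - A v j * B v i) * x 0 = 0" "(A v i * B v j - A v j * B v i) * x 1 = 0" unfolding z by simp_all
  then show False using par_det[OF v] x by simp
qed

lemma psi_hvec: assumes "v \<in> V" "hvec 2 x" shows "hvec g (psi v x)"
proof -
  obtain i j where ij: "i \<in> fc v" "j \<in> fc v" "i \<noteq> j" "i < g" "j < g" using fc_two[OF assms(1)] by metis
  obtain a b where "x = vec2 a b" "a \<noteq> 0 \<or> b \<noteq> 0" using assms(2) unfolding hvec2_iff by blast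
  then have "x 0 \<noteq> 0 \<or> x 1 \<noteq> 0" unfolding vec2_def by simp
  then have "pc v x i \<noteq> 0 \<or> pc v x j \<noteq> 0" by (rule pc_nonzero[OF assms(1) ij(1-3)])
  then have "\<exists>k. psi v x k \<noteq> 0" using ij(4,5) unfolding psi_def by metis
  then show ?thesis unfolding hvec_def psi_def by simp
qed

lemma psi_scale: "psi v (\<lambda>i. c * x i) = (\<lambda>i. c * psi v x i)"
  unfolding psi_def pc_def by (auto simp: algebra_simps)

lemma lam_psi:
  assumes v: "v \<in> V" "i \<in> fc v" "j \<in> fc v"
  shows "lam v i j (psi v x) = (\<lambda>k. (A v i * B v j - A v j * B v i) * vec2 (x 0) (x 1) k)"
proof -
  have e: "ext (psi v x) i = pc v x i" "ext (psi v x) j = pc v x j" using ext_psi[OF v(1)] fc_le v(2,3) by blast+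
  show ?thesis unfolding lam_def e by (rule ext) (auto simp: vec2_def pc_def algebra_simps)
qed

text \<open>Cramer's rule recovers the coordinates \<open>i\<close> and \<open>j\<close>; the third
  one follows because both sides lie in the hyperplane of sum zero.\<close>

lemma psi_lam:
  assumes v: "v \<in> V" "i \<in> fc v" "j \<in> fc v" "i \<noteq> j" and X: "\<And>i. i \<ge> g \<Longrightarrow> X i = 0"
    "\<And>k. k \<le> g \<Longrightarrow> k \<notin> fc v \<Longrightarrow> ext X k = 0"
  shows "psi v (lam v i j X) = (\<lambda>k. (A v i * B v j - A v j * B v i) * X k)"
proof -
  define D where "D = A v i * B v j - A v j * B v i"
  obtain l where l: "fc v = {i, j, l}" "l \<noteq> i" "l \<noteq> j" using fc_three[OF v] by metis
  let ?y = "lam v i j X"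
  have i: "pc v ?y i = D * ext X i" unfolding pc_def lam_def vec2_def D_def by (simp add: algebra_simps)
  have j: "pc v ?y j = D * ext X j" unfolding pc_def lam_def vec2_def D_def by (simp add: algebra_simps)
  have p0: "D * ext X i + (D * ext X j + pc v ?y l) = 0"
    using pc_sum[OF v(1), of ?y] l v(4) unfolding i[symmetric] j[symmetric] by simp
  have x0: "ext X i + (ext X j + ext X l) = 0"
    using ext_sum[of X] sum_fc[of "fc v" "ext X", OF X(2) fc_atMost] unfolding l(1) using l(2,3) v(4) by simp
  have "pc v ?y l = (D * ext X i + (D * ext X j + pc v ?y l)) - D * (ext X i + (ext X j + ext X l)) + D * ext X l"
    by (simp add: algebra_simps)
  then have l': "pc v ?y l = D * ext X l" unfolding p0 x0 by simp
  have all: "pc v ?y k = D * ext X k" if "k \<le> g" for k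
  proof (cases "k \<in> fc v")
    case True
    then have "k = i \<or> k = j \<or> k = l" unfolding l(1) by simp
    then show ?thesis using i j l' by (elim disjE) simp_all
  next
    case False then show ?thesis using pc_off[OF v(1) False] X(2)[OF that False] by simp
  qed
  show ?thesis
  proof
    fix k show "psi v ?y k = (A v i * B v j - A v j * B v i) * X k"
    proof (cases "k < g")
      case True
      then show ?thesis using all[of k] unfolding psi_def D_def by (simp add: ext_def)
    next
      case False then show ?thesis using X(1)[of k] unfolding psi_def by simp
    qed
  qed
qed

lemma polyfun_ext: assumes "i \<le> g" shows "polyfun g 1 (\<lambda>X. ext X i)"
proof (cases "i < g")
  case True then show ?thesis using polyfun_var[OF True] unfolding ext_def by simp
next
  case False
  have "polyfun g 1 (\<lambda>X. (-1) * (\<Sum>k<g. X k))" by (intro polyfun_scale polyfun_sum polyfun_var) simp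
  then show ?thesis using False assms unfolding ext_def by simp
qed

lemma polyfun_lam: assumes "i \<le> g" "j \<le> g" "k < 2" shows "polyfun g 1 (\<lambda>X. lam v i j X k)"
proof -
  have "polyfun g 1 (\<lambda>X. B v j * ext X i - B v i * ext X j)" "polyfun g 1 (\<lambda>X. A v i * ext X j - A v j * ext X i)"
    using assms by (intro polyfun_diff polyfun_scale polyfun_ext; simp)+
  then show ?thesis using assms(3) unfolding lam_def vec2_def by (cases "k = 0") (simp_all add: mult.commute)
qed

lemma polyfun_psi: assumes "i < g" shows "polyfun 2 1 (\<lambda>x. psi v x i)"
proof -
  have "polyfun 2 1 (\<lambda>x. A v i * x 0 + B v i * x 1)" by (intro polyfun_add polyfun_scale polyfun_var) simp_all
  then show ?thesis using assms unfolding psi_def pc_def by simp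
qed

lemma Psi_member: assumes "x \<in> p1_point p" shows "Psi v p = proj_class (psi v x)" "psi v x \<in> Psi v p"
proof -
  obtain c where c: "c \<noteq> 0" "x = (\<lambda>i. c * vec2 (rep0 p) (rep1 p) i)"
    using assms unfolding p1_point_rv proj_class_iff by blast
  then have "psi v x = (\<lambda>i. c * psi v (vec2 (rep0 p) (rep1 p)) i)" by (simp add: psi_scale)
  then show "Psi v p = proj_class (psi v x)" unfolding Psi_def using proj_class_scale[OF c(1)] by simp
  then show "psi v x \<in> Psi v p" using proj_class_self by simp
qed

lemma Psi_mem_iff: "X \<in> Psi v p \<Longrightarrow> \<exists>x\<in>p1_point p. X = psi v x"
proof -
  assume "X \<in> Psi v p"
  then obtain c where c: "c \<noteq> 0" "X = (\<lambda>i. c * psi v (vec2 (rep0 p) (rep1 p)) i)"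
    unfolding Psi_def proj_class_iff by blast
  then have "X = psi v (\<lambda>i. c * vec2 (rep0 p) (rep1 p) i)" by (simp add: psi_scale)
  moreover have "(\<lambda>i. c * vec2 (rep0 p) (rep1 p) i) \<in> p1_point p" unfolding p1_point_rv proj_class_iff using c(1) by blast
  ultimately show ?thesis by blast
qed

lemma Psi_proj: "v \<in> V \<Longrightarrow> Psi v p \<in> proj_space g"
  unfolding Psi_def proj_space_iff using psi_hvec hvec_rep by blast

lemma Psi_Lin: assumes "v \<in> V" shows "Psi v p \<in> Lin v"
  unfolding Lin_def
proof (intro CollectI conjI ballI allI impI)
  show "Psi v p \<in> proj_space g" by (rule Psi_proj[OF assms])
  fix X i assume "X \<in> Psi v p" "i \<le> g" "i \<notin> fc v"
  then obtain x where "X = psi v x" using Psi_mem_iff by blast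
  then show "ext X i = 0" using ext_psi[OF assms \<open>i \<le> g\<close>] pc_off[OF assms \<open>i \<notin> fc v\<close>] by simp
qed

lemma lam_class:
  assumes v: "v \<in> V" "i \<in> fc v" "j \<in> fc v" "i \<noteq> j" and X: "X \<in> Psi v p"
  shows "lam v i j X \<in> p1_point p"
proof -
  obtain x where x: "x \<in> p1_point p" "X = psi v x" using Psi_mem_iff[OF X] by blast
  have hx: "hvec 2 x" "p1_point p = proj_class x" using p1_point_member[OF x(1)] by auto
  then have "x = vec2 (x 0) (x 1)" unfolding hvec2_iff by (auto simp: vec2_def)
  then have "lam v i j X = (\<lambda>k. (A v i * B v j - A v j * B v i) * x k)" unfolding x(2) using lam_psi[OF v(1-3)] by metis
  then show ?thesis unfolding hx(2) proj_class_iff using par_det[OF v] by blast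
qed

lemma Psi_inj: assumes "v \<in> V" "Psi v p = Psi v q" shows "p = q"
proof -
  obtain i j where ij: "i \<in> fc v" "j \<in> fc v" "i \<noteq> j" using fc_two[OF assms(1)] by metis
  let ?X = "psi v (vec2 (rep0 p) (rep1 p))"
  have "?X \<in> Psi v p" unfolding Psi_def by (rule proj_class_self)
  then have "lam v i j ?X \<in> p1_point p" "lam v i j ?X \<in> p1_point q"
    using lam_class[OF assms(1) ij] assms(2) by blast+
  then have "p1_point p = p1_point q" using p1_point_member by metis
  then show ?thesis by (rule p1_point_inj)
qed

text \<open>The preimage is read off with \<open>lam\<close>. It is a nonzero vector because
  \<open>psi v\<close> sends it to a nonzero multiple of \<open>X\<close>.\<close>

lemma Lin_Psi:
  assumes v: "v \<in> V" and P: "P \<in> Lin v" obtains p where "P = Psi v p"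
proof -
  obtain i j where ij: "i \<in> fc v" "j \<in> fc v" "i \<noteq> j" using fc_two[OF v] by metis
  obtain X where X: "hvec g X" "P = proj_class X" using P unfolding Lin_def proj_space_iff by blast
  have XP: "X \<in> P" unfolding X(2) by (rule proj_class_self)
  define D where "D = A v i * B v j - A v j * B v i"
  have D: "D \<noteq> 0" unfolding D_def by (rule par_det[OF v ij])
  have "\<And>i. i \<ge> g \<Longrightarrow> X i = 0" "\<And>k. k \<le> g \<Longrightarrow> k \<notin> fc v \<Longrightarrow> ext X k = 0"
    using X(1) XP P unfolding hvec_def Lin_def by blast+
  note pl = psi_lam[OF v ij this]
  define y where "y = lam v i j X"
  have pl': "psi v y = (\<lambda>k. D * X k)" using pl unfolding D_def y_def by simp
  have y: "y = vec2 (y 0) (y 1)" unfolding y_def lam_def by (auto simp: vec2_def)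
  have "y 0 \<noteq> 0 \<or> y 1 \<noteq> 0"
  proof (rule ccontr)
    assume "\<not> ?thesis"
    then have "psi v y = (\<lambda>k. 0)" unfolding psi_def pc_def by auto
    then have "X k = 0" for k using pl' D by (metis mult_eq_0_iff)
    then show False using X(1) unfolding hvec_def by blast
  qed
  then have "p1_point (unrep (y 0) (y 1)) = proj_class y" using p1_point_unrep[of "y 0" "y 1"] y by simp
  then have "y \<in> p1_point (unrep (y 0) (y 1))" using proj_class_self by metis
  then have "Psi v (unrep (y 0) (y 1)) = proj_class (psi v y)" by (rule Psi_member)
  also have "\<dots> = P" unfolding pl' X(2) by (rule proj_class_scale[OF D])
  finally show ?thesis using that by metis
qed

lemma closedin_Lin: "closedin (zariski g) (Lin v)"
proof -
  have "proj_space g - Lin v = (\<Union>i\<in>{..g} - fc v. popen g (\<lambda>X. ext X i))"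
  proof (rule set_eqI)
    fix P
    show "P \<in> proj_space g - Lin v \<longleftrightarrow> P \<in> (\<Union>i\<in>{..g} - fc v. popen g (\<lambda>X. ext X i))"
    proof (cases "P \<in> proj_space g")
      case True
      then obtain X where X: "P = proj_class X" unfolding proj_space_iff by blast
      have e: "(\<forall>Y\<in>P. ext Y i \<noteq> 0) \<longleftrightarrow> ext X i \<noteq> 0" "(\<forall>Y\<in>P. ext Y i = 0) \<longleftrightarrow> ext X i = 0" if "i \<le> g" for i
        unfolding X using polyfun_zero_class[OF polyfun_ext[OF that], of _ X] proj_class_self[of X] by blast+
      have "P \<in> Lin v \<longleftrightarrow> (\<forall>i\<le>g. i \<notin> fc v \<longrightarrow> (\<forall>Y\<in>P. ext Y i = 0))" unfolding Lin_def using True by blast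
      also have "\<dots> \<longleftrightarrow> (\<forall>i\<le>g. i \<notin> fc v \<longrightarrow> ext X i = 0)" using e(2) by simp
      finally have 1: "P \<in> Lin v \<longleftrightarrow> (\<forall>i\<le>g. i \<notin> fc v \<longrightarrow> ext X i = 0)" .
      have "P \<in> (\<Union>i\<in>{..g} - fc v. popen g (\<lambda>X. ext X i)) \<longleftrightarrow> (\<exists>i\<le>g. i \<notin> fc v \<and> (\<forall>Y\<in>P. ext Y i \<noteq> 0))"
        unfolding popen_def using True by auto
      also have "\<dots> \<longleftrightarrow> (\<exists>i\<le>g. i \<notin> fc v \<and> ext X i \<noteq> 0)" using e(1) by (simp cong: conj_cong)
      finally show ?thesis using 1 True by blast
    qed (auto simp: popen_def)
  qed
  moreover have "openin (zariski g) (\<Union>i\<in>{..g} - fc v. popen g (\<lambda>X. ext X i))"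
    by (intro openin_Union) (auto intro!: openin_popen polyfun_ext)
  ultimately show ?thesis unfolding closedin_def by (simp add: Lin_def)
qed

lemma Psi_popen:
  assumes "v \<in> V" "polyfun g d f"
  shows "Psi v p \<in> popen g f \<longleftrightarrow> p1_point p \<in> popen 2 (\<lambda>x. f (psi v x))"
proof -
  have "(\<forall>X\<in>Psi v p. f X \<noteq> 0) \<longleftrightarrow> (\<forall>x\<in>p1_point p. f (psi v x) \<noteq> 0)"
    using Psi_mem_iff Psi_member(2) by blast
  then show ?thesis unfolding popen_def using Psi_proj[OF assms(1)] p1_point_range by blast
qed

lemma Psi_continuous: assumes "v \<in> V" shows "continuous_map p1_top (zariski g) (Psi v)"
proof (rule continuous_to_zariski)
  fix f :: "(nat \<Rightarrow> 'k) \<Rightarrow> 'k" and d assume f: "polyfun g d f"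
  have pf: "polyfun 2 d (\<lambda>x. f (psi v x))" by (rule polyfun_compose[OF f polyfun_psi])
  have sub: "popen 2 (\<lambda>x. f (psi v x)) \<subseteq> range p1_point" unfolding p1_point_range popen_def by blast
  have "p1_point ` {p. Psi v p \<in> popen g f} = popen 2 (\<lambda>x. f (psi v x))"
    unfolding Psi_popen[OF assms f] using sub by blast
  then show "openin p1_top {p \<in> topspace p1_top. Psi v p \<in> popen g f}"
    unfolding openin_p1 using openin_popen[OF pf] by simp
next
  show "Psi v ` topspace p1_top \<subseteq> proj_space g" using Psi_proj[OF assms] by blast
qed

text \<open>With \<open>i\<close> and \<open>j\<close> fixed, the linear forms
  \<open>lam v i j\<close> describe the inverse of \<open>Psi v\<close> on the whole line, so
  \<open>Psi v\<close> is a homeomorphism onto a closed subset.\<close>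

lemma Psi_closed: assumes v: "v \<in> V" and K: "closedin p1_top K" shows "closedin (zariski g) (Psi v ` K)"
proof -
  define inv where "inv P = (SOME p. P = Psi v p)" for P
  have inv: "Psi v (inv P) = P" if P: "P \<in> Lin v" for P
  proof -
    obtain p where "P = Psi v p" using Lin_Psi[OF v P] by metis
    then show ?thesis unfolding inv_def by (metis (mono_tags) someI)
  qed
  have inv2: "inv (Psi v p) = p" for p using inv[OF Psi_Lin[OF v]] Psi_inj[OF v] by blast
  obtain i j where ij: "i \<in> fc v" "j \<in> fc v" "i \<noteq> j" using fc_two[OF v] by metis
  let ?T = "subtopology (zariski g) (Lin v)"
  have tT: "topspace ?T = Lin v" by (auto simp: Lin_def)
  have pos: "p1_point (inv P) \<in> popen 2 f \<longleftrightarrow> P \<in> popen g (\<lambda>X. f (lam v i j X))"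
    if P: "P \<in> Lin v" and f: "polyfun 2 d f" for P f d
  proof -
    obtain X where X: "P = proj_class X" "P \<in> proj_space g" using P unfolding Lin_def proj_space_iff by blast
    have XP: "X \<in> P" unfolding X(1) by (rule proj_class_self)
    have lm: "lam v i j Y \<in> p1_point (inv P)" if "Y \<in> P" for Y
      by (rule lam_class[OF v ij]) (use that inv[OF P] in simp)
    have "p1_point (inv P) \<in> popen 2 f \<longleftrightarrow> f (lam v i j X) \<noteq> 0"
    proof -
      have c: "p1_point (inv P) = proj_class (lam v i j X)" using p1_point_member[OF lm[OF XP]] by simp
      have "p1_point (inv P) \<in> proj_space 2" using p1_point_range by blast
      then have "p1_point (inv P) \<in> popen 2 f \<longleftrightarrow> (\<forall>x\<in>proj_class (lam v i j X). f x \<noteq> 0)"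
        unfolding popen_def c by simp
      also have "\<dots> \<longleftrightarrow> f (lam v i j X) \<noteq> 0"
        using polyfun_zero_class[OF f, of _ "lam v i j X"] proj_class_self[of "lam v i j X"] by blast
      finally show ?thesis .
    qed
    moreover have "P \<in> popen g (\<lambda>X. f (lam v i j X)) \<longleftrightarrow> f (lam v i j X) \<noteq> 0"
    proof -
      have "polyfun g d (\<lambda>X. f (lam v i j X))" by (rule polyfun_compose[OF f]) (use fc_le ij in \<open>blast intro: polyfun_lam\<close>)
      from polyfun_zero_class[OF this, of _ X] show ?thesis
        unfolding popen_def using X proj_class_self[of X] by blast
    qed
    ultimately show ?thesis by simp
  qed
  have "continuous_map ?T p1_top inv"
  proof (rule continuous_to_p1, rule continuous_to_zariski)
    fix f :: "(nat \<Rightarrow> 'k) \<Rightarrow> 'k" and d assume f: "polyfun 2 d f"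
    have pf: "polyfun g d (\<lambda>X. f (lam v i j X))" by (rule polyfun_compose[OF f]) (use fc_le ij in \<open>blast intro: polyfun_lam\<close>)
    have "{P \<in> topspace ?T. p1_point (inv P) \<in> popen 2 f} = popen g (\<lambda>X. f (lam v i j X)) \<inter> Lin v"
      unfolding tT using pos[OF _ f] by blast
    then show "openin ?T {P \<in> topspace ?T. p1_point (inv P) \<in> popen 2 f}"
      using openin_popen[OF pf] unfolding openin_subtopology by blast
  next
    show "(\<lambda>P. p1_point (inv P)) ` topspace ?T \<subseteq> proj_space 2" using p1_point_range by blast
  qed
  then have "closedin ?T {P \<in> topspace ?T. inv P \<in> K}" using K by (rule closedin_continuous_map_preimage)
  moreover have "{P \<in> topspace ?T. inv P \<in> K} = Psi v ` K"
  proof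
    show "{P \<in> topspace ?T. inv P \<in> K} \<subseteq> Psi v ` K"
    proof
      fix P assume "P \<in> {P \<in> topspace ?T. inv P \<in> K}"
      then have "P \<in> Lin v" "inv P \<in> K" unfolding tT by auto
      then show "P \<in> Psi v ` K" using inv by (metis imageI)
    qed
    show "Psi v ` K \<subseteq> {P \<in> topspace ?T. inv P \<in> K}" unfolding tT using inv2 Psi_Lin[OF v] by auto
  qed
  ultimately show ?thesis using closedin_trans_full[OF _ closedin_Lin] by metis
qed

text \<open>In the hyperplane of sum zero a point supported on two coordinates has opposite values
  there, so up to scaling there is only one. A node is recognised in this way from either of its
  components.\<close>

lemma two_support:
  assumes X: "hvec g X" "\<And>i. i \<le> g \<Longrightarrow> i \<notin> {a, b} \<Longrightarrow> ext X i = 0"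
    and Y: "hvec g Y" "\<And>i. i \<le> g \<Longrightarrow> i \<notin> {a, b} \<Longrightarrow> ext Y i = 0"
    and ab: "a \<le> g" "b \<le> g" "a \<noteq> b"
  shows "proj_class X = proj_class Y" "ext X a \<noteq> 0" "ext X b \<noteq> 0"
proof -
  have key: "ext Z b = - ext Z a \<and> ext Z a \<noteq> 0" if Z: "hvec g Z" "\<And>i. i \<le> g \<Longrightarrow> i \<notin> {a, b} \<Longrightarrow> ext Z i = 0" for Z
  proof
    have "(\<Sum>i\<le>g. ext Z i) = (\<Sum>i\<in>{a, b}. ext Z i)" by (rule sum_fc) (use Z(2) ab in auto)
    then have "ext Z a + ext Z b = 0" using ext_sum[of Z] ab(3) by simp
    then show eb: "ext Z b = - ext Z a" by (simp add: eq_neg_iff_add_eq_0 add.commute)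
    show "ext Z a \<noteq> 0"
    proof
      assume "ext Z a = 0"
      then have "ext Z i = 0" if "i \<le> g" for i using Z(2)[OF that] eb by auto
      then have "Z i = 0" if "i < g" for i using that unfolding ext_def by (metis less_imp_le)
      then show False using Z(1) unfolding hvec_def by (metis not_le)
    qed
  qed
  note kX = key[OF X] and kY = key[OF Y]
  show "ext X a \<noteq> 0" "ext X b \<noteq> 0" using kX by simp_all
  define c where "c = ext Y a / ext X a"
  have c: "c \<noteq> 0" unfolding c_def using kX kY by simp
  have "ext Y i = c * ext X i" if "i \<le> g" for i
  proof -
    consider "i = a" | "i = b" | "i \<notin> {a, b}" by blast
    then show ?thesis
    proof cases
      case 1 then show ?thesis unfolding c_def using kX by simp
    next
      case 2 then show ?thesis unfolding c_def using kX kY by simp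
    next
      case 3 then show ?thesis using X(2)[OF that 3] Y(2)[OF that 3] by simp
    qed
  qed
  then have "Y i = c * X i" for i
  proof (cases "i < g")
    case True
    with \<open>\<And>i. i \<le> g \<Longrightarrow> ext Y i = c * ext X i\<close>[of i] show ?thesis by (simp add: ext_def)
  next
    case False then show ?thesis using X(1) Y(1) unfolding hvec_def by simp
  qed
  then have "Y = (\<lambda>i. c * X i)" by blast
  then show "proj_class X = proj_class Y" using proj_class_scale[OF c] by simp
qed

lemma Psi_node_support:
  assumes e: "{v, w} \<in> E" and X: "X \<in> Psi v (nod v w)" "i \<le> g" "i \<notin> fe v w" shows "ext X i = 0"
proof -
  have v: "v \<in> V" using edge_V[OF e] by simp
  obtain c where c: "X = (\<lambda>i. c * psi v (vec2 (rep0 (nod v w)) (rep1 (nod v w))) i)"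
    using X(1) unfolding Psi_def proj_class_iff by blast
  have "pc v (vec2 (rep0 (nod v w)) (rep1 (nod v w))) i = 0"
    using par_node[OF v e X(3)] unfolding pc_def vec2_def by simp
  then show ?thesis unfolding c ext_scale ext_psi[OF v X(2)] by simp
qed

lemma class_support_eq:
  assumes P: "P \<in> proj_space g" and Q: "Q \<in> proj_space g" and ab: "a \<le> g" "b \<le> g" "a \<noteq> b"
    and "\<And>X i. X \<in> P \<Longrightarrow> i \<le> g \<Longrightarrow> i \<notin> {a, b} \<Longrightarrow> ext X i = 0"
    and "\<And>X i. X \<in> Q \<Longrightarrow> i \<le> g \<Longrightarrow> i \<notin> {a, b} \<Longrightarrow> ext X i = 0"
  shows "P = Q" "X \<in> P \<Longrightarrow> ext X a \<noteq> 0" "X \<in> P \<Longrightarrow> ext X b \<noteq> 0"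
proof -
  obtain Y where Y: "hvec g Y" "Q = proj_class Y" using Q unfolding proj_space_iff by blast
  obtain X0 where X0: "hvec g X0" "P = proj_class X0" using P unfolding proj_space_iff by blast
  have YQ: "Y \<in> Q" and XP: "X0 \<in> P" unfolding Y(2) X0(2) by (rule proj_class_self)+
  show "P = Q" unfolding Y(2) X0(2)
    by (rule two_support(1)[OF X0(1) _ Y(1) _ ab]) (use assms(6,7) XP YQ in blast)+
  assume X: "X \<in> P"
  have hX: "hvec g X" using proj_space_member[OF P X] by simp
  show "ext X a \<noteq> 0" "ext X b \<noteq> 0"
    by (rule two_support(2,3)[OF hX _ hX _ ab]; use assms(6) X in blast)+
qed

lemma fe_pair: assumes "{v, w} \<in> E" obtains a b where "fe v w = {a, b}" "a \<noteq> b" "a \<le> g" "b \<le> g"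
  using card_fe[OF assms] card_2_iff fe_le by (metis insertCI)

lemma node_eq: assumes e: "{v, w} \<in> E" shows "Psi v (nod v w) = Psi w (nod w v)"
proof -
  have e': "{w, v} \<in> E" using e by (simp add: insert_commute)
  obtain a b where ab: "fe v w = {a, b}" "a \<noteq> b" "a \<le> g" "b \<le> g" using fe_pair[OF e] by metis
  have ba: "fe w v = {a, b}" using fe_sub(2)[of v w] ab by simp
  show ?thesis
    by (rule class_support_eq(1)[OF Psi_proj[OF edge_V(1)[OF e]] Psi_proj[OF edge_V(2)[OF e]] ab(3,4,2)])
      (use Psi_node_support[OF e] Psi_node_support[OF e'] ab(1) ba in blast)+
qed

text \<open>The nonzero coordinates of a common point belong to common faces. Nonadjacent vertices
  share at most one face, and a single nonzero coordinate contradicts the zero sum; adjacent ones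
  share the two sides of their edge, which leaves the node.\<close>

lemma Lin_Int:
  assumes vw: "v \<in> V" "w \<in> V" "v \<noteq> w" and P: "P \<in> Lin v" "P \<in> Lin w"
  shows "{v, w} \<in> E \<and> P = Psi v (nod v w)"
proof -
  have Pp: "P \<in> proj_space g" using P(1) unfolding Lin_def by blast
  have off: "ext X i = 0" if "X \<in> P" "i \<le> g" "i \<notin> fc v \<inter> fc w" for X i using P that unfolding Lin_def by blast
  have e: "{v, w} \<in> E"
  proof (rule ccontr)
    assume "{v, w} \<notin> E"
    then obtain i where i: "fc v \<inter> fc w \<subseteq> {i}" using card_Int_fc[OF vw] by blast
    obtain X where X: "hvec g X" "P = proj_class X" using Pp unfolding proj_space_iff by blast
    have XP: "X \<in> P" unfolding X(2) by (rule proj_class_self)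
    have z: "ext X k = 0" if "k \<le> g" "k \<noteq> i" for k using off[OF XP that(1)] that(2) i by blast
    have "ext X i = 0"
    proof (cases "i \<le> g")
      case True
      have "(\<Sum>k\<le>g. ext X k) = (\<Sum>k\<in>{i}. ext X k)" by (rule sum_fc) (use z True in auto)
      then show ?thesis using ext_sum[of X] by simp
    next
      case False then show ?thesis unfolding ext_def by simp
    qed
    then have z': "ext X k = 0" if "k \<le> g" for k using z that by metis
    then have "X k = 0" if "k < g" for k using that unfolding ext_def by (metis less_imp_le)
    then show False using X(1) unfolding hvec_def by (metis not_le)
  qed
  obtain a b where ab: "fe v w = {a, b}" "a \<noteq> b" "a \<le> g" "b \<le> g" using fe_pair[OF e] by metis
  have "P = Psi v (nod v w)"
    by (rule class_support_eq(1)[OF Pp Psi_proj[OF vw(1)] ab(3,4,2)])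
      (use off fc_Int_edge[OF e] Psi_node_support[OF e] ab(1) in blast)+
  then show ?thesis using e by blast
qed

lemma glue_iff: "(u, q) \<in> glue E \<nu> (v, p) \<longleftrightarrow> (u = v \<and> q = p) \<or> ({v, u} \<in> E \<and> v \<noteq> u \<and> p = nod v u \<and> q = nod u v) \<or>
   (u = v \<and> (\<exists>e\<in>E. v \<in> e \<and> p = \<nu> v e \<and> q = \<nu> u e))"
proof -
  have "(\<exists>e\<in>E. v \<in> e \<and> u \<in> e \<and> p = \<nu> v e \<and> q = \<nu> u e) \<longleftrightarrow> {v, u} \<in> E \<and> p = nod v u \<and> q = nod u v" if "v \<noteq> u"
  proof
    assume "\<exists>e\<in>E. v \<in> e \<and> u \<in> e \<and> p = \<nu> v e \<and> q = \<nu> u e"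
    then obtain e where e: "e \<in> E" "v \<in> e" "u \<in> e" "p = \<nu> v e" "q = \<nu> u e" by blast
    then obtain a b where "e = {a, b}" using edge_ex by blast
    then have "e = {v, u}" using e(2,3) that by auto
    then show "{v, u} \<in> E \<and> p = nod v u \<and> q = nod u v" using e unfolding nod_def by (simp add: insert_commute)
  next
    assume "{v, u} \<in> E \<and> p = nod v u \<and> q = nod u v"
    then show "\<exists>e\<in>E. v \<in> e \<and> u \<in> e \<and> p = \<nu> v e \<and> q = \<nu> u e"
      unfolding nod_def by (intro bexI[of _ "{v, u}"]) (simp_all add: insert_commute)
  qed
  then show ?thesis unfolding glue_def by (cases "v = u") auto
qed

lemma glue_mem: assumes "(u, q) \<in> glue E \<nu> (v, p)" "v \<in> V" shows "u \<in> V \<and> Psi u q = Psi v p"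
proof -
  consider "u = v" "q = p" | "{v, u} \<in> E" "p = nod v u" "q = nod u v" using assms(1) unfolding glue_iff by blast
  then show ?thesis
  proof cases
    case 2 then show ?thesis using node_eq[OF 2(1)] edge_V[OF 2(1)] by simp
  qed (use assms in simp)
qed

lemma glue_self: "(v, p) \<in> glue E \<nu> (v, p)" unfolding glue_def by simp

text \<open>Away from the nodes classes are single points, and distinct lines meet in nodes only; so
  the classes correspond to the points of the union of the lines.\<close>

lemma glue_eq: assumes "v \<in> V" "u \<in> V" shows "glue E \<nu> (v, p) = glue E \<nu> (u, q) \<longleftrightarrow> Psi v p = Psi u q"
proof
  assume "glue E \<nu> (v, p) = glue E \<nu> (u, q)"
  then have "(v, p) \<in> glue E \<nu> (u, q)" using glue_self by blast
  then show "Psi v p = Psi u q" using glue_mem assms by blast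
next
  assume P: "Psi v p = Psi u q"
  show "glue E \<nu> (v, p) = glue E \<nu> (u, q)"
  proof (cases "v = u")
    case True then show ?thesis using Psi_inj P assms by blast
  next
    case False
    have "Psi v p \<in> Lin v" "Psi v p \<in> Lin u" using Psi_Lin assms P by metis+
    from Lin_Int[OF assms False this] have e: "{v, u} \<in> E" "Psi v p = Psi v (nod v u)" by blast+
    then have p: "p = nod v u" using Psi_inj[OF assms(1)] by blast
    have q: "q = nod u v" using Psi_inj[OF assms(2)] node_eq[OF e(1)] e(2) P by metis
    have 1: "(a, b) \<in> glue E \<nu> (v, p) \<longleftrightarrow> (a, b) = (v, p) \<or> (a, b) = (u, q)" for a b
    proof -
      have "(a, b) \<in> glue E \<nu> (v, p) \<Longrightarrow> (a, b) = (v, p) \<or> (a, b) = (u, q)"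
      proof -
        assume "(a, b) \<in> glue E \<nu> (v, p)"
        then consider "a = v" "b = p" | "{v, a} \<in> E" "p = nod v a" "b = nod a v" unfolding glue_iff by blast
        then show ?thesis
        proof cases
          case 2
          have "a = u" by (rule inj_onD[OF nod_inj[OF assms(1)]]) (use 2 p e in \<open>auto simp: nbrs_def\<close>)
          then show ?thesis using 2 q by simp
        qed simp
      qed
      moreover have "(u, q) \<in> glue E \<nu> (v, p)" unfolding glue_iff using e p q False by blast
      ultimately show ?thesis using glue_self by blast
    qed
    have e': "{u, v} \<in> E" using e by (simp add: insert_commute)
    have 2: "(a, b) \<in> glue E \<nu> (u, q) \<longleftrightarrow> (a, b) = (v, p) \<or> (a, b) = (u, q)" for a b
    proof -
      have "(a, b) \<in> glue E \<nu> (u, q) \<Longrightarrow> (a, b) = (v, p) \<or> (a, b) = (u, q)"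
      proof -
        assume "(a, b) \<in> glue E \<nu> (u, q)"
        then consider "a = u" "b = q" | "{u, a} \<in> E" "q = nod u a" "b = nod a u" unfolding glue_iff by blast
        then show ?thesis
        proof cases
          case 2
          have "a = v" by (rule inj_onD[OF nod_inj[OF assms(2)]]) (use 2 q e' in \<open>auto simp: nbrs_def\<close>)
          then show ?thesis using 2 p by simp
        qed simp
      qed
      moreover have "(v, p) \<in> glue E \<nu> (u, q)" unfolding glue_iff using e' p q False by blast
      ultimately show ?thesis using glue_self by blast
    qed
    show ?thesis
    proof (rule set_eqI)
      fix x :: "'v \<times> 'k option"
      obtain a b where "x = (a, b)" by (cases x)
      then show "x \<in> glue E \<nu> (v, p) \<longleftrightarrow> x \<in> glue E \<nu> (u, q)" using 1 2 by simp
    qed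
  qed
qed

definition phi :: "('v \<times> 'k option) set \<Rightarrow> (nat \<Rightarrow> 'k) set" where
  "phi C = (case (SOME x. x \<in> C) of (v, p) \<Rightarrow> Psi v p)"

lemma phi_glue: assumes "v \<in> V" shows "phi (glue E \<nu> (v, p)) = Psi v p"
proof -
  obtain u q where uq: "(SOME x. x \<in> glue E \<nu> (v, p)) = (u, q)" by (meson surj_pair)
  have "(SOME x. x \<in> glue E \<nu> (v, p)) \<in> glue E \<nu> (v, p)" using glue_self by (rule someI)
  then show ?thesis unfolding phi_def uq using glue_mem[OF _ assms] by simp
qed

lemma topspace_curve: "topspace (graph_curve V E \<nu>) = glue E \<nu> ` (V \<times> UNIV)"
  unfolding graph_curve_def by (simp add: Sigma_def)

lemma phi_range: "phi ` topspace (graph_curve V E \<nu>) = (\<Union>v\<in>V. Lin v)"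
proof -
  have "phi ` topspace (graph_curve V E \<nu>) = (\<Union>v\<in>V. range (Psi v))"
    unfolding topspace_curve using phi_glue by (force simp: image_image)
  also have "\<dots> = (\<Union>v\<in>V. Lin v)"
  proof (rule SUP_cong[OF refl])
    fix v assume v: "v \<in> V"
    show "range (Psi v) = Lin v"
    proof
      show "range (Psi v) \<subseteq> Lin v" using Psi_Lin[OF v] by blast
      show "Lin v \<subseteq> range (Psi v)" using Lin_Psi[OF v] by (metis rangeI subsetI)
    qed
  qed
  finally show ?thesis .
qed

lemma closedin_Z: "closedin (zariski g) (\<Union>v\<in>V. Lin v)"
  using finV closedin_Lin by (intro closedin_Union) auto

lemma phi_continuous: "continuous_map (graph_curve V E \<nu>) (zariski g) phi"
  unfolding continuous_map_def
proof (intro conjI allI impI)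
  show "phi \<in> topspace (graph_curve V E \<nu>) \<rightarrow> topspace (zariski g)"
  proof
    fix x assume "x \<in> topspace (graph_curve V E \<nu>)"
    then have "phi x \<in> (\<Union>v\<in>V. Lin v)" using phi_range by blast
    then show "phi x \<in> topspace (zariski g)" unfolding topspace_zariski Lin_def by blast
  qed
  fix U :: "(nat \<Rightarrow> 'k) set set" assume U: "openin (zariski g) U"
  let ?W = "{x \<in> topspace (graph_curve V E \<nu>). phi x \<in> U}"
  let ?S = "sum_topology (\<lambda>_. p1_top) V :: ('v \<times> 'k option) topology"
  have "openin ?S {x \<in> topspace ?S. glue E \<nu> x \<in> ?W}"
    unfolding openin_sum_topology
  proof (intro conjI ballI)
    show "{x \<in> topspace ?S. glue E \<nu> x \<in> ?W} \<subseteq> Sigma V (topspace \<circ> (\<lambda>_. p1_top))" by auto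
    fix v assume v: "v \<in> V"
    have "{p. (v, p) \<in> {x \<in> topspace ?S. glue E \<nu> x \<in> ?W}} = {p \<in> topspace p1_top. Psi v p \<in> U}"
      using v phi_glue[OF v] by (auto simp: topspace_curve)
    then show "openin p1_top {p. (v, p) \<in> {x \<in> topspace ?S. glue E \<nu> x \<in> ?W}}"
      using openin_continuous_map_preimage[OF Psi_continuous[OF v] U] by simp
  qed
  then show "openin (graph_curve V E \<nu>) ?W"
    unfolding graph_curve_def openin_quotient_topology by auto
qed

text \<open>The image of a closed set is a finite union of sets, one in each line, which are closed
  by \<open>Psi_closed\<close>.\<close>

lemma phi_closed: "closed_map (graph_curve V E \<nu>) (zariski g) phi"
  unfolding closed_map_def
proof (intro allI impI)
  fix C assume C: "closedin (graph_curve V E \<nu>) C"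
  let ?S = "sum_topology (\<lambda>_. p1_top) V :: ('v \<times> 'k option) topology"
  let ?X = "topspace (graph_curve V E \<nu>)"
  have sub: "C \<subseteq> ?X" and op: "openin (graph_curve V E \<nu>) (?X - C)" using C unfolding closedin_def by auto
  have S: "openin ?S {x \<in> topspace ?S. glue E \<nu> x \<in> ?X - C}"
    using op unfolding graph_curve_def openin_quotient_topology by simp
  have cl: "closedin p1_top {p. glue E \<nu> (v, p) \<in> C}" if v: "v \<in> V" for v
  proof -
    have "openin p1_top {p. (v, p) \<in> {x \<in> topspace ?S. glue E \<nu> x \<in> ?X - C}}"
      using S v unfolding openin_sum_topology by blast
    moreover have "{p. (v, p) \<in> {x \<in> topspace ?S. glue E \<nu> x \<in> ?X - C}} = topspace p1_top - {p. glue E \<nu> (v, p) \<in> C}"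
      using v by (auto simp: topspace_curve)
    ultimately show ?thesis unfolding closedin_def by simp
  qed
  have "phi ` C = (\<Union>v\<in>V. Psi v ` {p. glue E \<nu> (v, p) \<in> C})"
  proof
    show "phi ` C \<subseteq> (\<Union>v\<in>V. Psi v ` {p. glue E \<nu> (v, p) \<in> C})"
    proof (rule image_subsetI)
      fix x assume x: "x \<in> C"
      then obtain v p where vp: "v \<in> V" "x = glue E \<nu> (v, p)" using sub unfolding topspace_curve by auto
      then show "phi x \<in> (\<Union>v\<in>V. Psi v ` {p. glue E \<nu> (v, p) \<in> C})" using x phi_glue[OF vp(1)] by blast
    qed
    show "(\<Union>v\<in>V. Psi v ` {p. glue E \<nu> (v, p) \<in> C}) \<subseteq> phi ` C"
    proof (intro UN_least image_subsetI)
      fix v p assume "v \<in> V" "p \<in> {p. glue E \<nu> (v, p) \<in> C}"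
      then show "Psi v p \<in> phi ` C" using phi_glue[of v p] by (intro image_eqI[of _ _ "glue E \<nu> (v, p)"]) simp_all
    qed
  qed
  then show "closedin (zariski g) (phi ` C)"
    using finV Psi_closed cl by (simp only:) (intro closedin_Union; auto)
qed

lemma phi_inj: "inj_on phi (topspace (graph_curve V E \<nu>))"
proof (rule inj_onI)
  fix x y assume "x \<in> topspace (graph_curve V E \<nu>)" "y \<in> topspace (graph_curve V E \<nu>)" and e: "phi x = phi y"
  then obtain v p u q where "v \<in> V" "x = glue E \<nu> (v, p)" "u \<in> V" "y = glue E \<nu> (u, q)" unfolding topspace_curve by auto
  then show "x = y" using e glue_eq phi_glue by simp
qed

lemma phi_homeo: "homeomorphic_map (graph_curve V E \<nu>) (subtopology (zariski g) (\<Union>v\<in>V. Lin v)) phi"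
proof (rule bijective_closed_imp_homeomorphic_map)
  have sub: "(\<Union>v\<in>V. Lin v) \<subseteq> topspace (zariski g)" using closedin_subset[OF closedin_Z] .
  show "continuous_map (graph_curve V E \<nu>) (subtopology (zariski g) (\<Union>v\<in>V. Lin v)) phi"
    using phi_continuous phi_range by (auto simp: continuous_map_in_subtopology)
  show "closed_map (graph_curve V E \<nu>) (subtopology (zariski g) (\<Union>v\<in>V. Lin v)) phi"
    using phi_closed phi_range by (intro closed_map_into_subtopology) auto
  show "phi ` topspace (graph_curve V E \<nu>) = topspace (subtopology (zariski g) (\<Union>v\<in>V. Lin v))"
    using phi_range sub by auto
  show "inj_on phi (topspace (graph_curve V E \<nu>))" by (rule phi_inj)
qed

end

section \<open>Regular functions on the curve and on the union of the lines\<close>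

lemma p1_regular_alt:
  fixes f :: "'k::field option \<Rightarrow> 'k"
  shows "p1_regular S f \<longleftrightarrow> (\<forall>p\<in>S. \<exists>U a b d. p \<in> U \<and> U \<subseteq> S \<and> openin p1_top U \<and> polyfun 2 d a \<and> polyfun 2 d b \<and>
     (\<forall>q\<in>U. \<forall>x\<in>p1_point q. b x \<noteq> 0 \<and> f q = a x / b x))" (is "?L \<longleftrightarrow> ?R")
proof -
  have st: "subtopology (zariski 2) (proj_space 2) = (zariski 2 :: (nat \<Rightarrow> 'k) set topology)"
    by (metis subtopology_topspace topspace_zariski)
  have inj: "inj (p1_point :: 'k option \<Rightarrow> _)" using p1_point_inj by (rule injI)
  show ?thesis
  proof
    assume ?L
    then obtain h where h: "regular_on 2 (proj_space 2) (p1_point ` S) h" "\<And>p. p \<in> S \<Longrightarrow> f p = h (p1_point p)"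
      unfolding p1_regular_def by blast
    show ?R
    proof
      fix p assume p: "p \<in> S"
      from h(1)[unfolded regular_on_alt st, rule_format, OF imageI[OF p]]
      obtain W a b d where W: "p1_point p \<in> W" "W \<subseteq> p1_point ` S" "openin (zariski 2) W"
        "polyfun 2 d a" "polyfun 2 d b" "\<forall>q\<in>W. \<forall>x\<in>q. b x \<noteq> 0 \<and> h q = a x / b x" by (elim exE conjE)
      define U where "U = {q. p1_point q \<in> W}"
      have im: "p1_point ` U = W" using W(2) unfolding U_def by blast
      have US: "U \<subseteq> S"
      proof
        fix q assume "q \<in> U"
        then obtain s where "s \<in> S" "p1_point q = p1_point s" using W(2) unfolding U_def by blast
        then show "q \<in> S" using p1_point_inj by metis
      qed
      have "openin p1_top U" unfolding openin_p1 im by (rule W(3))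
      moreover have "p \<in> U" using W(1) unfolding U_def by simp
      moreover have "b x \<noteq> 0 \<and> f q = a x / b x" if "q \<in> U" "x \<in> p1_point q" for q x
        using W(6) that US h(2)[of q] unfolding U_def by auto
      ultimately show "\<exists>U a b d. p \<in> U \<and> U \<subseteq> S \<and> openin p1_top U \<and> polyfun 2 d a \<and> polyfun 2 d b \<and>
         (\<forall>q\<in>U. \<forall>x\<in>p1_point q. b x \<noteq> 0 \<and> f q = a x / b x)"
        using US W(4,5) by (intro exI[of _ U] exI[of _ a] exI[of _ b] exI[of _ d]) simp
    qed
  next
    assume R: ?R
    define h where "h = (\<lambda>P. f (inv p1_point P))"
    have h: "h (p1_point p) = f p" for p unfolding h_def using inv_f_f[OF inj] by simp
    have "regular_on 2 (proj_space 2) (p1_point ` S) h"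
      unfolding regular_on_alt st
    proof
      fix P assume "P \<in> p1_point ` S"
      then obtain p where p: "p \<in> S" "P = p1_point p" by blast
      from R[rule_format, OF p(1)] obtain U a b d where U: "p \<in> U" "U \<subseteq> S" "openin p1_top U" "polyfun 2 d a" "polyfun 2 d b"
         "\<forall>q\<in>U. \<forall>x\<in>p1_point q. b x \<noteq> 0 \<and> f q = a x / b x" by (elim exE conjE)
      have "P \<in> p1_point ` U" "p1_point ` U \<subseteq> p1_point ` S" using U(1,2) p(2) by blast+
      moreover have "openin (zariski 2) (p1_point ` U)" using U(3) unfolding openin_p1 .
      moreover have "\<forall>q\<in>p1_point ` U. \<forall>x\<in>q. b x \<noteq> 0 \<and> h q = a x / b x" using U(6) by (simp add: h)
      ultimately show "\<exists>W a b d. P \<in> W \<and> W \<subseteq> p1_point ` S \<and> openin (zariski 2) W \<and> polyfun 2 d a \<and> polyfun 2 d b \<and>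
         (\<forall>q\<in>W. \<forall>x\<in>q. b x \<noteq> 0 \<and> h q = a x / b x)"
        using U(4,5) by (intro exI conjI)
    qed
    then show ?L unfolding p1_regular_def using h by metis
  qed
qed

lemma frac_combine:
  fixes n1 n2 :: "'a::field"
  assumes "n1 \<noteq> 0" "n2 \<noteq> 0"
  shows "x / n1 + y / n2 - c = ((x * n2 + n1 * y) - c * (n1 * n2)) / (n1 * n2)"
  using assms by (simp add: field_simps)

context param_system
begin

abbreviation "Z \<equiv> \<Union>v\<in>V. Lin v"

lemma regular_pullback:
  assumes f: "regular_on g Z U f" and v: "v \<in> V"
  shows "p1_regular {p. Psi v p \<in> U} (\<lambda>p. f (Psi v p))"
  unfolding p1_regular_alt
proof
  fix p assume "p \<in> {p. Psi v p \<in> U}"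
  then have "Psi v p \<in> U" by simp
  from f[unfolded regular_on_alt, rule_format, OF this]
  obtain W a b d where W: "Psi v p \<in> W" "W \<subseteq> U" "openin (subtopology (zariski g) Z) W"
    "polyfun g d a" "polyfun g d b" "\<forall>q\<in>W. \<forall>x\<in>q. b x \<noteq> 0 \<and> f q = a x / b x" by (elim exE conjE)
  obtain W0 where W0: "openin (zariski g) W0" "W = W0 \<inter> Z" using W(3) unfolding openin_subtopology by blast
  define T where "T = {q. Psi v q \<in> W}"
  have inZ: "Psi v q \<in> Z" for q using Psi_Lin[OF v] v by blast
  have "T = {q \<in> topspace p1_top. Psi v q \<in> W0}" unfolding T_def W0(2) using inZ by auto
  then have "openin p1_top T" using openin_continuous_map_preimage[OF Psi_continuous[OF v] W0(1)] by simp
  moreover have "polyfun 2 d (\<lambda>x. a (psi v x))" "polyfun 2 d (\<lambda>x. b (psi v x))"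
    by (rule polyfun_compose[OF W(4) polyfun_psi] polyfun_compose[OF W(5) polyfun_psi]; assumption)+
  moreover have "b (psi v x) \<noteq> 0 \<and> f (Psi v q) = a (psi v x) / b (psi v x)" if "q \<in> T" "x \<in> p1_point q" for q x
    using W(6) that(1) Psi_member(2)[OF that(2)] unfolding T_def by blast
  moreover have "p \<in> T" "T \<subseteq> {p. Psi v p \<in> U}" using W(1,2) unfolding T_def by auto
  ultimately show "\<exists>T a b d. p \<in> T \<and> T \<subseteq> {p. Psi v p \<in> U} \<and> openin p1_top T \<and> polyfun 2 d a \<and> polyfun 2 d b \<and>
      (\<forall>q\<in>T. \<forall>x\<in>p1_point q. b x \<noteq> 0 \<and> f (Psi v q) = a x / b x)"
    by (intro exI[of _ T] exI[of _ "\<lambda>x. a (psi v x)"] exI[of _ "\<lambda>x. b (psi v x)"] exI[of _ d]) simp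
qed

text \<open>The face \<open>d\<close> is not at \<open>v\<close>, so its coordinate vanishes on the
  line of \<open>v\<close>. Hence the linear map \<open>lam w a d\<close>, which inverts
  \<open>psi w\<close> on the line of \<open>w\<close>, contracts the line of \<open>v\<close>,
  apart from the zero of coordinate \<open>a\<close>, to the node.\<close>

lemma lam_node:
  assumes e: "{v, w} \<in> E" and X: "X \<in> Q" "Q \<in> Lin v" and a: "a \<in> fe v w" and d: "d \<in> fc w" "d \<notin> fc v" and nz: "ext X a \<noteq> 0"
  shows "lam w a d X \<in> p1_point (nod w v)"
proof -
  have e': "{w, v} \<in> E" using e by (simp add: insert_commute)
  have w: "w \<in> V" using edge_V[OF e] by simp
  have aw: "a \<in> fc w" "a \<noteq> d" using a d fc_Int_edge[OF e] by blast+
  have dg: "d \<le> g" using d(1) fc_le by blast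
  have dX: "ext X d = 0" using X d(2) dg unfolding Lin_def by blast
  let ?X0 = "psi w (vec2 (rep0 (nod w v)) (rep1 (nod w v)))"
  have X0: "?X0 \<in> Psi w (nod w v)" unfolding Psi_def by (rule proj_class_self)
  have dfe: "d \<notin> fe w v" using d(2) fe_sub(1)[of v w] fe_sub(2)[of v w] by blast
  have dX0: "ext ?X0 d = 0" by (rule Psi_node_support[OF e' X0 dg dfe])
  have l0: "lam w a d ?X0 \<in> p1_point (nod w v)" by (rule lam_class[OF w aw(1) d(1) aw(2) X0])
  have hv: "hvec 2 (lam w a d ?X0)" "p1_point (nod w v) = proj_class (lam w a d ?X0)" using p1_point_member[OF l0] by auto
  have aX0: "ext ?X0 a \<noteq> 0"
  proof
    assume "ext ?X0 a = 0"
    then have "lam w a d ?X0 = (\<lambda>_. 0)" unfolding lam_def using dX0 by (auto simp: vec2_def)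
    then show False using hv(1) unfolding hvec_def by simp
  qed
  have "lam w a d X = (\<lambda>k. (ext X a / ext ?X0 a) * lam w a d ?X0 k)"
    unfolding lam_def dX dX0 using aX0 by (auto simp: vec2_def)
  then show ?thesis unfolding hv(2) proj_class_iff using nz aX0 by (intro exI[of _ "ext X a / ext ?X0 a"]) simp
qed

lemma openin_diff_closed:
  assumes "openin (subtopology (zariski g) Z) U" "closedin (zariski g) C"
  shows "openin (subtopology (zariski g) Z) (U - C)"
proof -
  obtain U0 where U0: "openin (zariski g) U0" "U = U0 \<inter> Z" using assms(1) unfolding openin_subtopology by blast
  have "openin (zariski g) (U0 - C)" using U0(1) assms(2) by (rule openin_diff)
  moreover have "U - C = (U0 - C) \<inter> Z" using U0(2) by blast
  ultimately show ?thesis unfolding openin_subtopology by blast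
qed

lemma closedin_Psi_compl:
  assumes "v \<in> V" "openin p1_top T" shows "closedin (zariski g) (Psi v ` (UNIV - T))"
  using assms(2) by (intro Psi_closed[OF assms(1)]) (simp add: closedin_def Diff_Diff_Int)

text \<open>At a node with value \<open>c\<close> the functions on the two branches are combined as
  \<open>f1 + f2 - c\<close>, each extended by \<open>lam\<close> to a quotient of forms on the
  ambient space. By \<open>lam_node\<close> the one belonging to the other branch is constantly
  \<open>c\<close>, so the combination restricts to the given function on each branch.\<close>

lemma regular_glue:
  assumes U: "openin (subtopology (zariski g) Z) U"
    and f: "\<And>v. v \<in> V \<Longrightarrow> p1_regular {p. Psi v p \<in> U} (\<lambda>p. f (Psi v p))"
  shows "regular_on g Z U f"
  unfolding regular_on_alt
proof
  fix P assume PU: "P \<in> U"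
  have UZ: "U \<subseteq> Z" using openin_subset[OF U] by auto
  have loc: "\<exists>T a b d. p \<in> T \<and> openin p1_top T \<and> polyfun 2 d a \<and> polyfun 2 d b \<and>
      (\<forall>q\<in>T. \<forall>x\<in>p1_point q. b x \<noteq> 0 \<and> f (Psi v q) = a x / b x)" if vp: "v \<in> V" "P = Psi v p" for v p
  proof -
    have "p \<in> {p. Psi v p \<in> U}" using PU vp(2) by simp
    from f[OF vp(1), unfolded p1_regular_alt, rule_format, OF this]
    obtain T a b d where "p \<in> T" "openin p1_top T" "polyfun 2 d a" "polyfun 2 d b"
      "\<forall>q\<in>T. \<forall>x\<in>p1_point q. b x \<noteq> 0 \<and> f (Psi v q) = a x / b x" by (elim exE conjE)
    then show ?thesis by (intro exI conjI)
  qed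
  obtain v where v: "v \<in> V" "P \<in> Lin v" using PU UZ by blast
  obtain p where p: "P = Psi v p" using Lin_Psi[OF v] by metis
  obtain T a b d where T: "p \<in> T" "openin p1_top T" "polyfun 2 d a" "polyfun 2 d b"
      "\<forall>q\<in>T. \<forall>x\<in>p1_point q. b x \<noteq> 0 \<and> f (Psi v q) = a x / b x" using loc[OF v(1) p] by (elim exE conjE)
  show "\<exists>W a b d. P \<in> W \<and> W \<subseteq> U \<and> openin (subtopology (zariski g) Z) W \<and> polyfun g d a \<and> polyfun g d b \<and>
     (\<forall>q\<in>W. \<forall>x\<in>q. b x \<noteq> 0 \<and> f q = a x / b x)"
  proof (cases "\<exists>w\<in>V - {v}. P \<in> Lin w")
    case False
    obtain i j where ij: "i \<in> fc v" "j \<in> fc v" "i \<noteq> j" using fc_two[OF v(1)] by metis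
    define C where "C = (\<Union>w\<in>V - {v}. Lin w) \<union> Psi v ` (UNIV - T)"
    have "closedin (zariski g) (\<Union>w\<in>V - {v}. Lin w)" using finV closedin_Lin by (intro closedin_Union) auto
    then have C: "closedin (zariski g) C" unfolding C_def using closedin_Psi_compl[OF v(1) T(2)] by (rule closedin_Un)
    have "P \<notin> Psi v ` (UNIV - T)" using T(1) p Psi_inj[OF v(1)] by blast
    then have PC: "P \<in> U - C" unfolding C_def using PU False by blast
    have pf: "polyfun g d (\<lambda>X. a (lam v i j X))" "polyfun g d (\<lambda>X. b (lam v i j X))"
      by (rule polyfun_compose[OF T(3) polyfun_lam] polyfun_compose[OF T(4) polyfun_lam]; use ij fc_le in blast)+
    have "b (lam v i j X) \<noteq> 0 \<and> f Q = a (lam v i j X) / b (lam v i j X)" if Q: "Q \<in> U - C" "X \<in> Q" for Q X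
    proof -
      have "Q \<in> Lin v" using Q(1) UZ unfolding C_def by blast
      then obtain q where q: "Q = Psi v q" using Lin_Psi[OF v(1)] by metis
      have "q \<in> T" using Q(1) unfolding C_def q by blast
      moreover have "lam v i j X \<in> p1_point q" by (rule lam_class[OF v(1) ij]) (use Q(2) q in simp)
      ultimately show ?thesis using T(5) unfolding q by blast
    qed
    then show ?thesis
      using PC openin_diff_closed[OF U C] pf
      by (intro exI[of _ "U - C"] exI[of _ "\<lambda>X. a (lam v i j X)"] exI[of _ "\<lambda>X. b (lam v i j X)"] exI[of _ d]) simp
  next
    case True
    then obtain w where w: "w \<in> V" "w \<noteq> v" "P \<in> Lin w" by blast
    from Lin_Int[OF v(1) w(1) w(2)[symmetric] v(2) w(3)] have e: "{v, w} \<in> E" and Pn: "P = Psi v (nod v w)" by blast+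
    have e': "{w, v} \<in> E" using e by (simp add: insert_commute)
    have Pn': "P = Psi w (nod w v)" using Pn node_eq[OF e] by simp
    obtain T2 a2 b2 d2 where T2: "nod w v \<in> T2" "openin p1_top T2" "polyfun 2 d2 a2" "polyfun 2 d2 b2"
        "\<forall>q\<in>T2. \<forall>x\<in>p1_point q. b2 x \<noteq> 0 \<and> f (Psi w q) = a2 x / b2 x" using loc[OF w(1) Pn'] by (elim exE conjE)
    have pnod: "p = nod v w" using Pn p Psi_inj[OF v(1)] by blast
    obtain \<alpha> \<beta> where ab: "fe v w = {\<alpha>, \<beta>}" "\<alpha> \<noteq> \<beta>" "\<alpha> \<le> g" "\<beta> \<le> g" using fe_pair[OF e] by metis
    have ab': "fe w v = {\<alpha>, \<beta>}" using fe_sub(2)[of v w] ab by simp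
    have abv: "\<alpha> \<in> fc v" "\<beta> \<in> fc v" "\<alpha> \<in> fc w" "\<beta> \<in> fc w" using ab fe_sub(1)[of v w] ab' fe_sub(1)[of w v] by blast+
    obtain \<gamma> where \<gamma>: "fc v = {\<alpha>, \<beta>, \<gamma>}" "\<gamma> \<noteq> \<alpha>" "\<gamma> \<noteq> \<beta>" using fc_three[OF v(1) abv(1,2) ab(2)] by metis
    obtain \<delta> where \<delta>: "fc w = {\<alpha>, \<beta>, \<delta>}" "\<delta> \<noteq> \<alpha>" "\<delta> \<noteq> \<beta>" using fc_three[OF w(1) abv(3,4) ab(2)] by metis
    have nin: "\<gamma> \<notin> fc w" "\<delta> \<notin> fc v" using fc_Int_edge[OF e] \<gamma> \<delta> ab(1) by blast+
    have gin: "\<gamma> \<in> fc v" "\<delta> \<in> fc w" using \<gamma> \<delta> by simp_all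
    let ?N = "{Q \<in> proj_space g. \<forall>X\<in>Q. ext X \<alpha> = 0}"
    \<comment> \<open>As at a smooth point, but for two lines; in addition the zero set of the
      coordinate \<alpha> is removed, so that \<open>lam_node\<close> applies on both
      branches.\<close>
    define C where "C = (\<Union>u\<in>V - {v, w}. Lin u) \<union> (Psi v ` (UNIV - T) \<union> (Psi w ` (UNIV - T2) \<union> ?N))"
    have "closedin (zariski g) (\<Union>u\<in>V - {v, w}. Lin u)" using finV closedin_Lin by (intro closedin_Union) auto
    then have C: "closedin (zariski g) C" unfolding C_def
      by (intro closedin_Un closedin_Psi_compl[OF v(1) T(2)] closedin_Psi_compl[OF w(1) T2(2)] closedin_zero_set[OF polyfun_ext[OF ab(3)]])
    have 1: "P \<notin> Lin u" if u: "u \<in> V - {v, w}" for u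
    proof
      assume Pu: "P \<in> Lin u"
      have "u \<in> V" "v \<noteq> u" using u by auto
      from Lin_Int[OF v(1) this v(2) Pu] have eu: "{v, u} \<in> E" "P = Psi v (nod v u)" by blast+
      then have "nod v u = nod v w" using Pn Psi_inj[OF v(1)] by metis
      then have "u = w" using inj_onD[OF nod_inj[OF v(1)], of u w] eu(1) e unfolding nbrs_def by simp
      then show False using u by simp
    qed
    have 2: "P \<notin> Psi v ` (UNIV - T)" using T(1) p Psi_inj[OF v(1)] by blast
    have 3: "P \<notin> Psi w ` (UNIV - T2)" using T2(1) Pn' Psi_inj[OF w(1)] by blast
    have 4: "P \<notin> ?N"
    proof
      assume N: "P \<in> ?N"
      obtain X where X: "X \<in> P" using Pn proj_class_self unfolding Psi_def by blast
      have s: "ext Y i = 0" if "Y \<in> P" "i \<le> g" "i \<notin> {\<alpha>, \<beta>}" for Y i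
        using Psi_node_support[OF e] that unfolding Pn[symmetric] ab(1) by blast
      have Pp: "P \<in> proj_space g" using N by simp
      have "ext X \<alpha> \<noteq> 0" by (rule class_support_eq(2)[OF Pp Pp ab(3,4,2) s s X])
      then show False using N X by simp
    qed
    have PC: "P \<in> U - C" unfolding C_def using PU 1 2 3 4 by (simp only: Diff_iff Un_iff UN_iff) blast
    define c where "c = f P"
    let ?a1 = "\<lambda>X. a (lam v \<alpha> \<gamma> X)" let ?b1 = "\<lambda>X. b (lam v \<alpha> \<gamma> X)"
    let ?a2 = "\<lambda>X. a2 (lam w \<alpha> \<delta> X)" let ?b2 = "\<lambda>X. b2 (lam w \<alpha> \<delta> X)"
    have le: "\<gamma> \<le> g" "\<delta> \<le> g" using gin fc_le by blast+
    have pf: "polyfun g d ?a1" "polyfun g d ?b1" "polyfun g d2 ?a2" "polyfun g d2 ?b2"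
      by (rule polyfun_compose[OF T(3) polyfun_lam[OF ab(3) le(1)]] polyfun_compose[OF T(4) polyfun_lam[OF ab(3) le(1)]]
        polyfun_compose[OF T2(3) polyfun_lam[OF ab(3) le(2)]] polyfun_compose[OF T2(4) polyfun_lam[OF ab(3) le(2)]]; assumption)+
    let ?F = "\<lambda>X. (?a1 X * ?b2 X + ?b1 X * ?a2 X) - c * (?b1 X * ?b2 X)" let ?G = "\<lambda>X. ?b1 X * ?b2 X"
    have pF: "polyfun g (d + d2) ?F" by (intro polyfun_diff polyfun_add polyfun_scale polyfun_mult pf)
    have pG: "polyfun g (d + d2) ?G" by (intro polyfun_mult pf)
    have cT: "b x \<noteq> 0 \<and> c = a x / b x" if "x \<in> p1_point (nod v w)" for x
      using T(5) T(1) that unfolding c_def p pnod by blast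
    have cT2: "b2 x \<noteq> 0 \<and> c = a2 x / b2 x" if "x \<in> p1_point (nod w v)" for x
      using T2(5) T2(1) that unfolding c_def Pn' by blast
    have "?G X \<noteq> 0 \<and> f Q = ?F X / ?G X" if Q: "Q \<in> U - C" "X \<in> Q" for Q X
    proof -
      have nN: "Q \<notin> ?N" and nT: "Q \<notin> Psi v ` (UNIV - T)" and nT2: "Q \<notin> Psi w ` (UNIV - T2)"
        and nL: "\<And>u. u \<in> V - {v, w} \<Longrightarrow> Q \<notin> Lin u" using Q(1) unfolding C_def by blast+
      have QZ: "Q \<in> Z" using Q(1) UZ by blast
      then have Qp: "Q \<in> proj_space g" unfolding Lin_def by blast
      have nz: "ext X \<alpha> \<noteq> 0"
      proof
        assume "ext X \<alpha> = 0"
        then have "\<forall>Y\<in>Q. ext Y \<alpha> = 0"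
          using polyfun_zero_class[OF polyfun_ext[OF ab(3)], of _ X] proj_space_member[OF Qp Q(2)] by blast
        then show False using nN Qp by blast
      qed
      have "Q \<in> Lin v \<or> Q \<in> Lin w" using QZ nL by blast
      then have "?b1 X \<noteq> 0 \<and> ?b2 X \<noteq> 0 \<and> f Q = ?a1 X / ?b1 X + ?a2 X / ?b2 X - c"
      proof
        assume Qv: "Q \<in> Lin v"
        then obtain q where q: "Q = Psi v q" using Lin_Psi[OF v(1)] by metis
        have qT: "q \<in> T" using nT q by blast
        have "lam v \<alpha> \<gamma> X \<in> p1_point q" by (rule lam_class[OF v(1) abv(1) gin(1) \<gamma>(2)[symmetric]]) (use Q(2) q in simp)
        then have 1: "?b1 X \<noteq> 0 \<and> f Q = ?a1 X / ?b1 X" using T(5) qT unfolding q by blast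
        have "lam w \<alpha> \<delta> X \<in> p1_point (nod w v)" by (rule lam_node[OF e Q(2) Qv _ gin(2) nin(2) nz]) (simp add: ab(1))
        from cT2[OF this] 1 show ?thesis by simp
      next
        assume Qw: "Q \<in> Lin w"
        then obtain q where q: "Q = Psi w q" using Lin_Psi[OF w(1)] by metis
        have qT: "q \<in> T2" using nT2 q by blast
        have "lam w \<alpha> \<delta> X \<in> p1_point q" by (rule lam_class[OF w(1) abv(3) gin(2) \<delta>(2)[symmetric]]) (use Q(2) q in simp)
        then have 1: "?b2 X \<noteq> 0 \<and> f Q = ?a2 X / ?b2 X" using T2(5) qT unfolding q by blast
        have "lam v \<alpha> \<gamma> X \<in> p1_point (nod v w)" by (rule lam_node[OF e' Q(2) Qw _ gin(1) nin(1) nz]) (simp add: ab'(1))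
        from cT[OF this] 1 show ?thesis by simp
      qed
      then show ?thesis using frac_combine[of "?b1 X" "?b2 X" "?a1 X" "?a2 X" c] by simp
    qed
    then show ?thesis
      using PC openin_diff_closed[OF U C] pF pG
      by (intro exI[of _ "U - C"] exI[of _ ?F] exI[of _ ?G] exI[of _ "d + d2"]) simp
  qed
qed

lemma phi_closed_embedding: "closed_embedding V E \<nu> g phi"
  unfolding closed_embedding_def Let_def phi_range
proof (intro conjI allI impI)
  show "closedin (zariski g) Z" by (rule closedin_Z)
  show "homeomorphic_map (graph_curve V E \<nu>) (subtopology (zariski g) Z) phi" by (rule phi_homeo)
  fix U f assume U: "openin (subtopology (zariski g) Z) U"
  have cr: "curve_regular V E \<nu> {x \<in> topspace (graph_curve V E \<nu>). phi x \<in> U} (f \<circ> phi) \<longleftrightarrow>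
    (\<forall>v\<in>V. p1_regular {p. Psi v p \<in> U} (\<lambda>p. f (Psi v p)))"
    unfolding curve_regular_def
  proof (rule ball_cong[OF refl])
    fix v assume v: "v \<in> V"
    have "{p. glue E \<nu> (v, p) \<in> {x \<in> topspace (graph_curve V E \<nu>). phi x \<in> U}} = {p. Psi v p \<in> U}"
      using v phi_glue[OF v] by (auto simp: topspace_curve)
    moreover have "(\<lambda>p. (f \<circ> phi) (glue E \<nu> (v, p))) = (\<lambda>p. f (Psi v p))" using phi_glue[OF v] by simp
    ultimately show "p1_regular {p. glue E \<nu> (v, p) \<in> {x \<in> topspace (graph_curve V E \<nu>). phi x \<in> U}} (\<lambda>p. (f \<circ> phi) (glue E \<nu> (v, p))) =
      p1_regular {p. Psi v p \<in> U} (\<lambda>p. f (Psi v p))" by (simp only:)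
  qed
  show "regular_on g Z U f \<longleftrightarrow> curve_regular V E \<nu> {x \<in> topspace (graph_curve V E \<nu>). phi x \<in> U} (f \<circ> phi)"
    unfolding cr using regular_pullback regular_glue[OF U] by blast
qed

theorem phi_canonical: "canonical_embedding V E \<nu> phi"
  unfolding canonical_embedding_def Let_def gen[symmetric]
proof (intro conjI exI[of _ "\<lambda>i. sect (F i)"] ballI allI)
  show "dualizing_basis V E \<nu> g (\<lambda>i. sect (F i))" by (rule dualizing_basis_sect)
  show "closed_embedding V E \<nu> g phi" by (rule phi_closed_embedding)
  fix v p assume v: "v \<in> V"
  obtain \<kappa> where \<kappa>: "\<kappa> \<noteq> 0" "\<forall>i\<le>g. section_value E \<nu> v p (sect (F i) v) (\<kappa> * (A v i * rep0 p + B v i * rep1 p))"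
    using par_val[OF v, of p] by blast
  define c where "c = (\<lambda>i. \<kappa> * psi v (vec2 (rep0 p) (rep1 p)) i)"
  have "section_value E \<nu> v p (sect (F i) v) (c i)" if "i < g" for i
    using \<kappa>(2) that unfolding c_def psi_def pc_def vec2_def by simp
  moreover have h: "hvec g (psi v (vec2 (rep0 p) (rep1 p)))" by (rule psi_hvec[OF v hvec_rep])
  then have "\<forall>i\<ge>g. c i = 0" "\<exists>i. c i \<noteq> 0" using \<kappa>(1) unfolding hvec_def c_def by auto
  moreover have "phi (glue E \<nu> (v, p)) = proj_class c"
    unfolding phi_glue[OF v] Psi_def c_def using proj_class_scale[OF \<kappa>(1)] by simp
  ultimately show "\<exists>c. (\<forall>i<g. section_value E \<nu> v p (sect (F i) v) (c i)) \<and> (\<forall>i\<ge>g. c i = 0) \<and>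
    (\<exists>i. c i \<noteq> 0) \<and> phi (glue E \<nu> (v, p)) = proj_class c" by blast
qed

end

section \<open>Extending valuations\<close>

text \<open>Only the values at nonzero arguments matter; \<open>v 0\<close> is junk.\<close>

definition is_rval :: "('a::idom \<Rightarrow> real) \<Rightarrow> bool" where
  "is_rval v \<longleftrightarrow> (\<forall>x y. x \<noteq> 0 \<longrightarrow> y \<noteq> 0 \<longrightarrow> v (x * y) = v x + v y) \<and>
     (\<forall>x y. x \<noteq> 0 \<longrightarrow> y \<noteq> 0 \<longrightarrow> x + y \<noteq> 0 \<longrightarrow> min (v x) (v y) \<le> v (x + y))"

lemma rval_mult: "is_rval v \<Longrightarrow> x \<noteq> 0 \<Longrightarrow> y \<noteq> 0 \<Longrightarrow> v (x * y) = v x + v y"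
  and rval_add: "is_rval v \<Longrightarrow> x \<noteq> 0 \<Longrightarrow> y \<noteq> 0 \<Longrightarrow> x + y \<noteq> 0 \<Longrightarrow> min (v x) (v y) \<le> v (x + y)"
  unfolding is_rval_def by blast+

lemma rval_one: assumes "is_rval (v :: 'a::idom \<Rightarrow> real)" shows "v 1 = 0" "v (-1) = 0"
proof -
  show 1: "v 1 = 0" using rval_mult[OF assms, of 1 1] by simp
  have "(-1::'a) \<noteq> 0" by simp
  then show "v (-1) = 0" using rval_mult[OF assms, of "-1" "-1"] 1 by simp
qed

lemma rval_minus: assumes "is_rval v" "x \<noteq> 0" shows "v (- x) = v x"
  using rval_mult[OF assms(1) _ assms(2), of "-1"] rval_one[OF assms(1)] by simp

lemma rval_sum_gt:
  assumes v: "is_rval v" and S: "finite S" "\<And>s. s \<in> S \<Longrightarrow> f s = 0 \<or> v (f s) > c" "(\<Sum>s\<in>S. f s) \<noteq> 0"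
  shows "v (\<Sum>s\<in>S. f s) > c"
  using S
proof (induction S rule: finite_induct)
  case (insert s S)
  show ?case
  proof (cases "f s = 0 \<or> (\<Sum>s\<in>S. f s) = 0")
    case True
    then consider "f s = 0" | "(\<Sum>s\<in>S. f s) = 0" by blast
    then show ?thesis
    proof cases
      case 1
      then have e: "(\<Sum>s\<in>insert s S. f s) = (\<Sum>s\<in>S. f s)" using insert(1,2) by simp
      show ?thesis unfolding e by (rule insert.IH) (use insert.prems e in auto)
    next
      case 2
      then have e: "(\<Sum>s\<in>insert s S. f s) = f s" using insert(1,2) by simp
      then show ?thesis using insert.prems(1)[of s] insert.prems(2) by simp
    qed
  next
    case False
    then have "min (v (f s)) (v (\<Sum>s\<in>S. f s)) \<le> v (f s + (\<Sum>s\<in>S. f s))"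
      using insert by (intro rval_add[OF v]) auto
    moreover have "v (f s) > c" "v (\<Sum>s\<in>S. f s) > c" using insert False by auto
    ultimately show ?thesis using insert(1,2) by simp
  qed
qed simp

lemma rval_power: assumes "is_rval v" "x \<noteq> 0" shows "v (x ^ n) = n * v x"
proof (induction n)
  case 0 then show ?case using rval_one[OF assms(1)] by simp
next
  case (Suc n) then show ?case using rval_mult[OF assms(1,2), of "x ^ n"] assms(2) by (simp add: algebra_simps)
qed

lemma rval_inverse: fixes v :: "'a::field \<Rightarrow> real" assumes "is_rval v" "x \<noteq> 0" shows "v (inverse x) = - v x"
  using rval_mult[OF assms, of "inverse x"] rval_one[OF assms(1)] assms(2) by simp

lemma rval_powi: fixes v :: "'a::field \<Rightarrow> real" assumes "is_rval v" "x \<noteq> 0" shows "v (x powi n) = n * v x"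
proof (cases "n \<ge> 0")
  case True then show ?thesis using rval_power[OF assms] by (simp add: power_int_def)
next
  case False
  then show ?thesis using rval_power[OF assms(1), of "inverse x"] rval_inverse[OF assms] assms(2)
    by (simp add: power_int_def)
qed

lemma rval_prod: assumes "is_rval v" "\<And>s. s \<in> S \<Longrightarrow> f s \<noteq> 0" shows "v (\<Prod>s\<in>S. f s) = (\<Sum>s\<in>S. v (f s))"
  using assms(2)
proof (induction S rule: infinite_finite_induct)
  case (insert s S)
  have "(\<Prod>s\<in>S. f s) \<noteq> 0" using insert by simp
  then show ?case using insert rval_mult[OF assms(1), of "f s" "\<Prod>s\<in>S. f s"] by simp
qed (simp_all add: rval_one[OF assms(1)])

section \<open>Gauss valuations on polynomials and fractions\<close>

definition gauss :: "('a::idom \<Rightarrow> real) \<Rightarrow> real \<Rightarrow> 'a poly \<Rightarrow> real" where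
  "gauss v r p = Min ((\<lambda>n. v (coeff p n) + n * r) ` {n. coeff p n \<noteq> 0})"

lemma finite_coeffs: "finite {n. coeff p n \<noteq> (0::'a::zero)}"
  using MOST_coeff_eq_0[of p] by (simp add: eventually_cofinite)

lemma gauss_le: "coeff p n \<noteq> 0 \<Longrightarrow> gauss v r p \<le> v (coeff p n) + n * r"
  unfolding gauss_def by (intro Min_le) (auto intro: finite_imageI finite_coeffs)

lemma gauss_attained: assumes "p \<noteq> 0" obtains n where "coeff p n \<noteq> 0" "gauss v r p = v (coeff p n) + n * r"
proof -
  have "{n. coeff p n \<noteq> 0} \<noteq> {}" using assms leading_coeff_neq_0 by blast
  then have "gauss v r p \<in> (\<lambda>n. v (coeff p n) + n * r) ` {n. coeff p n \<noteq> 0}"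
    unfolding gauss_def by (intro Min_in) (auto intro: finite_imageI finite_coeffs)
  then show ?thesis using that by blast
qed

lemma gauss_ge: assumes "p \<noteq> 0" "\<And>n. coeff p n \<noteq> 0 \<Longrightarrow> c \<le> v (coeff p n) + n * r" shows "c \<le> gauss v r p"
  using gauss_attained[OF assms(1)] assms(2) by metis

text \<open>Gauss's lemma. The bound from below for a product is a termwise estimate. For the bound
  from above, let \<open>i0\<close> and \<open>j0\<close> be the least indices at which the minima
  are attained: the coefficient of index \<open>i0 + j0\<close> has a single term of least
  valuation, so nothing cancels.\<close>

lemma is_rval_gauss: assumes v: "is_rval v" shows "is_rval (gauss v r)"
  unfolding is_rval_def
proof (intro conjI allI impI)
  fix p q :: "'a poly" assume pq: "p \<noteq> 0" "q \<noteq> 0"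
  let ?g = "gauss v r"
  show "min (?g p) (?g q) \<le> ?g (p + q)" if s: "p + q \<noteq> 0"
  proof (rule gauss_ge[OF s])
    fix n assume n: "coeff (p + q) n \<noteq> 0"
    consider "coeff p n = 0" | "coeff q n = 0" | "coeff p n \<noteq> 0" "coeff q n \<noteq> 0" by blast
    then show "min (?g p) (?g q) \<le> v (coeff (p + q) n) + n * r"
    proof cases
      case 1 then show ?thesis using gauss_le[of q n v r] n by simp
    next
      case 2 then show ?thesis using gauss_le[of p n v r] n by simp
    next
      case 3
      then have "min (v (coeff p n)) (v (coeff q n)) \<le> v (coeff (p + q) n)"
        using rval_add[OF v 3] n by simp
      then show ?thesis using gauss_le[OF 3(1), of v r] gauss_le[OF 3(2), of v r] by linarith
    qed
  qed
  have nz: "p * q \<noteq> 0" using pq by simp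
  have ge: "?g p + ?g q \<le> v (coeff p i * coeff q j) + (i + j) * r" if "coeff p i \<noteq> 0" "coeff q j \<noteq> 0" for i j
    using gauss_le[OF that(1), of v r] gauss_le[OF that(2), of v r] rval_mult[OF v that] by (simp add: algebra_simps)
  have lower: "?g p + ?g q \<le> ?g (p * q)"
  proof (rule gauss_ge[OF nz])
    fix n assume n: "coeff (p * q) n \<noteq> 0"
    show "?g p + ?g q \<le> v (coeff (p * q) n) + n * r"
    proof (rule ccontr)
      assume c: "\<not> ?thesis"
      let ?c = "v (coeff (p * q) n)"
      have "v (\<Sum>i\<le>n. coeff p i * coeff q (n - i)) > ?c"
      proof (rule rval_sum_gt[OF v])
        fix i assume i: "i \<in> {..n}"
        show "coeff p i * coeff q (n - i) = 0 \<or> ?c < v (coeff p i * coeff q (n - i))"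
        proof (cases "coeff p i = 0 \<or> coeff q (n - i) = 0")
          case False
          then have "?g p + ?g q \<le> v (coeff p i * coeff q (n - i)) + (real i + real (n - i)) * r"
            using ge[of i "n - i"] by simp
          then show ?thesis using c i by (simp add: of_nat_diff)
        qed auto
      qed (use n in \<open>simp_all add: coeff_mult\<close>)
      then show False by (simp add: coeff_mult)
    qed
  qed
  define P where "P = (\<lambda>i. coeff p i \<noteq> 0 \<and> v (coeff p i) + i * r = ?g p)"
  define Q where "Q = (\<lambda>j. coeff q j \<noteq> 0 \<and> v (coeff q j) + j * r = ?g q)"
  define i0 where "i0 = (LEAST i. P i)"
  define j0 where "j0 = (LEAST j. Q j)"
  have "\<exists>i. P i" "\<exists>j. Q j" unfolding P_def Q_def using gauss_attained pq by metis+
  then have i0: "P i0" and j0: "Q j0" unfolding i0_def j0_def by (auto intro: LeastI_ex)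
  have li: "\<not> P i" if "i < i0" for i using that not_less_Least unfolding i0_def by blast
  have lj: "\<not> Q j" if "j < j0" for j using that not_less_Least unfolding j0_def by blast
  let ?n = "i0 + j0"
  let ?t = "\<lambda>i. coeff p i * coeff q (?n - i)"
  have main: "v (?t i0) + ?n * r = ?g p + ?g q" "?t i0 \<noteq> 0"
    using i0 j0 rval_mult[OF v, of "coeff p i0" "coeff q j0"] unfolding P_def Q_def by (auto simp: algebra_simps)
  have others: "?t i = 0 \<or> v (?t i) > v (?t i0)" if i: "i \<in> {..?n} - {i0}" for i
  proof (cases "coeff p i = 0 \<or> coeff q (?n - i) = 0")
    case False
    then have nz2: "coeff p i \<noteq> 0" "coeff q (?n - i) \<noteq> 0" by auto
    have a: "?g p \<le> v (coeff p i) + i * r" "?g q \<le> v (coeff q (?n - i)) + (?n - i) * r"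
      using gauss_le[OF nz2(1), of v r] gauss_le[OF nz2(2), of v r] by auto
    \<comment> \<open>One of the two indices lies below its least minimiser, where the weight is
      strictly greater than the minimum.\<close>
    have "i < i0 \<or> ?n - i < j0" using i by auto
    then have "?g p < v (coeff p i) + i * r \<or> ?g q < v (coeff q (?n - i)) + (?n - i) * r"
      using li[of i] lj[of "?n - i"] nz2 a unfolding P_def Q_def by fastforce
    then have "?g p + ?g q < v (?t i) + (real i + real (?n - i)) * r"
      using a rval_mult[OF v nz2] by (auto simp: algebra_simps)
    moreover have "real i + real (?n - i) = real ?n" using i by (simp add: of_nat_diff)
    ultimately show ?thesis using main(1) by simp
  qed auto
  have split: "coeff (p * q) ?n = ?t i0 + (\<Sum>i\<in>{..?n} - {i0}. ?t i)"
    unfolding coeff_mult by (rule sum.remove) auto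
  have "coeff (p * q) ?n \<noteq> 0 \<and> v (coeff (p * q) ?n) \<le> v (?t i0)"
  proof (rule ccontr)
    assume c: "\<not> ?thesis"
    have e: "?t i0 = coeff (p * q) ?n + (- (\<Sum>i\<in>{..?n} - {i0}. ?t i))" using split by simp
    show False
    proof (cases "(\<Sum>i\<in>{..?n} - {i0}. ?t i) = 0")
      case True then show ?thesis using split main(2) c by auto
    next
      case False
      have s: "v (\<Sum>i\<in>{..?n} - {i0}. ?t i) > v (?t i0)" using rval_sum_gt[OF v _ others False] by auto
      show ?thesis
      proof (cases "coeff (p * q) ?n = 0")
        case True
        then have "?t i0 = - (\<Sum>i\<in>{..?n} - {i0}. ?t i)" using e by simp
        then show ?thesis using s rval_minus[OF v False] by simp
      next
        case nz3: False
        then have "v (coeff (p * q) ?n) > v (?t i0)" using c by simp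
        moreover have "min (v (coeff (p * q) ?n)) (v (- (\<Sum>i\<in>{..?n} - {i0}. ?t i))) \<le> v (?t i0)"
          unfolding e by (rule rval_add[OF v nz3]) (use False main(2) e in auto)
        ultimately show ?thesis using s rval_minus[OF v False] by simp
      qed
    qed
  qed
  then have "?g (p * q) \<le> ?g p + ?g q" using gauss_le[of "p * q" ?n v r] main(1) by linarith
  then show "?g (p * q) = ?g p + ?g q" using lower by simp
qed

lemma gauss_monom_lin: assumes "c \<noteq> 0" shows "gauss v r [:0, c:] = v c + r"
proof -
  have "{n. coeff [:0, c:] n \<noteq> 0} = {1}" using assms by (auto simp: coeff_pCons' split: if_splits)
  then show ?thesis unfolding gauss_def by simp
qed

lemma gauss_const: assumes "c \<noteq> 0" shows "gauss v r [:c:] = v c"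
proof -
  have "{n. coeff [:c:] n \<noteq> 0} = {0}" using assms by (auto simp: coeff_pCons' split: if_splits)
  then show ?thesis unfolding gauss_def by simp
qed

lemma gauss_lin: assumes "a \<noteq> 0" "b \<noteq> 0" shows "gauss v r [:a, b:] = min (v a) (v b + r)"
proof -
  have "{n. coeff [:a, b:] n \<noteq> 0} = {0, 1}" using assms by (auto simp: coeff_pCons' split: if_splits)
  then show ?thesis unfolding gauss_def by simp
qed

definition fval :: "('a::idom \<Rightarrow> real) \<Rightarrow> 'a fract \<Rightarrow> real" where
  "fval v x = (SOME y. \<exists>a b. x = Fract a b \<and> b \<noteq> 0 \<and> y = v a - v b)"

lemma fval_Fract: assumes v: "is_rval v" and ab: "a \<noteq> 0" "b \<noteq> 0" shows "fval v (Fract a b) = v a - v b"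
proof -
  let ?P = "\<lambda>y. \<exists>a' b'. Fract a b = Fract a' b' \<and> b' \<noteq> 0 \<and> y = v a' - v b'"
  have "?P (fval v (Fract a b))" unfolding fval_def by (rule someI[of ?P "v a - v b"]) (use ab in blast)
  then obtain a' b' where *: "Fract a b = Fract a' b'" "b' \<noteq> 0" "fval v (Fract a b) = v a' - v b'" by blast
  have e: "a * b' = a' * b" using * ab by (simp add: eq_fract)
  then have "a' \<noteq> 0" using ab * by auto
  then have "v a + v b' = v a' + v b" using e rval_mult[OF v] ab * by metis
  then show ?thesis using * by simp
qed

lemma is_rval_fval: assumes v: "is_rval v" shows "is_rval (fval v)"
  unfolding is_rval_def
proof (intro conjI allI impI)
  fix x y :: "'a fract" assume xy: "x \<noteq> 0" "y \<noteq> 0"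
  obtain a b where ab: "x = Fract a b" "b \<noteq> 0" by (cases x) auto
  obtain c d where cd: "y = Fract c d" "d \<noteq> 0" by (cases y) auto
  have ac: "a \<noteq> 0" "c \<noteq> 0" using xy ab cd by (auto simp: fract_collapse)
  show "fval v (x * y) = fval v x + fval v y"
    unfolding ab cd using fval_Fract[OF v] ac ab(2) cd(2) rval_mult[OF v] by simp
  show "min (fval v x) (fval v y) \<le> fval v (x + y)" if s: "x + y \<noteq> 0"
  proof -
    have xy: "x + y = Fract (a * d + c * b) (b * d)" using ab cd by simp
    then have nz: "a * d + c * b \<noteq> 0" using s by (auto simp: fract_collapse)
    have "min (v (a * d)) (v (c * b)) \<le> v (a * d + c * b)" using rval_add[OF v _ _ nz] ac ab(2) cd(2) by simp
    then have "min (v a + v d) (v c + v b) \<le> v (a * d + c * b)" using rval_mult[OF v] ac ab(2) cd(2) by simp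
    moreover have "fval v (x + y) = v (a * d + c * b) - (v b + v d)"
      unfolding xy using fval_Fract[OF v nz] ab(2) cd(2) rval_mult[OF v] by simp
    moreover have "fval v x = v a - v b" "fval v y = v c - v d" unfolding ab cd using fval_Fract[OF v] ac ab(2) cd(2) by simp_all
    ultimately show ?thesis by linarith
  qed
qed

lemma valuation_rval:
  assumes "valuation val" shows "is_rval (\<lambda>x. real_of_ereal (val x))" "x \<noteq> 0 \<Longrightarrow> val x = ereal (real_of_ereal (val x))"
proof -
  have fin: "val x = ereal (real_of_ereal (val x))" if "x \<noteq> 0" for x
  proof -
    have "val x \<noteq> \<infinity>" "val x \<noteq> -\<infinity>" using assms that unfolding valuation_def by blast+
    then show ?thesis by (cases "val x") simp_all
  qed
  then show "x \<noteq> 0 \<Longrightarrow> val x = ereal (real_of_ereal (val x))" .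
  show "is_rval (\<lambda>x. real_of_ereal (val x))"
    unfolding is_rval_def
  proof (intro conjI allI impI)
    fix x y :: 'a assume xy: "x \<noteq> 0" "y \<noteq> 0"
    have "val (x * y) = val x + val y" using assms unfolding valuation_def by blast
    then show "real_of_ereal (val (x * y)) = real_of_ereal (val x) + real_of_ereal (val y)"
      by (subst (asm) fin[OF xy(1)], subst (asm) fin[OF xy(2)]) simp
    assume s: "x + y \<noteq> 0"
    have "min (val x) (val y) \<le> val (x + y)" using assms unfolding valuation_def by blast
    then have "min (ereal (real_of_ereal (val x))) (ereal (real_of_ereal (val y))) \<le> ereal (real_of_ereal (val (x + y)))"
      by (simp only: fin[OF xy(1), symmetric] fin[OF xy(2), symmetric] fin[OF s, symmetric])
    then show "min (real_of_ereal (val x)) (real_of_ereal (val y)) \<le> real_of_ereal (val (x + y))"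
      by (simp add: min_def split: if_splits)
  qed
qed

section \<open>Laurent polynomials\<close>

lemma lookup_mult_pairs:
  "Poly_Mapping.lookup (f * h) c = (\<Sum>(a, b) | (a, b) \<in> Poly_Mapping.keys f \<times> Poly_Mapping.keys h \<and> a + b = c.
     Poly_Mapping.lookup f a * Poly_Mapping.lookup h b)"
proof -
  let ?K = "Poly_Mapping.keys f \<times> Poly_Mapping.keys h"
  have "f * h = (\<Sum>a\<in>Poly_Mapping.keys f. \<Sum>b\<in>Poly_Mapping.keys h.
      Poly_Mapping.single (a + b) (Poly_Mapping.lookup f a * Poly_Mapping.lookup h b))"
    by (subst poly_mapping_expand[of f], subst poly_mapping_expand[of h]) (simp add: sum_product mult_single)
  also have "\<dots> = (\<Sum>(a, b)\<in>?K. Poly_Mapping.single (a + b) (Poly_Mapping.lookup f a * Poly_Mapping.lookup h b))"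
    by (rule sum.cartesian_product)
  finally have "Poly_Mapping.lookup (f * h) c = (\<Sum>(a, b)\<in>?K. if a + b = c then Poly_Mapping.lookup f a * Poly_Mapping.lookup h b else 0)"
    by (simp add: lookup_sum lookup_single when_def case_prod_unfold)
  also have "\<dots> = (\<Sum>x | x \<in> ?K \<and> (case x of (a, b) \<Rightarrow> a + b = c). case x of (a, b) \<Rightarrow> Poly_Mapping.lookup f a * Poly_Mapping.lookup h b)"
    by (subst sum.inter_filter) (auto intro!: sum.cong)
  also have "{x. x \<in> ?K \<and> (case x of (a, b) \<Rightarrow> a + b = c)} = {(a, b). (a, b) \<in> ?K \<and> a + b = c}" by auto
  finally show ?thesis .
qed

definition wdot :: "(nat \<Rightarrow> real) \<Rightarrow> (nat \<Rightarrow>\<^sub>0 int) \<Rightarrow> real" where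
  "wdot w a = (\<Sum>i \<in> Poly_Mapping.keys a. w i * real_of_int (Poly_Mapping.lookup a i))"

lemma wdot_super: "finite S \<Longrightarrow> Poly_Mapping.keys a \<subseteq> S \<Longrightarrow> wdot w a = (\<Sum>i\<in>S. w i * real_of_int (Poly_Mapping.lookup a i))"
  unfolding wdot_def by (intro sum.mono_neutral_left) (auto simp: in_keys_iff)

lemma wdot_add: "wdot w (a + b) = wdot w a + wdot w b"
proof -
  let ?S = "Poly_Mapping.keys a \<union> Poly_Mapping.keys b"
  have "Poly_Mapping.keys (a + b) \<subseteq> ?S" by (rule Poly_Mapping.keys_add)
  then have "wdot w (a + b) = (\<Sum>i\<in>?S. w i * real_of_int (Poly_Mapping.lookup (a + b) i))" by (intro wdot_super) auto
  also have "\<dots> = wdot w a + wdot w b"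
    by (simp add: lookup_add algebra_simps sum.distrib wdot_super[of ?S a] wdot_super[of ?S b])
  finally show ?thesis .
qed

text \<open>\<open>umin v w f\<close>: the initial form of \<open>f\<close> at \<open>w\<close> is a monomial.\<close>

definition umin :: "('k::field \<Rightarrow> real) \<Rightarrow> (nat \<Rightarrow> real) \<Rightarrow> 'k laurent \<Rightarrow> bool" where
  "umin v w f \<longleftrightarrow> (\<exists>a\<in>Poly_Mapping.keys f. \<forall>b\<in>Poly_Mapping.keys f. b \<noteq> a \<longrightarrow>
     v (Poly_Mapping.lookup f a) + wdot w a < v (Poly_Mapping.lookup f b) + wdot w b)"

text \<open>Every other pair of terms has strictly greater weight than the pair of minimal terms, so
  the product of these two is not cancelled and is the unique minimal term.\<close>

lemma umin_mult:
  assumes v: "is_rval v" and f: "umin v w f" and h: "umin v w h" shows "umin v w (f * h)"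
proof -
  let ?W = "\<lambda>f a. v (Poly_Mapping.lookup f a) + wdot w a"
  obtain a0 where a0: "a0 \<in> Poly_Mapping.keys f" "\<And>b. b \<in> Poly_Mapping.keys f \<Longrightarrow> b \<noteq> a0 \<Longrightarrow> ?W f a0 < ?W f b"
    using f unfolding umin_def by blast
  obtain b0 where b0: "b0 \<in> Poly_Mapping.keys h" "\<And>b. b \<in> Poly_Mapping.keys h \<Longrightarrow> b \<noteq> b0 \<Longrightarrow> ?W h b0 < ?W h b"
    using h unfolding umin_def by blast
  let ?t = "\<lambda>x. case x of (a, b) \<Rightarrow> Poly_Mapping.lookup f a * Poly_Mapping.lookup h b"
  let ?S = "\<lambda>c. {(a, b). (a, b) \<in> Poly_Mapping.keys f \<times> Poly_Mapping.keys h \<and> a + b = c}"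
  have fS: "finite (?S c)" for c by (rule finite_subset[of _ "Poly_Mapping.keys f \<times> Poly_Mapping.keys h"]) auto
  let ?c0 = "a0 + b0"
  define m where "m = ?W f a0 + ?W h b0"
  have big: "v (?t x) > m - wdot w c" if x: "x \<in> ?S c" "x \<noteq> (a0, b0)" for x c
  proof -
    obtain a b where ab: "x = (a, b)" "a \<in> Poly_Mapping.keys f" "b \<in> Poly_Mapping.keys h" "a + b = c" using x(1) by auto
    have le: "?W f a0 \<le> ?W f a" "?W h b0 \<le> ?W h b" using a0(2)[OF ab(2)] b0(2)[OF ab(3)] by fastforce+
    have "a \<noteq> a0 \<or> b \<noteq> b0" using x(2) ab(1) by simp
    then have "?W f a0 + ?W h b0 < ?W f a + ?W h b"
      using a0(2)[OF ab(2)] b0(2)[OF ab(3)] le by fastforce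
    moreover have "v (?t x) = v (Poly_Mapping.lookup f a) + v (Poly_Mapping.lookup h b)"
      using ab rval_mult[OF v] by (simp add: in_keys_iff)
    moreover have "wdot w c = wdot w a + wdot w b" using ab(4) wdot_add by blast
    ultimately show ?thesis unfolding m_def by simp
  qed
  have t0: "?t (a0, b0) \<noteq> 0" "v (?t (a0, b0)) = m - wdot w ?c0"
    using a0(1) b0(1) rval_mult[OF v] unfolding m_def wdot_add by (simp_all add: in_keys_iff)
  have in0: "(a0, b0) \<in> ?S ?c0" using a0(1) b0(1) by simp
  let ?r = "\<Sum>x\<in>?S ?c0 - {(a0, b0)}. ?t x"
  have l0: "Poly_Mapping.lookup (f * h) ?c0 = ?t (a0, b0) + ?r"
    unfolding lookup_mult_pairs by (rule sum.remove[OF fS in0])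
  have rbig: "?r = 0 \<or> v ?r > v (?t (a0, b0))"
    using rval_sum_gt[OF v, of "?S ?c0 - {(a0, b0)}" ?t "v (?t (a0, b0))"] fS big unfolding t0(2) by blast
  have k0: "Poly_Mapping.lookup (f * h) ?c0 \<noteq> 0 \<and> v (Poly_Mapping.lookup (f * h) ?c0) \<le> v (?t (a0, b0))"
  proof (cases "?r = 0")
    case True then show ?thesis using l0 t0(1) by simp
  next
    case False
    then have r: "v (- ?r) > v (?t (a0, b0))" using rbig rval_minus[OF v False] by simp
    have e: "?t (a0, b0) = Poly_Mapping.lookup (f * h) ?c0 + - ?r" using l0 by simp
    have "Poly_Mapping.lookup (f * h) ?c0 \<noteq> 0"
    proof
      assume "Poly_Mapping.lookup (f * h) ?c0 = 0"
      then have "?t (a0, b0) = - ?r" using e by simp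
      then show False using r by simp
    qed
    moreover have "min (v (Poly_Mapping.lookup (f * h) ?c0)) (v (- ?r)) \<le> v (?t (a0, b0))"
      unfolding e by (rule rval_add[OF v calculation]) (use False t0(1) e in auto)
    ultimately show ?thesis using r by linarith
  qed
  show ?thesis
    unfolding umin_def
  proof (intro bexI[of _ ?c0] ballI impI)
    show "?c0 \<in> Poly_Mapping.keys (f * h)" using k0 by (simp add: in_keys_iff)
    fix c assume c: "c \<in> Poly_Mapping.keys (f * h)" "c \<noteq> ?c0"
    have "(a0, b0) \<notin> ?S c" using c(2) by auto
    then have "\<And>x. x \<in> ?S c \<Longrightarrow> v (?t x) > m - wdot w c" using big by blast
    then have "v (\<Sum>x\<in>?S c. ?t x) > m - wdot w c"
      using c(1) lookup_mult_pairs[of f h c] by (intro rval_sum_gt[OF v fS]) (auto simp: in_keys_iff)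
    then have "v (Poly_Mapping.lookup (f * h) c) + wdot w c > m" unfolding lookup_mult_pairs by simp
    moreover have "v (Poly_Mapping.lookup (f * h) ?c0) + wdot w ?c0 \<le> m" using k0 t0(2) by simp
    ultimately show "?W (f * h) ?c0 < ?W (f * h) c" by simp
  qed
qed

lemma polys_in_mult: "F \<in> polys_in J \<Longrightarrow> G \<in> polys_in J \<Longrightarrow> F * (G :: (nat \<Rightarrow>\<^sub>0 'e::monoid_add) \<Rightarrow>\<^sub>0 'k::semiring_0) \<in> polys_in J"
  unfolding polys_in_def using keys_mult[of F G] by (fastforce dest: subsetD[OF Poly_Mapping.keys_add])

lemma polys_in_sum: "(\<And>a. a \<in> S \<Longrightarrow> f a \<in> polys_in J) \<Longrightarrow> (\<Sum>a\<in>S. f a :: (nat \<Rightarrow>\<^sub>0 'e::zero) \<Rightarrow>\<^sub>0 'k::comm_monoid_add) \<in> polys_in J"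
proof (induction S rule: infinite_finite_induct)
  case (insert a S)
  then show ?case unfolding polys_in_def using Poly_Mapping.keys_add[of "f a" "\<Sum>a\<in>S. f a"] by auto
qed (simp_all add: polys_in_def)

lemma one_polys_in: "(1 :: (nat \<Rightarrow>\<^sub>0 'e::monoid_add) \<Rightarrow>\<^sub>0 'k::zero_neq_one) \<in> polys_in J"
  unfolding polys_in_def by simp

lemma ideal_gen_mem: fixes R :: "'a::comm_ring_1 set" assumes "1 \<in> R" "a \<in> S" shows "a \<in> ideal_gen R S"
  unfolding ideal_gen_def mem_Collect_eq
  by (rule exI[of _ "{a}"], rule exI[of _ "\<lambda>_. 1"]) (use assms in auto)

lemma ideal_gen_vanish:
  fixes h :: "'a::comm_ring_1 \<Rightarrow> 'b::comm_ring_1"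
  assumes "\<And>(T :: 'a set) f. h (\<Sum>a\<in>T. f a) = (\<Sum>a\<in>T. h (f a))" "\<And>a b. h (a * b) = h a * h b" "\<And>a. a \<in> S \<Longrightarrow> h a = 0"
    "x \<in> ideal_gen R S"
  shows "h x = 0"
proof -
  obtain T c where T: "x = (\<Sum>a\<in>T. c a * a)" "T \<subseteq> S" using assms(4) unfolding ideal_gen_def by blast
  show ?thesis unfolding T(1) assms(1,2) using assms(3) T(2) by (intro sum.neutral) auto
qed

lemma keys_map_int [simp]: "Poly_Mapping.keys (Poly_Mapping.map int m) = Poly_Mapping.keys m"
  by (auto simp: in_keys_iff Poly_Mapping.map.rep_eq when_def split: if_splits)

lemma lookup_map_int [simp]: "Poly_Mapping.lookup (Poly_Mapping.map int m) i = int (Poly_Mapping.lookup m i)"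
  by (simp add: Poly_Mapping.map.rep_eq when_def)

lemma map_int_add: "Poly_Mapping.map int (a + b) = Poly_Mapping.map int a + Poly_Mapping.map int b"
  by (rule poly_mapping_eqI) (simp add: lookup_add)

definition zterm :: "nat set \<Rightarrow> (nat \<Rightarrow>\<^sub>0 nat) \<Rightarrow> 'k::field \<Rightarrow> 'k laurent" where
  "zterm A m c = (if Poly_Mapping.keys m \<inter> A = {} then Poly_Mapping.single (Poly_Mapping.map int m) c else 0)"

lemma zterm_add: "zterm A m (c + d) = zterm A m c + zterm A m d"
  unfolding zterm_def by (simp add: single_add)

lemma zterm_zero [simp]: "zterm A m 0 = 0" unfolding zterm_def by simp

lemma keys_add_nat: "Poly_Mapping.keys (m + n :: nat \<Rightarrow>\<^sub>0 nat) = Poly_Mapping.keys m \<union> Poly_Mapping.keys n"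
  by (auto simp: in_keys_iff lookup_add)

lemma zterm_mult: "zterm A m c * zterm A n d = zterm A (m + n) (c * d)"
proof -
  have "Poly_Mapping.keys (m + n) \<inter> A = {} \<longleftrightarrow> Poly_Mapping.keys m \<inter> A = {} \<and> Poly_Mapping.keys n \<inter> A = {}"
    unfolding keys_add_nat by blast
  then show ?thesis unfolding zterm_def by (simp add: mult_single map_int_add)
qed

lemma set_zero_super:
  assumes "finite S" "Poly_Mapping.keys F \<subseteq> S" shows "set_zero A F = (\<Sum>m\<in>S. zterm A m (Poly_Mapping.lookup F m))"
proof -
  have "set_zero A F = (\<Sum>m\<in>Poly_Mapping.keys F. zterm A m (Poly_Mapping.lookup F m))"
    unfolding set_zero_def zterm_def by (subst sum.inter_filter[symmetric]) simp_all
  also have "\<dots> = (\<Sum>m\<in>S. zterm A m (Poly_Mapping.lookup F m))"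
    using assms by (intro sum.mono_neutral_left) (auto simp: in_keys_iff)
  finally show ?thesis .
qed

lemma set_zero_add: "set_zero A (F + G) = set_zero A F + set_zero A G"
proof -
  let ?S = "Poly_Mapping.keys F \<union> Poly_Mapping.keys G"
  have "set_zero A (F + G) = (\<Sum>m\<in>?S. zterm A m (Poly_Mapping.lookup (F + G) m))"
    using Poly_Mapping.keys_add[of F G] by (intro set_zero_super) auto
  also have "\<dots> = set_zero A F + set_zero A G"
    by (simp add: lookup_add zterm_add sum.distrib set_zero_super[of ?S F] set_zero_super[of ?S G])
  finally show ?thesis .
qed

lemma set_zero_single: "set_zero A (Poly_Mapping.single m c) = zterm A m c"
proof -
  have "set_zero A (Poly_Mapping.single m c) = (\<Sum>n\<in>{m}. zterm A n (Poly_Mapping.lookup (Poly_Mapping.single m c) n))"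
    by (intro set_zero_super) auto
  then show ?thesis by simp
qed

lemma set_zero_zero [simp]: "set_zero A 0 = 0" unfolding set_zero_def by simp

lemma set_zero_sum: "set_zero A (\<Sum>a\<in>S. f a) = (\<Sum>a\<in>S. set_zero A (f a))"
  by (induction S rule: infinite_finite_induct) (simp_all add: set_zero_add)

lemma set_zero_mult: "set_zero A (F * G) = set_zero A F * set_zero A G"
proof -
  have "F * G = (\<Sum>m\<in>Poly_Mapping.keys F. \<Sum>n\<in>Poly_Mapping.keys G.
      Poly_Mapping.single (m + n) (Poly_Mapping.lookup F m * Poly_Mapping.lookup G n))"
    by (subst poly_mapping_expand[of F], subst poly_mapping_expand[of G]) (simp add: sum_product mult_single)
  then have "set_zero A (F * G) = (\<Sum>m\<in>Poly_Mapping.keys F. \<Sum>n\<in>Poly_Mapping.keys G.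
      zterm A m (Poly_Mapping.lookup F m) * zterm A n (Poly_Mapping.lookup G n))"
    by (simp add: set_zero_sum set_zero_single zterm_mult)
  also have "\<dots> = set_zero A F * set_zero A G"
    by (simp add: set_zero_super[OF finite_keys order_refl] sum_product)
  finally show ?thesis .
qed

lemma set_zero_one [simp]: "set_zero A 1 = 1"
proof -
  have "set_zero A (Poly_Mapping.single 0 1) = zterm A 0 1" by (rule set_zero_single)
  moreover have "Poly_Mapping.map int 0 = (0 :: nat \<Rightarrow>\<^sub>0 int)" by (rule poly_mapping_eqI) simp
  ultimately show ?thesis by (simp add: zterm_def)
qed

lemma set_zero_polys_in: assumes "F \<in> polys_in J" shows "set_zero A F \<in> polys_in (J - A)"
  unfolding set_zero_def
proof (rule polys_in_sum)
  fix m assume m: "m \<in> {m \<in> Poly_Mapping.keys F. Poly_Mapping.keys m \<inter> A = {}}"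
  then have "Poly_Mapping.keys m \<subseteq> J" using assms unfolding polys_in_def by blast
  then show "Poly_Mapping.single (Poly_Mapping.map int m) (Poly_Mapping.lookup F m) \<in> polys_in (J - A)"
    using m unfolding polys_in_def by auto
qed

lemma stratum_ideal_polys_in:
  assumes "I \<subseteq> polys_in {..<N}" "f \<in> stratum_ideal N A I" shows "f \<in> polys_in ({..<N} - A)"
proof -
  obtain T c where T: "f = (\<Sum>a\<in>T. c a * a)" "T \<subseteq> set_zero A ` I" "\<And>a. a \<in> T \<Longrightarrow> c a \<in> polys_in ({..<N} - A)"
    using assms(2) unfolding stratum_ideal_def ideal_gen_def by blast
  show ?thesis unfolding T(1)
  proof (rule polys_in_sum)
    fix a assume a: "a \<in> T"
    then obtain F where "F \<in> I" "a = set_zero A F" using T(2) by blast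
    then show "c a * a \<in> polys_in ({..<N} - A)" using assms(1) set_zero_polys_in T(3)[OF a] by (blast intro: polys_in_mult)
  qed
qed

text \<open>A minimum over finitely many terms is attained twice or is unique. Passing from extended
  to real weights is safe because the coefficients in the support are nonzero.\<close>

lemma trop_iff_umin:
  assumes v: "valuation val"
  shows "w \<in> trop val J \<longleftrightarrow> (\<forall>f\<in>J. f \<noteq> 0 \<longrightarrow> \<not> umin (\<lambda>x. real_of_ereal (val x)) w f)"
proof -
  have "(\<exists>a \<in> Poly_Mapping.keys f. \<exists>b \<in> Poly_Mapping.keys f. a \<noteq> b \<and>
        trop_weight val w f a = trop_weight val w f b \<and>
        (\<forall>c \<in> Poly_Mapping.keys f. trop_weight val w f a \<le> trop_weight val w f c))
     \<longleftrightarrow> \<not> umin (\<lambda>x. real_of_ereal (val x)) w f" (is "?L \<longleftrightarrow> ?R") if f: "f \<noteq> 0" for f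
  proof -
    define W where "W a = real_of_ereal (val (Poly_Mapping.lookup f a)) + wdot w a" for a
    have tw: "trop_weight val w f a = ereal (W a)" if "a \<in> Poly_Mapping.keys f" for a
      unfolding trop_weight_def W_def wdot_def[symmetric]
    proof -
      have "Poly_Mapping.lookup f a \<noteq> 0" using that by (simp add: in_keys_iff)
      from valuation_rval(2)[OF v this]
      show "val (Poly_Mapping.lookup f a) + ereal (wdot w a) = ereal (real_of_ereal (val (Poly_Mapping.lookup f a)) + wdot w a)"
        by (metis plus_ereal.simps(1))
    qed
    have u: "umin (\<lambda>x. real_of_ereal (val x)) w f \<longleftrightarrow>
        (\<exists>a\<in>Poly_Mapping.keys f. \<forall>b\<in>Poly_Mapping.keys f. b \<noteq> a \<longrightarrow> W a < W b)" unfolding umin_def W_def ..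
    have L: "?L \<longleftrightarrow> (\<exists>a \<in> Poly_Mapping.keys f. \<exists>b \<in> Poly_Mapping.keys f. a \<noteq> b \<and> W a = W b \<and> (\<forall>c \<in> Poly_Mapping.keys f. W a \<le> W c))"
    proof (intro bex_cong refl)
      fix a b assume ab: "a \<in> Poly_Mapping.keys f" "b \<in> Poly_Mapping.keys f"
      have "(\<forall>c \<in> Poly_Mapping.keys f. trop_weight val w f a \<le> trop_weight val w f c) \<longleftrightarrow> (\<forall>c \<in> Poly_Mapping.keys f. W a \<le> W c)"
        by (rule ball_cong[OF refl]) (simp add: tw ab(1))
      then show "(a \<noteq> b \<and> trop_weight val w f a = trop_weight val w f b \<and> (\<forall>c \<in> Poly_Mapping.keys f. trop_weight val w f a \<le> trop_weight val w f c))
        \<longleftrightarrow> (a \<noteq> b \<and> W a = W b \<and> (\<forall>c \<in> Poly_Mapping.keys f. W a \<le> W c))" by (simp add: tw ab)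
    qed
    have "Poly_Mapping.keys f \<noteq> {}" using f by simp
    then have "Min (W ` Poly_Mapping.keys f) \<in> W ` Poly_Mapping.keys f" by (intro Min_in) auto
    then obtain a where a: "a \<in> Poly_Mapping.keys f" "W a = Min (W ` Poly_Mapping.keys f)" by auto
    have am: "W a \<le> W c" if "c \<in> Poly_Mapping.keys f" for c unfolding a(2) using that by simp
    show ?thesis unfolding L u
    proof
      assume "\<exists>a \<in> Poly_Mapping.keys f. \<exists>b \<in> Poly_Mapping.keys f. a \<noteq> b \<and> W a = W b \<and> (\<forall>c \<in> Poly_Mapping.keys f. W a \<le> W c)"
      then show "\<not> (\<exists>a\<in>Poly_Mapping.keys f. \<forall>b\<in>Poly_Mapping.keys f. b \<noteq> a \<longrightarrow> W a < W b)" by (metis not_less)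
    next
      assume "\<not> (\<exists>a\<in>Poly_Mapping.keys f. \<forall>b\<in>Poly_Mapping.keys f. b \<noteq> a \<longrightarrow> W a < W b)"
      then obtain b where b: "b \<in> Poly_Mapping.keys f" "b \<noteq> a" "\<not> W a < W b" using a(1) by blast
      then have "W a = W b" using am[OF b(1)] by simp
      then have "a \<noteq> b \<and> W a = W b \<and> (\<forall>c \<in> Poly_Mapping.keys f. W a \<le> W c)" using b(2) am by simp
      then show "\<exists>a \<in> Poly_Mapping.keys f. \<exists>b \<in> Poly_Mapping.keys f. a \<noteq> b \<and> W a = W b \<and> (\<forall>c \<in> Poly_Mapping.keys f. W a \<le> W c)"
        by (rule bexI[OF bexI[OF _ b(1)] a(1)])
    qed
  qed
  then show ?thesis unfolding trop_def by blast
qed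

text \<open>The extension field is the fraction field of polynomials in two variables: the inner one
  is the parameter \<open>t\<close> of a line, the outer one the scaling factor
  \<open>s\<close>.\<close>

definition emb :: "'k::field \<Rightarrow> 'k poly poly fract" where "emb c = Fract [:[:c:]:] 1"

lemma emb_simps [simp]: "emb 0 = 0" "emb 1 = 1" "emb (a + b) = emb a + emb b" "emb (a * b) = emb a * emb b"
  unfolding emb_def by (simp_all add: Zero_fract_def One_fract_def pCons_one)

lemma emb_nonzero: "c \<noteq> 0 \<Longrightarrow> emb c \<noteq> 0"
  unfolding emb_def by (simp add: Zero_fract_def eq_fract)

definition lmono :: "(nat \<Rightarrow>\<^sub>0 int) \<Rightarrow> (nat \<Rightarrow> 'b::field) \<Rightarrow> 'b" where
  "lmono a x = (\<Prod>i\<in>Poly_Mapping.keys a. x i powi Poly_Mapping.lookup a i)"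

lemma lmono_super: "finite S \<Longrightarrow> Poly_Mapping.keys a \<subseteq> S \<Longrightarrow> lmono a x = (\<Prod>i\<in>S. x i powi Poly_Mapping.lookup a i)"
  unfolding lmono_def by (intro prod.mono_neutral_left) (auto simp: in_keys_iff)

lemma lmono_add: assumes "\<And>i. x i \<noteq> 0" shows "lmono (a + b) x = lmono a x * lmono b x"
proof -
  let ?S = "Poly_Mapping.keys a \<union> Poly_Mapping.keys b"
  have "lmono (a + b) x = (\<Prod>i\<in>?S. x i powi Poly_Mapping.lookup (a + b) i)"
    using Poly_Mapping.keys_add[of a b] by (intro lmono_super) auto
  also have "\<dots> = lmono a x * lmono b x"
    by (simp add: lookup_add power_int_add assms prod.distrib lmono_super[of ?S a] lmono_super[of ?S b])
  finally show ?thesis .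
qed

definition lev :: "(nat \<Rightarrow> 'k poly poly fract) \<Rightarrow> 'k::field laurent \<Rightarrow> 'k poly poly fract" where
  "lev x f = (\<Sum>a\<in>Poly_Mapping.keys f. emb (Poly_Mapping.lookup f a) * lmono a x)"

lemma lev_super: "finite S \<Longrightarrow> Poly_Mapping.keys f \<subseteq> S \<Longrightarrow> lev x f = (\<Sum>a\<in>S. emb (Poly_Mapping.lookup f a) * lmono a x)"
  unfolding lev_def by (intro sum.mono_neutral_left) (auto simp: in_keys_iff)

lemma lev_add: "lev x (f + h) = lev x f + lev x h"
proof -
  let ?S = "Poly_Mapping.keys f \<union> Poly_Mapping.keys h"
  have "lev x (f + h) = (\<Sum>a\<in>?S. emb (Poly_Mapping.lookup (f + h) a) * lmono a x)"
    using Poly_Mapping.keys_add[of f h] by (intro lev_super) auto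
  also have "\<dots> = lev x f + lev x h"
    by (simp add: lookup_add distrib_right sum.distrib lev_super[of ?S f] lev_super[of ?S h])
  finally show ?thesis .
qed

lemma lev_zero [simp]: "lev x 0 = 0" unfolding lev_def by simp

lemma lev_sum: "lev x (\<Sum>a\<in>S. f a) = (\<Sum>a\<in>S. lev x (f a))"
  by (induction S rule: infinite_finite_induct) (simp_all add: lev_add)

lemma lev_single: "lev x (Poly_Mapping.single a c) = emb c * lmono a x"
  unfolding lev_def by (cases "c = 0") auto

lemma lev_mult: assumes "\<And>i. x i \<noteq> 0" shows "lev x (f * h) = lev x f * lev x h"
proof -
  have "f * h = (\<Sum>a\<in>Poly_Mapping.keys f. \<Sum>b\<in>Poly_Mapping.keys h.
      Poly_Mapping.single (a + b) (Poly_Mapping.lookup f a * Poly_Mapping.lookup h b))"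
    by (subst poly_mapping_expand[of f], subst poly_mapping_expand[of h]) (simp add: sum_product mult_single)
  then have "lev x (f * h) = (\<Sum>a\<in>Poly_Mapping.keys f. \<Sum>b\<in>Poly_Mapping.keys h.
      (emb (Poly_Mapping.lookup f a) * lmono a x) * (emb (Poly_Mapping.lookup h b) * lmono b x))"
    by (simp add: lev_sum lev_single lmono_add[OF assms] mult.assoc mult.left_commute)
  also have "\<dots> = lev x f * lev x h" unfolding lev_def by (simp add: sum_product)
  finally show ?thesis .
qed

text \<open>If the term of least weight is unique, the remaining terms cannot cancel it. This is the
  elementary inclusion of the fundamental theorem of tropical geometry, for a point over a valued
  extension field.\<close>

lemma umin_lev:
  assumes v: "is_rval v" "\<And>c. c \<noteq> 0 \<Longrightarrow> v (emb c) = v0 c" and x: "\<And>i. x i \<noteq> 0" "\<And>i. i \<in> J \<Longrightarrow> v (x i) = w i"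
    and f: "f \<in> polys_in J" "umin v0 w f"
  shows "lev x f \<noteq> 0"
proof
  assume z: "lev x f = 0"
  let ?t = "\<lambda>a. emb (Poly_Mapping.lookup f a) * lmono a x"
  let ?K = "Poly_Mapping.keys f"
  obtain a where a: "a \<in> ?K" "\<And>b. b \<in> ?K \<Longrightarrow> b \<noteq> a \<Longrightarrow>
     v0 (Poly_Mapping.lookup f a) + wdot w a < v0 (Poly_Mapping.lookup f b) + wdot w b"
    using f(2) unfolding umin_def by blast
  have lm: "lmono b x \<noteq> 0" for b unfolding lmono_def using x(1) by simp
  have vt: "?t b \<noteq> 0 \<and> v (?t b) = v0 (Poly_Mapping.lookup f b) + wdot w b" if b: "b \<in> ?K" for b
  proof -
    have c: "Poly_Mapping.lookup f b \<noteq> 0" using b by (simp add: in_keys_iff)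
    have "v (lmono b x) = (\<Sum>i\<in>Poly_Mapping.keys b. v (x i powi Poly_Mapping.lookup b i))"
      unfolding lmono_def by (rule rval_prod[OF v(1)]) (use x(1) in simp)
    also have "\<dots> = wdot w b"
      unfolding wdot_def
    proof (rule sum.cong[OF refl])
      fix i assume "i \<in> Poly_Mapping.keys b"
      then have "i \<in> J" using f(1) b unfolding polys_in_def by blast
      then show "v (x i powi Poly_Mapping.lookup b i) = w i * real_of_int (Poly_Mapping.lookup b i)"
        using rval_powi[OF v(1) x(1)] x(2) by simp
    qed
    finally show ?thesis using rval_mult[OF v(1) emb_nonzero[OF c] lm[of b]] v(2)[OF c] emb_nonzero[OF c] lm[of b] by simp
  qed
  let ?r = "\<Sum>b\<in>?K - {a}. ?t b"
  have "lev x f = ?t a + ?r" unfolding lev_def by (rule sum.remove[OF finite_keys a(1)])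
  then have r: "?r = - ?t a" using z by (simp add: eq_neg_iff_add_eq_0 add.commute)
  have "v ?r > v (?t a)"
  proof (rule rval_sum_gt[OF v(1)])
    fix b assume "b \<in> ?K - {a}"
    then show "?t b = 0 \<or> v (?t a) < v (?t b)" using a vt by simp
  next
    show "?r \<noteq> 0" unfolding r using vt[OF a(1)] by simp
  qed simp
  then show False unfolding r using rval_minus[OF v(1)] vt[OF a(1)] by (metis less_irrefl)
qed

definition peval :: "(nat \<Rightarrow> 'k poly poly) \<Rightarrow> 'k::field mpoly \<Rightarrow> 'k poly poly" where
  "peval U F = (\<Sum>m\<in>Poly_Mapping.keys F. [:[:Poly_Mapping.lookup F m:]:] * mono_eval m U)"

text \<open>Over a finite field the product of all \<open>t - a\<close>, increased by 1, would be a
  nonconstant polynomial without roots.\<close>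

lemma alg_closed_infinite: "infinite (UNIV :: 'k::alg_closed_field set)"
proof
  assume fin: "finite (UNIV :: 'k set)"
  let ?p = "(\<Prod>a\<in>(UNIV :: 'k set). [:- a, 1:]) + 1"
  have ev: "poly ?p x = 1" for x :: 'k
  proof -
    have "(\<Prod>a\<in>(UNIV :: 'k set). poly [:- a, 1:] x) = 0" by (rule prod_zero[OF fin]) (auto intro: bexI[of _ x])
    then show ?thesis by (simp add: poly_prod)
  qed
  have "degree (\<Prod>a\<in>(UNIV :: 'k set). [:- a, 1:]) = (\<Sum>a\<in>(UNIV :: 'k set). 1)"
    by (subst degree_prod_eq_sum_degree) auto
  then have d: "degree (\<Prod>a\<in>(UNIV :: 'k set). [:- a, 1:]) > 0" using fin by (simp add: card_gt_0_iff)
  then have "degree ?p = degree (\<Prod>a\<in>(UNIV :: 'k set). [:- a, 1:])" by (intro degree_add_eq_left) simp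
  then obtain x where "poly ?p x = 0" using alg_closed_imp_poly_has_root[of ?p] d by auto
  then show False unfolding ev by simp
qed

lemma Fract_sum: "Fract (\<Sum>a\<in>S. f a) 1 = (\<Sum>a\<in>S. Fract (f a) (1::'a::idom))"
proof (induction S rule: infinite_finite_induct)
  case (insert a S)
  have "Fract (\<Sum>a\<in>insert a S. f a) 1 = Fract (f a) 1 + Fract (\<Sum>a\<in>S. f a) (1::'a)" using insert(1,2) by simp
  then show ?case unfolding insert.IH using insert(1,2) by simp
qed (simp_all add: Zero_fract_def)

lemma Fract_prod: "Fract (\<Prod>a\<in>S. f a) 1 = (\<Prod>a\<in>S. Fract (f a) (1::'a::idom))"
proof (induction S rule: infinite_finite_induct)
  case (insert a S)
  have "Fract (\<Prod>a\<in>insert a S. f a) 1 = Fract (f a) 1 * Fract (\<Prod>a\<in>S. f a) 1" using insert(1,2) by simp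
  then show ?case unfolding insert.IH using insert(1,2) by simp
qed (simp_all add: One_fract_def)

lemma Fract_power: "Fract a 1 ^ n = Fract (a ^ n) (1::'a::idom)"
  by (induction n) (simp_all add: One_fract_def)

lemma lev_set_zero:
  assumes "\<And>i. i \<in> A \<Longrightarrow> U i = 0" "\<And>i. i \<notin> A \<Longrightarrow> x i = Fract (U i) 1"
  shows "lev x (set_zero A F) = Fract (peval U F) 1"
proof -
  have t: "lev x (zterm A m c) = Fract ([:[:c:]:] * mono_eval m U) 1" for m c
  proof (cases "Poly_Mapping.keys m \<inter> A = {}")
    case True
    have "lmono (Poly_Mapping.map int m) x = (\<Prod>i\<in>Poly_Mapping.keys m. Fract (U i ^ Poly_Mapping.lookup m i) 1)"
      unfolding lmono_def keys_map_int
    proof (rule prod.cong[OF refl])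
      fix i assume "i \<in> Poly_Mapping.keys m"
      then have "x i = Fract (U i) 1" using True assms(2) by blast
      then show "x i powi Poly_Mapping.lookup (Poly_Mapping.map int m) i = Fract (U i ^ Poly_Mapping.lookup m i) 1"
        by (simp add: Fract_power)
    qed
    then have "lmono (Poly_Mapping.map int m) x = Fract (mono_eval m U) 1" unfolding mono_eval_def Fract_prod .
    then show ?thesis using True unfolding zterm_def emb_def[symmetric] by (simp add: lev_single emb_def)
  next
    case False
    then obtain i where i: "i \<in> Poly_Mapping.keys m" "i \<in> A" by blast
    have "U i ^ Poly_Mapping.lookup m i = 0" using assms(1)[OF i(2)] i(1) by (simp add: in_keys_iff)
    then have "mono_eval m U = 0" unfolding mono_eval_def using i(1) by (auto intro!: prod_zero)
    then show ?thesis using False unfolding zterm_def by (simp add: Zero_fract_def)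
  qed
  have "lev x (set_zero A F) = (\<Sum>m\<in>Poly_Mapping.keys F. lev x (zterm A m (Poly_Mapping.lookup F m)))"
    unfolding set_zero_super[OF finite_keys order_refl] lev_sum ..
  also have "\<dots> = Fract (peval U F) 1" unfolding t peval_def Fract_sum ..
  finally show ?thesis .
qed

text \<open>A nonzero polynomial has finitely many roots; this is applied in \<open>t\<close> for
  every fixed \<open>s\<close>, and then in \<open>s\<close>.\<close>

lemma poly_poly_zero:
  fixes P :: "'k::alg_closed_field poly poly"
  assumes "\<And>s t. poly (poly P [:s:]) t = 0" shows "P = 0"
proof -
  have inf: "infinite (UNIV :: 'k set)" by (rule alg_closed_infinite)
  have "poly P [:s:] = 0" for s
  proof (rule ccontr)
    assume "poly P [:s:] \<noteq> 0"
    then have "finite {t. poly (poly P [:s:]) t = 0}" by (rule poly_roots_finite)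
    then show False using assms[of s] inf by simp
  qed
  then have "range (\<lambda>s::'k. [:s:]) \<subseteq> {x. poly P x = 0}" by blast
  moreover have "infinite (range (\<lambda>s::'k. [:s:]))" using inf by (auto simp: finite_image_iff inj_def)
  ultimately show ?thesis using poly_roots_finite finite_subset by blast
qed

lemma poly_peval: "poly (poly (peval (\<lambda>i. [:0, u i:]) F) [:s:]) t = mpoly_eval F (\<lambda>i. s * poly (u i) t)"
  unfolding peval_def mpoly_eval_alt mono_eval_def by (simp add: poly_sum poly_prod poly_power mult.commute)

text \<open>A curve through the points \<open>s \<cdot> u(t)\<close>, read over the function field with its two Gauss valuations,
  is a point of the variety whose valuation is \<open>q\<close>.\<close>

lemma trop_parametrised:
  fixes u :: "nat \<Rightarrow> 'k::alg_closed_field poly"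
  assumes v: "valuation val" and I: "\<And>F s t. F \<in> S \<Longrightarrow> mpoly_eval F (\<lambda>i. s * poly (u i) t) = 0"
    and S: "S \<subseteq> polys_in {..<N}"
    and u: "\<And>i. i < N \<Longrightarrow> u i = 0 \<longleftrightarrow> i \<in> A"
    and w: "\<And>i. i < N \<Longrightarrow> i \<notin> A \<Longrightarrow> gauss (\<lambda>x. real_of_ereal (val x)) r (u i) + l = w i"
    and A: "A \<subseteq> {..<N}"
  shows "w \<in> trop val (stratum_ideal N A (ideal_gen (polys_in {..<N}) S))"
  unfolding trop_iff_umin[OF v]
proof (intro ballI impI)
  let ?val = "\<lambda>x. real_of_ereal (val x)"
  let ?v = "fval (gauss (gauss ?val r) l)"
  have v0: "is_rval ?val" by (rule valuation_rval(1)[OF v])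
  have v1: "is_rval (gauss (gauss ?val r) l)" by (intro is_rval_gauss v0)
  then have v2: "is_rval ?v" by (rule is_rval_fval)
  let ?I = "ideal_gen (polys_in {..<N}) S"
  fix f assume f: "f \<in> stratum_ideal N A ?I" "f \<noteq> 0"
  have fv: "?v (Fract a 1) = gauss (gauss ?val r) l a" if "a \<noteq> 0" for a
    using fval_Fract[OF v1 that, of 1] rval_one[OF v1] by simp
  have ve: "?v (emb c) = ?val c" if "c \<noteq> 0" for c
    unfolding emb_def using fv[of "[:[:c:]:]"] that by (simp add: gauss_const)
  define U where "U i = (if i < N then [:0, u i:] else 0)" for i
  \<comment> \<open>The value 1 is a dummy for the variables that do not occur on the stratum; it
    keeps every \<open>x i\<close> nonzero, as \<open>lev_mult\<close> requires.\<close>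
  define x where "x i = (if i < N \<and> i \<notin> A then Fract (U i) 1 else 1)" for i
  have x0: "x i \<noteq> 0" for i
  proof (cases "i < N \<and> i \<notin> A")
    case True
    then have "[:0, u i:] \<noteq> 0" using u by simp
    then show ?thesis using True unfolding x_def U_def by (simp add: Zero_fract_def eq_fract)
  qed (auto simp: x_def)
  have xw: "?v (x i) = w i" if i: "i \<in> {..<N} - A" for i
  proof -
    have n: "u i \<noteq> 0" using u i by auto
    then have "?v (x i) = gauss (gauss ?val r) l [:0, u i:]" using fv[of "[:0, u i:]"] i unfolding x_def U_def by simp
    also have "\<dots> = w i" using gauss_monom_lin[OF n] w i by simp
    finally show ?thesis .
  qed
  have gen: "lev x (set_zero A F) = 0" if F: "F \<in> S" for F
  proof -
    have Fp: "F \<in> polys_in {..<N}" using F S by blast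
    have eqU: "peval U F = peval (\<lambda>i. [:0, u i:]) F"
      unfolding peval_def mono_eval_def
    proof (intro sum.cong prod.cong refl arg_cong2[where f = "(*)"])
      fix m i assume "m \<in> Poly_Mapping.keys F" "i \<in> Poly_Mapping.keys m"
      then have "i < N" using Fp unfolding polys_in_def by blast
      then show "U i ^ Poly_Mapping.lookup m i = [:0, u i:] ^ Poly_Mapping.lookup m i" unfolding U_def by simp
    qed
    have "peval (\<lambda>i. [:0, u i:]) F = 0" by (rule poly_poly_zero) (unfold poly_peval, rule I[OF F])
    \<comment> \<open>Variables of index at least \<open>N\<close> do not occur in \<open>F\<close>,
      so they may be set to zero too; this agrees with the zeros of \<open>U\<close>.\<close>
    moreover have "lev x (set_zero A F) = lev x (set_zero (A \<union> {N..}) F)"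
    proof -
      have "set_zero A F = set_zero (A \<union> {N..}) F"
        unfolding set_zero_def by (rule sum.cong) (use Fp in \<open>fastforce simp: polys_in_def\<close>)+
      then show ?thesis by simp
    qed
    moreover have "lev x (set_zero (A \<union> {N..}) F) = Fract (peval U F) 1"
    proof (rule lev_set_zero)
      fix i show "i \<in> A \<union> {N..} \<Longrightarrow> U i = 0" using u[of i] unfolding U_def by auto
      show "i \<notin> A \<union> {N..} \<Longrightarrow> x i = Fract (U i) 1" unfolding x_def by auto
    qed
    ultimately show ?thesis unfolding eqU by (simp add: Zero_fract_def)
  qed
  have I0: "lev x (set_zero A F) = 0" if "F \<in> ?I" for F
    by (rule ideal_gen_vanish[where h = "\<lambda>F. lev x (set_zero A F)", OF _ _ gen that])
      (simp_all add: set_zero_sum lev_sum set_zero_mult lev_mult[OF x0])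
  have "lev x f = 0"
    by (rule ideal_gen_vanish[where h = "lev x", OF lev_sum lev_mult[OF x0] _ f(1)[unfolded stratum_ideal_def]]) (use I0 in blast)
  moreover have "?I \<subseteq> polys_in {..<N}"
  proof
    fix F assume "F \<in> ?I"
    then obtain T c where T: "F = (\<Sum>a\<in>T. c a * a)" "T \<subseteq> S" "\<And>a. a \<in> T \<Longrightarrow> c a \<in> polys_in {..<N}"
      unfolding ideal_gen_def by blast
    show "F \<in> polys_in {..<N}" unfolding T(1) by (rule polys_in_sum, rule polys_in_mult) (use T S in auto)
  qed
  then have "f \<in> polys_in ({..<N} - A)" using stratum_ideal_polys_in f(1) by blast
  ultimately show "\<not> umin ?val w f" using umin_lev[of ?v ?val x "{..<N} - A" w f, OF v2 ve x0 xw] by blast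
qed

section \<open>Linear forms and the tropicalisation of a single line\<close>

lemma umin_linear:
  fixes v :: "'k::field \<Rightarrow> real"
  assumes v: "is_rval v" and S: "finite S" "i \<in> S" "i \<notin> A" "\<And>j. j \<in> S \<Longrightarrow> j \<notin> A \<Longrightarrow> j \<noteq> i \<Longrightarrow> w i < w j"
  shows "umin v w (set_zero A (\<Sum>j\<in>S. mvar j))"
proof -
  let ?e = "\<lambda>j. Poly_Mapping.single j 1 :: nat \<Rightarrow>\<^sub>0 int"
  let ?f = "set_zero A (\<Sum>j\<in>S. mvar j) :: 'k laurent"
  have z: "zterm A (Poly_Mapping.single j 1) (1::'k) = (if j \<in> A then 0 else Poly_Mapping.single (?e j) 1)" for j
  proof -
    have "Poly_Mapping.map int (Poly_Mapping.single j 1) = ?e j"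
      by (rule poly_mapping_eqI) (simp add: lookup_single when_def)
    then show ?thesis unfolding zterm_def by simp
  qed
  have inj: "?e j = ?e k \<longleftrightarrow> j = k" for j k
  proof
    assume "?e j = ?e k"
    then have "Poly_Mapping.keys (?e j) = Poly_Mapping.keys (?e k)" by (simp only:)
    then show "j = k" by simp
  qed simp
  have f: "Poly_Mapping.lookup ?f a = (\<Sum>j\<in>S. if j \<in> A then 0 else if ?e j = a then 1 else 0)" for a
    unfolding set_zero_sum mvar_def set_zero_single z lookup_sum by (rule sum.cong) (simp_all add: lookup_single when_def)
  have fe: "Poly_Mapping.lookup ?f (?e k) = 1" if k: "k \<in> S" "k \<notin> A" for k
  proof -
    have "Poly_Mapping.lookup ?f (?e k) = (\<Sum>j\<in>S. if j = k then 1 else 0)"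
      unfolding f inj by (rule sum.cong) (use k in auto)
    then show ?thesis using k(1) S(1) by simp
  qed
  have keys: "\<exists>k\<in>S - A. a = ?e k" if "a \<in> Poly_Mapping.keys ?f" for a
  proof (rule ccontr)
    assume "\<not> ?thesis"
    then have "Poly_Mapping.lookup ?f a = 0" unfolding f by (intro sum.neutral) auto
    then show False using that unfolding in_keys_iff by blast
  qed
  have wd: "wdot w (?e k) = w k" for k unfolding wdot_def by simp
  show ?thesis
    unfolding umin_def
  proof (intro bexI[of _ "?e i"] ballI impI)
    show "?e i \<in> Poly_Mapping.keys ?f" using fe[OF S(2,3)] by (simp add: in_keys_iff)
    fix b assume b: "b \<in> Poly_Mapping.keys ?f" "b \<noteq> ?e i"
    then obtain k where k: "k \<in> S" "k \<notin> A" "b = ?e k" using keys by blast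
    then have "w i < w k" using S(4) b(2) by blast
    then show "v (Poly_Mapping.lookup ?f (?e i)) + wdot w (?e i) < v (Poly_Mapping.lookup ?f b) + wdot w b"
      unfolding k(3) fe[OF S(2,3)] fe[OF k(1,2)] wd by simp
  qed
qed

lemma umin_one: "umin v w 1"
  unfolding umin_def by simp

lemma umin_nonzero: "umin v w f \<Longrightarrow> f \<noteq> 0"
  unfolding umin_def by auto

lemma umin_set_zero_prod:
  assumes v: "is_rval v" and "finite S" "\<And>s. s \<in> S \<Longrightarrow> umin v w (set_zero A (f s))"
  shows "umin v w (set_zero A (\<Prod>s\<in>S. f s))"
  using assms(2,3)
proof (induction S rule: finite_induct)
  case empty then show ?case by (simp add: umin_one)
next
  case (insert s S) then show ?case by (simp add: set_zero_mult umin_mult[OF v])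
qed

text \<open>\<open>trop_line A g q\<close>: the point \<open>q\<close> lies on the tropicalisation of the line on which only the coordinates of
  \<open>A\<close> are nonzero and the coordinates sum to zero, where the coordinate \<open>g\<close> is omitted.\<close>

definition trop_line :: "nat set \<Rightarrow> nat \<Rightarrow> (nat \<Rightarrow> ereal) \<Rightarrow> bool" where
  "trop_line A g q \<longleftrightarrow> (\<forall>i<g. i \<notin> A \<longrightarrow> q i = \<infinity>) \<and> (g \<notin> A \<longrightarrow> (\<forall>i\<in>A. \<exists>j\<in>A. j \<noteq> i \<and> q j \<le> q i))"

text \<open>If \<open>g\<close> belongs to \<open>A\<close>, its coordinate is minus the sum of the
  other two, which are then free, and \<open>a\<close> names one of least weight. Otherwise the
  minimum is attained twice, at \<open>a\<close> and \<open>b\<close>, and \<open>c\<close> is a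
  coordinate of greatest weight.\<close>

lemma trop_line_cases:
  assumes q: "q \<in> tp_cone g" and A: "A \<subseteq> {..g}" "card A = 3" and t: "trop_line A g q"
  obtains (outer) a b where "A = {g, a, b}" "distinct [g, a, b]" "a < g" "b < g" "q a \<noteq> \<infinity>" "q a \<le> q b"
  | (inner) a b c where "g \<notin> A" "A = {a, b, c}" "distinct [a, b, c]" "a < g" "b < g" "c < g" "q a \<noteq> \<infinity>" "q a = q b" "q a \<le> q c"
proof -
  have fA: "finite A" using A(1) finite_subset by blast
  have inf: "q i = \<infinity>" if "i < g" "i \<notin> A" for i using t that unfolding trop_line_def by blast
  obtain i0 where i0: "i0 < g" "q i0 \<noteq> \<infinity>" using q unfolding tp_cone_def by blast
  then have i0A: "i0 \<in> A" using inf by blast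
  show ?thesis
  proof (cases "g \<in> A")
    case True
    have "card (A - {g, i0}) = 1" using card_Diff_subset[of "{g, i0}" A] A(2) True i0A i0(1) by simp
    then obtain b where b: "A - {g, i0} = {b}" by (auto simp: card_1_singleton_iff)
    then have bb: "b \<in> A" "b \<noteq> g" "b \<noteq> i0" by blast+
    have Ae: "A = {g, i0, b}" using b True i0A by blast
    have bg: "b < g" using bb A(1) by (metis atMost_iff le_neq_implies_less subsetD)
    show ?thesis
    proof (cases "q i0 \<le> q b")
      case True then show ?thesis using outer[of i0 b] Ae bb bg i0 by simp
    next
      case False
      then have "q b \<noteq> \<infinity>" "q b \<le> q i0" by auto
      moreover have "A = {g, b, i0}" using Ae by blast
      ultimately show ?thesis using outer[of b i0] bb bg i0 by simp
    qed
  next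
    case False
    have Ag: "i < g" if "i \<in> A" for i using that A(1) False by (metis atMost_iff le_neq_implies_less subsetD)
    have two: "\<exists>j\<in>A. j \<noteq> i \<and> q j \<le> q i" if "i \<in> A" for i using t False that unfolding trop_line_def by blast
    have "Max (q ` A) \<in> q ` A" using i0A fA by (intro Max_in) auto
    then obtain c where c: "c \<in> A" "q c = Max (q ` A)" by auto
    have cm: "q i \<le> q c" if "i \<in> A" for i unfolding c(2) using that fA by simp
    have "card (A - {c}) = 2" using c(1) A(2) fA by simp
    then obtain a b where ab: "A - {c} = {a, b}" "a \<noteq> b" by (auto simp: card_2_iff)
    then have Ae: "A = {a, b, c}" "a \<noteq> c" "b \<noteq> c" using c(1) by blast+
    have "q b \<le> q a"
    proof -
      obtain j where "j \<in> A" "j \<noteq> a" "q j \<le> q a" using two[of a] Ae by auto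
      then show ?thesis using Ae cm[of b] by auto
    qed
    moreover have "q a \<le> q b"
    proof -
      obtain j where "j \<in> A" "j \<noteq> b" "q j \<le> q b" using two[of b] Ae by auto
      then show ?thesis using Ae cm[of a] by auto
    qed
    ultimately have eab: "q a = q b" by simp
    have "q a \<noteq> \<infinity>"
    proof
      assume "q a = \<infinity>"
      then have "q i0 = \<infinity>" using i0A Ae cm[of a] eab by auto
      then show False using i0 by simp
    qed
    then show ?thesis using inner[of a b c] False Ae ab(2) eab Ag cm[of a] by simp
  qed
qed

lemma tp_cone_real: "q \<in> tp_cone g \<Longrightarrow> i < g \<Longrightarrow> q i \<noteq> \<infinity> \<Longrightarrow> q i = ereal (real_of_ereal (q i))"
  unfolding tp_cone_def by (cases "q i") (auto simp: PiE_iff)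

text \<open>The line is parametrised by (1, t) in the two free coordinates, or by (1, -1 - t, t) if
  the three coordinates sum to zero; \<open>t\<close> is replaced by 0 when its coordinate is to be
  infinite. The shift \<open>l\<close> is the least weight, and the Gauss parameter \<open>r\<close>
  is the excess of the coordinate of \<open>t\<close> over it, if that is finite.\<close>

lemma trop_line_param:
  fixes v :: "'k::field \<Rightarrow> real"
  assumes v: "is_rval v" and q: "q \<in> tp_cone g" and A: "A \<subseteq> {..g}" "card A = 3" and t: "trop_line A g q"
  obtains u r l where "\<And>i. i \<notin> A \<Longrightarrow> u i = (0 :: 'k poly)" "\<And>i. i \<ge> g \<Longrightarrow> u i = 0" "\<And>i. i < g \<Longrightarrow> u i = 0 \<longleftrightarrow> q i = \<infinity>"
    "g \<notin> A \<Longrightarrow> (\<Sum>i<g. u i) = 0" "\<And>i. i < g \<Longrightarrow> q i \<noteq> \<infinity> \<Longrightarrow> gauss v r (u i) + l = real_of_ereal (q i)"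
proof -
  have inf: "q i = \<infinity>" if "i < g" "i \<notin> A" for i using t that unfolding trop_line_def by blast
  note re = tp_cone_real[OF q]
  have v1: "v 1 = 0" "v (-1) = 0" using rval_one[OF v] by auto
  have g1: "gauss v r 1 = 0" for r using gauss_const[of 1 v r] v1 by (simp add: pCons_one)
  from q A t show ?thesis
  proof (cases rule: trop_line_cases)
    case (outer a b)
    define u where "u i = (if i = a then 1 else if i = b \<and> q b \<noteq> \<infinity> then [:0, 1:] else (0 :: 'k poly))" for i
    define l where "l = real_of_ereal (q a)"
    define r where "r = real_of_ereal (q b) - l"
    show ?thesis
    proof (rule that[of u r l])
      show "u i = 0" if "i \<notin> A" for i using that outer(1) unfolding u_def by auto
      show "u i = 0" if "i \<ge> g" for i using that outer(3,4) unfolding u_def by auto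
      show "u i = 0 \<longleftrightarrow> q i = \<infinity>" if "i < g" for i
      proof (cases "i = a \<or> i = b")
        case True then show ?thesis using outer(2,5) unfolding u_def by auto
      next
        case False
        then have "q i = \<infinity>" using inf[OF that] that outer(1) by auto
        then show ?thesis using False unfolding u_def by simp
      qed
      show "(\<Sum>i<g. u i) = 0" if "g \<notin> A" using that outer(1) by blast
      fix i assume i: "i < g" "q i \<noteq> \<infinity>"
      then have "i \<in> A" using inf by blast
      then consider "i = a" | "i = b" "b \<noteq> a" using outer(1,2) i(1) by auto
      then show "gauss v r (u i) + l = real_of_ereal (q i)"
      proof cases
        case 1 then show ?thesis using g1 unfolding u_def l_def by simp
      next
        case 2
        then have "u i = [:0, 1:]" using i(2) unfolding u_def by simp
        then show ?thesis using 2 v1 gauss_monom_lin[of 1 v r] unfolding r_def by simp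
      qed
    qed
  next
    case (inner a b c)
    define l where "l = real_of_ereal (q a)"
    define r where "r = (if q c = \<infinity> then 0 else real_of_ereal (q c) - l)"
    define u where "u i = (if i = a then 1 else if i = b then (if q c = \<infinity> then [:-1:] else [:-1, -1:])
      else if i = c \<and> q c \<noteq> \<infinity> then [:0, 1:] else (0 :: 'k poly))" for i
    show ?thesis
    proof (rule that[of u r l])
      show u0: "u i = 0" if "i \<notin> A" for i using that inner(2) unfolding u_def by auto
      show "u i = 0" if "i \<ge> g" for i using that inner(4-6) unfolding u_def by auto
      show "u i = 0 \<longleftrightarrow> q i = \<infinity>" if "i < g" for i
      proof (cases "i \<in> A")
        case True then show ?thesis using inner(2,3,7,8) unfolding u_def by (auto simp: one_pCons)
      next
        case False
        then show ?thesis using inf[OF that] u0 by simp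
      qed
      have "(\<Sum>i<g. u i) = (\<Sum>i\<in>A. u i)" using u0 inner(2,4-6) by (intro sum.mono_neutral_right) auto
      also have "\<dots> = 0" using inner(2,3) unfolding u_def by (auto simp: one_pCons)
      finally show "(\<Sum>i<g. u i) = 0" .
      fix i assume i: "i < g" "q i \<noteq> \<infinity>"
      then have "i \<in> A" using inf by blast
      then consider "i = a" | "i = b" | "i = c" "q c \<noteq> \<infinity>" using inner(2) i(2) by auto
      then show "gauss v r (u i) + l = real_of_ereal (q i)"
      proof cases
        case 1 then show ?thesis using g1 unfolding u_def l_def by simp
      next
        case 2
        show ?thesis
        proof (cases "q c = \<infinity>")
          case True
          then have "u i = [:-1:]" using 2 inner(3) unfolding u_def by simp
          then show ?thesis using gauss_const[of "-1" v r] v1 2 inner(8) unfolding l_def by simp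
        next
          case False
          \<comment> \<open>\<open>r \<ge> 0\<close> makes the constant term of
            \<open>-1 - t\<close> dominant, so that \<open>a\<close> and \<open>b\<close> get the
            same weight.\<close>
          have "ereal (real_of_ereal (q a)) \<le> ereal (real_of_ereal (q c))"
            using re[OF inner(4,7)] re[OF inner(6) False] inner(9) by simp
          then have "r \<ge> 0" using False unfolding r_def l_def by simp
          moreover have "u i = [:-1, -1:]" using 2 inner(3) False unfolding u_def by simp
          ultimately show ?thesis using gauss_lin[of "-1" "-1" v r] v1 2 inner(8) unfolding l_def by simp
        qed
      next
        case 3
        then have "u i = [:0, 1:]" using inner(3) unfolding u_def by auto
        then show ?thesis using 3 v1 gauss_monom_lin[of 1 v r] unfolding r_def by simp
      qed
    qed
  qed
qed

section \<open>The tropicalisation of the curve as a union of tropical lines\<close>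

context param_system
begin

abbreviation "gens \<equiv> {H \<in> polys_in {..<g}. (\<exists>d. homogeneous d H) \<and> (\<forall>p\<in>(\<Union>v\<in>V. Lin v). \<forall>x\<in>p. mpoly_eval H x = 0)}"

lemma gens_vanish:
  assumes H: "H \<in> gens" and v: "v \<in> V" and X: "\<And>i. i \<ge> g \<Longrightarrow> X i = 0" "\<And>i. i \<le> g \<Longrightarrow> i \<notin> fc v \<Longrightarrow> ext X i = 0"
  shows "mpoly_eval H X = 0"
proof -
  obtain d where d: "hpoly g d H" using H unfolding hpoly_def by blast
  have z: "mpoly_eval H x = 0" if "p \<in> Lin v" "x \<in> p" for p x using H v that by blast
  show ?thesis
  proof (cases "\<exists>i. X i \<noteq> 0")
    case True
    have "proj_class X \<in> proj_space g" unfolding proj_space_iff hvec_def using True X(1) by blast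
    moreover have "ext Y i = 0" if "Y \<in> proj_class X" "i \<le> g" "i \<notin> fc v" for Y i
    proof -
      have "\<exists>c. c \<noteq> 0 \<and> Y = (\<lambda>i. c * X i)" using that(1) unfolding proj_class_iff .
      then obtain c where "Y = (\<lambda>i. c * X i)" by metis
      then show ?thesis using ext_scale[of c X] X(2)[OF that(2,3)] by simp
    qed
    ultimately have "proj_class X \<in> Lin v" unfolding Lin_def by blast
    then show ?thesis using z proj_class_self by blast
  next
    case False
    \<comment> \<open>The zero vector is not a point of projective space. By homogeneity the value
      there is \<open>0 ^ d\<close> times the value at a point of the line, which is zero even if
      \<open>d = 0\<close>.\<close>
    obtain Y where Y: "mpoly_eval H Y = 0" using z[OF Psi_Lin[OF v]] unfolding Psi_def using proj_class_self by blast
    have "X = (\<lambda>i. 0 * Y i)" using False by auto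
    then show ?thesis using polyfun_homog[OF polyfun_eval[OF d], of 0 Y] Y by simp
  qed
qed

lemma trop_line_imp_trop:
  assumes val: "valuation val" and q: "q \<in> tp_cone g" and v: "v \<in> V" and t: "trop_line (fc v) g q"
  shows "(\<lambda>i. real_of_ereal (q i)) \<in> trop val (stratum_ideal g {i. i < g \<and> q i = \<infinity>} (homogeneous_ideal g (\<Union>v\<in>V. Lin v)))"
proof -
  obtain u r l where u: "\<And>i. i \<notin> fc v \<Longrightarrow> u i = 0" "\<And>i. i \<ge> g \<Longrightarrow> u i = 0" "\<And>i. i < g \<Longrightarrow> u i = 0 \<longleftrightarrow> q i = \<infinity>"
    "g \<notin> fc v \<Longrightarrow> (\<Sum>i<g. u i) = 0"
    "\<And>i. i < g \<Longrightarrow> q i \<noteq> \<infinity> \<Longrightarrow> gauss (\<lambda>x. real_of_ereal (val x)) r (u i) + l = real_of_ereal (q i)"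
    using trop_line_param[OF valuation_rval(1)[OF val] q fc_atMost card_fc[OF v] t] by blast
  show ?thesis
    unfolding homogeneous_ideal_def
  proof (rule trop_parametrised[where u = u and r = r and l = l, OF val])
    fix H s t assume H: "H \<in> gens"
    show "mpoly_eval H (\<lambda>i. s * poly (u i) t) = 0"
    proof (rule gens_vanish[OF H v])
      show "s * poly (u i) t = 0" if "i \<ge> g" for i using u(2)[OF that] by simp
      fix i assume i: "i \<le> g" "i \<notin> fc v"
      show "ext (\<lambda>i. s * poly (u i) t) i = 0"
      proof (cases "i = g")
        case True
        then have "(\<Sum>k<g. s * poly (u k) t) = s * poly (\<Sum>k<g. u k) t" by (simp add: poly_sum sum_distrib_left)
        also have "\<dots> = 0" using u(4) i(2) True by simp
        finally show ?thesis using True unfolding ext_def by simp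
      next
        case False
        then show ?thesis using u(1)[OF i(2)] i(1) unfolding ext_def by simp
      qed
    qed
  qed (use u in auto)
qed

lemma trop_imp_trop_line:
  assumes val: "valuation val" and q: "q \<in> tp_cone g"
    and t: "(\<lambda>i. real_of_ereal (q i)) \<in> trop val (stratum_ideal g {i. i < g \<and> q i = \<infinity>} (homogeneous_ideal g (\<Union>v\<in>V. Lin v)))"
  shows "\<exists>v\<in>V. trop_line (fc v) g q"
proof (rule ccontr)
  assume no: "\<not> ?thesis"
  let ?A = "{i. i < g \<and> q i = \<infinity>}"
  let ?w = "\<lambda>i. real_of_ereal (q i)"
  let ?val = "\<lambda>x. real_of_ereal (val x)"
  have rv: "is_rval ?val" by (rule valuation_rval(1)[OF val])
  have re: "q i = ereal (?w i)" if "i < g" "q i \<noteq> \<infinity>" for i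
    using q that unfolding tp_cone_def by (cases "q i") (auto simp: PiE_iff)
  have "\<exists>l. hpoly g 1 l \<and> (\<forall>p\<in>Lin v. \<forall>x\<in>p. mpoly_eval l x = 0) \<and> umin ?val ?w (set_zero ?A l)" if v: "v \<in> V" for v
  proof -
    have "\<not> trop_line (fc v) g q" using no v by blast
    \<comment> \<open>A weight off the tropical line either is finite at a coordinate that vanishes
      on the line, giving the form \<open>x i\<close>, or has a unique minimum among the three
      coordinates, giving their sum. Both forms are sums of variables over a set \<open>S\<close>
      and are treated together.\<close>
    then consider i where "i < g" "i \<notin> fc v" "q i \<noteq> \<infinity>"
      | i where "g \<notin> fc v" "i \<in> fc v" "\<And>j. j \<in> fc v \<Longrightarrow> j \<noteq> i \<Longrightarrow> q i < q j"
      unfolding trop_line_def by (meson not_le)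
    then obtain S i where S: "finite S" "S \<subseteq> {..<g}" "i \<in> S" "q i \<noteq> \<infinity>" "\<And>j. j \<in> S \<Longrightarrow> j \<noteq> i \<Longrightarrow> q i < q j"
      and Sv: "\<And>p x. p \<in> Lin v \<Longrightarrow> x \<in> p \<Longrightarrow> (\<Sum>j\<in>S. x j) = 0"
    proof cases
      case (1 i)
      have "x i = 0" if "p \<in> Lin v" "x \<in> p" for p x
      proof -
        have "ext x i = 0" using that 1(1,2) unfolding Lin_def by simp
        then show ?thesis using 1(1) unfolding ext_def by simp
      qed
      then show ?thesis using that[of "{i}" i] 1 by simp
    next
      case (2 i)
      obtain j where "j \<in> fc v" "j \<noteq> i" using fc_two[OF v] by metis
      then have "q i \<noteq> \<infinity>" using 2(3) by fastforce
      moreover have "fc v \<subseteq> {..<g}" using fc_le 2(1) by (metis lessThan_iff le_neq_implies_less subsetI)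
      moreover have "(\<Sum>j\<in>fc v. x j) = 0" if "p \<in> Lin v" "x \<in> p" for p x
      proof -
        have "ext x k = 0" if "k \<le> g" "k \<notin> fc v" for k using \<open>p \<in> Lin v\<close> \<open>x \<in> p\<close> that unfolding Lin_def by blast
        then have "(\<Sum>i\<le>g. ext x i) = (\<Sum>i\<in>fc v. ext x i)" using fc_atMost by (intro sum.mono_neutral_right) auto
        also have "\<dots> = (\<Sum>i\<in>fc v. x i)" by (rule sum.cong) (use \<open>fc v \<subseteq> {..<g}\<close> in \<open>auto simp: ext_def\<close>)
        finally show ?thesis using ext_sum[of x] by simp
      qed
      ultimately show ?thesis using that[of "fc v" i] 2 by simp
    qed
    let ?l = "\<Sum>j\<in>S. mvar j :: 'k mpoly"
    have "hpoly g 1 ?l" by (rule hpoly_sum, rule hpoly_mvar) (use S(2) in auto)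
    moreover have "\<forall>p\<in>Lin v. \<forall>x\<in>p. mpoly_eval ?l x = 0" using Sv by (simp add: mpoly_eval_sum mpoly_eval_mvar)
    moreover have "umin ?val ?w (set_zero ?A ?l)"
    proof (rule umin_linear[OF rv S(1,3)])
      show "i \<notin> ?A" using S(4) by simp
      fix j assume j: "j \<in> S" "j \<notin> ?A" "j \<noteq> i"
      then have jg: "j < g" "q j \<noteq> \<infinity>" using S(2) by auto
      have ig: "i < g" using S(2,3) by auto
      have "ereal (?w i) < ereal (?w j)" using S(5)[OF j(1,3)] re[OF jg] re[OF ig S(4)] by simp
      then show "?w i < ?w j" by simp
    qed
    ultimately show ?thesis by blast
  qed
  then have "\<forall>v\<in>V. \<exists>l. hpoly g 1 l \<and> (\<forall>p\<in>Lin v. \<forall>x\<in>p. mpoly_eval l x = 0) \<and> umin ?val ?w (set_zero ?A l)" by blast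
  from bchoice[OF this] obtain l where
    l0: "\<forall>v\<in>V. hpoly g 1 (l v) \<and> (\<forall>p\<in>Lin v. \<forall>x\<in>p. mpoly_eval (l v) x = 0) \<and> umin ?val ?w (set_zero ?A (l v))" ..
  have l: "\<And>v. v \<in> V \<Longrightarrow> hpoly g 1 (l v)" "\<And>v p x. v \<in> V \<Longrightarrow> p \<in> Lin v \<Longrightarrow> x \<in> p \<Longrightarrow> mpoly_eval (l v) x = 0"
    "\<And>v. v \<in> V \<Longrightarrow> umin ?val ?w (set_zero ?A (l v))" using l0 by blast+
  let ?P = "\<Prod>v\<in>V. l v"
  have "hpoly g (\<Sum>v\<in>V. 1) ?P" by (rule hpoly_prod[OF l(1) finV])
  moreover have "mpoly_eval ?P x = 0" if "v \<in> V" "p \<in> Lin v" "x \<in> p" for v p x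
    unfolding mpoly_eval_prod by (rule prod_zero[OF finV]) (use l(2) that in blast)
  ultimately have "?P \<in> gens" unfolding hpoly_def by blast
  then have "?P \<in> homogeneous_ideal g (\<Union>v\<in>V. Lin v)"
    unfolding homogeneous_ideal_def by (rule ideal_gen_mem[OF one_polys_in])
  then have "set_zero ?A ?P \<in> stratum_ideal g ?A (homogeneous_ideal g (\<Union>v\<in>V. Lin v))"
    unfolding stratum_ideal_def by (intro ideal_gen_mem[OF one_polys_in] imageI)
  moreover have "umin ?val ?w (set_zero ?A ?P)" by (rule umin_set_zero_prod[OF rv finV l(3)])
  ultimately show False using t umin_nonzero unfolding trop_iff_umin[OF val] by blast
qed

lemma trop_proj_curve:
  assumes "valuation val"
  shows "trop_proj val g (homogeneous_ideal g (\<Union>v\<in>V. Lin v)) = {tp_class g q | q. q \<in> tp_cone g \<and> (\<exists>v\<in>V. trop_line (fc v) g q)}"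
  unfolding trop_proj_def using trop_line_imp_trop[OF assms] trop_imp_trop_line[OF assms] by blast

end

section \<open>Points of tropical projective space in multiplicative coordinates\<close>

text \<open>Multiplicative coordinates \<open>exp (- q)\<close>: infinity becomes 0, translation
  becomes scaling, and continuity at infinity becomes continuity at 0 on the closed
  half-line.\<close>

definition ln_coord :: "real \<Rightarrow> ereal" where "ln_coord y = (if y = 0 then \<infinity> else ereal (- ln y))"

definition exp_coord :: "ereal \<Rightarrow> real" where "exp_coord x = (if x = \<infinity> then 0 else exp (- real_of_ereal x))"

lemma ln_coord_simps [simp]: "ln_coord 0 = \<infinity>" "ln_coord 1 = 0" "ln_coord y \<noteq> -\<infinity>" "ln_coord y = \<infinity> \<longleftrightarrow> y = 0"
  unfolding ln_coord_def by auto

lemma exp_ln_coord: "y \<ge> 0 \<Longrightarrow> exp_coord (ln_coord y) = y"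
  unfolding exp_coord_def ln_coord_def by auto

lemma ln_exp_coord: "x \<noteq> -\<infinity> \<Longrightarrow> ln_coord (exp_coord x) = x"
  unfolding exp_coord_def ln_coord_def by (cases x) auto

lemma exp_coord_nonneg: "exp_coord x \<ge> 0" unfolding exp_coord_def by simp

lemma exp_coord_pos: "x \<noteq> \<infinity> \<Longrightarrow> exp_coord x > 0" unfolding exp_coord_def by simp

lemma exp_coord_add: "x \<noteq> -\<infinity> \<Longrightarrow> exp_coord (ereal r + x) = exp (- r) * exp_coord x"
  unfolding exp_coord_def by (cases x) (auto simp flip: exp_add)

lemma exp_coord_le_one: "0 \<le> x \<Longrightarrow> exp_coord x \<le> 1"
  unfolding exp_coord_def by (cases x) auto

lemma ln_coord_nonneg: "0 \<le> y \<Longrightarrow> y \<le> 1 \<Longrightarrow> 0 \<le> ln_coord y"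
  unfolding ln_coord_def by auto

lemma ln_coord_continuous: "continuous_on {0..} ln_coord"
  unfolding continuous_on_def
proof
  fix y :: real assume y: "y \<in> {0..}"
  show "(ln_coord \<longlongrightarrow> ln_coord y) (at y within {0..})"
  proof (cases "y = 0")
    case True
    show ?thesis unfolding True ln_coord_simps
      unfolding tendsto_PInfty
    proof
      fix r :: real
      have "\<forall>\<^sub>F z in at (0::real) within {0..}. z < exp (- r)"
        by (rule order_tendstoD(2)[OF tendsto_ident_at]) simp
      moreover have "\<forall>\<^sub>F z in at (0::real) within {0..}. z \<in> {0..} \<and> z \<noteq> 0" by (simp add: eventually_at_filter)
      ultimately show "\<forall>\<^sub>F z in at 0 within {0..}. ereal r < ln_coord z"
      proof eventually_elim
        case (elim z)
        then have "ln z < - r" using ln_less_cancel_iff[of z "exp (- r)"] by simp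
        then show ?case using elim unfolding ln_coord_def by simp
      qed
    qed
  next
    case False
    then have pos: "y > 0" using y by simp
    have "isCont (\<lambda>z. ereal (- ln z)) y" using pos by (intro continuous_intros) auto
    then have "((\<lambda>z. ereal (- ln z)) \<longlongrightarrow> ereal (- ln y)) (at y within {0..})"
      by (meson isCont_def tendsto_within_subset subset_UNIV)
    moreover have "\<forall>\<^sub>F z in at y within {0..}. ereal (- ln z) = ln_coord z"
    proof -
      have "\<forall>\<^sub>F z in at y within {0..}. 0 < z" by (rule order_tendstoD(1)[OF tendsto_ident_at pos])
      then show ?thesis by eventually_elim (simp add: ln_coord_def)
    qed
    ultimately have "(ln_coord \<longlongrightarrow> ereal (- ln y)) (at y within {0..})" by (rule Lim_transform_eventually)
    then show ?thesis using False unfolding ln_coord_def by simp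
  qed
qed

lemma exp_coord_continuous: "continuous_on {x. x \<noteq> -\<infinity>} exp_coord"
  unfolding continuous_on_def
proof
  fix x :: ereal assume x: "x \<in> {x. x \<noteq> -\<infinity>}"
  let ?F = "at x within {x. x \<noteq> -\<infinity>}"
  show "(exp_coord \<longlongrightarrow> exp_coord x) ?F"
  proof (cases "x = \<infinity>")
    case True
    show ?thesis
    proof (rule order_tendstoI)
      fix a assume "a < exp_coord x"
      then have "a < 0" using True unfolding exp_coord_def by simp
      then show "\<forall>\<^sub>F z in ?F. a < exp_coord z" using exp_coord_nonneg by (simp add: less_le_trans)
    next
      fix a assume "exp_coord x < a"
      then have a: "0 < a" using True unfolding exp_coord_def by simp
      have "\<forall>\<^sub>F z in ?F. ereal (- ln a) < z" by (rule order_tendstoD(1)[OF tendsto_ident_at]) (simp add: True)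
      then show "\<forall>\<^sub>F z in ?F. exp_coord z < a"
      proof eventually_elim
        case (elim z)
        show ?case
        proof (cases "z = \<infinity>")
          case False
          then have "- real_of_ereal z < ln a" using elim by (cases z) auto
          then have "exp (- real_of_ereal z) < exp (ln a)" by simp
          then show ?thesis using False a unfolding exp_coord_def by simp
        qed (simp add: exp_coord_def a)
      qed
    qed
  next
    case False
    have "continuous_on (UNIV - {\<infinity>, -\<infinity>}) (\<lambda>z. exp (- real_of_ereal z))"
      by (intro continuous_intros continuous_on_real)
    then have "isCont (\<lambda>z. exp (- real_of_ereal z)) x"
      using x False by (subst (asm) continuous_on_eq_continuous_at) (auto intro: open_delete open_Diff finite_imp_closed)
    then have "((\<lambda>z. exp (- real_of_ereal z)) \<longlongrightarrow> exp (- real_of_ereal x)) ?F"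
      by (meson isCont_def tendsto_within_subset subset_UNIV)
    moreover have "\<forall>\<^sub>F z in ?F. exp (- real_of_ereal z) = exp_coord z"
    proof -
      have "\<forall>\<^sub>F z in ?F. z < \<infinity>" by (rule order_tendstoD(2)[OF tendsto_ident_at]) (use False in simp)
      then show ?thesis by eventually_elim (simp add: exp_coord_def)
    qed
    ultimately have "(exp_coord \<longlongrightarrow> exp (- real_of_ereal x)) ?F" by (rule Lim_transform_eventually)
    then show ?thesis using False unfolding exp_coord_def by simp
  qed
qed

lemma continuous_map_from_quotient:
  assumes "continuous_map X Y (f \<circ> q)" shows "continuous_map (quotient_topology X q) Y f"
proof -
  have im: "f (q x) \<in> topspace Y" if "x \<in> topspace X" for x
    using assms that unfolding continuous_map_def by auto
  show ?thesis
    unfolding continuous_map_def openin_quotient_topology topspace_quotient_topology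
  proof (intro conjI allI impI)
    show "f \<in> q ` topspace X \<rightarrow> topspace Y" using im by auto
    fix U assume U: "openin Y U"
    have "{x \<in> topspace X. q x \<in> {c \<in> q ` topspace X. f c \<in> U}} = {x \<in> topspace X. (f \<circ> q) x \<in> U}" by auto
    then show "openin X {x \<in> topspace X. q x \<in> {c \<in> q ` topspace X. f c \<in> U}}"
      using assms U unfolding continuous_map_def by simp
  qed auto
qed

lemma continuous_map_to_quotient: "continuous_map X (quotient_topology X q) q"
  unfolding continuous_map_def openin_quotient_topology topspace_quotient_topology by auto

lemma tp_class_self: "q \<in> extensional {..<N} \<Longrightarrow> q \<in> tp_class N q"
  unfolding tp_class_def by (auto simp: extensional_def restrict_def fun_eq_iff intro!: exI[of _ 0])

lemma tp_class_shift: "tp_class N (\<lambda>i\<in>{..<N}. ereal r + q i) = tp_class N q"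
proof -
  have e: "(\<lambda>i\<in>{..<N}. ereal s + (\<lambda>i\<in>{..<N}. ereal r + q i) i) = (\<lambda>i\<in>{..<N}. ereal (s + r) + q i)" for s
    by (rule restrict_ext) (simp flip: plus_ereal.simps add: add.assoc)
  show ?thesis
  proof
    show "tp_class N (\<lambda>i\<in>{..<N}. ereal r + q i) \<subseteq> tp_class N q" unfolding tp_class_def e by blast
    show "tp_class N q \<subseteq> tp_class N (\<lambda>i\<in>{..<N}. ereal r + q i)"
    proof
      fix p assume "p \<in> tp_class N q"
      then obtain s where "p = (\<lambda>i\<in>{..<N}. ereal s + q i)" unfolding tp_class_def by blast
      then have "p = (\<lambda>i\<in>{..<N}. ereal ((s - r) + r) + q i)" by simp
      then show "p \<in> tp_class N (\<lambda>i\<in>{..<N}. ereal r + q i)" unfolding tp_class_def e by blast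
    qed
  qed
qed

definition simplex_point :: "nat \<Rightarrow> (nat \<Rightarrow> real) \<Rightarrow> nat \<Rightarrow> real" where
  "simplex_point N y = (\<lambda>i\<in>{..<N}. y i / (\<Sum>j<N. y j))"

text \<open>Dividing by the sum of the multiplicative coordinates does not depend on the
  representative. This gives continuous real functions on the quotient that separate points, from
  which Hausdorffness is deduced.\<close>

definition to_simplex :: "nat \<Rightarrow> (nat \<Rightarrow> ereal) set \<Rightarrow> nat \<Rightarrow> real" where
  "to_simplex N C = simplex_point N (\<lambda>i. exp_coord ((SOME q. q \<in> C) i))"

lemma to_simplex_class:
  assumes q: "q \<in> tp_cone N" shows "to_simplex N (tp_class N q) = simplex_point N (\<lambda>i. exp_coord (q i))"
proof -
  have "q \<in> tp_class N q" using q by (intro tp_class_self) (auto simp: tp_cone_def PiE_def)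
  then have "(SOME p. p \<in> tp_class N q) \<in> tp_class N q" by (rule someI[of "\<lambda>p. p \<in> tp_class N q"])
  then obtain r where r: "(SOME p. p \<in> tp_class N q) = (\<lambda>i\<in>{..<N}. ereal r + q i)" unfolding tp_class_def by blast
  have e: "exp_coord ((\<lambda>i\<in>{..<N}. ereal r + q i) i) = exp (- r) * exp_coord (q i)" if "i < N" for i
    using q that exp_coord_add[of "q i" r] unfolding tp_cone_def by (auto simp: PiE_iff)
  have s: "(\<Sum>j<N. exp_coord ((\<lambda>i\<in>{..<N}. ereal r + q i) j)) = exp (- r) * (\<Sum>j<N. exp_coord (q j))"
    unfolding sum_distrib_left by (rule sum.cong) (use e in auto)
  show ?thesis unfolding to_simplex_def r simplex_point_def s by (rule restrict_ext) (use e in simp)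
qed

lemma topspace_tp_cone: "topspace (subtopology (product_topology (\<lambda>_. euclidean) {..<N}) (tp_cone N)) = tp_cone N"
  by (auto simp: tp_cone_def PiE_def)

lemma to_simplex_continuous: "continuous_map (tp_top N) (product_topology (\<lambda>_. euclideanreal) {..<N}) (to_simplex N)"
  unfolding tp_top_def
proof (rule continuous_map_from_quotient)
  let ?X = "subtopology (product_topology (\<lambda>_. euclidean) {..<N}) (tp_cone N) :: (nat \<Rightarrow> ereal) topology"
  have coord: "continuous_map ?X euclideanreal (\<lambda>q. exp_coord (q i))" if "i < N" for i
  proof -
    have "continuous_map ?X (top_of_set {x. x \<noteq> -\<infinity>}) (\<lambda>q. q i)"
      unfolding continuous_map_in_subtopology
    proof
      show "continuous_map ?X euclidean (\<lambda>q. q i)"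
        using that by (intro continuous_map_from_subtopology continuous_map_product_projection) simp
      show "(\<lambda>q. q i) \<in> topspace ?X \<rightarrow> {x. x \<noteq> -\<infinity>}" using that unfolding topspace_tp_cone tp_cone_def by (auto simp: PiE_iff)
    qed
    moreover have "continuous_map (top_of_set {x. x \<noteq> -\<infinity>}) euclideanreal exp_coord"
      using exp_coord_continuous by simp
    ultimately have "continuous_map ?X euclideanreal (exp_coord \<circ> (\<lambda>q. q i))" by (rule continuous_map_compose)
    then show ?thesis by (simp add: comp_def)
  qed
  have s: "(\<Sum>j<N. exp_coord (q j)) \<noteq> 0" if q: "q \<in> tp_cone N" for q
  proof -
    obtain i where i: "i < N" "q i \<noteq> \<infinity>" using q unfolding tp_cone_def by blast
    have "exp_coord (q i) \<le> (\<Sum>j<N. exp_coord (q j))" using i(1) exp_coord_nonneg by (intro member_le_sum) auto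
    then show ?thesis using exp_coord_pos[OF i(2)] by simp
  qed
  have "continuous_map ?X (product_topology (\<lambda>_. euclideanreal) {..<N}) (\<lambda>q. simplex_point N (\<lambda>i. exp_coord (q i)))"
    unfolding continuous_map_componentwise
  proof (intro conjI ballI)
    show "(\<lambda>q. simplex_point N (\<lambda>i. exp_coord (q i))) ` topspace ?X \<subseteq> extensional {..<N}" by (auto simp: simplex_point_def)
    fix k assume k: "k \<in> {..<N}"
    have "continuous_map ?X euclideanreal (\<lambda>q. exp_coord (q k) / (\<Sum>j<N. exp_coord (q j)))"
    proof (intro continuous_map_real_divide continuous_map_sum coord)
      fix x assume "x \<in> topspace ?X" then show "(\<Sum>j<N. exp_coord (x j)) \<noteq> 0" using s unfolding topspace_tp_cone by blast
    qed (use k in auto)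
    then show "continuous_map ?X euclideanreal (\<lambda>q. simplex_point N (\<lambda>i. exp_coord (q i)) k)"
      using k unfolding simplex_point_def by simp
  qed
  moreover have "(to_simplex N \<circ> tp_class N) q = simplex_point N (\<lambda>i. exp_coord (q i))" if "q \<in> topspace ?X" for q
    using to_simplex_class that unfolding topspace_tp_cone comp_def by blast
  ultimately show "continuous_map ?X (product_topology (\<lambda>_. euclideanreal) {..<N}) (to_simplex N \<circ> tp_class N)"
    by (rule continuous_map_eq[OF _ sym])
qed

text \<open>A normal form for points of tropical projective space: the least tropical coordinate is
  0, that is, the greatest multiplicative coordinate is 1.\<close>

definition max_one :: "nat \<Rightarrow> (nat \<Rightarrow> real) \<Rightarrow> bool" where
  "max_one N y \<longleftrightarrow> (\<forall>i<N. 0 \<le> y i \<and> y i \<le> 1) \<and> (\<exists>i<N. y i = 1)"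

definition tp_of :: "nat \<Rightarrow> (nat \<Rightarrow> real) \<Rightarrow> (nat \<Rightarrow> ereal) set" where
  "tp_of N y = tp_class N (\<lambda>i\<in>{..<N}. ln_coord (y i))"

lemma max_one_cone: assumes "max_one N y" shows "(\<lambda>i\<in>{..<N}. ln_coord (y i)) \<in> tp_cone N"
proof -
  obtain i where "i < N" "y i = 1" using assms unfolding max_one_def by blast
  then have "\<exists>i<N. (\<lambda>i\<in>{..<N}. ln_coord (y i)) i \<noteq> \<infinity>" by (intro exI[of _ i]) simp
  then show ?thesis unfolding tp_cone_def by simp
qed

lemma to_simplex_tp_of: assumes "max_one N y" shows "to_simplex N (tp_of N y) = simplex_point N y"
proof -
  have e: "exp_coord ((\<lambda>i\<in>{..<N}. ln_coord (y i)) i) = y i" if "i < N" for i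
    using assms that exp_ln_coord unfolding max_one_def by simp
  then have "(\<Sum>j<N. exp_coord ((\<lambda>i\<in>{..<N}. ln_coord (y i)) j)) = (\<Sum>j<N. y j)" by (intro sum.cong) auto
  then show ?thesis unfolding tp_of_def to_simplex_class[OF max_one_cone[OF assms]] simplex_point_def
    by (intro restrict_ext) (use e in simp)
qed

text \<open>At an index where \<open>y\<close> is 1, proportionality shows that the sum of
  \<open>z\<close> is at most the sum of \<open>y\<close>; by symmetry the sums agree, and then so
  do the coordinates.\<close>

lemma simplex_point_inj:
  assumes y: "max_one N y" and z: "max_one N z" and e: "simplex_point N y = simplex_point N z" and i: "i < N"
  shows "y i = z i"
proof -
  have pos: "(\<Sum>j<N. y j) > 0" if y: "max_one N y" for y
  proof -
    obtain i where i: "i < N" "y i = 1" using y unfolding max_one_def by blast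
    have "y i \<le> (\<Sum>j<N. y j)" using i(1) y unfolding max_one_def by (intro member_le_sum) auto
    then show ?thesis using i by simp
  qed
  let ?S = "\<Sum>j<N. y j" and ?T = "\<Sum>j<N. z j"
  have c: "y j * ?T = z j * ?S" if "j < N" for j
    using fun_cong[OF e, of j] that pos[OF y] pos[OF z] unfolding simplex_point_def by (simp add: frac_eq_eq)
  obtain j where j: "j < N" "y j = 1" using y unfolding max_one_def by blast
  obtain k where k: "k < N" "z k = 1" using z unfolding max_one_def by blast
  have "?T = z j * ?S" using c[OF j(1)] j(2) by simp
  also have "\<dots> \<le> ?S" using pos[OF y] z j(1) unfolding max_one_def by (simp add: mult_left_le_one_le)
  finally have 1: "?T \<le> ?S" .
  have "?S = y k * ?T" using c[OF k(1)] k(2) by simp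
  also have "\<dots> \<le> ?T" using pos[OF z] y k(1) unfolding max_one_def by (simp add: mult_left_le_one_le)
  finally have "?S = ?T" using 1 by simp
  then show ?thesis using c[OF i] pos[OF z] by simp
qed

lemma tp_of_inj: "max_one N y \<Longrightarrow> max_one N z \<Longrightarrow> tp_of N y = tp_of N z \<Longrightarrow> i < N \<Longrightarrow> y i = z i"
  using simplex_point_inj to_simplex_tp_of by metis

lemma tp_of_continuous:
  assumes c: "\<And>i. i < N \<Longrightarrow> continuous_map X euclideanreal (\<lambda>x. Y x i)" and m: "\<And>x. x \<in> topspace X \<Longrightarrow> max_one N (Y x)"
  shows "continuous_map X (tp_top N) (\<lambda>x. tp_of N (Y x))"
proof -
  let ?P = "subtopology (product_topology (\<lambda>_. euclidean) {..<N}) (tp_cone N) :: (nat \<Rightarrow> ereal) topology"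
  have "continuous_map X ?P (\<lambda>x. \<lambda>i\<in>{..<N}. ln_coord (Y x i))"
    unfolding continuous_map_in_subtopology continuous_map_componentwise
  proof (intro conjI ballI)
    show "(\<lambda>x. \<lambda>i\<in>{..<N}. ln_coord (Y x i)) \<in> topspace X \<rightarrow> tp_cone N" using m max_one_cone by blast
    fix k assume k: "k \<in> {..<N}"
    have "continuous_map X (top_of_set {0..}) (\<lambda>x. Y x k)"
      unfolding continuous_map_in_subtopology using c k m by (auto simp: max_one_def)
    moreover have "continuous_map (top_of_set {0..}) euclidean ln_coord" using ln_coord_continuous by simp
    ultimately have "continuous_map X euclidean (ln_coord \<circ> (\<lambda>x. Y x k))" by (rule continuous_map_compose)
    then show "continuous_map X euclidean (\<lambda>x. (\<lambda>i\<in>{..<N}. ln_coord (Y x i)) k)" using k by (simp add: comp_def)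
  qed auto
  from continuous_map_compose[OF this continuous_map_to_quotient] show ?thesis
    unfolding tp_top_def tp_of_def comp_def .
qed

lemma Hausdorff_tp_subspace:
  assumes "\<And>C. C \<in> S \<Longrightarrow> \<exists>y. max_one N y \<and> C = tp_of N y"
  shows "Hausdorff_space (subtopology (tp_top N) S)"
proof (rule Hausdorff_space_injective_preimage)
  show "Hausdorff_space (product_topology (\<lambda>_. euclideanreal) {..<N})" by (simp add: Hausdorff_space_product_topology)
  show "continuous_map (subtopology (tp_top N) S) (product_topology (\<lambda>_. euclideanreal) {..<N}) (to_simplex N)"
    by (rule continuous_map_from_subtopology[OF to_simplex_continuous])
  show "inj_on (to_simplex N) (topspace (subtopology (tp_top N) S))"
  proof (rule inj_onI)
    fix C D assume CD: "C \<in> topspace (subtopology (tp_top N) S)" "D \<in> topspace (subtopology (tp_top N) S)"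
      and e: "to_simplex N C = to_simplex N D"
    obtain y where y: "max_one N y" "C = tp_of N y" using assms CD(1) by auto
    obtain z where z: "max_one N z" "D = tp_of N z" using assms CD(2) by auto
    have "simplex_point N y = simplex_point N z" using e y z to_simplex_tp_of by metis
    then have "\<And>i. i < N \<Longrightarrow> y i = z i" by (rule simplex_point_inj[OF y(1) z(1)])
    then show "C = D" unfolding y(2) z(2) tp_of_def by (metis (no_types, lifting) lessThan_iff restrict_ext)
  qed
qed

section \<open>The tropical curve\<close>

lemma edge_seg_swap: "u \<noteq> v \<Longrightarrow> edge_seg V u v s = edge_seg V v u (1 - s)"
  unfolding edge_seg_def by (rule restrict_ext) auto

lemma edge_seg_0: "u \<noteq> v \<Longrightarrow> edge_seg V u v 0 = unit_at V u"
  unfolding edge_seg_def unit_at_def by (rule restrict_ext) auto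

section \<open>Cells of the graph and of the tropical curve\<close>

context face_system
begin

text \<open>Two vertices with the same three faces would be joined by an edge with more than one
  pair of sides.\<close>

lemma fc_inj: assumes "u \<in> V" "v \<in> V" "fc u = fc v" shows "u = v"
proof (rule ccontr)
  assume ne: "u \<noteq> v"
  obtain a b c where abc: "fc u = {a, b, c}" "a \<noteq> b" "a \<noteq> c" "b \<noteq> c" using card_fc[OF assms(1)] card_eq_3_iff by metis
  have "fe u v = {a, b}" using fc_share(2)[OF assms(1,2) ne, of "{a, b}"] abc assms(3) by auto
  moreover have "fe u v = {a, c}" using fc_share(2)[OF assms(1,2) ne, of "{a, c}"] abc assms(3) by auto
  ultimately show False using abc(2-4) by (auto simp: doubleton_eq_iff)
qed

text \<open>A directed edge, not running from the outer face into the interior, indexes a cell of the tropical curve: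
  the part of the image of the edge that lies on the tropical line of its first vertex. It is half the edge,
  or the whole edge if it runs towards the outer face.\<close>

definition flag :: "'v \<Rightarrow> 'v \<Rightarrow> bool" where "flag u v \<longleftrightarrow> {u, v} \<in> E \<and> (g \<in> fc u \<longrightarrow> g \<in> fc v)"

text \<open>\<open>r = 1\<close> is the vertex \<open>u\<close>. \<open>r = 0\<close> is the
  midpoint of the edge, except on an edge from a vertex off the outer face to one on it, where it is
  the far end \<open>v\<close>.\<close>

definition cell_graph :: "'v \<Rightarrow> 'v \<Rightarrow> real \<Rightarrow> 'v \<Rightarrow> real" where
  "cell_graph u v r = edge_seg V u v (if g \<in> fc v \<longrightarrow> g \<in> fc u then (1 - r) / 2 else 1 - r)"

text \<open>Multiplicative coordinates of a ray of the tropical line of \<open>u\<close>: the two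
  sides of the edge have least weight, and \<open>r\<close> belongs to the third face at
  \<open>u\<close>. The end \<open>r = 0\<close> lies in the boundary of tropical projective
  space.\<close>

definition cell_trop :: "'v \<Rightarrow> 'v \<Rightarrow> real \<Rightarrow> nat \<Rightarrow> real" where
  "cell_trop u v r i = (if i \<in> fe u v then 1 else if i \<in> fc u then r else 0)"

text \<open>\<open>trop_coord\<close> is a single formula, visibly continuous on the whole graph, for the coordinates \<open>cell_trop\<close>. The
  sum over the vertices of face \<open>i\<close> would do if all cells were whole edges; on an edge \<open>(v, w)\<close> leaving the face \<open>i\<close>
  that is divided into two half-edge cells, the correction makes the coordinate \<open>i\<close> vanish beyond the midpoint.\<close>

definition cut_pairs :: "nat \<Rightarrow> ('v \<times> 'v) set" where
  "cut_pairs i = {(v, w). {v, w} \<in> E \<and> i \<in> fc v \<and> i \<notin> fc w \<and> (g \<in> fc w \<longrightarrow> g \<in> fc v)}"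

definition trop_coord :: "('v \<Rightarrow> real) \<Rightarrow> nat \<Rightarrow> real" where
  "trop_coord t i = (\<Sum>v | v \<in> V \<and> i \<in> fc v. t v) - (\<Sum>(v, w)\<in>cut_pairs i. min (t v) (t w))"

lemma finite_cut_pairs: "finite (cut_pairs i)"
  by (rule finite_subset[of _ "V \<times> V"]) (auto simp: cut_pairs_def finV dest: edge_V)

lemma flag_fe: assumes "flag u v" "g \<in> fc u" shows "g \<in> fe u v"
  using assms fc_Int_edge unfolding flag_def by blast

lemma fe_proper: assumes "{u, v} \<in> E" obtains c where "fc u = insert c (fe u v)" "c \<notin> fe u v"
proof -
  have "card (fc u - fe u v) = 1"
    using card_fc[OF edge_V(1)[OF assms]] card_fe[OF assms] fe_sub(1)[of u v] by (simp add: card_Diff_subset)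
  then obtain c where "fc u - fe u v = {c}" by (auto simp: card_1_singleton_iff)
  then show ?thesis using that[of c] fe_sub(1)[of u v] by blast
qed

text \<open>On one edge only its two ends and at most one cut pair contribute. On a halved edge at
  the point with coordinates \<open>1 - s\<close> and \<open>s\<close>, the face of \<open>u\<close>
  off the edge gets \<open>1 - s - s = r\<close>, and the one of \<open>v\<close> gets
  \<open>s - s = 0\<close>.\<close>

lemma trop_coord_cell:
  assumes f: "flag u v" and r: "0 \<le> r" "r \<le> 1" and i: "i < g"
  shows "trop_coord (cell_graph u v r) i = cell_trop u v r i"
proof -
  have e: "{u, v} \<in> E" using f unfolding flag_def by blast
  note uv = edge_V[OF e]
  define s where "s = (if g \<in> fc v \<longrightarrow> g \<in> fc u then (1 - r) / 2 else 1 - r)"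
  have s: "0 \<le> s" "s \<le> 1" using r unfolding s_def by auto
  let ?t = "edge_seg V u v s"
  have t: "?t u = 1 - s" "?t v = s" "\<And>w. w \<in> V \<Longrightarrow> w \<noteq> u \<Longrightarrow> w \<noteq> v \<Longrightarrow> ?t w = 0"
    using uv unfolding edge_seg_def by auto
  have tnn: "?t w \<ge> 0" if "w \<in> V" for w using that s unfolding edge_seg_def by auto
  have vs: "(\<Sum>w | w \<in> V \<and> i \<in> fc w. ?t w) = (\<Sum>w\<in>{u, v} \<inter> {w. i \<in> fc w}. ?t w)"
    by (rule sum.mono_neutral_right) (use finV uv t(3) in auto)
  have cs: "(\<Sum>(x, w)\<in>cut_pairs i. min (?t x) (?t w)) = (\<Sum>(x, w)\<in>cut_pairs i \<inter> {(u, v), (v, u)}. min (?t x) (?t w))"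
  proof (rule sum.mono_neutral_right[OF finite_cut_pairs])
    show "\<forall>p\<in>cut_pairs i - cut_pairs i \<inter> {(u, v), (v, u)}. (case p of (x, w) \<Rightarrow> min (?t x) (?t w)) = 0"
    proof
      fix p assume p: "p \<in> cut_pairs i - cut_pairs i \<inter> {(u, v), (v, u)}"
      obtain x w where xw: "p = (x, w)" by (cases p)
      have "{x, w} \<in> E" using p unfolding xw cut_pairs_def by auto
      note xV = edge_V[OF this]
      have "(x \<noteq> u \<and> x \<noteq> v) \<or> (w \<noteq> u \<and> w \<noteq> v)" using p xV(3) unfolding xw by auto
      then have "?t x = 0 \<or> ?t w = 0" using t(3) xV by blast
      then show "(case p of (x, w) \<Rightarrow> min (?t x) (?t w)) = 0" using tnn xV(1,2) unfolding xw by fastforce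
    qed
  qed auto
  have fe: "fc u \<inter> fc v = fe u v" by (rule fc_Int_edge[OF e])
  have e': "{v, u} \<in> E" using e by (simp add: insert_commute)
  have eq: "cell_graph u v r = ?t" unfolding cell_graph_def s_def ..
  consider "i \<in> fe u v" | "i \<in> fc u" "i \<notin> fc v" | "i \<in> fc v" "i \<notin> fc u" | "i \<notin> fc u" "i \<notin> fc v" using fe by blast
  then show ?thesis
  proof cases
    case 1
    then have "i \<in> fc u" "i \<in> fc v" using fe by auto
    then have "{u, v} \<inter> {w. i \<in> fc w} = {u, v}" "cut_pairs i \<inter> {(u, v), (v, u)} = {}" unfolding cut_pairs_def by auto
    then show ?thesis unfolding eq trop_coord_def vs cs cell_trop_def using 1 uv(3) t by simp
  next
    case 2
    have ni: "i \<notin> fe u v" using 2 fe by blast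
    have v1: "{u, v} \<inter> {w. i \<in> fc w} = {u}" using 2 by auto
    show ?thesis
    proof (cases "g \<in> fc v \<longrightarrow> g \<in> fc u")
      case True
      then have "cut_pairs i \<inter> {(u, v), (v, u)} = {(u, v)}" using 2 e unfolding cut_pairs_def by auto
      moreover have "s = (1 - r) / 2" using True unfolding s_def by simp
      ultimately show ?thesis unfolding eq trop_coord_def vs cs cell_trop_def v1 using 2 ni t r by (simp add: min_def)
    next
      case False
      then have "cut_pairs i \<inter> {(u, v), (v, u)} = {}" using 2 unfolding cut_pairs_def by auto
      moreover have "s = 1 - r" using False unfolding s_def by simp
      ultimately show ?thesis unfolding eq trop_coord_def vs cs cell_trop_def v1 using 2 ni t by simp
    qed
  next
    case 3
    have ni: "i \<notin> fe u v" using 3 fe by blast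
    have v1: "{u, v} \<inter> {w. i \<in> fc w} = {v}" using 3 by auto
    have cp: "cut_pairs i \<inter> {(u, v), (v, u)} = {(v, u)}" using 3 e' f unfolding cut_pairs_def flag_def by auto
    \<comment> \<open>Otherwise the only face of \<open>v\<close> off the edge is the omitted face
      \<open>g\<close>, while \<open>i < g\<close> is such a face as well.\<close>
    have same: "g \<in> fc v \<longrightarrow> g \<in> fc u"
    proof (rule ccontr)
      assume n: "\<not> ?thesis"
      obtain c where c: "fc v = insert c (fe v u)" using fe_proper[OF e'] by metis
      have "g \<notin> fe v u" using n fe_sub(2)[of u v] fe by blast
      then have "c = g" "i = c" using c n 3 ni fe_sub(2)[of u v] by auto
      then show False using i by simp
    qed
    then have "s = (1 - r) / 2" unfolding s_def by simp
    then show ?thesis unfolding eq trop_coord_def vs cs cell_trop_def v1 cp using 3 ni t r by (simp add: min_def)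
  next
    case 4
    then have "{u, v} \<inter> {w. i \<in> fc w} = {}" "cut_pairs i \<inter> {(u, v), (v, u)} = {}" unfolding cut_pairs_def by auto
    then show ?thesis unfolding eq trop_coord_def vs cs cell_trop_def using 4 fe by auto
  qed
qed

lemma graph_point_seg:
  assumes t: "t \<in> topspace (graph_top V E)"
  obtains u v s where "{u, v} \<in> E" "0 \<le> s" "s \<le> 1" "t = edge_seg V u v s"
proof -
  have tp: "t \<in> extensional V" "\<And>v. v \<in> V \<Longrightarrow> 0 \<le> t v" "(\<Sum>v\<in>V. t v) = 1"
      "(\<exists>v\<in>V. {u\<in>V. t u \<noteq> 0} \<subseteq> {v}) \<or> (\<exists>e\<in>E. {u\<in>V. t u \<noteq> 0} \<subseteq> e)"
    using t unfolding topspace_graph_top by blast+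
  from tp(4) show ?thesis
  proof
    assume "\<exists>v\<in>V. {u\<in>V. t u \<noteq> 0} \<subseteq> {v}"
    then obtain v where v: "v \<in> V" "t = unit_at V v" using support_singleton[OF finV tp(1,3)] by blast
    have "nbrs v \<noteq> {}" using card_nbrs[OF v(1)] by auto
    then obtain w where w: "{v, w} \<in> E" unfolding nbrs_def by blast
    show ?thesis using that[OF w, of 0] v(2) edge_seg_0[OF edge_V(3)[OF w], of V] by simp
  next
    assume "\<exists>e\<in>E. {u\<in>V. t u \<noteq> 0} \<subseteq> e"
    then obtain e where e: "e \<in> E" "{u\<in>V. t u \<noteq> 0} \<subseteq> e" by blast
    obtain u v where uv: "e = {u, v}" "u \<noteq> v" "u \<in> V" "v \<in> V" using edge_ex[OF e(1)] by blast
    have "t = edge_seg V u v (t v)" using support_edge[OF finV tp(1,3)] e(2) uv by blast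
    moreover have "t v \<le> 1" using member_le_sum[OF uv(4), of t] tp(2,3) finV by simp
    ultimately show ?thesis using that[of u v "t v"] e(1) uv(1,4) tp(2) by blast
  qed
qed

text \<open>A divided edge is covered by its halves, an undivided one by the cell that starts at its
  vertex off the outer face.\<close>

lemma graph_point_cell:
  assumes t: "t \<in> topspace (graph_top V E)"
  obtains u v r where "flag u v" "0 \<le> r" "r \<le> 1" "t = cell_graph u v r"
proof -
  obtain u v s where e: "{u, v} \<in> E" and s: "0 \<le> s" "s \<le> 1" and ts: "t = edge_seg V u v s"
    using graph_point_seg[OF t] by metis
  have e': "{v, u} \<in> E" using e by (simp add: insert_commute)
  have sw: "t = edge_seg V v u (1 - s)" using ts edge_seg_swap[OF edge_V(3)[OF e], of V] by simp
  consider "g \<in> fc u \<longleftrightarrow> g \<in> fc v" "s \<le> 1 / 2" | "g \<in> fc u \<longleftrightarrow> g \<in> fc v" "s \<ge> 1 / 2"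
    | "g \<notin> fc u" "g \<in> fc v" | "g \<in> fc u" "g \<notin> fc v" by linarith
  then show ?thesis
  proof cases
    case 1
    then show ?thesis using that[of u v "1 - 2 * s"] e s ts unfolding flag_def cell_graph_def by simp
  next
    case 2
    then have "t = cell_graph v u (2 * s - 1)" unfolding cell_graph_def sw by (auto intro!: arg_cong[where f = "edge_seg V v u"])
    then show ?thesis using that[of v u "2 * s - 1"] 2 e' s unfolding flag_def by simp
  next
    case 3
    then show ?thesis using that[of u v "1 - s"] e s ts unfolding flag_def cell_graph_def by simp
  next
    case 4
    then show ?thesis using that[of v u s] e' s sw unfolding flag_def cell_graph_def by simp
  qed
qed

lemma cell_graph_in: assumes "flag u v" "0 \<le> r" "r \<le> 1" shows "cell_graph u v r \<in> topspace (graph_top V E)"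
  unfolding cell_graph_def using assms edge_V[of u v] unfolding flag_def by (intro edge_seg_in finV) auto

text \<open>At least one of the two sides of the edge differs from the omitted face and so
  contributes a coordinate equal to 1.\<close>

lemma cell_max_one: assumes f: "flag u v" and r: "0 \<le> r" "r \<le> 1" shows "max_one g (cell_trop u v r)"
proof -
  have e: "{u, v} \<in> E" using f unfolding flag_def by blast
  obtain a b where ab: "fe u v = {a, b}" "a \<noteq> b" using card_fe[OF e] card_2_iff by metis
  then have "a < g \<or> b < g" using fe_le[of a u v] fe_le[of b u v] by auto
  then have "\<exists>i<g. cell_trop u v r i = 1" using ab(1) unfolding cell_trop_def by auto
  then show ?thesis unfolding max_one_def using r by (simp add: cell_trop_def)
qed

lemma cell_graph_one: assumes "flag u v" shows "cell_graph u v 1 = unit_at V u"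
proof -
  have "u \<noteq> v" using assms edge_V(3) unfolding flag_def by blast
  then show ?thesis unfolding cell_graph_def by (simp add: edge_seg_0)
qed

text \<open>If the omitted face is at \<open>u\<close>, the choice of directions in
  \<open>flag\<close> makes it a side of the edge. So the parameter \<open>r\<close> can always be
  read off from a coordinate below \<open>g\<close>.\<close>

lemma third_face:
  assumes f: "flag u v" obtains c where "c \<in> fc u" "c \<notin> fe u v" "c < g"
proof -
  have e: "{u, v} \<in> E" using f unfolding flag_def by blast
  obtain c where c: "fc u = insert c (fe u v)" "c \<notin> fe u v" using fe_proper[OF e] by metis
  then have "c \<noteq> g" "c \<le> g" using flag_fe[OF f] fc_le by blast+
  then show ?thesis using that[of c] c by simp
qed

text \<open>The nonzero coordinates determine \<open>fc u\<close>, or \<open>fe u v\<close> at the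
  end \<open>r = 0\<close>, up to the invisible face \<open>g\<close>; this gap is closed by
  counting. An end with \<open>r = 0\<close> can agree with a point with
  \<open>r' \<noteq> 0\<close> only if the latter is a vertex on the outer face and the former the
  end of an undivided edge running there.\<close>

lemma cell_inj:
  assumes f: "flag u v" "flag u' v'" and r: "0 \<le> r" "r \<le> 1" "0 \<le> r'" "r' \<le> 1"
    and y: "\<And>i. i < g \<Longrightarrow> cell_trop u v r i = cell_trop u' v' r' i"
  shows "cell_graph u v r = cell_graph u' v' r'"
proof -
  have supp: "{i. i < g \<and> cell_trop u v r i \<noteq> 0} = (if r = 0 then fe u v else fc u) - {g}" for u v r
    using fe_sub(1)[of u v] fc_le[of _ u] unfolding cell_trop_def by (auto simp: le_less)
  have supp_eq: "(if r = 0 then fe u v else fc u) - {g} = (if r' = 0 then fe u' v' else fc u') - {g}"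
    unfolding supp[symmetric] using y by auto
  have e: "{u, v} \<in> E" "{u', v'} \<in> E" using f unfolding flag_def by auto
  note uv = edge_V[OF e(1)] and uv' = edge_V[OF e(2)]
  have same_card: "S = T" if "S - {g} = T - {g}" "card S = card T" "finite S" "finite T" for S T :: "nat set"
  proof -
    have c: "card X = card (X - {g}) + (if g \<in> X then 1 else 0)" if "finite X" for X
      using card_Suc_Diff1[OF that, of g] by simp
    have "(if g \<in> S then 1 else 0) = (if g \<in> T then 1 else (0::nat))"
      using c[OF that(3)] c[OF that(4)] unfolding that(1,2) by linarith
    then have "g \<in> S \<longleftrightarrow> g \<in> T" by (cases "g \<in> S"; cases "g \<in> T") simp_all
    then show ?thesis using that(1) by blast
  qed
  have mixed: "cell_graph u v r = cell_graph u' v' r'"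
    if f: "flag u v" "flag u' v'" and z: "r = 0" "r' \<noteq> 0"
      and s: "fe u v - {g} = fc u' - {g}" and y: "\<And>i. i < g \<Longrightarrow> cell_trop u v r i = cell_trop u' v' r' i" for u v u' v' r r'
  proof -
    have e: "{u, v} \<in> E" "{u', v'} \<in> E" using f unfolding flag_def by auto
    note uv = edge_V[OF e(1)] and uv' = edge_V[OF e(2)]
    have "card (fc u' - {g}) \<ge> 2" using card_fc[OF uv'(1)] by (simp add: card_Diff_singleton_if)
    then have c2: "card (fe u v - {g}) \<ge> 2" unfolding s .
    have gn: "g \<notin> fe u v"
    proof
      assume "g \<in> fe u v"
      then have "card (fe u v - {g}) = 1" using card_fe[OF e(1)] by (simp add: card_Diff_singleton)
      then show False using c2 by simp
    qed
    then have sub: "fe u v \<subseteq> fc u'" using s by blast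
    obtain w where w: "{u', w} \<in> E" "fe u' w = fe u v" using pair_edge[OF uv'(1) sub card_fe[OF e(1)]] by blast
    have "{u', w} = {u, v}" by (rule fe_inj[OF w(1) e(1) w(2)])
    then have "u' = u \<or> u' = v" by auto
    moreover have gu: "g \<notin> fc u" using flag_fe[OF f(1)] gn by blast
    moreover have gu': "g \<in> fc u'"
    proof (rule ccontr)
      assume "g \<notin> fc u'"
      then have "fc u' = fe u v" using s gn by simp
      then show False using card_fc[OF uv'(1)] card_fe[OF e(1)] by simp
    qed
    ultimately have u'v: "u' = v" by blast
    have "cell_graph u v r = edge_seg V u v 1" using z(1) gu gu' unfolding cell_graph_def u'v by simp
    also have "\<dots> = unit_at V v" using edge_seg_swap[OF uv(3), of V 1] edge_seg_0[of v u V] uv(3) by simp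
    finally have 1: "cell_graph u v r = unit_at V v" .
    obtain c where c: "c \<in> fc u'" "c \<notin> fe u' v'" "c < g" using third_face[OF f(2)] by metis
    then have "c \<in> fe u v" using s by auto
    then have "r' = 1" using y[OF c(3)] c unfolding cell_trop_def by simp
    then show ?thesis using 1 cell_graph_one[OF f(2)] u'v by simp
  qed
  show ?thesis
  proof (cases "r = 0"; cases "r' = 0")
    assume z: "r = 0" "r' = 0"
    have "fe u v = fe u' v'" by (rule same_card) (use supp_eq z card_fe[OF e(1)] card_fe[OF e(2)] in auto)
    then have "{u, v} = {u', v'}" by (rule fe_inj[OF e])
    then consider "u = u'" "v = v'" | "u = v'" "v = u'" by (auto simp: doubleton_eq_iff)
    then show ?thesis
    proof cases
      \<comment> \<open>Both directions are flags, so the edge is halved and the two cells end in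
        its midpoint.\<close>
      case 2
      then have "cell_graph u v r = edge_seg V u v (1 / 2)" "cell_graph u' v' r' = edge_seg V v u (1 / 2)"
        using f z unfolding flag_def cell_graph_def by auto
      then show ?thesis using edge_seg_swap[OF uv(3), of V "1 / 2"] by simp
    qed (use z in simp)
  next
    assume "r = 0" "r' \<noteq> 0"
    then show ?thesis using supp_eq by (intro mixed f y) auto
  next
    assume "r \<noteq> 0" "r' = 0"
    then have "cell_graph u' v' r' = cell_graph u v r" using supp_eq by (intro mixed f) (auto simp: y)
    then show ?thesis ..
  next
    assume z: "r \<noteq> 0" "r' \<noteq> 0"
    have "fc u = fc u'" by (rule same_card) (use supp_eq z card_fc[OF uv(1)] card_fc[OF uv'(1)] in auto)
    then have uu: "u = u'" by (rule fc_inj[OF uv(1) uv'(1)])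
    obtain c where c: "c \<in> fc u" "c \<notin> fe u v" "c < g" using third_face[OF f(1)] by metis
    obtain c' where c': "c' \<in> fc u'" "c' \<notin> fe u' v'" "c' < g" using third_face[OF f(2)] by metis
    show ?thesis
    proof (cases "r = 1 \<or> r' = 1")
      case True
      then have "r = 1 \<and> r' = 1" using y[OF c(3)] y[OF c'(3)] c c' uu unfolding cell_trop_def by (auto split: if_splits)
      then show ?thesis using cell_graph_one[OF f(1)] cell_graph_one[OF f(2)] uu by simp
    next
      case False
      have m: "i \<in> fe u v \<longleftrightarrow> i \<in> fe u' v'" if "i < g" for i
        using y[OF that] False fe_sub(1)[of u v] fe_sub(1)[of u' v'] uu unfolding cell_trop_def by (auto split: if_splits)
      have "fe u v - {g} = fe u' v' - {g}" using m fe_le[of _ u v] fe_le[of _ u' v'] by (auto simp: le_less)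
      then have "fe u v = fe u' v'" by (rule same_card) (use card_fe[OF e(1)] card_fe[OF e(2)] in auto)
      then have "{u, v} = {u', v'}" by (rule fe_inj[OF e])
      then have "v = v'" using uu uv(3) by (auto simp: doubleton_eq_iff)
      moreover have "r = r'" using y[OF c(3)] c uu \<open>v = v'\<close> unfolding cell_trop_def by simp
      ultimately show ?thesis using uu by simp
    qed
  qed
qed

lemma trop_line_cell:
  assumes f: "flag u v" and r: "0 \<le> r" "r \<le> 1"
  shows "trop_line (fc u) g (\<lambda>i\<in>{..<g}. ln_coord (cell_trop u v r i))"
  unfolding trop_line_def
proof (intro conjI allI impI ballI)
  show "(\<lambda>i\<in>{..<g}. ln_coord (cell_trop u v r i)) i = \<infinity>" if "i < g" "i \<notin> fc u" for i
    using that fe_sub(1)[of u v] unfolding cell_trop_def by auto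
  have e: "{u, v} \<in> E" using f unfolding flag_def by blast
  fix i assume g: "g \<notin> fc u" and i: "i \<in> fc u"
  then have lt: "j < g" if "j \<in> fc u" for j using that fc_le[of j u] by (metis le_neq_implies_less)
  obtain a b where ab: "fe u v = {a, b}" "a \<noteq> b" using card_fe[OF e] card_2_iff by metis
  obtain j where j: "j \<in> fe u v" "j \<noteq> i" using ab by (metis insertCI)
  have "0 \<le> cell_trop u v r i" "cell_trop u v r i \<le> 1" using r unfolding cell_trop_def by auto
  moreover have ju: "j \<in> fc u" using j(1) fe_sub(1)[of u v] by blast
  ultimately have "(\<lambda>i\<in>{..<g}. ln_coord (cell_trop u v r i)) j \<le> (\<lambda>i\<in>{..<g}. ln_coord (cell_trop u v r i)) i"
    using lt[OF ju] lt[OF i] j(1) ln_coord_nonneg by (simp add: cell_trop_def)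
  then show "\<exists>j\<in>fc u. j \<noteq> i \<and> (\<lambda>i\<in>{..<g}. ln_coord (cell_trop u v r i)) j \<le> (\<lambda>i\<in>{..<g}. ln_coord (cell_trop u v r i)) i"
    using ju j(2) by blast
qed

text \<open>Two faces of least weight, or the omitted face and one of least weight, are the sides of
  an edge at \<open>u\<close>. Subtracting the least weight \<open>l\<close> normalises the class,
  and \<open>r\<close> encodes the excess of the third face.\<close>

lemma trop_line_is_cell:
  assumes q: "q \<in> tp_cone g" and u: "u \<in> V" and t: "trop_line (fc u) g q"
  shows "\<exists>v r. flag u v \<and> 0 \<le> r \<and> r \<le> 1 \<and> tp_class g q = tp_of g (cell_trop u v r)"
proof -
  have nm: "q i \<noteq> -\<infinity>" if "i < g" for i using q that unfolding tp_cone_def by (auto simp: PiE_iff)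
  have main: ?thesis if P: "P \<subseteq> fc u" "card P = 2" and gP: "g \<in> fc u \<Longrightarrow> g \<in> P" and fcu: "fc u = insert c P" and c: "c \<notin> P" "c < g"
    and a: "q a \<noteq> \<infinity>" "a < g" "\<And>i. i \<in> P \<Longrightarrow> i < g \<Longrightarrow> q i = q a" "q a \<le> q c" for P c a
  proof -
    obtain v where v: "{u, v} \<in> E" "fe u v = P" using pair_edge[OF u P] by blast
    have fl: "flag u v" unfolding flag_def using v gP fc_Int_edge[OF v(1)] by blast
    define l where "l = real_of_ereal (q a)"
    have ql: "q a = ereal l" unfolding l_def by (rule tp_cone_real[OF q a(2,1)])
    define r where "r = exp_coord (ereal (- l) + q c)"
    have "0 \<le> ereal (- l) + q c" using a(4) ql by (cases "q c") auto
    then have r: "0 \<le> r" "r \<le> 1" unfolding r_def using exp_coord_nonneg exp_coord_le_one by auto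
    have "(\<lambda>i\<in>{..<g}. ereal (- l) + q i) = (\<lambda>i\<in>{..<g}. ln_coord (cell_trop u v r i))"
    proof (rule restrict_ext)
      fix i assume "i \<in> {..<g}"
      then have i: "i < g" by simp
      consider "i \<in> P" | "i = c" | "i \<notin> fc u" using fcu by blast
      then show "ereal (- l) + q i = ln_coord (cell_trop u v r i)"
      proof cases
        case 1
        then have "q i = ereal l" using a(3) i ql by simp
        then show ?thesis using 1 v(2) unfolding cell_trop_def by (simp add: zero_ereal_def)
      next
        case 2
        have "ereal (- l) + q c \<noteq> -\<infinity>" using nm[OF c(2)] by (cases "q c") auto
        then show ?thesis using 2 v(2) fcu c(1) unfolding cell_trop_def r_def by (simp add: ln_exp_coord)
      next
        case 3
        then have "q i = \<infinity>" using t i unfolding trop_line_def by blast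
        then show ?thesis using 3 v(2) P(1) unfolding cell_trop_def by auto
      qed
    qed
    then have "tp_class g q = tp_of g (cell_trop u v r)" unfolding tp_of_def using tp_class_shift[of g "- l" q] by simp
    then show ?thesis using fl r by blast
  qed
  have "fc u \<subseteq> {..g}" using fc_le by blast
  from q this card_fc[OF u] t show ?thesis
  proof (cases rule: trop_line_cases)
    case (outer a b)
    show ?thesis by (rule main[of "{g, a}" b a]) (use outer in auto)
  next
    case (inner a b c)
    show ?thesis by (rule main[of "{a, b}" c a]) (use inner in auto)
  qed
qed

lemma trop_curve_cells:
  "{tp_class g q | q. q \<in> tp_cone g \<and> (\<exists>v\<in>V. trop_line (fc v) g q)} =
   {tp_of g (cell_trop u v r) | u v r. flag u v \<and> 0 \<le> r \<and> r \<le> 1}" (is "?L = ?R")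
proof
  show "?L \<subseteq> ?R"
  proof
    fix C assume "C \<in> ?L"
    then obtain q u where q: "C = tp_class g q" "q \<in> tp_cone g" "u \<in> V" "trop_line (fc u) g q" by blast
    from trop_line_is_cell[OF q(2-4)] show "C \<in> ?R" unfolding q(1) by blast
  qed
  show "?R \<subseteq> ?L"
  proof
    fix C assume "C \<in> ?R"
    then obtain u v r where f: "flag u v" "0 \<le> r" "r \<le> 1" and C: "C = tp_of g (cell_trop u v r)" by blast
    have u: "u \<in> V" using f(1) edge_V unfolding flag_def by blast
    have "\<exists>v\<in>V. trop_line (fc v) g (\<lambda>i\<in>{..<g}. ln_coord (cell_trop u v' r i))" if "flag u v'" for v'
      by (rule bexI[of _ u]) (use trop_line_cell[OF that f(2,3)] u in auto)
    from this[OF f(1)] show "C \<in> ?L" unfolding C tp_of_def mem_Collect_eq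
      by (intro exI[of _ "\<lambda>i\<in>{..<g}. ln_coord (cell_trop u v r i)"] conjI refl max_one_cone[OF cell_max_one[OF f]])
  qed
qed

section \<open>The homeomorphism of the graph with the tropical curve\<close>

lemma trop_coord_continuous: "continuous_map (graph_top V E) euclideanreal (\<lambda>t. trop_coord t i)"
proof -
  have p: "continuous_map (graph_top V E) euclideanreal (\<lambda>t. t v)" if "v \<in> V" for v
    unfolding graph_top_def using that by (intro continuous_map_from_subtopology continuous_map_product_projection)
  have c: "continuous_map (graph_top V E) euclideanreal (\<lambda>t. min (t v) (t w))" if "(v, w) \<in> cut_pairs i" for v w
    using that edge_V[of v w] unfolding cut_pairs_def by (intro continuous_map_real_min p) auto
  show ?thesis
    unfolding trop_coord_def
    by (intro continuous_map_diff continuous_map_sum finite_cut_pairs)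
      (use finV p c in \<open>auto simp: case_prod_unfold\<close>)
qed

text \<open>A finite union of closed segments; vertices are covered as ends of segments, since every
  vertex has an edge.\<close>

lemma compact_graph_top: "compact_space (graph_top V E)"
proof -
  let ?K = "(\<lambda>(u, v). edge_seg V u v ` {0..1}) ` {(u, v). {u, v} \<in> E}"
  have fin: "finite {(u, v). {u, v} \<in> E}" by (rule finite_subset[of _ "V \<times> V"]) (auto simp: finV dest: edge_V)
  have c: "compactin (graph_top V E) (edge_seg V u v ` {0..1})" if "{u, v} \<in> E" for u v
    by (rule image_compactin[OF _ edge_seg_continuous[OF finV that edge_V[OF that]]]) (simp add: compactin_subtopology)
  have "compactin (graph_top V E) (\<Union>?K)" by (rule compactin_Union) (use fin c in auto)
  moreover have "topspace (graph_top V E) \<subseteq> \<Union>?K"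
  proof
    fix t assume "t \<in> topspace (graph_top V E)"
    then obtain u v s where "{u, v} \<in> E" "0 \<le> s" "s \<le> 1" "t = edge_seg V u v s" using graph_point_seg by metis
    then show "t \<in> \<Union>?K" by (intro UnionI[of "edge_seg V u v ` {0..1}"]) auto
  qed
  ultimately show ?thesis unfolding compact_space_def using compactin_subset_topspace by (metis subset_antisym)
qed

lemma trop_curve_homeo:
  "subtopology (tp_top g) {tp_class g q | q. q \<in> tp_cone g \<and> (\<exists>v\<in>V. trop_line (fc v) g q)} homeomorphic_space graph_top V E"
  unfolding trop_curve_cells
proof -
  let ?S = "{tp_of g (cell_trop u v r) | u v r. flag u v \<and> 0 \<le> r \<and> r \<le> 1}"
  let ?X = "graph_top V E"
  let ?f = "\<lambda>t. tp_of g (trop_coord t)"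
  have tp: "tp_of g y = tp_of g z" if "\<And>i. i < g \<Longrightarrow> y i = z i" for y z
    unfolding tp_of_def using that by (metis (no_types, lifting) lessThan_iff restrict_ext)
  have val: "?f (cell_graph u v r) = tp_of g (cell_trop u v r)" if "flag u v" "0 \<le> r" "r \<le> 1" for u v r
    by (rule tp) (rule trop_coord_cell[OF that])
  have mo: "max_one g (trop_coord t)" if t: "t \<in> topspace ?X" for t
  proof -
    obtain u v r where c: "flag u v" "0 \<le> r" "r \<le> 1" "t = cell_graph u v r" using graph_point_cell[OF t] by metis
    show ?thesis using cell_max_one[OF c(1-3)] trop_coord_cell[OF c(1-3)] unfolding c(4) max_one_def by auto
  qed
  have cont: "continuous_map ?X (tp_top g) ?f" by (rule tp_of_continuous[OF trop_coord_continuous mo])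
  have im: "?f ` topspace ?X = ?S"
  proof
    show "?f ` topspace ?X \<subseteq> ?S"
    proof
      fix C assume "C \<in> ?f ` topspace ?X"
      then obtain t where t: "t \<in> topspace ?X" "C = ?f t" by blast
      obtain u v r where c: "flag u v" "0 \<le> r" "r \<le> 1" "t = cell_graph u v r" using graph_point_cell[OF t(1)] by metis
      show "C \<in> ?S" unfolding t(2) c(4) val[OF c(1-3)] using c(1-3) by blast
    qed
    show "?S \<subseteq> ?f ` topspace ?X"
    proof
      fix C assume "C \<in> ?S"
      then obtain u v r where c: "flag u v" "0 \<le> r" "r \<le> 1" "C = tp_of g (cell_trop u v r)" by blast
      show "C \<in> ?f ` topspace ?X" unfolding c(4) val[OF c(1-3), symmetric] using cell_graph_in[OF c(1-3)] by (rule imageI)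
    qed
  qed
  have inj: "inj_on ?f (topspace ?X)"
  proof (rule inj_onI)
    fix s t assume s: "s \<in> topspace ?X" and t: "t \<in> topspace ?X" and e: "?f s = ?f t"
    obtain u v r where c: "flag u v" "0 \<le> r" "r \<le> 1" "s = cell_graph u v r" using graph_point_cell[OF s] by metis
    obtain u' v' r' where c': "flag u' v'" "0 \<le> r'" "r' \<le> 1" "t = cell_graph u' v' r'" using graph_point_cell[OF t] by metis
    have "tp_of g (cell_trop u v r) = tp_of g (cell_trop u' v' r')" using e val c c' by metis
    then have "cell_trop u v r i = cell_trop u' v' r' i" if "i < g" for i
      using tp_of_inj[OF cell_max_one[OF c(1-3)] cell_max_one[OF c'(1-3)] _ that] by blast
    then show "s = t" unfolding c(4) c'(4) using cell_inj[OF c(1) c'(1) c(2,3) c'(2,3)] by blast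
  qed
  have top: "?S \<subseteq> topspace (tp_top g)"
    using continuous_map_image_subset_topspace[OF cont] unfolding im .
  have "homeomorphic_map ?X (subtopology (tp_top g) ?S) ?f"
  proof (rule continuous_imp_homeomorphic_map[OF _ compact_graph_top _ _ inj])
    show "continuous_map ?X (subtopology (tp_top g) ?S) ?f"
      unfolding continuous_map_in_subtopology using cont im by blast
    show "Hausdorff_space (subtopology (tp_top g) ?S)" by (rule Hausdorff_tp_subspace) (use cell_max_one in blast)
    show "?f ` topspace ?X = topspace (subtopology (tp_top g) ?S)"
      unfolding im topspace_subtopology using top by (rule Int_absorb1[symmetric])
  qed
  then show "subtopology (tp_top g) ?S homeomorphic_space ?X"
    using homeomorphic_map_imp_homeomorphic_space homeomorphic_space_sym by blast
qed

end

lemma (in param_system) canonical_trop: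
  assumes "valuation val"
  shows "\<exists>\<phi>. canonical_embedding V E \<nu> \<phi> \<and>
    trop_proj_top val g (homogeneous_ideal g (\<phi> ` topspace (graph_curve V E \<nu>))) homeomorphic_space graph_top V E"
proof (intro exI conjI)
  show "canonical_embedding V E \<nu> phi" by (rule phi_canonical)
  show "trop_proj_top val g (homogeneous_ideal g (phi ` topspace (graph_curve V E \<nu>))) homeomorphic_space graph_top V E"
    unfolding trop_proj_top_def phi_range trop_proj_curve[OF assms] by (rule trop_curve_homeo)
qed

lemma (in curve_system) param_system_ex: "\<exists>A B. param_system V E g F \<nu> A B"
proof -
  have "\<forall>v\<in>V. \<exists>P. (\<forall>i. i \<notin> fc v \<longrightarrow> fst P i = 0 \<and> snd P i = 0) \<and> (\<Sum>i\<in>fc v. fst P i) = 0 \<and> (\<Sum>i\<in>fc v. snd P i) = 0 \<and>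
    (\<forall>i\<in>fc v. \<forall>j\<in>fc v. i \<noteq> j \<longrightarrow> fst P i * snd P j - fst P j * snd P i \<noteq> 0) \<and>
    (\<forall>w i. {v, w} \<in> E \<longrightarrow> i \<notin> fe v w \<longrightarrow> fst P i * rep0 (nod v w) + snd P i * rep1 (nod v w) = 0) \<and>
    (\<forall>z. \<exists>\<kappa>. \<kappa> \<noteq> 0 \<and> (\<forall>i\<le>g. section_value E \<nu> v z (sect (F i) v) (\<kappa> * (fst P i * rep0 z + snd P i * rep1 z))))"
    (is "\<forall>v\<in>V. \<exists>P. ?Q v P")
  proof
    fix v assume v: "v \<in> V"
    show "\<exists>P. ?Q v P" using vertex_param[OF v] unfolding split_paired_Ex fst_conv snd_conv .
  qed
  from bchoice[OF this] obtain P where P: "\<forall>v\<in>V. ?Q v (P v)" ..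
  have Q: "?Q v (P v)" if "v \<in> V" for v using P that by (rule bspec)
  note Q1 = Q[THEN conjunct1] and Q2 = Q[THEN conjunct2, THEN conjunct2]
  have "param_system V E g F \<nu> (\<lambda>v. fst (P v)) (\<lambda>v. snd (P v))"
  proof (intro param_system.intro param_system_axioms.intro curve_system_axioms)
    fix v assume v: "v \<in> V"
    show "fst (P v) i = 0 \<and> snd (P v) i = 0" if "i \<notin> fc v" for i
      using Q1[OF v, THEN spec, THEN mp, OF that] .
    show "(\<Sum>i\<in>fc v. fst (P v) i) = 0 \<and> (\<Sum>i\<in>fc v. snd (P v) i) = 0"
      by (rule conjI[OF Q[OF v, THEN conjunct2, THEN conjunct1] Q2[OF v, THEN conjunct1]])
    show "fst (P v) i * snd (P v) j - fst (P v) j * snd (P v) i \<noteq> 0" if "i \<in> fc v" "j \<in> fc v" "i \<noteq> j" for i j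
      using Q2[OF v, THEN conjunct2, THEN conjunct1, THEN bspec, OF that(1), THEN bspec, OF that(2), THEN mp, OF that(3)] .
    show "fst (P v) i * rep0 (nod v w) + snd (P v) i * rep1 (nod v w) = 0" if "{v, w} \<in> E" "i \<notin> fe v w" for w i
      using Q2[OF v, THEN conjunct2, THEN conjunct2, THEN conjunct1, THEN spec, THEN spec, THEN mp, OF that(1), THEN mp, OF that(2)] .
    show "\<exists>\<kappa>. \<kappa> \<noteq> 0 \<and> (\<forall>i\<le>g. section_value E \<nu> v z (sect (F i) v) (\<kappa> * (fst (P v) i * rep0 z + snd (P v) i * rep1 z)))" for z
      using Q2[OF v, THEN conjunct2, THEN conjunct2, THEN conjunct2, THEN spec] .
  qed
  then show ?thesis by blast
qed

theorem theorem1p3: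
  fixes val :: "'k::alg_closed_field \<Rightarrow> ereal"
    and V :: "'v set" and E :: "'v set set"
    and \<nu> :: "'v \<Rightarrow> 'v set \<Rightarrow> 'k option"
  assumes "valuation val"
    and "simple_graph V E" and "three_regular V E" and "three_edge_connected V E"
    and "planar_graph V E"
    and "node_positions V E \<nu>"
  shows "\<exists>\<phi>. canonical_embedding V E \<nu> \<phi> \<and>
    trop_proj_top val (genus V E)
      (homogeneous_ideal (genus V E) (\<phi> ` topspace (graph_curve V E \<nu>)))
    homeomorphic_space graph_top V E"
proof -
  obtain F :: "nat \<Rightarrow> 'v \<Rightarrow> 'v \<Rightarrow> 'k" where F: "face_system V E (genus V E) F"
    using planar_face_system[OF assms(2-5)] by blast
  have "curve_system V E (genus V E) F \<nu>"
    using F assms(6) by (intro curve_system.intro curve_system_axioms.intro)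
  then obtain A B where "param_system V E (genus V E) F \<nu> A B" using curve_system.param_system_ex by blast
  then show ?thesis using assms(1) by (rule param_system.canonical_trop)
qed

end
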